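(* Let $\Omega\subset\mathbb{R}^2$ be a strictly convex bounded domain with boundary $\Gamma$. (i) Let $a\in C^3(\overline\Omega)$ and $k\in C^3(\overline\Omega\times\mathbf{S}^1)$ be real valued, with scattering kernel $k(z,\boldsymbol\theta\cdot\boldsymbol\theta')$ and with $\sigma_a:=a-k_0>0$ on $\overline\Omega$. Let $f_0,\widetilde f\in W^{3,p}(\Omega)$, $p>4$, be real valued with $(f_0-\widetilde f)/\sigma_a\in C_0(\overline\Omega)$, and let $\widetilde{\mathbf{F}}\in W^{3,p}(\Omega;\mathbb{R}^2)$. Then $$\mathbf{F}:=\widetilde{\mathbf{F}}+\nabla\left(\frac{f_0-\widetilde f}{\sigma_a}\right)$$ is a real valued vector field such that the data $g_{f_0,\mathbf{F}}$ coming from the linearly anisotropic source $f_0+\boldsymbol\theta\cdot\mathbf{F}$ is the same as the data $g_{\widetilde f,\widetilde{\mathbf{F}}}$ coming from the linearly anisotropic source $\widetilde f+\boldsymbol\theta\cdot\widetilde{\mathbf{F}}$: $$g_{f_0,\,\widetilde{\mathbf{F}}+\nabla\left(\frac{f_0-\widetilde f}{\sigma_a}\right)}=g_{\widetilde f,\widetilde{\mathbf{F}}}.$$ (ii) Let the scattering kernel be $k(z,\cos\theta)=k_0(z)+2\sum_{n=1}^M k_{-n}(z)\cos(n\theta)$ for some fixed integer $M\ge1$, with $a,k_0,k_{-1},\dots,k_{-M}\in C^3(\overline\Omega)$ real valued and $\sigma_a:=a-k_0>0$ on $\overline\Omega$. Let $f_0+\boldsymbol\theta\cdot\mathbf{F}$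 and $\widetilde f+\boldsymbol\theta\cdot\widetilde{\mathbf{F}}$ be real valued linearly anisotropic sources with $f_0,\widetilde f\in W^{3,p}(\Omega)$ and $\mathbf{F},\widetilde{\mathbf{F}}\in W^{3,p}(\Omega;\mathbb{R}^2)$, $p>4$. If $g_{f_0,\mathbf{F}}=g_{\widetilde f,\widetilde{\mathbf{F}}}$, then $$\mathbf{F}=\widetilde{\mathbf{F}}+\nabla\left(\frac{f_0-\widetilde f}{\sigma_a}\right).$$
   Context: $\mathbf{S}^1$ is the unit circle with measure $d\boldsymbol\theta$ normalized so that $\int_{\mathbf{S}^1}d\boldsymbol\theta=1$. $\nabla$ is the gradient in the spatial variable. With $\nu(\zeta)$ the outer unit normal at $\zeta\in\Gamma$, $\Gamma_\pm:=\{(\zeta,\boldsymbol\theta)\in\Gamma\times\mathbf{S}^1:\pm\nu(\zeta)\cdot\boldsymbol\theta>0\}$. $C_0(\overline\Omega)$ is the space of continuous functions on $\overline\Omega$ vanishing on $\Gamma$. The scattering kernel depends on the two directions only through the angle between them. $k_0$ denotes the zeroth angular Fourier coefficient of $k$: $k_0(z)=\frac1{2\pi}\int_{-\pi}^{\pi}k(z,\cos\theta)\,d\theta=\int_{\mathbf{S}^1}k(z,\boldsymbol\theta\cdot\boldsymbol\theta')\,d\boldsymbol\theta'$. The transport problem with source $f(z,\boldsymbol\theta)$ is $$\boldsymbol\theta\cdot\nabla u(z,\boldsymbol\theta)+a(z)u(z,\boldsymbol\theta)-\int_{\mathbf{S}^1}k(z,\boldsymbol\theta\cdot\boldsymbol\theta')u(z,\boldsymbol\theta')\,d\boldsymbol\theta'=f(z,\boldsymbol\theta)\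 \text{ in }\Omega\times\mathbf{S}^1,\qquad u|_{\Gamma_-}=0.$$ Standing assumption: $a$ and $k$ are such that, for $p>1$ and any $f\in L^p(\Omega\times\mathbf{S}^1)$, this problem has a unique solution $u\in L^p(\Omega\times\mathbf{S}^1)$. Data: for a scalar field $f_0$ and vector field $\mathbf{F}$, $g_{f_0,\mathbf{F}}$ is the boundary trace $u|_{\Gamma_+}$ of the solution $u$ with source $f=f_0+\boldsymbol\theta\cdot\mathbf{F}$ (equivalently, since $u|_{\Gamma_-}=0$, the trace on $\Gamma\times\mathbf{S}^1$). All data are for the same coefficients $a$ and $k$. *)

theory Defs
  imports "HOL-Analysis.Analysis"
begin

type_synonym plane = "real ^ 2"

definition strictly_convex :: "'a::euclidean_space set \<Rightarrow> bool" where
  "strictly_convex S \<longleftrightarrow>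
     convex S \<and> (\<forall>x\<in>closure S. \<forall>y\<in>closure S. x \<noteq> y \<longrightarrow> open_segment x y \<subseteq> interior S)"

definition strictly_convex_domain :: "plane set \<Rightarrow> bool" where
  "strictly_convex_domain \<Omega> \<longleftrightarrow>
     open \<Omega> \<and> connected \<Omega> \<and> \<Omega> \<noteq> {} \<and> bounded \<Omega> \<and> strictly_convex \<Omega>"

text \<open>For a convex set the outer normals are the directions of supporting half-planes.\<close>

definition outer_unit_normal :: "plane set \<Rightarrow> plane \<Rightarrow> plane \<Rightarrow> bool" where
  "outer_unit_normal \<Omega> \<zeta> \<nu> \<longleftrightarrow> norm \<nu> = 1 \<and> (\<forall>x\<in>\<Omega>. \<nu> \<bullet> (x - \<zeta>) \<le> 0)"

text \<open>A convex curve has a unique outer normal at all but countably many points. There the quantifier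
  over \<open>\<nu>\<close> just names that normal; it gives the sets \<open>\<Gamma>\<^sub>+\<close> and \<open>\<Gamma>\<^sub>-\<close> a meaning at a
  corner as well. There is always at least one \<open>\<nu>\<close> by the supporting hyperplane theorem.\<close>

definition outflow :: "plane set \<Rightarrow> (plane \<times> plane) set" where
  "outflow \<Omega> =
     {(\<zeta>, \<theta>) \<in> frontier \<Omega> \<times> sphere 0 1. \<forall>\<nu>. outer_unit_normal \<Omega> \<zeta> \<nu> \<longrightarrow> \<nu> \<bullet> \<theta> > 0}"

definition inflow :: "plane set \<Rightarrow> (plane \<times> plane) set" where
  "inflow \<Omega> =
     {(\<zeta>, \<theta>) \<in> frontier \<Omega> \<times> sphere 0 1. \<forall>\<nu>. outer_unit_normal \<Omega> \<zeta> \<nu> \<longrightarrow> \<nu> \<bullet> \<theta> < 0}"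

definition circle_measure :: "plane measure" where
  "circle_measure =
     distr (uniform_measure lborel {-pi..pi}) (restrict_space borel (sphere 0 1))
       (\<lambda>t. vector [cos t, sin t])"

definition phase_measure :: "plane set \<Rightarrow> (plane \<times> plane) measure" where
  "phase_measure \<Omega> = restrict_space lborel \<Omega> \<Otimes>\<^sub>M circle_measure"

definition perp :: "plane \<Rightarrow> plane" where
  "perp \<theta> = vector [- \<theta> $ 2, \<theta> $ 1]"

text \<open>Almost everywhere on \<open>B \<subseteq> \<Gamma> \<times> S\<^sup>1\<close>, where \<open>B\<close> is the outflow or inflow boundary. The
  natural measure there is \<open>|\<nu>(\<zeta>) \<bullet> \<theta>|\<close> times arc length times \<open>d\<theta>\<close>, which has the same null
  sets as arc length times \<open>d\<theta>\<close>. Since each oriented line leaves (enters) a convex domain at most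
  once, \<open>(\<zeta>, \<theta>) \<mapsto> (\<zeta> \<bullet> perp \<theta>, \<theta>)\<close> is injective on \<open>B\<close>, and it carries this measure to
  \<open>ds d\<theta>\<close>. The definition is written in these coordinates.\<close>

definition AE_boundary :: "(plane \<times> plane) set \<Rightarrow> (plane \<Rightarrow> plane \<Rightarrow> bool) \<Rightarrow> bool" where
  "AE_boundary B P \<longleftrightarrow>
     (AE (s, \<theta>) in lborel \<Otimes>\<^sub>M circle_measure. \<forall>\<zeta>. (\<zeta>, \<theta>) \<in> B \<and> \<zeta> \<bullet> perp \<theta> = s \<longrightarrow> P \<zeta> \<theta>)"

text \<open>\<open>L\<^sup>p\<close> classes are represented by their Borel measurable members.\<close>

definition Lp :: "'a measure \<Rightarrow> real \<Rightarrow> ('a \<Rightarrow> real) \<Rightarrow> bool" where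
  "Lp M p f \<longleftrightarrow> f \<in> borel_measurable M \<and> integrable M (\<lambda>x. \<bar>f x\<bar> powr p)"

text \<open>\<open>C\<^sup>n\<close> on the closure of an open set \<open>S\<close>: all derivatives up to order \<open>n\<close> exist on \<open>S\<close> and
  extend continuously to \<open>closure S\<close>; \<open>g\<close> is the extended partial derivative.\<close>

primrec Ck_closure :: "nat \<Rightarrow> 'a::euclidean_space set \<Rightarrow> ('a \<Rightarrow> real) \<Rightarrow> bool" where
  "Ck_closure 0 S f \<longleftrightarrow> continuous_on (closure S) f"
| "Ck_closure (Suc n) S f \<longleftrightarrow>
     continuous_on (closure S) f \<and> (\<forall>x\<in>S. f differentiable (at x)) \<and>
     (\<forall>i\<in>Basis. \<exists>g. (\<forall>x\<in>S. g x = frechet_derivative f (at x) i) \<and> Ck_closure n S g)"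

definition smooth :: "('a::euclidean_space \<Rightarrow> real) \<Rightarrow> bool" where
  "smooth f \<longleftrightarrow> (\<forall>n. Ck_closure n UNIV f)"

definition test_function :: "plane set \<Rightarrow> (plane \<Rightarrow> real) \<Rightarrow> bool" where
  "test_function \<Omega> \<phi> \<longleftrightarrow> smooth \<phi> \<and> (\<exists>K. compact K \<and> K \<subseteq> \<Omega> \<and> (\<forall>z. z \<notin> K \<longrightarrow> \<phi> z = 0))"

definition locally_integrable_on :: "plane set \<Rightarrow> (plane \<Rightarrow> real) \<Rightarrow> bool" where
  "locally_integrable_on \<Omega> f \<longleftrightarrow> (\<forall>K. compact K \<and> K \<subseteq> \<Omega> \<longrightarrow> set_integrable lborel K f)"

definition has_weak_partial :: "plane set \<Rightarrow> plane \<Rightarrow> (plane \<Rightarrow> real) \<Rightarrow> (plane \<Rightarrow> real) \<Rightarrow> bool" where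
  "has_weak_partial \<Omega> i f g \<longleftrightarrow>
     locally_integrable_on \<Omega> f \<and> locally_integrable_on \<Omega> g \<and>
     (\<forall>\<phi>. test_function \<Omega> \<phi> \<longrightarrow>
        (LINT z:\<Omega>|lborel. f z * frechet_derivative \<phi> (at z) i) = - (LINT z:\<Omega>|lborel. g z * \<phi> z))"

primrec sobolev :: "nat \<Rightarrow> real \<Rightarrow> plane set \<Rightarrow> (plane \<Rightarrow> real) \<Rightarrow> bool" where
  "sobolev 0 p \<Omega> f \<longleftrightarrow> Lp (restrict_space lborel \<Omega>) p f"
| "sobolev (Suc n) p \<Omega> f \<longleftrightarrow>
     Lp (restrict_space lborel \<Omega>) p f \<and>
     (\<forall>i\<in>Basis. \<exists>g. has_weak_partial \<Omega> i f g \<and> sobolev n p \<Omega> g)"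

definition sobolev_field :: "nat \<Rightarrow> real \<Rightarrow> plane set \<Rightarrow> (plane \<Rightarrow> plane) \<Rightarrow> bool" where
  "sobolev_field n p \<Omega> F \<longleftrightarrow> (\<forall>i\<in>Basis. sobolev n p \<Omega> (\<lambda>z. F z \<bullet> i))"

definition has_weak_gradient :: "plane set \<Rightarrow> (plane \<Rightarrow> real) \<Rightarrow> (plane \<Rightarrow> plane) \<Rightarrow> bool" where
  "has_weak_gradient \<Omega> q G \<longleftrightarrow> (\<forall>i\<in>Basis. has_weak_partial \<Omega> i q (\<lambda>z. G z \<bullet> i))"

text \<open>A chosen representative; it is determined up to a null set whenever a weak gradient exists.\<close>

definition weak_gradient :: "plane set \<Rightarrow> (plane \<Rightarrow> real) \<Rightarrow> plane \<Rightarrow> plane" where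
  "weak_gradient \<Omega> q = (SOME G. has_weak_gradient \<Omega> q G)"

text \<open>Membership of the almost-everywhere class of \<open>q\<close> in \<open>C\<^sub>0(closure \<Omega>)\<close>.\<close>

definition C0_closure :: "plane set \<Rightarrow> (plane \<Rightarrow> real) \<Rightarrow> bool" where
  "C0_closure \<Omega> q \<longleftrightarrow>
     (\<exists>h. continuous_on (closure \<Omega>) h \<and> (\<forall>\<zeta>\<in>frontier \<Omega>. h \<zeta> = 0) \<and>
          (AE z in restrict_space lborel \<Omega>. q z = h z))"

text \<open>A scattering kernel is a function \<open>k z s\<close>, where \<open>s = \<theta> \<bullet> \<theta>' \<in> [-1, 1]\<close>; as a function on
  \<open>closure \<Omega> \<times> S\<^sup>1\<close> it is \<open>k z (cos t)\<close>, with \<open>t\<close> the angle.\<close>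

definition C3_kernel :: "plane set \<Rightarrow> (plane \<Rightarrow> real \<Rightarrow> real) \<Rightarrow> bool" where
  "C3_kernel \<Omega> k \<longleftrightarrow> Ck_closure 3 (\<Omega> \<times> (UNIV :: real set)) (\<lambda>(z, t). k z (cos t))"

definition zeroth_coeff :: "(plane \<Rightarrow> real \<Rightarrow> real) \<Rightarrow> plane \<Rightarrow> real" where
  "zeroth_coeff k z = (1 / (2 * pi)) * (LINT t:{-pi..pi}|lborel. k z (cos t))"

definition scattering ::
  "(plane \<Rightarrow> real \<Rightarrow> real) \<Rightarrow> (plane \<times> plane \<Rightarrow> real) \<Rightarrow> plane \<Rightarrow> plane \<Rightarrow> real" where
  "scattering k u z \<theta> = (LINT \<theta>'|circle_measure. k z (\<theta> \<bullet> \<theta>') * u (z, \<theta>'))"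

text \<open>Test functions on \<open>\<Omega> \<times> S\<^sup>1\<close> are given through smooth extensions in \<open>\<theta>\<close> to the plane.\<close>

definition phase_test_function :: "plane set \<Rightarrow> (plane \<times> plane \<Rightarrow> real) \<Rightarrow> bool" where
  "phase_test_function \<Omega> \<phi> \<longleftrightarrow>
     smooth \<phi> \<and> (\<exists>K. compact K \<and> K \<subseteq> \<Omega> \<and> (\<forall>z \<theta>. z \<notin> K \<longrightarrow> \<phi> (z, \<theta>) = 0))"

text \<open>The transport equation in the sense of distributions; the derivative of \<open>\<phi>\<close> that occurs is
  \<open>\<theta> \<bullet> \<nabla>\<phi>\<close>, the gradient being taken in \<open>z\<close>.\<close>

definition transport_equation ::
  "plane set \<Rightarrow> (plane \<Rightarrow> real) \<Rightarrow> (plane \<Rightarrow> real \<Rightarrow> real) \<Rightarrow>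
   (plane \<times> plane \<Rightarrow> real) \<Rightarrow> (plane \<times> plane \<Rightarrow> real) \<Rightarrow> bool" where
  "transport_equation \<Omega> a k f u \<longleftrightarrow>
     (\<forall>\<phi>. phase_test_function \<Omega> \<phi> \<longrightarrow>
        (LINT (z, \<theta>)|phase_measure \<Omega>.
            - u (z, \<theta>) * frechet_derivative (\<lambda>y. \<phi> (y, \<theta>)) (at z) \<theta>
            + (a z * u (z, \<theta>) - scattering k u z \<theta>) * \<phi> (z, \<theta>))
        = (LINT (z, \<theta>)|phase_measure \<Omega>. f (z, \<theta>) * \<phi> (z, \<theta>)))"

text \<open>The traces of a class \<open>u\<close> are the one-sided limits along characteristics, taken for a
  suitable representative \<open>v\<close> (for a solution of the transport equation, the one that is absolutely
  continuous along almost every characteristic). By Fubini two representatives which have limits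
  have the same ones, up to null sets.\<close>

definition has_outflow_trace ::
  "plane set \<Rightarrow> (plane \<times> plane \<Rightarrow> real) \<Rightarrow> (plane \<times> plane \<Rightarrow> real) \<Rightarrow> bool" where
  "has_outflow_trace \<Omega> u g \<longleftrightarrow>
     (\<exists>v. (AE x in phase_measure \<Omega>. v x = u x) \<and>
          AE_boundary (outflow \<Omega>)
            (\<lambda>\<zeta> \<theta>. ((\<lambda>t. v (\<zeta> - t *\<^sub>R \<theta>, \<theta>)) \<longlongrightarrow> g (\<zeta>, \<theta>)) (at_right 0)))"

definition has_inflow_trace ::
  "plane set \<Rightarrow> (plane \<times> plane \<Rightarrow> real) \<Rightarrow> (plane \<times> plane \<Rightarrow> real) \<Rightarrow> bool" where
  "has_inflow_trace \<Omega> u g \<longleftrightarrow>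
     (\<exists>v. (AE x in phase_measure \<Omega>. v x = u x) \<and>
          AE_boundary (inflow \<Omega>)
            (\<lambda>\<zeta> \<theta>. ((\<lambda>t. v (\<zeta> + t *\<^sub>R \<theta>, \<theta>)) \<longlongrightarrow> g (\<zeta>, \<theta>)) (at_right 0)))"

definition transport_solution ::
  "plane set \<Rightarrow> (plane \<Rightarrow> real) \<Rightarrow> (plane \<Rightarrow> real \<Rightarrow> real) \<Rightarrow> real \<Rightarrow>
   (plane \<times> plane \<Rightarrow> real) \<Rightarrow> (plane \<times> plane \<Rightarrow> real) \<Rightarrow> bool" where
  "transport_solution \<Omega> a k p f u \<longleftrightarrow>
     Lp (phase_measure \<Omega>) p u \<and> transport_equation \<Omega> a k f u \<and> has_inflow_trace \<Omega> u (\<lambda>_. 0)"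

definition well_posed ::
  "plane set \<Rightarrow> (plane \<Rightarrow> real) \<Rightarrow> (plane \<Rightarrow> real \<Rightarrow> real) \<Rightarrow> bool" where
  "well_posed \<Omega> a k \<longleftrightarrow>
     (\<forall>p>1. \<forall>f. Lp (phase_measure \<Omega>) p f \<longrightarrow>
        (\<exists>u. transport_solution \<Omega> a k p f u \<and>
             (\<forall>v. transport_solution \<Omega> a k p f v \<longrightarrow> (AE x in phase_measure \<Omega>. v x = u x))))"

definition anisotropic_source ::
  "(plane \<Rightarrow> real) \<Rightarrow> (plane \<Rightarrow> plane) \<Rightarrow> plane \<times> plane \<Rightarrow> real" where
  "anisotropic_source f\<^sub>0 F = (\<lambda>(z, \<theta>). f\<^sub>0 z + \<theta> \<bullet> F z)"

definition has_boundary_data ::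
  "plane set \<Rightarrow> (plane \<Rightarrow> real) \<Rightarrow> (plane \<Rightarrow> real \<Rightarrow> real) \<Rightarrow> real \<Rightarrow>
   (plane \<Rightarrow> real) \<Rightarrow> (plane \<Rightarrow> plane) \<Rightarrow> (plane \<times> plane \<Rightarrow> real) \<Rightarrow> bool" where
  "has_boundary_data \<Omega> a k p f\<^sub>0 F g \<longleftrightarrow>
     (\<exists>u. transport_solution \<Omega> a k p (anisotropic_source f\<^sub>0 F) u \<and> has_outflow_trace \<Omega> u g)"

text \<open>A chosen representative of the data, which are determined up to a null set of the outflow
  boundary.\<close>

definition boundary_data ::
  "plane set \<Rightarrow> (plane \<Rightarrow> real) \<Rightarrow> (plane \<Rightarrow> real \<Rightarrow> real) \<Rightarrow> real \<Rightarrow>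
   (plane \<Rightarrow> real) \<Rightarrow> (plane \<Rightarrow> plane) \<Rightarrow> plane \<times> plane \<Rightarrow> real" where
  "boundary_data \<Omega> a k p f\<^sub>0 F = (SOME g. has_boundary_data \<Omega> a k p f\<^sub>0 F g)"

definition same_data :: "plane set \<Rightarrow> (plane \<times> plane \<Rightarrow> real) \<Rightarrow> (plane \<times> plane \<Rightarrow> real) \<Rightarrow> bool" where
  "same_data \<Omega> g h \<longleftrightarrow> AE_boundary (outflow \<Omega>) (\<lambda>\<zeta> \<theta>. g (\<zeta>, \<theta>) = h (\<zeta>, \<theta>))"

end

theory Submission
  imports Defs
begin

text \<open>Both parts rest on representatives that are absolutely continuous along almost every line in the
  direction \<open>\<theta>\<close>, in the coordinates \<open>line s \<theta> t = s perp \<theta> + t \<theta>\<close>. In part (i) the function \<open>q = (f - ft) / \<sigma>\<close>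
  does not depend on \<open>\<theta>\<close> and vanishes on the boundary, so adding it to a solution changes the source by
  \<open>\<sigma> q + \<theta> \<bullet> \<nabla>q\<close> and leaves both traces unchanged. In part (ii) the difference \<open>W\<close> of two solutions has zero traces on the
  whole boundary. An exponent \<open>h\<close> with \<open>\<theta> \<bullet> \<nabla>h = a\<close> that has only nonnegative angular Fourier modes removes the
  attenuation: the modes \<open>V\<^sub>n\<close> of \<open>V = e\<^sup>h W\<close> satisfy, for large \<open>n\<close>, a two-term recurrence in the spatial
  Fourier variable whose factor has modulus one, and therefore vanish. Descending in \<open>n\<close>, all modes of
  \<open>W\<close> except the zeroth vanish. The equation then says that the zeroth mode is \<open>q\<close> and that its gradient is
  the difference of the vector fields.\<close>

text \<open>Solutions are only integrable and the data only see limits along almost every line, so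
  the weak equation must become an exact identity on lines before a boundary value can enter. Once
  it has, two vanishing traces mean that \<open>W\<close> extended by zero solves the equation on
  whole lines; test functions then need no compact support in the domain, and exponentials in space
  become admissible. An integral of \<open>a\<close> along a half line would also remove the
  attenuation, but in general it mixes all angular modes. With an exponent of nonnegative modes the
  n-th mode of the product depends only on modes of \<open>W\<close> from n on, and the same holds
  for the inverse factor; so the vanishing of all modes from some index on passes to
  \<open>V\<close> and back. Such an exponent is half the signed line integral of \<open>a\<close>,
  corrected by half a Hilbert transform that is constant along lines; it is reached as a limit of
  explicit kernels. The descent can start because a kernel with M modes scatters nothing above M,
  and it ends at the index 1 because the vector field occupies the first mode of the source.\<close>

section \<open>Smooth functions on the whole space\<close>

text \<open>On \<open>UNIV\<close> the extended partial derivative in \<open>Ck_closure\<close> has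
  to be the derivative itself, so the existential quantifier can be traded for a named
  derivative.\<close>

lemma Ck_UNIV_I:
 fixes f :: "'a::euclidean_space => real"
 assumes "!!x. (f has_derivative f' x) (at x)" "!!i. i : Basis ==> Ck_closure n UNIV (%x. f' x i)"
 shows "Ck_closure (Suc n) UNIV f"
proof -
 have "continuous_on UNIV f"
  using assms(1) by (meson continuous_at_imp_continuous_on has_derivative_continuous)
 moreover have "!!x. frechet_derivative f (at x) = f' x"
  using assms(1) by (metis frechet_derivative_at)
 moreover have "\<forall>x. f differentiable (at x)"
  using assms(1) by (auto simp: differentiable_def)
 ultimately show ?thesis using assms(2) by auto
qed

lemma Ck_UNIV_E:
 fixes f :: "'a::euclidean_space => real"
 assumes "Ck_closure (Suc n) UNIV f"
 shows "(f has_derivative frechet_derivative f (at x)) (at x)"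
  and "i : Basis ==> Ck_closure n UNIV (%x. frechet_derivative f (at x) i)"
proof -
 show "(f has_derivative frechet_derivative f (at x)) (at x)"
  using assms by (simp add: frechet_derivative_works[symmetric])
 assume "i : Basis"
 then obtain g where "\<forall>x. g x = frechet_derivative f (at x) i" "Ck_closure n UNIV g"
  using assms unfolding Ck_closure.simps(2) by (metis UNIV_I)
 then show "Ck_closure n UNIV (%x. frechet_derivative f (at x) i)"
  by (metis (no_types, lifting) ext)
qed

lemma Ck_UNIV_Suc:
 fixes f :: "'a::euclidean_space => real"
 shows "Ck_closure (Suc n) UNIV f ==> Ck_closure n UNIV f"
proof (induction n arbitrary: f)
 case 0 then show ?case by simp
next
 case (Suc n)
 show ?case
  by (rule Ck_UNIV_I[OF Ck_UNIV_E(1)[OF Suc.prems]]) (use Suc.IH Ck_UNIV_E(2)[OF Suc.prems] in blast)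
qed

lemma Ck_UNIV_const: "Ck_closure n UNIV (%x::'a::euclidean_space. c)"
proof (induction n arbitrary: c)
 case (Suc n)
 show ?case by (rule Ck_UNIV_I[of _ "%_ _. 0"]) (auto intro: Suc)
qed simp

lemma Ck_UNIV_add:
 fixes f :: "'a::euclidean_space => real"
 shows "Ck_closure n UNIV f ==> Ck_closure n UNIV g ==> Ck_closure n UNIV (%x. f x + g x)"
proof (induction n arbitrary: f g)
 case 0 then show ?case by (auto intro: continuous_on_add)
next
 case (Suc n)
 show ?case
  by (rule Ck_UNIV_I[OF has_derivative_add[OF Ck_UNIV_E(1)[OF Suc.prems(1)] Ck_UNIV_E(1)[OF Suc.prems(2)]]])
    (use Suc.IH Ck_UNIV_E(2)[OF Suc.prems(1)] Ck_UNIV_E(2)[OF Suc.prems(2)] in blast)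
qed

lemma Ck_UNIV_mult:
 fixes f :: "'a::euclidean_space => real"
 shows "Ck_closure n UNIV f ==> Ck_closure n UNIV g ==> Ck_closure n UNIV (%x. f x * g x)"
proof (induction n arbitrary: f g)
 case 0 then show ?case by (auto intro: continuous_on_mult)
next
 case (Suc n)
 show ?case
  by (rule Ck_UNIV_I[OF has_derivative_mult[OF Ck_UNIV_E(1)[OF Suc.prems(1)] Ck_UNIV_E(1)[OF Suc.prems(2)]]])
    (intro Ck_UNIV_add Suc.IH Ck_UNIV_E(2)[OF Suc.prems(1)] Ck_UNIV_E(2)[OF Suc.prems(2)]
     Ck_UNIV_Suc[OF Suc.prems(1)] Ck_UNIV_Suc[OF Suc.prems(2)])
qed

lemma Ck_UNIV_sum:
 fixes f :: "'i => 'a::euclidean_space => real"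
 shows "(!!i. i : I ==> Ck_closure n UNIV (f i)) ==> Ck_closure n UNIV (%x. \<Sum>i\<in>I. f i x)"
 by (induction I rule: infinite_finite_induct) (auto intro!: Ck_UNIV_const Ck_UNIV_add)

text \<open>The direction \<open>L i\<close> is not a basis vector, so the induction hypothesis does
  not reach the composed derivative directly; it is expanded over the basis, with the constant
  coefficients \<open>L i \<bullet> j\<close>.\<close>

lemma Ck_UNIV_linear:
 fixes f :: "'b::euclidean_space => real" and L :: "'a::euclidean_space => 'b"
 assumes L: "bounded_linear L"
 shows "Ck_closure n UNIV f ==> Ck_closure n UNIV (%x. f (L x))"
proof (induction n arbitrary: f)
 case 0
 then show ?case
  using continuous_on_compose2[of UNIV f UNIV L] linear_continuous_on[OF L] by auto
next
 case (Suc n)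
 have d: "((%x. f (L x)) has_derivative (%h. frechet_derivative f (at (L x)) (L h))) (at x)" for x
  using has_derivative_compose[OF bounded_linear_imp_has_derivative[OF L] Ck_UNIV_E(1)[OF Suc.prems]]
  by blast
 show ?case
 proof (rule Ck_UNIV_I[OF d])
  fix i :: 'a
  have lin: "linear (frechet_derivative f (at (L x)))" for x
   using has_derivative_linear[OF Ck_UNIV_E(1)[OF Suc.prems]] .
  have "frechet_derivative f (at (L x)) (L i) = (\<Sum>j\<in>Basis. (L i \<bullet> j) * frechet_derivative f (at (L x)) j)" for x
   by (subst euclidean_representation[symmetric, of "L i"], subst linear_sum[OF lin])
     (simp add: linear_scale[OF lin])
  then show "Ck_closure n UNIV (%x. frechet_derivative f (at (L x)) (L i))"
   by (auto intro!: Ck_UNIV_sum Ck_UNIV_mult Ck_UNIV_const Suc.IH[OF Ck_UNIV_E(2)[OF Suc.prems]])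
 qed
qed

lemma Ck_UNIV_bounded_linear:
 fixes L :: "'a::euclidean_space => real"
 assumes L: "bounded_linear L"
 shows "Ck_closure n UNIV L"
proof (cases n)
 case 0 then show ?thesis using linear_continuous_on[OF L] by simp
next
 case (Suc m)
 then show ?thesis
  using Ck_UNIV_I[OF bounded_linear_imp_has_derivative[OF L], of m] Ck_UNIV_const by blast
qed

text \<open>The outer function has one real variable, so its derivative is multiplication by its
  value at 1, and the induction stays among real valued functions.\<close>

lemma Ck_UNIV_compose:
 fixes f :: "'a::euclidean_space => real" and g :: "real => real"
 shows "Ck_closure n UNIV g ==> Ck_closure n UNIV f ==> Ck_closure n UNIV (%x. g (f x))"
proof (induction n arbitrary: f g)
 case 0
 then show ?case using continuous_on_compose2[of UNIV g UNIV f] by auto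
next
 case (Suc n)
 have d: "((%x. g (f x)) has_derivative (%h. frechet_derivative g (at (f x)) (frechet_derivative f (at x) h))) (at x)" for x
  using has_derivative_compose[OF Ck_UNIV_E(1)[OF Suc.prems(2)] Ck_UNIV_E(1)[OF Suc.prems(1)]]
  by blast
 show ?case
 proof (rule Ck_UNIV_I[OF d])
  fix i :: 'a assume i: "i : Basis"
  have lin: "linear (frechet_derivative g (at (f x)))" for x
   using has_derivative_linear[OF Ck_UNIV_E(1)[OF Suc.prems(1)]] .
  have "frechet_derivative g (at (f x)) y = y * frechet_derivative g (at (f x)) 1" for x y
   using linear_scale[OF lin, of x y 1] by simp
  moreover have "Ck_closure n UNIV (%x. frechet_derivative f (at x) i * frechet_derivative g (at (f x)) 1)"
   by (intro Ck_UNIV_mult Ck_UNIV_E(2)[OF Suc.prems(2) i] Ck_UNIV_Suc[OF Suc.prems(2)]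
      Suc.IH[OF Ck_UNIV_E(2)[OF Suc.prems(1)]]) auto
  ultimately show "Ck_closure n UNIV (%x. frechet_derivative g (at (f x)) (frechet_derivative f (at x) i))"
   by (metis (no_types, lifting) ext)
 qed
qed

lemma smoothI_Ck: "(!!n. Ck_closure n UNIV f) ==> smooth f"
 by (simp add: smooth_def)

lemma smooth_Ck: "smooth f ==> Ck_closure n UNIV f"
 by (simp add: smooth_def)

lemma smooth_const: "smooth (%x. c)"
 by (simp add: smooth_def Ck_UNIV_const)

lemma smooth_add: "smooth f ==> smooth g ==> smooth (%x. f x + g x)"
 by (simp add: smooth_def Ck_UNIV_add)

lemma smooth_mult: "smooth f ==> smooth g ==> smooth (%x. f x * g x)"
 by (simp add: smooth_def Ck_UNIV_mult)

lemma smooth_linear: "bounded_linear L ==> smooth f ==> smooth (%x. f (L x))"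
 by (simp add: smooth_def Ck_UNIV_linear)

lemma smooth_bounded_linear: "bounded_linear L ==> smooth L"
 by (simp add: smooth_def Ck_UNIV_bounded_linear)

lemma smooth_compose: "smooth g ==> smooth f ==> smooth (%x. g (f x))"
 by (simp add: smooth_def Ck_UNIV_compose)

lemma smooth_prod: "(!!i. i : I ==> smooth (f i)) ==> smooth (%x. \<Prod>i\<in>I. f i x)"
 by (induction I rule: infinite_finite_induct) (auto intro!: smooth_const smooth_mult)

lemma smooth_has_derivative: "smooth f ==> (f has_derivative frechet_derivative f (at x)) (at x)"
 using Ck_UNIV_E(1) smooth_Ck by blast

lemma smooth_continuous: "smooth f ==> continuous_on UNIV f"
 using smooth_Ck[of f 0] by simp

text \<open>Joint continuity in the point and the direction: in the transport derivative the
  direction moves together with the point.\<close>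

lemma smooth_continuous_derivative:
 fixes f :: "'a::euclidean_space => real"
 assumes "smooth f"
 shows "continuous_on UNIV (%(x, h). frechet_derivative f (at x) h)"
proof -
 have c: "continuous_on UNIV (%x. frechet_derivative f (at x) i)" if "i : Basis" for i
  using Ck_UNIV_E(2)[OF smooth_Ck[OF assms, of "Suc 0"] that] by simp
 have lin: "linear (frechet_derivative f (at x))" for x
  using has_derivative_linear[OF smooth_has_derivative[OF assms]] .
 have "frechet_derivative f (at x) h = (\<Sum>j\<in>Basis. (h \<bullet> j) * frechet_derivative f (at x) j)" for x h
  by (subst euclidean_representation[symmetric, of h], subst linear_sum[OF lin])
    (simp add: linear_scale[OF lin])
 then have eq: "(%(x, h). frechet_derivative f (at x) h) = (%(x,h). \<Sum>j\<in>Basis. (h \<bullet> j) * frechet_derivative f (at x) j)"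
  by (intro ext) (metis (no_types, lifting) case_prod_unfold)
 show ?thesis unfolding eq unfolding case_prod_unfold
  by (intro continuous_on_sum continuous_on_mult continuous_on_compose2[OF c] continuous_intros) auto
qed

section \<open>Smooth bumps on boxes\<close>

text \<open>The powers of \<open>1 / x\<close> make the span of this family closed under
  differentiation, so a single induction over all \<open>m\<close> shows that its members are
  smooth.\<close>

definition exp_inv :: "nat => real => real" where
 "exp_inv m x = (if x > 0 then (1 / x) ^ m * exp (- (1 / x)) else 0)"

lemma tendsto_exp_inv: "(exp_inv m \<longlongrightarrow> 0) (at_right 0)"
proof -
 have "((%y. y ^ m / exp y) \<longlongrightarrow> 0) (at_top :: real filter)"
  by (rule tendsto_power_div_exp_0)
 then have "((%x. inverse x ^ m / exp (inverse x)) \<longlongrightarrow> (0::real)) (at_right 0)"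
  by (rule filterlim_compose) (rule filterlim_inverse_at_top_right)
 moreover have "\<forall>\<^sub>F x in at_right (0::real). inverse x ^ m / exp (inverse x) = exp_inv m x"
  by (auto simp: exp_inv_def eventually_at_right_field exp_minus divide_inverse intro!: exI[of _ 1])
 ultimately show ?thesis by (simp add: tendsto_cong)
qed

lemma exp_inv_deriv:
 "(exp_inv m has_real_derivative (exp_inv (m + 2) x - real m * exp_inv (m + 1) x)) (at x)"
proof -
 consider "x > 0" | "x < 0" | "x = 0" by linarith
 then show ?thesis
 proof cases
  case 1
  have d: "((%x. (1 / x) ^ m * exp (- (1 / x))) has_real_derivative
   ((1/x)^(m+2) * exp (- (1/x)) - real m * ((1/x)^(m+1) * exp (- (1/x))))) (at x)"
  proof (cases m)
   case 0
   then show ?thesis using 1 by (auto intro!: derivative_eq_intros simp: field_simps power2_eq_square)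
  next
   case (Suc k)
   have i: "((%x. 1 / x) has_real_derivative - (1 / x^2)) (at x)"
    using 1 by (auto intro!: derivative_eq_intros simp: power2_eq_square)
   have "((%x. exp (- (1 / x))) has_real_derivative exp (- (1/x)) * (1 / x^2)) (at x)"
    using DERIV_chain2[OF DERIV_exp DERIV_minus[OF i]] by simp
   from DERIV_mult[OF DERIV_power[OF i, of "Suc k"] this]
   have "((%x. (1 / x) ^ Suc k * exp (- (1 / x))) has_real_derivative
    real (Suc k) * (1/x)^k * (- (1 / x^2)) * exp (- (1/x)) + (1/x)^Suc k * (exp (- (1/x)) * (1 / x^2))) (at x)"
    by (simp add: algebra_simps add_divide_distrib)
   moreover have "real (Suc k) * (1/x)^k * (- (1 / x^2)) * exp (- (1/x)) + (1/x)^Suc k * (exp (- (1/x)) * (1 / x^2)) =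
    (1/x)^(m+2) * exp (- (1/x)) - real m * ((1/x)^(m+1) * exp (- (1/x)))"
    using 1 by (simp add: Suc field_simps power2_eq_square)
   ultimately show ?thesis unfolding Suc by simp
  qed
  have "((exp_inv m) has_real_derivative
   ((1/x)^(m+2) * exp (- (1/x)) - real m * ((1/x)^(m+1) * exp (- (1/x))))) (at x)"
   by (rule DERIV_cong_ev[THEN iffD2, OF refl _ refl d])
     (rule eventually_mono[OF eventually_nhds_in_open[of "{0<..}" x]], use 1 in \<open>auto simp: exp_inv_def\<close>)
  then show ?thesis using 1 by (simp add: exp_inv_def)
 next
  case 2
  have "(exp_inv m has_real_derivative 0) (at x)"
   by (rule DERIV_cong_ev[THEN iffD2, OF refl _ refl DERIV_const[of 0]])
     (rule eventually_mono[OF eventually_nhds_in_open[of "{..<0}" x]], use 2 in \<open>auto simp: exp_inv_def\<close>)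
  then show ?thesis using 2 by (simp add: exp_inv_def)
 next
  case 3
  \<comment> \<open>Division by \<open>h\<close> raises the exponent by one, so the right difference
    quotient at the origin is the next member of the family, which tends to 0.\<close>
  have "((%h. exp_inv m h / h) \<longlongrightarrow> 0) (at_right 0)"
  proof (rule Lim_transform_eventually[OF tendsto_exp_inv[of "Suc m"]])
   show "\<forall>\<^sub>F x in at_right 0. exp_inv (Suc m) x = exp_inv m x / x"
    by (auto simp: exp_inv_def eventually_at_right_field intro!: exI[of _ 1])
  qed
  moreover have "((%h. exp_inv m h / h) \<longlongrightarrow> 0) (at_left 0)"
   by (rule Lim_transform_eventually[OF tendsto_const])
     (auto simp: exp_inv_def eventually_at_left_field intro!: exI[of _ "-1"])
  ultimately have "((%h. exp_inv m h / h) \<longlongrightarrow> 0) (at 0)"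
   by (simp add: filterlim_at_split)
  then show ?thesis using 3 by (simp add: DERIV_def exp_inv_def)
 qed
qed

lemma smooth_exp_inv: "smooth (exp_inv m)"
proof (rule smoothI_Ck)
 fix n show "Ck_closure n UNIV (exp_inv m)"
 proof (induction n arbitrary: m)
  case 0
  show ?case using exp_inv_deriv[of m] by (auto intro!: continuous_at_imp_continuous_on DERIV_isCont)
 next
  case (Suc n)
  have "(exp_inv m has_derivative (*) (exp_inv (m + 2) x - real m * exp_inv (m + 1) x)) (at x)" for x
   using exp_inv_deriv[of m x] by (simp add: has_field_derivative_def)
  then show ?case
  proof (rule Ck_UNIV_I)
   have "Ck_closure n UNIV (%x. exp_inv (m + 2) x + (- real m) * exp_inv (m + 1) x)"
    by (intro Ck_UNIV_add Ck_UNIV_mult Ck_UNIV_const Suc)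
   then show "Ck_closure n UNIV (%x. (exp_inv (m + 2) x - real m * exp_inv (m + 1) x) * i)"
    if "i : Basis" for i using that by simp
  qed
 qed
qed

text \<open>Growing \<open>n\<close> steepens the profile without enlarging the support: the
  indicator of an open box becomes a bounded pointwise limit of smooth functions vanishing off that
  box. This takes the place of mollification throughout.\<close>

definition box_bump :: "nat => 'a::euclidean_space => 'a => 'a => real" where
 "box_bump n a b x =
   (\<Prod>i\<in>Basis. exp_inv 0 (real (Suc n) * ((x - a) \<bullet> i)) * exp_inv 0 (real (Suc n) * ((b - x) \<bullet> i)))"

lemma smooth_box_bump: "smooth (box_bump n a b)"
proof -
 have "smooth (%x. exp_inv 0 (real (Suc n) * ((x - a) \<bullet> i)))" for i
 proof -
  have "smooth (%x. (x \<bullet> (real (Suc n) *\<^sub>R i)) + (- real (Suc n) * (a \<bullet> i)))"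
   by (intro smooth_add smooth_const smooth_bounded_linear bounded_linear_inner_left)
  from smooth_compose[OF smooth_exp_inv[of 0] this] show ?thesis
   by (simp add: algebra_simps)
 qed
 moreover have "smooth (%x. exp_inv 0 (real (Suc n) * ((b - x) \<bullet> i)))" for i
 proof -
  have "smooth (%x. (x \<bullet> (- real (Suc n) *\<^sub>R i)) + (real (Suc n) * (b \<bullet> i)))"
   by (intro smooth_add smooth_const smooth_bounded_linear bounded_linear_inner_left)
  from smooth_compose[OF smooth_exp_inv[of 0] this] show ?thesis
   by (simp add: algebra_simps)
 qed
 ultimately show ?thesis unfolding box_bump_def
  by (intro smooth_prod smooth_mult)
qed

lemma exp_inv_bounds: "0 <= exp_inv 0 x" "exp_inv 0 x <= 1"
 by (auto simp: exp_inv_def)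

lemma box_bump_bounds: "0 <= box_bump n a b x" "box_bump n a b x <= 1"
 unfolding box_bump_def
 by (intro prod_nonneg mult_nonneg_nonneg exp_inv_bounds,
   intro prod_le_1 conjI mult_nonneg_nonneg mult_le_one exp_inv_bounds)

lemma box_bump_eq_0: "x \<notin> box a b ==> box_bump n a b x = 0"
proof -
 assume "x \<notin> box a b"
 then obtain i where i: "i : Basis" "(x - a) \<bullet> i <= 0 \<or> (b - x) \<bullet> i <= 0"
  by (auto simp: mem_box inner_diff_left not_less)
 have "real (Suc n) * r <= 0" if "r <= 0" for r
  using that by (simp add: mult_nonneg_nonpos del: of_nat_Suc)
 then have "exp_inv 0 (real (Suc n) * ((x - a) \<bullet> i)) * exp_inv 0 (real (Suc n) * ((b - x) \<bullet> i)) = 0"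
  using i(2) by (auto simp: exp_inv_def not_less[symmetric] simp del: of_nat_Suc)
 then show ?thesis unfolding box_bump_def using i(1) by (intro prod_zero) auto
qed

lemma tendsto_box_bump: "(%n. box_bump n a b x) \<longlonglongrightarrow> indicator (box a b) x"
proof (cases "x : box a b")
 case False then show ?thesis by (simp add: box_bump_eq_0)
next
 case True
 have "(%n. exp_inv 0 (real (Suc n) * r)) \<longlonglongrightarrow> 1" if "r > 0" for r
 proof -
  have "(%n. exp (- (1 / r * inverse (real (Suc n))))) \<longlonglongrightarrow> exp (- (1 / r * 0))"
   by (intro tendsto_intros LIMSEQ_inverse_real_of_nat)
  then show ?thesis using that by (simp add: exp_inv_def field_simps del: of_nat_Suc)
 qed
 then have "(%n. box_bump n a b x) \<longlonglongrightarrow> (\<Prod>i\<in>(Basis::'a set). 1 * 1)"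
  unfolding box_bump_def using True
  by (intro tendsto_prod tendsto_mult) (auto simp: mem_box inner_diff_left)
 then show ?thesis using True by simp
qed

lemma measurable_box_bump[measurable]: "box_bump n a b : borel_measurable borel"
 by (intro borel_measurable_continuous_onI smooth_continuous smooth_box_bump)

section \<open>The fundamental lemma of the calculus of variations\<close>

lemma open_countable_cbox_cover:
 fixes U :: "'a::euclidean_space set"
 assumes "open U"
 obtains D where "countable D" "!!a b. (a, b) : D ==> cbox a b \<subseteq> U" "U = (\<Union>(a, b)\<in>D. box a b)"
proof -
 define F where "F = {(a, b). cbox a b \<subseteq> U}"
 have U: "U = \<Union>((%(a, b). box a b) ` F)"
 proof (intro equalityI subsetI)
  fix x assume "x : U"
  then obtain a b where "x : box a b" "cbox a b \<subseteq> U"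
   using open_contains_cbox[OF assms \<open>x : U\<close>] by metis
  then show "x : \<Union>((%(a, b). box a b) ` F)" by (auto simp: F_def)
 next
  fix x assume "x : \<Union>((%(a, b). box a b) ` F)"
  then obtain a b where "(a, b) : F" "x : box a b" by auto
  then show "x : U" using box_subset_cbox[of a b] by (auto simp: F_def)
 qed
 have "open S" if "S : (%(a, b). box a b) ` F" for S :: "'a set" using that by auto
 from Lindelof[OF this] obtain G where
  G: "G \<subseteq> (%(a, b). box a b) ` F" "countable G" "\<Union>G = \<Union>((%(a, b). box a b) ` F)"
  by auto
 from G(1,2) obtain D where D: "countable D" "D \<subseteq> F" "G = (%(a, b). box a b) ` D"
  using countable_subset_image[of G "%(a,b). box a b" F, THEN iffD1] by blast
 show ?thesis
 proof (rule that[OF D(1)])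
  show "cbox a b \<subseteq> U" if "(a, b) : D" for a b using that D(2) by (auto simp: F_def)
  show "U = (\<Union>(a, b)\<in>D. box a b)" using U G(3) D(3) by simp
 qed
qed

text \<open>Bumps converge boundedly to indicators of boxes, boxes generate the Borel sets, and
  countably many of them cover \<open>U\<close>. The measure is only tied to a trace of the Borel
  sets on some \<open>S\<close>, so that the statement covers both the plane and the phase space,
  whose directions lie on a circle.\<close>

theorem fundamental_lemma:
 fixes \<mu> :: "'a::euclidean_space measure" and g :: "'a => real"
 assumes sets: "sets \<mu> = sets (restrict_space borel S)"
  and U: "open U"
  and int: "!!a b. cbox a b \<subseteq> U ==> integrable \<mu> (%x. indicator (cbox a b) x * g x)"
  and zero: "!!a b n. cbox a b \<subseteq> U ==> (\<integral>x. g x * box_bump n a b x \<partial>\<mu>) = 0"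
 shows "AE x in \<mu>. x : U --> g x = 0"
proof -
 have space: "space \<mu> = S"
  using sets_eq_imp_space_eq[OF sets] by (simp add: space_restrict_space)
 have id[measurable]: "(%x. x) : \<mu> \<rightarrow>\<^sub>M borel"
  by (subst measurable_cong_sets[OF sets refl]) (simp add: measurable_restrict_space1)
 have bx[measurable]: "{x : space \<mu>. x : A} : sets \<mu>" if "A : sets borel" for A
  using measurable_sets[OF id that] by (simp add: vimage_def Int_def conj_commute)
 have ind[measurable]: "(%x. indicator A x :: real) : borel_measurable \<mu>" if "A : sets borel" for A
  using measurable_compose[OF id borel_measurable_indicator[OF that]] .
 have indI: "integrable \<mu> (%x. indicator A x * f x)"
  if "integrable \<mu> f" "A : sets borel" for f :: "'a => real" and A
  using that(1)
 proof (rule Bochner_Integration.integrable_bound)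
  show "(%x. indicator A x * f x) : borel_measurable \<mu>"
   using ind[OF that(2)] borel_measurable_integrable[OF that(1)] by (rule borel_measurable_times)
 qed (simp add: indicator_def)
 have box0: "(\<integral>x. indicator (box a b) x * g x \<partial>\<mu>) = 0" if ab: "cbox a b \<subseteq> U" for a b
 proof -
  let ?h = "%x. indicator (cbox a b) x * g x"
  have mh[measurable]: "?h : borel_measurable \<mu>" using int[OF ab] by simp
  have eq: "g x * box_bump n a b x = ?h x * box_bump n a b x" for n x
   using box_bump_eq_0[of x a b n] box_subset_cbox[of a b] by (auto simp: indicator_def)
  have eq2: "indicator (box a b) x * g x = ?h x * indicator (box a b) x" for x
   using box_subset_cbox[of a b] by (auto simp: indicator_def)
  have "(%n. \<integral>x. ?h x * box_bump n a b x \<partial>\<mu>) \<longlonglongrightarrow> (\<integral>x. ?h x * indicator (box a b) x \<partial>\<mu>)"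
  proof (rule integral_dominated_convergence[where w="%x. norm (?h x)"])
   show "integrable \<mu> (%x. norm (?h x))" using int[OF ab] by (rule integrable_norm)
   show "AE x in \<mu>. norm (?h x * box_bump n a b x) <= norm (?h x)" for n
    using box_bump_bounds[of n a b] by (auto simp: abs_mult intro!: mult_left_le)
   show "AE x in \<mu>. (%n. ?h x * box_bump n a b x) \<longlonglongrightarrow> ?h x * indicator (box a b) x"
    by (intro AE_I2 tendsto_mult tendsto_const tendsto_box_bump)
  qed measurable
  then show ?thesis unfolding eq2
   using zero[OF ab] unfolding eq by (simp add: LIMSEQ_const_iff)
 qed
 obtain D where D: "countable D" "!!a b. (a, b) : D ==> cbox a b \<subseteq> U" "U = (\<Union>(a, b)\<in>D. box a b)"
  using open_countable_cbox_cover[OF U] by blast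
 have "AE x in \<mu>. x : box a b --> g x = 0" if "(a, b) : D" for a b
 proof -
  have ab: "cbox a b \<subseteq> U" using D(2) that .
  define h where "h x = indicator (box a b) x * g x" for x
  have h: "integrable \<mu> h"
   using indI[OF int[OF ab], of "box a b"]
   by (rule Bochner_Integration.integrable_cong[OF refl, THEN iffD1, rotated])
     (use box_subset_cbox[of a b] in \<open>auto simp: indicator_def h_def\<close>)
  \<comment> \<open>Dynkin's argument: boxes are stable under intersection, and the integrability of
    \<open>h\<close> on one fixed box handles complements and disjoint unions.\<close>
  have hA: "(\<integral>x. indicator A x * h x \<partial>\<mu>) = 0" if "A : sets borel" for A
  proof -
   have "A : sigma_sets UNIV (range (%(a, b). box a b :: 'a set))"
    using that by (simp add: borel_eq_box sets_measure_of)
   have "Int_stable (range (%(a, b). box a b :: 'a set))"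
    by (auto simp: Int_stable_def box_Int_box)
   moreover have "range (%(a, b). box a b :: 'a set) \<subseteq> Pow UNIV" by simp
   ultimately show ?thesis using \<open>A : sigma_sets _ _\<close>
   proof (induction rule: sigma_sets_induct_disjoint)
    case (basic A)
    then obtain c d where A: "A = box c d" by auto
    obtain c' d' where *: "box c d \<inter> box a b = box c' d'"
     using box_Int_box[of c d a b] by auto
    \<comment> \<open>The corners of an empty box are arbitrary, hence the case split below; a
      nonempty \<open>box c' d'\<close> has \<open>cbox c' d'\<close> as closure, which then lies in
      \<open>U\<close>.\<close>
    have "closure (box c' d') \<subseteq> cbox a b"
     by (metis "*" Int_lower2 box_subset_cbox closed_cbox closure_minimal order_trans)
    show ?case
    proof (cases "box c' d' = {}")
     case True
     then have "indicator A x * h x = 0" for x using * by (auto simp: A h_def indicator_def)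
     then show ?thesis by (simp only: Bochner_Integration.integral_zero)
    next
     case False
     then have "cbox c' d' \<subseteq> U" using \<open>closure (box c' d') \<subseteq> cbox a b\<close> ab by simp
     from box0[OF this] have "(\<integral>x. indicator (box c d \<inter> box a b) x * g x \<partial>\<mu>) = 0"
      unfolding * .
     then show ?thesis by (simp add: A h_def indicator_inter_arith mult.assoc)
    qed
   next
    case empty then show ?case by simp
   next
    case (compl A)
    then have A: "A : sets borel" by (simp add: borel_eq_box sets_measure_of)
    have "(\<integral>x. indicator (UNIV - A) x * h x \<partial>\<mu>) = (\<integral>x. h x - indicator A x * h x \<partial>\<mu>)"
     by (intro Bochner_Integration.integral_cong) (auto simp: indicator_def)
    also have "\<dots> = (\<integral>x. h x \<partial>\<mu>) - (\<integral>x. indicator A x * h x \<partial>\<mu>)"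
     by (intro Bochner_Integration.integral_diff h indI A)
    also have "\<dots> = 0" using box0[OF ab] compl.IH by (simp add: h_def)
    finally show ?case .
   next
    case (union A)
    then have A: "range A \<subseteq> sets borel" by (auto simp: borel_eq_box sets_measure_of)
    then have iA: "integrable \<mu> (%x. indicator (A i) x * h x)" for i
     by (intro h indI) auto
    have "(%n. \<integral>x. (\<Sum>i<n. indicator (A i) x * h x) \<partial>\<mu>) \<longlonglongrightarrow> (\<integral>x. indicator (\<Union>i. A i) x * h x \<partial>\<mu>)"
    proof (rule integral_dominated_convergence[where w="%x. norm (h x)"])
     have UA[measurable]: "(\<Union>i. A i) : sets borel" using A by auto
     show "(%x. indicator (\<Union>i. A i) x * h x) : borel_measurable \<mu>"
      using ind[OF UA] h by measurable
     show "(%x. \<Sum>i<n. indicator (A i) x * h x) : borel_measurable \<mu>" for n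
      using iA by (intro borel_measurable_sum) auto
     have s: "(\<Sum>i<n. indicator (A i) x * h x) = indicator (\<Union>i<n. A i) x * h x" for n x
     proof -
      have "disjoint_family_on A {..<n}"
       using union.hyps(1) by (auto simp: disjoint_family_on_def)
      then have "(\<Sum>i<n. indicator (A i) x :: real) = indicator (\<Union>i<n. A i) x"
       by (intro indicator_UN_disjoint[symmetric]) auto
      then show ?thesis by (simp only: sum_distrib_right[symmetric])
     qed
     show "AE x in \<mu>. norm (\<Sum>i<n. indicator (A i) x * h x) <= norm (h x)" for n
      unfolding s by (auto simp: indicator_def)
     show "AE x in \<mu>. (%n. \<Sum>i<n. indicator (A i) x * h x) \<longlonglongrightarrow> indicator (\<Union>i. A i) x * h x"
      unfolding s by (intro AE_I2 tendsto_mult tendsto_const LIMSEQ_indicator_UN)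
     show "integrable \<mu> (%x. norm (h x))" using h by simp
    qed
    moreover have "(\<integral>x. (\<Sum>i<n. indicator (A i) x * h x) \<partial>\<mu>) = 0" for n
     using iA union.IH by (subst Bochner_Integration.integral_sum) auto
    ultimately show ?case by (simp add: LIMSEQ_const_iff)
   qed
  qed
  have "AE x in \<mu>. h x = 0"
  proof (rule density_unique_real[OF h integrable_zero])
   fix A assume "A : sets \<mu>"
   then obtain B where B: "B : sets borel" "A = S \<inter> B" by (auto simp: sets sets_restrict_space)
   have "(\<integral>x. indicator A x * h x \<partial>\<mu>) = (\<integral>x. indicator B x * h x \<partial>\<mu>)"
    by (intro Bochner_Integration.integral_cong) (auto simp: B space indicator_def)
   then show "set_lebesgue_integral \<mu> A h = set_lebesgue_integral \<mu> A (%_. 0)" using hA[OF B(1)] by (simp add: set_lebesgue_integral_def)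
  qed
  then show ?thesis by eventually_elim (auto simp: h_def)
 qed
 then have "AE x in \<mu>. \<forall>(a, b)\<in>D. x : box a b --> g x = 0"
  using D(1) by (subst AE_ball_countable) auto
 then show ?thesis by eventually_elim (use D(3) in auto)
qed

section \<open>The circle and the phase space\<close>

lemma borel_measurable_vector2[measurable (raw)]:
 assumes [measurable]: "f : borel_measurable M" "g : borel_measurable M"
 shows "(%x. vector [f x, g x] :: real^2) : borel_measurable M"
proof -
 have "(vector [a, b] :: real^2) = a *\<^sub>R axis 1 1 + b *\<^sub>R axis 2 1" for a b
  by (simp add: vec_eq_iff forall_2 axis_def)
 then show ?thesis by simp
qed

lemma borel_measurable_vec_nth[measurable (raw)]:
 assumes [measurable]: "f : borel_measurable M"
 shows "(%x. (f x :: real^'n) $ i) : borel_measurable M"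
 by (rule measurable_compose[OF assms])
   (intro borel_measurable_continuous_onI linear_continuous_on bounded_linear_vec_nth)

lemma norm_cos_sin: "norm (vector [cos t, sin t] :: real^2) = 1"
 by (simp add: norm_vec_def L2_set_def UNIV_2)

lemma cos_sin_measurable:
 "(%t. vector [cos t, sin t]) : uniform_measure lborel {-pi..pi} \<rightarrow>\<^sub>M restrict_space borel (sphere (0::plane) 1)"
 by (intro measurable_restrict_space2) (auto simp: norm_cos_sin)

lemma sets_circle[measurable_cong]: "sets circle_measure = sets (restrict_space borel (sphere 0 1))"
 by (simp add: circle_measure_def)

lemma space_circle: "space circle_measure = sphere 0 1"
 by (simp add: circle_measure_def space_restrict_space)

lemma measurable_circle_borel: "(%th. th) : circle_measure \<rightarrow>\<^sub>M borel"
 by (subst measurable_cong_sets[OF sets_circle refl]) (simp add: measurable_restrict_space1)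

lemma borel_measurable_snd_circle[measurable (raw)]:
 "f : M \<rightarrow>\<^sub>M (N \<Otimes>\<^sub>M circle_measure) ==> (%x. snd (f x)) : borel_measurable M"
 by (rule measurable_compose[OF measurable_compose[OF _ measurable_snd] measurable_circle_borel])

lemma borel_measurable_fst_circle[measurable (raw)]:
 "f : M \<rightarrow>\<^sub>M (circle_measure \<Otimes>\<^sub>M N) ==> (%x. fst (f x)) : borel_measurable M"
 by (rule measurable_compose[OF measurable_compose[OF _ measurable_fst] measurable_circle_borel])

lemma borel_measurable_circle[measurable]: "(%th. th) : borel_measurable circle_measure"
 by (rule measurable_circle_borel)

lemma emeasure_circle_space: "emeasure circle_measure (space circle_measure) = 1"
proof -
 have "(%t. vector [cos t, sin t]) -` sphere (0::plane) 1 \<inter> space (uniform_measure lborel {-pi..pi}) = UNIV"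
  by (auto simp: norm_cos_sin)
 then have "emeasure circle_measure (space circle_measure) = emeasure (uniform_measure lborel {-pi..pi}) UNIV"
  unfolding circle_measure_def
  using sets.top[of "restrict_space borel (sphere (0::plane) 1)"]
  by (subst emeasure_distr[OF cos_sin_measurable]) (auto simp: space_restrict_space)
 also have "\<dots> = 1" by (simp add: ennreal_divide_self)
 finally show ?thesis .
qed

interpretation circle: finite_measure circle_measure
 by (rule finite_measureI) (simp add: emeasure_circle_space)

interpretation lc: pair_sigma_finite "lborel :: 'a::euclidean_space measure" circle_measure
 by unfold_locales

interpretation lcl: pair_sigma_finite "(lborel :: 'a::euclidean_space measure) \<Otimes>\<^sub>M circle_measure" "lborel :: 'b::euclidean_space measure"
 by (rule pair_sigma_finite.intro) (auto intro: lc.sigma_finite_measure_axioms lborel.sigma_finite_measure_axioms)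

lemma circle_integrable_bounded:
 fixes f :: "plane => 'b::{banach, second_countable_topology}"
 assumes "f : borel_measurable circle_measure" "!!th. norm th = 1 ==> norm (f th) <= B"
 shows "integrable circle_measure f"
 using assms by (intro circle.integrable_const_bound[where B=B] AE_I2) (auto simp: space_circle)

lemma integral_circle_const: "(\<integral>th. c \<partial>circle_measure) = (c :: 'b::{banach, second_countable_topology})"
 using emeasure_circle_space by (simp add: measure_def)

text \<open>The whole plane is kept and functions are cut off instead: shifts in the direction and
  line coordinates then preserve one fixed measure.\<close>

abbreviation phase_space :: "(plane \<times> plane) measure" where
 "phase_space \<equiv> lborel \<Otimes>\<^sub>M circle_measure"

lemma space_phase: "space phase_space = UNIV \<times> sphere 0 1"
 by (simp add: space_pair_measure space_circle)

text \<open>This is the form of the sigma algebra that \<open>fundamental_lemma\<close> asks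
  for.\<close>

lemma sets_phase: "sets phase_space = sets (restrict_space borel (UNIV \<times> sphere 0 1))"
proof (rule set_eqI)
 fix A :: "(plane \<times> plane) set"
 let ?R = "restrict_space (borel :: (plane \<times> plane) measure) (UNIV \<times> sphere 0 1)"
 have 1: "(%x. x) : phase_space \<rightarrow>\<^sub>M ?R"
 proof (rule measurable_restrict_space2)
  have "(%x. (fst x, snd x)) : phase_space \<rightarrow>\<^sub>M borel" by measurable
  then show "(%x. x) : phase_space \<rightarrow>\<^sub>M borel" by simp
 qed (auto simp: space_phase)
 have b: "(%x. x) : ?R \<rightarrow>\<^sub>M borel" by (simp add: measurable_restrict_space1)
 have "(%x. (fst x, snd x)) : ?R \<rightarrow>\<^sub>M phase_space"
 proof (rule measurable_Pair)
  show "fst : ?R \<rightarrow>\<^sub>M lborel"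
   using measurable_compose[OF b, of fst borel]
   by (simp add: borel_measurable_continuous_onI continuous_on_fst[OF continuous_on_id])
  have "snd : ?R \<rightarrow>\<^sub>M borel"
   using measurable_compose[OF b, of snd borel]
   by (simp add: borel_measurable_continuous_onI continuous_on_snd[OF continuous_on_id])
  then have "snd : ?R \<rightarrow>\<^sub>M restrict_space borel (sphere 0 1)"
   by (rule measurable_restrict_space2[rotated]) (auto simp: space_restrict_space)
  then show "snd : ?R \<rightarrow>\<^sub>M circle_measure"
   by (subst measurable_cong_sets[OF refl sets_circle])
 qed
 then have 2: "(%x. x) : ?R \<rightarrow>\<^sub>M phase_space" by simp
 have sp: "space ?R = space phase_space" by (simp add: space_restrict_space space_phase)
 show "A : sets phase_space \<longleftrightarrow> A : sets ?R"
 proof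
  assume A: "A : sets phase_space"
  have "A \<subseteq> space ?R" unfolding sp using sets.sets_into_space[OF A] .
  then show "A : sets ?R" using measurable_sets[OF 2 A] by (simp add: Int_absorb2)
 next
  assume A: "A : sets ?R"
  have "A \<subseteq> space phase_space" unfolding sp[symmetric] using sets.sets_into_space[OF A] .
  then show "A : sets phase_space" using measurable_sets[OF 1 A] by (simp add: Int_absorb2)
 qed
qed

text \<open>Both measures agree on rectangles and the factors are sigma finite. The lemma carries
  statements over \<open>phase_measure\<close> to cut-off functions on
  \<open>phase_space\<close>.\<close>

lemma phase_measure_eq:
 assumes [measurable]: "Om : sets borel"
 shows "phase_measure Om = restrict_space phase_space (Om \<times> UNIV)"
proof -
 have O: "Om \<times> UNIV \<inter> space phase_space : sets phase_space"
 proof -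
  have "Om \<times> space circle_measure : sets phase_space" by auto
  then show ?thesis by (simp add: space_phase space_circle Times_Int_Times)
 qed
 show ?thesis
  unfolding phase_measure_def
 proof (rule pair_measure_eqI)
  show "sigma_finite_measure (restrict_space lborel Om)"
   by (intro sigma_finite_measure_restrict_space sigma_finite_lborel) simp
  show "sigma_finite_measure circle_measure" by unfold_locales
  let ?P = "restrict_space phase_space (Om \<times> UNIV)"
  show s: "sets (restrict_space lborel Om \<Otimes>\<^sub>M circle_measure) = sets ?P"
  proof (rule set_eqI)
   fix A :: "(plane \<times> plane) set"
   let ?R = "restrict_space lborel Om \<Otimes>\<^sub>M circle_measure"
   have sp: "space ?R = space ?P"
    by (auto simp: space_pair_measure space_restrict_space)
   have 1: "(%x. x) : ?R \<rightarrow>\<^sub>M ?P"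
   proof (rule measurable_restrict_space2)
    show "(%x. x) : space ?R \<rightarrow> Om \<times> UNIV" by (auto simp: space_pair_measure space_restrict_space)
    have "(%x. (fst x, snd x)) : ?R \<rightarrow>\<^sub>M phase_space"
     by (intro measurable_Pair measurable_snd measurable_compose[OF measurable_fst])
       (simp add: measurable_restrict_space1)
    then show "(%x. x) : ?R \<rightarrow>\<^sub>M phase_space" by simp
   qed
   have b: "(%x. x) : ?P \<rightarrow>\<^sub>M phase_space" by (simp add: measurable_restrict_space1)
   have "(%x. (fst x, snd x)) : ?P \<rightarrow>\<^sub>M ?R"
    by (intro measurable_Pair measurable_restrict_space2 measurable_compose[OF b measurable_fst]
      measurable_compose[OF b measurable_snd]) (auto simp: space_restrict_space)
   then have 2: "(%x. x) : ?P \<rightarrow>\<^sub>M ?R" by simp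
   show "A : sets ?R \<longleftrightarrow> A : sets ?P"
   proof
    assume A: "A : sets ?R"
    have "A \<subseteq> space ?P" unfolding sp[symmetric] using sets.sets_into_space[OF A] .
    then show "A : sets ?P" using measurable_sets[OF 2 A] by (simp add: Int_absorb2)
   next
    assume A: "A : sets ?P"
    have "A \<subseteq> space ?R" unfolding sp using sets.sets_into_space[OF A] .
    then show "A : sets ?R" using measurable_sets[OF 1 A] by (simp add: Int_absorb2)
   qed
  qed
  fix A B assume A: "A : sets (restrict_space lborel Om)" and B: "B : sets circle_measure"
  from A have A': "A \<subseteq> Om" "A : sets lborel"
   by (auto simp: sets_restrict_space)
  have "emeasure ?P (A \<times> B) = emeasure phase_space (A \<times> B)"
   using A' by (intro emeasure_restrict_space O) auto
  also have "\<dots> = emeasure lborel A * emeasure circle_measure B"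
   using A' B by (intro circle.emeasure_pair_measure_Times) auto
  also have "emeasure lborel A = emeasure (restrict_space lborel Om) A"
   using A' by (simp add: emeasure_restrict_space)
  finally show "emeasure (restrict_space lborel Om) A * emeasure circle_measure B = emeasure ?P (A \<times> B)"
   by simp
 qed
qed

lemma phase_restrict_sets:
 assumes [measurable]: "Om : sets borel"
 shows "Om \<times> UNIV \<inter> space phase_space : sets phase_space"
proof -
 have "Om \<times> space circle_measure : sets phase_space" by auto
 then show ?thesis by (simp add: space_phase space_circle Times_Int_Times)
qed

lemma AE_phase_measure:
 assumes "Om : sets borel"
 shows "(AE x in phase_measure Om. P x) \<longleftrightarrow> (AE x in phase_space. fst x : Om --> P x)"
 unfolding phase_measure_eq[OF assms] AE_restrict_space_iff[OF phase_restrict_sets[OF assms]]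
 by (auto simp: mem_Times_iff)

lemma integral_phase_measure:
 fixes f :: "plane \<times> plane => 'b::{banach, second_countable_topology}"
 assumes "Om : sets borel"
 shows "(\<integral>x. f x \<partial>phase_measure Om) = (\<integral>x. indicator Om (fst x) *\<^sub>R f x \<partial>phase_space)"
 unfolding phase_measure_eq[OF assms] integral_restrict_space[OF phase_restrict_sets[OF assms]]
 by (auto intro!: Bochner_Integration.integral_cong simp: indicator_def mem_Times_iff)

lemma integrable_phase_measure:
 fixes f :: "plane \<times> plane => 'b::{banach, second_countable_topology}"
 assumes "Om : sets borel"
 shows "integrable (phase_measure Om) f \<longleftrightarrow> integrable phase_space (%x. indicator Om (fst x) *\<^sub>R f x)"
 unfolding phase_measure_eq[OF assms] integrable_restrict_space[OF phase_restrict_sets[OF assms]]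
 by (auto intro!: Bochner_Integration.integrable_cong simp: indicator_def mem_Times_iff)

lemma measurable_phase_measure:
 fixes f :: "plane \<times> plane => 'b::real_normed_vector"
 assumes "Om : sets borel"
 shows "f : borel_measurable (phase_measure Om) \<longleftrightarrow> (%x. indicator Om (fst x) *\<^sub>R f x) : borel_measurable phase_space"
 unfolding phase_measure_eq[OF assms] borel_measurable_restrict_space_iff[OF phase_restrict_sets[OF assms]]
 by (auto intro!: measurable_cong simp: indicator_def mem_Times_iff)

lemma finite_phase_measure:
 assumes "Om : sets borel" "bounded Om"
 shows "finite_measure (phase_measure Om)"
proof (rule finite_measureI)
 have "emeasure lborel Om ~= \<infinity>" using emeasure_bounded_finite[OF assms(2)] by simp
 then show "emeasure (phase_measure Om) (space (phase_measure Om)) ~= \<infinity>"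
  unfolding phase_measure_def space_pair_measure
  by (subst circle.emeasure_pair_measure_Times)
    (use assms(1) sets.top[of "restrict_space lborel Om"] in
     \<open>auto simp: emeasure_circle_space emeasure_restrict_space space_restrict_space\<close>)
qed

subsection \<open>Coordinates along lines\<close>

definition line :: "real => plane => real => plane" where
 "line s th t = s *\<^sub>R perp th + t *\<^sub>R th"

lemma perp_nth[simp]: "perp th $ 1 = - th $ 2" "perp th $ 2 = th $ 1"
 by (auto simp: perp_def)

lemma norm_plane: "(norm (x::plane))\<^sup>2 = (x $ 1)\<^sup>2 + (x $ 2)\<^sup>2"
 by (simp add: norm_vec_def L2_set_def UNIV_2)

lemma inner_plane: "(x::plane) \<bullet> y = x $ 1 * y $ 1 + x $ 2 * y $ 2"
 by (simp add: inner_vec_def UNIV_2)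

lemma line_inner:
 assumes "norm th = 1"
 shows "line s th t \<bullet> perp th = s" "line s th t \<bullet> th = t"
proof -
 have "(th $ 1)\<^sup>2 + (th $ 2)\<^sup>2 = 1" using norm_plane[of th] assms by simp
 then have 1: "th $ 1 * th $ 1 = 1 - th $ 2 * th $ 2" by (simp add: power2_eq_square)
 show "line s th t \<bullet> perp th = s" "line s th t \<bullet> th = t"
  by (auto simp: line_def inner_plane algebra_simps 1)
qed

lemma line_of_point:
 assumes "norm th = 1"
 shows "line (z \<bullet> perp th) th (z \<bullet> th) = z"
proof -
 have "(th $ 1)\<^sup>2 + (th $ 2)\<^sup>2 = 1" using norm_plane[of th] assms by simp
 then have 1: "th $ 1 * th $ 1 = 1 - th $ 2 * th $ 2" by (simp add: power2_eq_square)
 have 2: "th $ 1 * (th $ 1 * c) = c - th $ 2 * th $ 2 * c" for c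
  using 1 by (metis mult.assoc left_diff_distrib mult_1)
 show ?thesis by (simp add: vec_eq_iff forall_2 line_def inner_plane algebra_simps 2)
qed

lemma line_add: "line s th t + r *\<^sub>R th = line s th (t + r)"
 by (simp add: line_def algebra_simps)

lemma norm_line:
 assumes "norm th = 1"
 shows "(norm (line s th t))\<^sup>2 = s\<^sup>2 + t\<^sup>2"
proof -
 have "(th $ 1)\<^sup>2 + (th $ 2)\<^sup>2 = 1" using norm_plane[of th] assms by simp
 then have "s\<^sup>2 + t\<^sup>2 = s\<^sup>2 * ((th $ 1)\<^sup>2 + (th $ 2)\<^sup>2) + t\<^sup>2 * ((th $ 1)\<^sup>2 + (th $ 2)\<^sup>2)" by simp
 then show ?thesis unfolding norm_plane line_def by (simp add: algebra_simps power2_eq_square)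
qed

lemma distr_coords: "distr (lborel \<Otimes>\<^sub>M lborel) borel (%(s, t). vector [s, t] :: real^2) = lborel"
proof (rule lborel_eqI[symmetric])
 fix l u :: "real^2" assume lu: "!!b. b : Basis ==> l \<bullet> b <= u \<bullet> b"
 have "axis 1 1 : (Basis :: (real^2) set)" "axis 2 1 : (Basis :: (real^2) set)" by (auto simp: axis_in_Basis_iff)
 with lu[of "axis 1 1"] lu[of "axis 2 1"] have le: "l $ 1 <= u $ 1" "l $ 2 <= u $ 2"
  by (auto simp: inner_axis)
 have "(%(s, t). vector [s, t] :: real^2) -` box l u \<inter> space (lborel \<Otimes>\<^sub>M lborel) = {l $ 1<..<u $ 1} \<times> {l $ 2<..<u $ 2}"
  by (auto simp: mem_box_cart forall_2 space_pair_measure)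
 then have "emeasure (distr (lborel \<Otimes>\<^sub>M lborel) borel (%(s, t). vector [s, t] :: real^2)) (box l u)
   = emeasure (lborel \<Otimes>\<^sub>M lborel) ({l $ 1<..<u $ 1} \<times> {l $ 2<..<u $ 2})"
  by (subst emeasure_distr) auto
 also have "\<dots> = ennreal (u $ 1 - l $ 1) * ennreal (u $ 2 - l $ 2)"
  using le by (subst lborel.emeasure_pair_measure_Times) auto
 also have "\<dots> = ennreal (\<Prod>b\<in>Basis. (u - l) \<bullet> b)"
 proof -
  have B: "(Basis :: (real^2) set) = {axis 1 1, axis 2 1}"
   by (auto simp: Basis_vec_def UNIV_2)
  have "axis 1 1 ~= (axis 2 1 :: real^2)" by (simp add: axis_eq_axis)
  then show ?thesis using le by (simp add: B inner_axis ennreal_mult')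
 qed
 finally show "emeasure (distr (lborel \<Otimes>\<^sub>M lborel) borel (%(s, t). vector [s, t] :: real^2)) (box l u) = (\<Prod>b\<in>Basis. (u - l) \<bullet> b)" .
qed simp

lemma distr_orthogonal:
 fixes f :: "plane => plane"
 assumes f: "orthogonal_transformation f"
 shows "distr lborel borel f = lborel"
proof (rule lborel_eqI[symmetric])
 fix l u :: plane assume lu: "!!b. b : Basis ==> l \<bullet> b <= u \<bullet> b"
 have lin: "bounded_linear f" using f by (simp add: linear_conv_bounded_linear[symmetric] orthogonal_transformation_linear)
 have [measurable]: "f : borel_measurable borel"
  by (intro borel_measurable_continuous_onI linear_continuous_on lin)
 have g: "orthogonal_transformation (inv f)" using f by (rule orthogonal_transformation_inv)
 have bij: "bij f" using f by (rule orthogonal_transformation_bij)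
 have pre: "f -` box l u = inv f ` box l u" using bij by (simp add: bij_vimage_eq_inv_image)
 have bx: "f -` box l u : sets borel" using measurable_sets[of f borel borel "box l u"] by simp
 have "emeasure (distr lborel borel f) (box l u) = emeasure lebesgue (inv f ` box l u)"
  using bx by (subst emeasure_distr) (auto simp: pre)
 also have "\<dots> = measure lebesgue (inv f ` box l u)"
  by (intro emeasure_eq_measure2 measurable_orthogonal_image g) simp
 also have "measure lebesgue (inv f ` box l u) = measure lebesgue (box l u)"
  by (intro measure_orthogonal_image g) simp
 also have "measure lebesgue (box l u) = (\<Prod>b\<in>Basis. (u - l) \<bullet> b)"
  using lu by (simp add: measure_lborel_box_eq)
 finally show "emeasure (distr lborel borel f) (box l u) = (\<Prod>b\<in>Basis. (u - l) \<bullet> b)" .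
qed simp

lemma distr_line:
 assumes "norm th = 1"
 shows "distr (lborel \<Otimes>\<^sub>M lborel) borel (%(s, t). line s th t) = lborel"
proof -
 define f where "f x = line (x $ 1) th (x $ 2)" for x :: plane
 have lin: "linear f"
  by (intro linearI) (auto simp: f_def line_def algebra_simps)
 have "orthogonal_transformation f"
  unfolding orthogonal_transformation
 proof (intro conjI lin allI)
  fix v :: plane
  have "(norm (f v))\<^sup>2 = (norm v)\<^sup>2" using norm_line[OF assms] by (simp add: f_def norm_plane)
  then show "norm (f v) = norm v" by simp
 qed
 then have "lborel = distr lborel borel f" by (rule distr_orthogonal[symmetric])
 also have "\<dots> = distr (distr (lborel \<Otimes>\<^sub>M lborel) borel (%(s, t). vector [s, t] :: real^2)) borel f"
  by (simp add: distr_coords)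
 also have "\<dots> = distr (lborel \<Otimes>\<^sub>M lborel) borel (f \<circ> (%(s, t). vector [s, t]))"
  using lin by (intro distr_distr) (auto intro: borel_measurable_continuous_onI linear_continuous_on simp: linear_conv_bounded_linear)
 also have "f \<circ> (%(s, t). vector [s, t]) = (%(s, t). line s th t)" by (auto simp: f_def)
 finally show ?thesis by simp
qed

lemma measurable_perp[measurable (raw)]:
 assumes [measurable]: "f : borel_measurable M"
 shows "(%x. perp (f x)) : borel_measurable M"
 unfolding perp_def by measurable

lemma measurable_line[measurable (raw)]:
 assumes [measurable]: "f : borel_measurable M" "g : borel_measurable M" "h : borel_measurable M"
 shows "(%x. line (f x) (g x) (h x)) : borel_measurable M"
 unfolding line_def by measurable

text \<open>For a fixed direction the passage to line coordinates is a rotation of the plane;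
  integrating over the direction last reduces the claim to \<open>distr_line\<close>.\<close>

lemma distr_phase_lines:
 "distr ((lborel \<Otimes>\<^sub>M circle_measure) \<Otimes>\<^sub>M lborel) phase_space (%x. (line (fst (fst x)) (snd (fst x)) (snd x), snd (fst x))) = phase_space"
 (is "distr ?M _ ?f = _")
proof (rule measure_eqI)
 have f[measurable]: "?f : ?M \<rightarrow>\<^sub>M phase_space" by measurable
 fix A assume "A : sets (distr ?M phase_space ?f)"
 then have A[measurable]: "A : sets phase_space" by simp
 have *: "(\<integral>\<^sup>+s. \<integral>\<^sup>+t. indicator A (line s th t, th) \<partial>lborel \<partial>lborel) = (\<integral>\<^sup>+z. indicator A (z, th) \<partial>lborel)"
  if "th : space circle_measure" for th
 proof -
  have n: "norm th = 1" using that by (simp add: space_circle)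
  have [measurable]: "(%z. indicator A (z, th) :: ennreal) : borel_measurable borel"
   using measurable_compose[OF measurable_Pair2'[OF that, of lborel] borel_measurable_indicator[OF A]] by simp
  have [measurable]: "(%x. line (fst x) th (snd x)) : borel_measurable (lborel \<Otimes>\<^sub>M lborel)" by measurable
  have "(\<integral>\<^sup>+z. indicator A (z, th) \<partial>lborel) = (\<integral>\<^sup>+z. indicator A (z, th) \<partial>distr (lborel \<Otimes>\<^sub>M lborel) borel (%(s, t). line s th t))"
   by (simp add: distr_line[OF n])
  also have "\<dots> = (\<integral>\<^sup>+x. indicator A (line (fst x) th (snd x), th) \<partial>(lborel \<Otimes>\<^sub>M lborel))"
   by (subst nn_integral_distr) (auto simp: case_prod_beta' cong: nn_integral_cong)
  also have "\<dots> = (\<integral>\<^sup>+s. \<integral>\<^sup>+t. indicator A (line s th t, th) \<partial>lborel \<partial>lborel)"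
   by (subst lborel.nn_integral_fst[symmetric]) auto
  finally show ?thesis by simp
 qed
 have "emeasure (distr ?M phase_space ?f) A = (\<integral>\<^sup>+x. indicator A x \<partial>distr ?M phase_space ?f)"
  by (rule nn_integral_indicator[symmetric]) (simp only: sets_distr A)
 also have "\<dots> = (\<integral>\<^sup>+x. indicator A (?f x) \<partial>?M)"
  by (rule nn_integral_distr) measurable
 also have "\<dots> = (\<integral>\<^sup>+x. \<integral>\<^sup>+t. indicator A (line (fst x) (snd x) t, snd x) \<partial>lborel \<partial>(lborel \<Otimes>\<^sub>M circle_measure))"
  by (subst lborel.nn_integral_fst[symmetric]) auto
 also have "\<dots> = (\<integral>\<^sup>+th. \<integral>\<^sup>+s. \<integral>\<^sup>+t. indicator A (line s th t, th) \<partial>lborel \<partial>lborel \<partial>circle_measure)"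
  by (subst lc.nn_integral_snd[symmetric]) auto
 also have "\<dots> = (\<integral>\<^sup>+th. \<integral>\<^sup>+z. indicator A (z, th) \<partial>lborel \<partial>circle_measure)"
  by (intro nn_integral_cong *)
 also have "\<dots> = (\<integral>\<^sup>+x. indicator A x \<partial>phase_space)"
  using lc.nn_integral_snd[OF borel_measurable_indicator[OF A]] by simp
 finally show "emeasure (distr ?M phase_space ?f) A = emeasure phase_space A" by (simp only: nn_integral_indicator[OF A])
qed simp

lemma AE_phase_lines:
 assumes "AE x in phase_space. P x"
 shows "AE x in lborel \<Otimes>\<^sub>M circle_measure. AE t in lborel. P (line (fst x) (snd x) t, snd x)"
proof -
 have "AE x in distr ((lborel \<Otimes>\<^sub>M circle_measure) \<Otimes>\<^sub>M lborel) phase_space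
  (%x. (line (fst (fst x)) (snd (fst x)) (snd x), snd (fst x))). P x"
  unfolding distr_phase_lines by (rule assms)
 then have "AE x in (lborel \<Otimes>\<^sub>M circle_measure) \<Otimes>\<^sub>M lborel. P (line (fst (fst x)) (snd (fst x)) (snd x), snd (fst x))"
  by (rule AE_distrD[rotated]) measurable
 from lcl.AE_pair[OF this] show ?thesis by simp
qed

text \<open>A null set of lines fills a null set of points: its preimage in line coordinates is a
  product with the real axis, of measure zero times infinity, which is zero.\<close>

lemma AE_phase_points:
 assumes "AE x in lborel \<Otimes>\<^sub>M circle_measure. P x"
 shows "AE x in phase_space. P (fst x \<bullet> perp (snd x), snd x)"
proof -
 from assms obtain N where N: "{x : space (lborel \<Otimes>\<^sub>M circle_measure). \<not> P x} \<subseteq> N" "N : null_sets (lborel \<Otimes>\<^sub>M circle_measure)"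
  by (auto simp: eventually_ae_filter)
 then have N0[measurable]: "N : sets (lborel \<Otimes>\<^sub>M circle_measure)" by auto
 let ?g = "%x::plane \<times> plane. (fst x \<bullet> perp (snd x), snd x)"
 have g[measurable]: "?g : phase_space \<rightarrow>\<^sub>M lborel \<Otimes>\<^sub>M circle_measure" by measurable
 let ?A = "?g -` N \<inter> space phase_space"
 have A: "?A : sets phase_space" by (rule measurable_sets[OF g N0])
 let ?f = "%x. (line (fst (fst x)) (snd (fst x)) (snd x), snd (fst x)) :: plane \<times> plane"
 let ?M = "(lborel \<Otimes>\<^sub>M circle_measure) \<Otimes>\<^sub>M (lborel :: real measure)"
 have f[measurable]: "?f : ?M \<rightarrow>\<^sub>M phase_space" by measurable
 have "emeasure phase_space ?A = emeasure (distr ?M phase_space ?f) ?A"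
  by (simp only: distr_phase_lines)
 also have "\<dots> = emeasure ?M (?f -` ?A \<inter> space ?M)"
  by (rule emeasure_distr[OF f A])
 also have "?f -` ?A \<inter> space ?M = N \<times> space lborel"
  using sets.sets_into_space[OF N0]
  by (auto simp: space_pair_measure space_circle line_inner)
 also have "emeasure ?M (N \<times> space (lborel :: real measure)) = emeasure (lborel \<Otimes>\<^sub>M circle_measure) N * emeasure lborel (space (lborel :: real measure))"
  by (rule lborel.emeasure_pair_measure_Times[OF N0]) simp
 also have "\<dots> = 0" using N(2) by auto
 finally have "?A : null_sets phase_space" using A by blast
 then show ?thesis
 proof (rule AE_I')
  show "{x : space phase_space. \<not> P (?g x)} \<subseteq> ?A"
  proof
   fix x assume x: "x : {x : space phase_space. \<not> P (?g x)}"
   then have "?g x : space (lborel \<Otimes>\<^sub>M circle_measure)" by (auto simp: space_pair_measure)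
   with x N(1) show "x : ?A" by auto
  qed
 qed
qed

lemma integrable_phase_lines:
 fixes f :: "plane \<times> plane => 'b::{banach, second_countable_topology}"
 assumes "integrable phase_space f"
 shows "integrable ((lborel \<Otimes>\<^sub>M circle_measure) \<Otimes>\<^sub>M lborel)
      (%x. f (line (fst (fst x)) (snd (fst x)) (snd x), snd (fst x)))"
proof -
 have "integrable (distr ((lborel \<Otimes>\<^sub>M circle_measure) \<Otimes>\<^sub>M lborel) phase_space
  (%x. (line (fst (fst x)) (snd (fst x)) (snd x), snd (fst x)))) f"
  unfolding distr_phase_lines by (rule assms)
 then show ?thesis
  by (subst (asm) integrable_distr_eq) (use assms in \<open>auto intro: borel_measurable_integrable\<close>)
qed

lemma AE_integrable_lines:
 fixes f :: "plane \<times> plane => 'b::{banach, second_countable_topology}"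
 assumes "integrable phase_space f"
 shows "AE x in lborel \<Otimes>\<^sub>M circle_measure. integrable lborel (%t. f (line (fst x) (snd x) t, snd x))"
 using lcl.AE_integrable_fst'[OF integrable_phase_lines[OF assms]] by simp

lemma integral_phase_lines:
 fixes f :: "plane \<times> plane => 'b::{banach, second_countable_topology}"
 assumes "integrable phase_space f"
 shows "(\<integral>x. f x \<partial>phase_space) =
  (\<integral>x. (\<integral>t. f (line (fst x) (snd x) t, snd x) \<partial>lborel) \<partial>(lborel \<Otimes>\<^sub>M circle_measure))"
proof -
 let ?f = "%x. (line (fst (fst x)) (snd (fst x)) (snd x), snd (fst x)) :: plane \<times> plane"
 let ?M = "(lborel \<Otimes>\<^sub>M circle_measure) \<Otimes>\<^sub>M (lborel :: real measure)"
 have "(\<integral>x. f x \<partial>phase_space) = (\<integral>x. f x \<partial>distr ?M phase_space ?f)"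
  unfolding distr_phase_lines by simp
 also have "\<dots> = (\<integral>x. f (?f x) \<partial>?M)"
  by (rule integral_distr) (use assms in \<open>auto intro: borel_measurable_integrable\<close>)
 also have "\<dots> = (\<integral>x. (\<integral>t. f (line (fst x) (snd x) t, snd x) \<partial>lborel) \<partial>(lborel \<Otimes>\<^sub>M circle_measure))"
  using lcl.integral_fst'[OF integrable_phase_lines[OF assms]] by simp
 finally show ?thesis .
qed

text \<open>The flow of the vector field \<theta> \<bullet> \<nabla>, that is, motion with unit
  speed along characteristics.\<close>

definition shift :: "real => plane \<times> plane => plane \<times> plane" where
 "shift r x = (fst x + r *\<^sub>R snd x, snd x)"

lemma shift_simps[simp]: "fst (shift r x) = fst x + r *\<^sub>R snd x" "snd (shift r x) = snd x"
 by (auto simp: shift_def)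

lemma shift_shift: "shift r (shift q x) = shift (r + q) x"
 by (simp add: shift_def algebra_simps)

lemma shift_0[simp]: "shift 0 x = x"
 by (simp add: shift_def)

lemma measurable_shift[measurable (raw)]:
 assumes [measurable]: "f : borel_measurable M" "g : M \<rightarrow>\<^sub>M phase_space"
 shows "(%x. shift (f x) (g x)) : M \<rightarrow>\<^sub>M phase_space"
proof -
 have [measurable]: "(%x. fst (g x)) : borel_measurable M" "(%x. snd (g x)) : M \<rightarrow>\<^sub>M circle_measure"
  using measurable_compose[OF assms(2) measurable_fst] measurable_compose[OF assms(2) measurable_snd] by auto
 have [measurable]: "(%x. snd (g x)) : borel_measurable M"
  by (rule borel_measurable_snd_circle[OF assms(2)])
 show ?thesis unfolding shift_def by measurable
qed

lemma distr_shift: "distr phase_space phase_space (shift r) = phase_space"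
proof (rule measure_eqI)
 fix A assume "A : sets (distr phase_space phase_space (shift r))"
 then have A[measurable]: "A : sets phase_space" by simp
 have f[measurable]: "shift r : phase_space \<rightarrow>\<^sub>M phase_space" by measurable
 have *: "(\<integral>\<^sup>+z. indicator A (shift r (z, th)) \<partial>lborel) = (\<integral>\<^sup>+z. indicator A (z, th) \<partial>lborel)"
  if "th : space circle_measure" for th
 proof -
  have [measurable]: "(%z. indicator A (z, th) :: ennreal) : borel_measurable borel"
   using measurable_compose[OF measurable_Pair2'[OF that, of lborel] borel_measurable_indicator[OF A]] by simp
  have "(\<integral>\<^sup>+z. indicator A (z, th) \<partial>lborel) = (\<integral>\<^sup>+z. indicator A (z, th) \<partial>distr lborel borel ((+) (r *\<^sub>R th)))"
   by (simp add: lborel_distr_plus)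
  also have "\<dots> = (\<integral>\<^sup>+z. indicator A (r *\<^sub>R th + z, th) \<partial>lborel)"
   by (subst nn_integral_distr) auto
  finally show ?thesis by (simp add: shift_def add.commute)
 qed
 have "emeasure (distr phase_space phase_space (shift r)) A = (\<integral>\<^sup>+x. indicator A x \<partial>distr phase_space phase_space (shift r))"
  by (rule nn_integral_indicator[symmetric]) (simp only: sets_distr A)
 also have "\<dots> = (\<integral>\<^sup>+x. indicator A (shift r x) \<partial>phase_space)"
  by (rule nn_integral_distr) measurable
 also have "\<dots> = (\<integral>\<^sup>+th. \<integral>\<^sup>+z. indicator A (shift r (z, th)) \<partial>lborel \<partial>circle_measure)"
  by (subst lc.nn_integral_snd[symmetric]) auto
 also have "\<dots> = (\<integral>\<^sup>+th. \<integral>\<^sup>+z. indicator A (z, th) \<partial>lborel \<partial>circle_measure)"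
  by (intro nn_integral_cong *)
 also have "\<dots> = (\<integral>\<^sup>+x. indicator A x \<partial>phase_space)"
  using lc.nn_integral_snd[OF borel_measurable_indicator[OF A]] by simp
 finally show "emeasure (distr phase_space phase_space (shift r)) A = emeasure phase_space A" by (simp only: nn_integral_indicator[OF A])
qed simp

lemma integrable_shift:
 fixes f :: "plane \<times> plane => 'b::{banach, second_countable_topology}"
 assumes "integrable phase_space f"
 shows "integrable phase_space (%x. f (shift r x))"
 using assms integrable_distr_eq[of "shift r" phase_space phase_space f]
 by (simp add: distr_shift measurable_shift borel_measurable_integrable)

lemma integral_shift:
 fixes f :: "plane \<times> plane => 'b::{banach, second_countable_topology}"
 assumes "f : borel_measurable phase_space"
 shows "(\<integral>x. f (shift r x) \<partial>phase_space) = (\<integral>x. f x \<partial>phase_space)"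
 using assms integral_distr[of "shift r" phase_space phase_space f]
 by (simp add: distr_shift measurable_shift)

interpretation ll: pair_sigma_finite "lborel :: real measure" phase_space
 by (rule pair_sigma_finite.intro) (auto intro: lc.sigma_finite_measure_axioms lborel.sigma_finite_measure_axioms)

section \<open>From the weak equation to identities on lines\<close>

lemma frechet_slice:
 fixes ph :: "plane \<times> plane => real"
 assumes "smooth ph"
 shows "frechet_derivative (%y. ph (y, th)) (at z) h = frechet_derivative ph (at (z, th)) (h, 0)"
proof -
 have d: "((%y. (y, th)) has_derivative (%h. (h, 0))) (at z)"
  by (auto intro!: derivative_eq_intros)
 have "((%y. ph (y, th)) has_derivative (%h. frechet_derivative ph (at (z, th)) (h, 0))) (at z)"
  using has_derivative_compose[OF d smooth_has_derivative[OF assms]] .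
 then show ?thesis by (metis frechet_derivative_at)
qed

definition transport_deriv :: "(plane \<times> plane => real) => plane \<times> plane => real" where
 "transport_deriv ph x = frechet_derivative ph (at x) (snd x, 0)"

lemma continuous_on_slice: "continuous_on S (%x :: plane \<times> plane. (x, (snd x, 0 :: plane)))"
 by (intro continuous_intros)

text \<open>A phase test function has compact support in the position only; the bounds come from
  compactness of the unit circle, hence the restriction to unit directions.\<close>

lemma phase_test_function_bounded:
 assumes ph: "phase_test_function Om ph"
 obtains C where "C >= 0" "!!x. norm (snd x) = 1 ==> \<bar>ph x\<bar> <= C"
  "!!x. norm (snd x) = 1 ==> \<bar>transport_deriv ph x\<bar> <= C"
proof -
 from ph obtain K where s: "smooth ph" and K: "compact K" "K \<subseteq> Om" "!!z th. z \<notin> K ==> ph (z, th) = 0"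
  by (auto simp: phase_test_function_def)
 have cS: "compact (K \<times> sphere (0::plane) 1)" using K(1) by (intro compact_Times compact_sphere)
 have "continuous_on (K \<times> sphere 0 1) ph"
  using smooth_continuous[OF s] continuous_on_subset by blast
 from compact_continuous_image[OF this cS] have "bounded (ph ` (K \<times> sphere 0 1))"
  by (rule compact_imp_bounded)
 then obtain A where A: "!!x. x : K \<times> sphere 0 1 ==> \<bar>ph x\<bar> <= A"
  by (auto simp: bounded_iff)
 have "continuous_on (K \<times> sphere 0 1) (transport_deriv ph)"
  unfolding transport_deriv_def
  using continuous_on_compose2[OF smooth_continuous_derivative[OF s] continuous_on_slice, of "K \<times> sphere 0 1"]
  by simp
 from compact_continuous_image[OF this cS] have "bounded (transport_deriv ph ` (K \<times> sphere 0 1))"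
  by (rule compact_imp_bounded)
 then obtain B where B: "!!x. x : K \<times> sphere 0 1 ==> \<bar>transport_deriv ph x\<bar> <= B"
  by (auto simp: bounded_iff)
 have out: "transport_deriv ph x = 0" if "fst x \<notin> K" for x
 proof -
  have "((%_. 0) has_derivative (%_. 0)) (at x)" by simp
  then have "(ph has_derivative (%_. 0)) (at x)"
  proof (rule has_derivative_transform_within_open)
   show "open ((- K) \<times> UNIV)" using K(1) by (intro open_Times open_Compl compact_imp_closed) auto
   show "x : (- K) \<times> UNIV" using that by (cases x) auto
  qed (use K(3) in auto)
  then have "frechet_derivative ph (at x) = (%_. 0)" by (metis frechet_derivative_at)
  then show ?thesis by (simp add: transport_deriv_def)
 qed
 show ?thesis
 proof (rule that[of "\<bar>A\<bar> + \<bar>B\<bar>"])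
  fix x :: "plane \<times> plane" assume x: "norm (snd x) = 1"
  show "\<bar>ph x\<bar> <= \<bar>A\<bar> + \<bar>B\<bar>"
  proof (cases "fst x : K")
   case True then show ?thesis using A[of x] x by (cases x) auto
  next
   case False then show ?thesis using K(3)[of "fst x" "snd x"] by simp
  qed
  show "\<bar>transport_deriv ph x\<bar> <= \<bar>A\<bar> + \<bar>B\<bar>"
  proof (cases "fst x : K")
   case True then show ?thesis using B[of x] x by (cases x) auto
  next
   case False then show ?thesis using out by simp
  qed
 qed simp
qed

lemma continuous_transport_deriv: "smooth ph ==> continuous_on UNIV (transport_deriv ph)"
 unfolding transport_deriv_def
 using continuous_on_compose2[OF smooth_continuous_derivative continuous_on_slice, of ph UNIV]
 by simp

lemma measurable_phase_borel: "(%x. x) : phase_space \<rightarrow>\<^sub>M borel"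
proof -
 have "(%x. (fst x, snd x)) : phase_space \<rightarrow>\<^sub>M borel" by measurable
 then show ?thesis by simp
qed

lemma measurable_phase_continuous:
 fixes f :: "plane \<times> plane => 'b::topological_space"
 assumes "continuous_on UNIV f"
 shows "f : borel_measurable phase_space"
 using measurable_compose[OF measurable_phase_borel borel_measurable_continuous_onI[OF assms]] .

lemma integrable_mult_bounded:
 fixes f :: "'a => real" and g :: "'a => 'b::{real_normed_field, banach, second_countable_topology}"
 assumes f: "integrable M g" and m: "h : borel_measurable M" and b: "!!x. x : space M ==> norm (h x) <= C"
 shows "integrable M (%x. g x * h x)"
proof (rule Bochner_Integration.integrable_bound[of M "%x. C * norm (g x)"])
 show "integrable M (%x. C * norm (g x))" using f by simp
 show "(%x. g x * h x) : borel_measurable M" using f m by simp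
 show "AE x in M. norm (g x * h x) <= norm (C * norm (g x))"
 proof (rule AE_I2)
  fix x assume "x : space M"
  then have "norm (g x) * norm (h x) <= norm (g x) * \<bar>C\<bar>"
   using b[of x] by (intro mult_left_mono) auto
  then show "norm (g x * h x) <= norm (C * norm (g x))"
   by (simp add: norm_mult abs_mult mult.commute)
 qed
qed

lemma integrable_indicator_Icc: "integrable lborel (indicat_real {a..b::real})"
 using integrable_real_indicator[of "{a..b}" lborel] emeasure_lborel_cbox_finite[of a b] by auto

text \<open>At each time the shift preserves the integral of \<open>H\<close>, and the time interval
  is bounded. The factor \<open>c\<close> lets one statement serve shifted (\<open>c = 1\<close>)
  and unshifted (\<open>c = 0\<close>) integrands in the applications of Fubini.\<close>

lemma integrable_shift_pair:
 fixes H :: "plane \<times> plane => real"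
 assumes H: "integrable phase_space H"
  and w: "w : borel_measurable (lborel \<Otimes>\<^sub>M phase_space)"
  and C: "!!r x. norm (snd x) = 1 ==> \<bar>w (r, x)\<bar> <= C * indicator {a..b} r"
 shows "integrable (lborel \<Otimes>\<^sub>M phase_space) (%p. H (shift (c * fst p) (snd p)) * w p)"
proof -
 have [measurable]: "H : borel_measurable phase_space" using H by simp
 have C': "\<bar>w (r, x)\<bar> <= \<bar>C\<bar> * indicator {a..b} r" if "x : space phase_space" for r x
 proof -
  have "norm (snd x) = 1" using that by (auto simp: space_phase)
  from C[OF this, of r] show ?thesis
   by (rule order_trans) (intro mult_right_mono, auto)
 qed
 have int: "integrable (lborel \<Otimes>\<^sub>M phase_space) (%p. H (shift (c * fst p) (snd p)) * (\<bar>C\<bar> * indicator {a..b} (fst p)))"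
 proof (rule ll.Fubini_integrable)
  show "(%p. H (shift (c * fst p) (snd p)) * (\<bar>C\<bar> * indicator {a..b} (fst p))) : borel_measurable (lborel \<Otimes>\<^sub>M phase_space)"
   by measurable
  have "(\<integral>x. norm (H (shift (c * r) x) * (\<bar>C\<bar> * indicator {a..b} r)) \<partial>phase_space)
    = indicator {a..b} r * (\<bar>C\<bar> * (\<integral>x. \<bar>H x\<bar> \<partial>phase_space))" for r
   using integral_shift[of "%x. \<bar>H x\<bar>" "c * r"] by (simp add: abs_mult)
  then show "integrable lborel (%r. \<integral>x. norm (H (shift (c * fst (r, x)) (snd (r, x))) * (\<bar>C\<bar> * indicator {a..b} (fst (r, x)))) \<partial>phase_space)"
   using integrable_indicator_Icc[of a b] by simp
  show "AE r in lborel. integrable phase_space (%x. H (shift (c * fst (r, x)) (snd (r, x))) * (\<bar>C\<bar> * indicator {a..b} (fst (r, x))))"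
   using integrable_shift[OF H] by simp
 qed
 show ?thesis
 proof (rule Bochner_Integration.integrable_bound[OF int])
  show "(%p. H (shift (c * fst p) (snd p)) * w p) : borel_measurable (lborel \<Otimes>\<^sub>M phase_space)"
   using w by measurable
  show "AE p in lborel \<Otimes>\<^sub>M phase_space. norm (H (shift (c * fst p) (snd p)) * w p)
    <= norm (H (shift (c * fst p) (snd p)) * (\<bar>C\<bar> * indicator {a..b} (fst p)))"
   using C' by (intro AE_I2) (auto simp: abs_mult space_pair_measure intro!: mult_left_mono)
 qed
qed

lemma bounded_linear_shift: "bounded_linear (shift r)"
 unfolding shift_def
 by (intro bounded_linear_Pair bounded_linear_add bounded_linear_fst bounded_linear_snd
   bounded_linear_const_scaleR)

lemma transport_deriv_shift:
 assumes "smooth ph"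
 shows "transport_deriv (%x. ph (shift r x)) x = transport_deriv ph (shift r x)"
proof -
 have "((%x. ph (shift r x)) has_derivative (%h. frechet_derivative ph (at (shift r x)) (shift r h))) (at x)"
  using has_derivative_compose[OF bounded_linear_imp_has_derivative[OF bounded_linear_shift]
    smooth_has_derivative[OF assms]] .
 then have "frechet_derivative (%x. ph (shift r x)) (at x) = (%h. frechet_derivative ph (at (shift r x)) (shift r h))"
  by (metis frechet_derivative_at)
 then show ?thesis by (simp add: transport_deriv_def shift_def)
qed

lemma has_real_derivative_shift:
 assumes "smooth ph"
 shows "((%r. ph (shift (- r) x)) has_real_derivative - transport_deriv ph (shift (- r) x)) (at r)"
proof -
 have d: "((%r. shift (- r) x) has_derivative (%h. h *\<^sub>R (- snd x, 0))) (at r)"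
  unfolding shift_def by (auto intro!: derivative_eq_intros)
 have "((%r. ph (shift (- r) x)) has_derivative (%h. frechet_derivative ph (at (shift (- r) x)) (h *\<^sub>R (- snd x, 0)))) (at r)"
  using has_derivative_compose[OF d smooth_has_derivative[OF assms]] .
 moreover have "frechet_derivative ph (at y) (h *\<^sub>R (- v, 0)) = - frechet_derivative ph (at y) (v, 0) * h" for y v h
 proof -
  have lin: "linear (frechet_derivative ph (at y))"
   using has_derivative_linear[OF smooth_has_derivative[OF assms]] .
  have "h *\<^sub>R (- v, 0::plane) = (- h) *\<^sub>R (v, 0)" by simp
  then show ?thesis by (simp only: linear_scale[OF lin]) simp
 qed
 ultimately show ?thesis
  unfolding has_field_derivative_def transport_deriv_def
  by (elim has_derivative_eq_rhs) (simp add: fun_eq_iff)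
qed

text \<open>The weak equation is tested with the bump transported for a time \<open>r\<close>, the
  result is integrated over \<open>r\<close> from 0 to \<open>ta\<close>, and invariance of the
  measure moves the transport from the bump to \<open>u\<close> and \<open>H\<close>. Convexity
  keeps the transported supports inside the domain.\<close>

theorem shift_identity:
 fixes u H :: "plane \<times> plane => real"
 assumes Om: "open Om" "convex Om"
  and u: "integrable phase_space u" and H: "integrable phase_space H"
  and weak: "!!ph. phase_test_function Om ph ==>
    (\<integral>x. u x * transport_deriv ph x \<partial>phase_space) = - (\<integral>x. H x * ph x \<partial>phase_space)"
  and ta: "ta >= 0"
 shows "AE x in phase_space. fst x : Om & fst (shift ta x) : Om -->
   u (shift ta x) = u x + (\<integral>r. indicator {0..ta} r * H (shift r x) \<partial>lborel)"
proof -
 have mu[measurable]: "u : borel_measurable phase_space" and mH[measurable]: "H : borel_measurable phase_space"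
  using u H by auto
 define P where "P x = (\<integral>r. indicator {0..ta} r * H (shift r x) \<partial>lborel)" for x
 define g where "g x = u (shift ta x) - u x - P x" for x
 \<comment> \<open>Directions are not normalised here, so that the set is open in the full product,
   as \<open>fundamental_lemma\<close> requires.\<close>
 define U where "U = {x :: plane \<times> plane. fst x : Om & fst x + ta *\<^sub>R snd x : Om}"
 have "open (fst -` Om \<inter> (%x :: plane \<times> plane. fst x + ta *\<^sub>R snd x) -` Om)"
  by (intro open_Int open_vimage Om(1)) (auto intro!: continuous_intros)
 moreover have "U = fst -` Om \<inter> (%x :: plane \<times> plane. fst x + ta *\<^sub>R snd x) -` Om"
  by (auto simp: U_def)
 ultimately have U: "open U" by simp
 have intP: "integrable (lborel \<Otimes>\<^sub>M phase_space) (%p. H (shift (1 * fst p) (snd p)) * (indicator {0..ta} (fst p) * w (snd p)))"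
  if [measurable]: "w : borel_measurable phase_space" and "!!x. norm (snd x) = 1 ==> \<bar>w x\<bar> <= C" for w C
  by (rule integrable_shift_pair[OF H, where C=C and a=0 and b=ta])
    (use that in \<open>auto simp: indicator_def abs_mult\<close>)
 have P: "integrable phase_space P"
  using ll.integrable_snd[of "%r x. H (shift (1 * r) x) * (indicator {0..ta} r * 1)"] intP[of "%_. 1" 1]
  by (simp add: P_def[abs_def] case_prod_beta' mult.commute)
 have g: "integrable phase_space g"
  unfolding g_def by (intro Bochner_Integration.integrable_diff integrable_shift u P)
 have "AE x in phase_space. x : U --> g x = 0"
 proof (rule fundamental_lemma[OF sets_phase U])
  fix a b :: "plane \<times> plane" assume ab: "cbox a b \<subseteq> U"
  have "(%x. indicator (cbox a b) x :: real) : borel_measurable phase_space"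
   by (rule measurable_compose[OF measurable_phase_borel]) auto
  then have "integrable phase_space (%x. g x * indicator (cbox a b) x)"
   by (rule integrable_mult_bounded[OF g, where C=1]) (auto simp: indicator_def)
  then show "integrable phase_space (%x. indicator (cbox a b) x * g x)"
   by (simp add: mult.commute)
  fix n
  let ?ph = "box_bump n a b"
  define ph where "ph r x = ?ph (shift (- r) x)" for r x
  have s: "smooth ?ph" by (rule smooth_box_bump)
  \<comment> \<open>The start \<open>z\<close> and the end \<open>z + ta \<theta>\<close> of the
    motion lie in the domain for all points of the closed box, and the position at time
    \<open>r\<close> is their convex combination with weight \<open>r / ta\<close>.\<close>
  have t: "phase_test_function Om (ph r)" if r: "r : {0..ta}" for r
   unfolding phase_test_function_def
  proof (intro conjI exI)
   show "smooth (ph r)" unfolding ph_def by (rule smooth_linear[OF bounded_linear_shift s])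
   let ?K = "(%x. fst x + r *\<^sub>R snd x) ` cbox a b"
   show "compact ?K" by (intro compact_continuous_image compact_cbox continuous_intros)
   show "?K \<subseteq> Om"
   proof clarify
    fix z th assume "(z, th) : cbox a b"
    then have z: "z : Om" "z + ta *\<^sub>R th : Om" using ab by (auto simp: U_def)
    show "fst (z, th) + r *\<^sub>R snd (z, th) : Om"
    proof (cases "ta = 0")
     case True then show ?thesis using r z by simp
    next
     case False
     have "(1 - r / ta) *\<^sub>R z + (r / ta) *\<^sub>R (z + ta *\<^sub>R th) : Om"
      using convexD_alt[OF Om(2) z, of "r / ta"] r False by (auto simp: field_simps)
     moreover have "(1 - r / ta) *\<^sub>R z + (r / ta) *\<^sub>R (z + ta *\<^sub>R th) = z + r *\<^sub>R th"
      using False by (simp add: algebra_simps)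
     ultimately show ?thesis by simp
    qed
   qed
   show "\<forall>z th. z \<notin> ?K --> ph r (z, th) = 0"
   proof (intro allI impI)
    fix z th assume z: "z \<notin> ?K"
    have "shift (- r) (z, th) \<notin> cbox a b"
    proof
     assume "shift (- r) (z, th) : cbox a b"
     from imageI[OF this, of "%x. fst x + r *\<^sub>R snd x"] z show False by simp
    qed
    then show "ph r (z, th) = 0" unfolding ph_def using box_subset_cbox by (intro box_bump_eq_0) blast
   qed
  qed
  have t0: "phase_test_function Om ?ph" using t[of 0] ta by (simp add: ph_def[abs_def])
  obtain C where C: "C >= 0" "!!x. norm (snd x) = 1 ==> \<bar>?ph x\<bar> <= C"
   "!!x. norm (snd x) = 1 ==> \<bar>transport_deriv ?ph x\<bar> <= C"
   using phase_test_function_bounded[OF t0] by blast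
  have mph[measurable]: "?ph : borel_measurable phase_space"
   by (rule measurable_phase_continuous[OF smooth_continuous[OF s]])
  have md[measurable]: "transport_deriv ?ph : borel_measurable phase_space"
   by (rule measurable_phase_continuous[OF continuous_transport_deriv[OF s]])
  have i1: "integrable phase_space (%x. f x * ?ph (shift r x))" if "integrable phase_space f" for f r
   by (rule integrable_mult_bounded[OF that, where C=C]) (use C(2)[of "shift r _"] in \<open>auto simp: space_phase\<close>)
  have S1: "(\<integral>x. u (shift ta x) * ?ph x \<partial>phase_space) = (\<integral>x. u x * ph ta x \<partial>phase_space)"
   using integral_shift[of "%x. u x * ph ta x" ta] by (simp add: ph_def shift_shift)
  have S2: "(\<integral>x. H (shift r x) * ?ph x \<partial>phase_space) = (\<integral>x. H x * ph r x \<partial>phase_space)" for r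
   using integral_shift[of "%x. H x * ph r x" r] by (simp add: ph_def shift_shift)
  \<comment> \<open>The increment of the transported bump is an integral of transport derivatives,
    to each of which the weak equation applies.\<close>
  have FTC: "ph ta x - ?ph x = - (\<integral>r. indicator {0..ta} r * transport_deriv ?ph (shift (- r) x) \<partial>lborel)" for x
  proof -
   have "(\<integral>r. indicator {0..ta} r *\<^sub>R (- transport_deriv ?ph (shift (- r) x)) \<partial>lborel) = ph ta x - ph 0 x"
   proof (rule integral_FTC_atLeastAtMost[OF ta])
    fix r show "((%r. ph r x) has_vector_derivative - transport_deriv ?ph (shift (- r) x)) (at r within {0..ta})"
     using has_real_derivative_shift[OF s, of x r] unfolding ph_def
     by (simp add: has_real_derivative_iff_has_vector_derivative has_vector_derivative_at_within)
    show "continuous_on {0..ta} (%r. - transport_deriv ?ph (shift (- r) x))"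
     unfolding shift_def
     by (intro continuous_intros continuous_on_compose2[OF continuous_transport_deriv[OF s]]) auto
   qed
   then show ?thesis by (simp add: ph_def)
  qed
  have w1: "integrable (lborel \<Otimes>\<^sub>M phase_space) (%p. u (shift (0 * fst p) (snd p)) * (indicator {0..ta} (fst p) * transport_deriv ?ph (shift (- fst p) (snd p))))"
   by (rule integrable_shift_pair[OF u, where C=C and a=0 and b=ta])
     (use C in \<open>auto simp: indicator_def abs_mult\<close>)
  have w2: "integrable (lborel \<Otimes>\<^sub>M phase_space) (%p. H (shift (1 * fst p) (snd p)) * (indicator {0..ta} (fst p) * ?ph (snd p)))"
   by (rule intP[OF mph C(2)])
  have "(\<integral>x. u x * (ph ta x - ?ph x) \<partial>phase_space)
   = (\<integral>x. (\<integral>r. - (u x * (indicator {0..ta} r * transport_deriv ?ph (shift (- r) x))) \<partial>lborel) \<partial>phase_space)"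
   unfolding FTC by simp
  also have "\<dots> = - (\<integral>r. (\<integral>x. u x * (indicator {0..ta} r * transport_deriv ?ph (shift (- r) x)) \<partial>phase_space) \<partial>lborel)"
   using ll.Fubini_integral[of "%r x. u x * (indicator {0..ta} r * transport_deriv ?ph (shift (- r) x))"] w1
   by (simp add: case_prod_beta')
  also have "\<dots> = - (\<integral>r. indicator {0..ta} r * (\<integral>x. u x * transport_deriv (ph r) x \<partial>phase_space) \<partial>lborel)"
   unfolding ph_def transport_deriv_shift[OF s] by (simp add: mult.left_commute[of "u _" "indicator _ _"])
  also have "\<dots> = - (\<integral>r. indicator {0..ta} r * (- (\<integral>x. H x * ph r x \<partial>phase_space)) \<partial>lborel)"
   using weak[OF t] by (intro arg_cong[where f=uminus] Bochner_Integration.integral_cong) (auto simp: indicator_def)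
  also have "\<dots> = (\<integral>r. (\<integral>x. H (shift r x) * (indicator {0..ta} r * ?ph x) \<partial>phase_space) \<partial>lborel)"
   unfolding S2[symmetric] by (simp add: mult.left_commute[of "H _" "indicator _ _"])
  also have "\<dots> = (\<integral>x. (\<integral>r. H (shift r x) * (indicator {0..ta} r * ?ph x) \<partial>lborel) \<partial>phase_space)"
   using ll.Fubini_integral[of "%r x. H (shift r x) * (indicator {0..ta} r * ?ph x)"] w2
   by (simp add: case_prod_beta')
  also have "\<dots> = (\<integral>x. P x * ?ph x \<partial>phase_space)"
   unfolding P_def by (intro Bochner_Integration.integral_cong) (simp_all add: mult.assoc[symmetric] mult.commute[of "H _"])
  finally have eq: "(\<integral>x. u x * (ph ta x - ?ph x) \<partial>phase_space) = (\<integral>x. P x * ?ph x \<partial>phase_space)" .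
  have "(\<integral>x. g x * ?ph x \<partial>phase_space) = (\<integral>x. u (shift ta x) * ?ph x - u x * ?ph x - P x * ?ph x \<partial>phase_space)"
   by (simp add: g_def algebra_simps)
  also have "\<dots> = (\<integral>x. u (shift ta x) * ?ph x \<partial>phase_space) - (\<integral>x. u x * ?ph x \<partial>phase_space) - (\<integral>x. P x * ?ph x \<partial>phase_space)"
   using i1[OF integrable_shift[OF u], of ta 0] i1[OF u, of 0] i1[OF P, of 0] by simp
  also have "\<dots> = 0"
   using i1[OF u, of 0] i1[OF u, of "- ta"]
   unfolding S1 eq[symmetric] by (simp add: right_diff_distrib ph_def)
  finally show "(\<integral>x. g x * ?ph x \<partial>phase_space) = 0" .
 qed
 then show ?thesis
  by eventually_elim (auto simp: U_def g_def P_def)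
qed

lemma AE_lborel_exists_between:
 assumes "AE t in lborel. Q t" "a < (b::real)"
 obtains t where "a < t" "t < b" "Q t"
proof -
 have "\<exists>t. a < t & t < b & Q t"
 proof (rule ccontr)
  assume no: "\<not> ?thesis"
  have "AE t in lborel. t \<notin> {a<..<b}" using assms(1) by eventually_elim (use no in auto)
  then have "{a<..<b} : null_sets lborel" by (subst AE_iff_null_sets) auto
  then have "emeasure lborel {a<..<b} = 0" by blast
  then show False using assms(2) by simp
 qed
 then show ?thesis using that by blast
qed

text \<open>Two good points are compared through a third one: for almost every \<open>r\<close> to
  the right of both, \<open>D r\<close> equals either value, and openness of \<open>I\<close> leaves
  room for such an \<open>r\<close> just beyond the larger point.\<close>

lemma const_on_good_points:
 fixes D :: "real => 'b"
 assumes I: "open I"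
  and g: "AE t in lborel. good t"
  and good: "!!t. good t ==> t : I ==> AE ta in lborel. ta >= 0 & t + ta : I --> D (t + ta) = D t"
 obtains c where "!!t. t : I ==> good t ==> D t = c"
proof -
 have fwd: "AE r in lborel. r >= t & r : I --> D r = D t" if "good t" "t : I" for t
 proof -
  have "AE ta in distr lborel borel ((+) (- t)). ta >= 0 & t + ta : I --> D (t + ta) = D t"
   unfolding lborel_distr_plus using good[OF that] .
  from AE_distrD[OF _ this] show ?thesis by simp
 qed
 have le: "D t1 = D t0" if t: "t0 <= t1" "t0 : I" "t1 : I" "good t0" "good t1" for t0 t1
 proof -
  from I t(3) obtain e where e: "e > 0" "ball t1 e \<subseteq> I" by (auto simp: open_contains_ball)
  have "AE r in lborel. (r >= t0 & r : I --> D r = D t0) & (r >= t1 & r : I --> D r = D t1)"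
   using fwd[OF t(4,2)] fwd[OF t(5,3)] by eventually_elim auto
  then obtain r where r: "t1 < r" "r < t1 + e"
   "(r >= t0 & r : I --> D r = D t0) & (r >= t1 & r : I --> D r = D t1)"
   by (rule AE_lborel_exists_between[of _ t1 "t1 + e"]) (use e in auto)
  then have "r : ball t1 e" by (simp add: dist_real_def)
  then have "r : I" using e(2) by blast
  with r t(1) show ?thesis by auto
 qed
 show ?thesis
 proof (cases "\<exists>t. t : I & good t")
  case True
  then obtain t where "t : I" "good t" by auto
  then show ?thesis using that[of "D t"] le by (metis linear)
 next
  case False then show ?thesis using that by blast
 qed
qed

text \<open>Integration starts at minus infinity. For \<open>H\<close> cut off to the domain the
  primitive vanishes before the line enters, which ties the free constant of a line to the inflow
  value.\<close>

definition line_primitive :: "(plane \<times> plane => real) => real => plane => real => real" where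
 "line_primitive H s th t = (\<integral>r. indicator {..t} r * H (line s th r, th) \<partial>lborel)"

lemma line_primitive_diff:
 assumes H: "integrable lborel (%t. H (line s th t, th))" and "ta >= 0"
 shows "line_primitive H s th (t + ta) = line_primitive H s th t + (\<integral>r. indicator {0..ta} r * H (line s th (t + r), th) \<partial>lborel)"
proof -
 have i: "integrable lborel (%r. H (line s th r, th) * indicator A r)" if "A : sets borel" for A
  by (rule integrable_mult_bounded[OF H, where C=1]) (use that in auto)
 have i': "integrable lborel (%r. indicator A r * H (line s th r, th))" if "A : sets borel" for A
  using i[OF that] by (simp add: mult.commute)
 have "(\<integral>r. indicator {0..ta} r * H (line s th (t + r), th) \<partial>lborel)
   = (\<integral>r. indicator {t..t + ta} r * H (line s th r, th) \<partial>lborel)"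
  using lborel_integral_real_affine[of 1 "%r. indicator {t..t + ta} r * H (line s th r, th)" t]
  by (simp add: indicator_def)
 also have "\<dots> = (\<integral>r. indicator {..t + ta} r * H (line s th r, th) - indicator {..t} r * H (line s th r, th) \<partial>lborel)"
 proof (rule integral_cong_AE)
  show "AE r in lborel. indicator {t..t + ta} r * H (line s th r, th) =
    indicator {..t + ta} r * H (line s th r, th) - indicator {..t} r * H (line s th r, th)"
   using AE_lborel_singleton[of t] by eventually_elim (use \<open>ta >= 0\<close> in \<open>auto simp: indicator_def\<close>)
 qed (intro borel_measurable_integrable Bochner_Integration.integrable_diff i'; simp)+
 also have "\<dots> = line_primitive H s th (t + ta) - line_primitive H s th t"
  unfolding line_primitive_def by (rule Bochner_Integration.integral_diff) (auto intro: i')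
 finally show ?thesis by simp
qed

text \<open>On almost every line almost every point is good, in the sense that
  \<open>shift_identity\<close> holds from it for almost every increment. At these points
  \<open>u\<close> minus its primitive is one constant; \<open>v\<close> uses that constant at every
  point of the line.\<close>

theorem characteristic_representative:
 fixes u H :: "plane \<times> plane => real"
 assumes Om: "open Om" "convex Om"
  and u: "integrable phase_space u" and H: "integrable phase_space H"
  and weak: "!!ph. phase_test_function Om ph ==>
    (\<integral>x. u x * transport_deriv ph x \<partial>phase_space) = - (\<integral>x. H x * ph x \<partial>phase_space)"
 obtains v where "AE x in phase_space. fst x : Om --> v x = u x"
  "AE x in lborel \<Otimes>\<^sub>M circle_measure. integrable lborel (%t. H (line (fst x) (snd x) t, snd x)) \<and>
    (\<exists>c. \<forall>t. line (fst x) (snd x) t : Om -->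
     v (line (fst x) (snd x) t, snd x) = c + line_primitive H (fst x) (snd x) t)"
proof -
 have mu[measurable]: "u : borel_measurable phase_space" and mH[measurable]: "H : borel_measurable phase_space"
  using u H by auto
 have mO[measurable]: "Om : sets borel" using Om(1) by simp
 define Q where "Q ta x \<longleftrightarrow> ta >= 0 & fst x : Om & fst (shift ta x) : Om -->
   u (shift ta x) = u x + (\<integral>r. indicator {0..ta} r * H (shift r x) \<partial>lborel)" for ta x
 have "AE x in phase_space. Q ta x" for ta
 proof (cases "ta >= 0")
  case True
  have "AE x in phase_space. fst x : Om & fst (shift ta x) : Om -->
    u (shift ta x) = u x + (\<integral>r. indicator {0..ta} r * H (shift r x) \<partial>lborel)"
   by (intro shift_identity Om u H weak True)
  then show ?thesis by eventually_elim (simp add: Q_def)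
 qed (simp add: Q_def)
 then have "AE ta in lborel. AE x in phase_space. Q ta x" by simp
 \<comment> \<open>For each increment almost every point is fine; Fubini exchanges the two
   quantifiers, for which the set of good pairs must be measurable.\<close>
 then have good: "AE x in phase_space. AE ta in lborel. Q ta x"
 proof (subst (asm) ll.AE_commute)
  have [measurable]: "(%p. \<integral>r. indicator {0..fst p} r * H (shift r (snd p)) \<partial>lborel) : borel_measurable ((lborel :: real measure) \<Otimes>\<^sub>M phase_space)"
  proof -
   have [measurable]: "(%x. H (shift (snd x) (snd (fst x)))) : borel_measurable (((lborel :: real measure) \<Otimes>\<^sub>M phase_space) \<Otimes>\<^sub>M lborel)"
    by (rule measurable_compose[OF measurable_shift mH])
      (auto intro: measurable_compose[OF measurable_fst measurable_snd])
   have "(%p. \<integral>r. (if 0 <= r & r <= fst p then 1 else 0) * H (shift r (snd p)) \<partial>lborel)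
     : borel_measurable ((lborel :: real measure) \<Otimes>\<^sub>M phase_space)"
    by measurable
   then show ?thesis by (simp add: indicator_def of_bool_def)
  qed
  show "{x : space (lborel \<Otimes>\<^sub>M phase_space). Q (fst x) (snd x)} : sets (lborel \<Otimes>\<^sub>M phase_space)"
  proof -
   have [measurable]: "(%p. u (shift (fst p) (snd p))) : borel_measurable ((lborel :: real measure) \<Otimes>\<^sub>M phase_space)"
    by (rule measurable_compose[OF measurable_shift mu]) auto
   have [measurable]: "(%p. u (snd p)) : borel_measurable ((lborel :: real measure) \<Otimes>\<^sub>M phase_space)"
    by (rule measurable_compose[OF measurable_snd mu])
   have [measurable]: "(%p. fst (snd p)) : borel_measurable ((lborel :: real measure) \<Otimes>\<^sub>M phase_space)"
    "(%p. snd (snd p)) : borel_measurable ((lborel :: real measure) \<Otimes>\<^sub>M phase_space)"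
    by measurable
   show ?thesis unfolding Q_def shift_simps by measurable
  qed
 qed
 define good where "good x \<longleftrightarrow> (AE ta in lborel. Q ta x)" for x
 define D where "D s th t = u (line s th t, th) - line_primitive H s th t" for s th t
 define L where "L y \<longleftrightarrow> norm (snd y) = 1 & integrable lborel (%t. H (line (fst y) (snd y) t, snd y)) \<and>
   (AE t in lborel. good (line (fst y) (snd y) t, snd y))" for y
 have "AE x in lborel \<Otimes>\<^sub>M circle_measure. norm (snd x) = 1"
  by (intro AE_I2) (auto simp: space_pair_measure space_circle)
 then have L: "AE y in lborel \<Otimes>\<^sub>M circle_measure. L y"
  using AE_integrable_lines[OF H] AE_phase_lines[OF good]
  by eventually_elim (simp add: L_def good_def)
 \<comment> \<open>The constant depends on the line only, so it also prescribes values at the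
   exceptional points, where \<open>u\<close> itself says nothing.\<close>
 define C where "C s th = (SOME c. \<forall>t. line s th t : Om --> good (line s th t, th) --> D s th t = c)" for s th
 define v where "v x = C (fst x \<bullet> perp (snd x)) (snd x) + line_primitive H (fst x \<bullet> perp (snd x)) (snd x) (fst x \<bullet> snd x)" for x
 have C: "D s th t = C s th" if a: "L (s, th)" "line s th t : Om" "good (line s th t, th)" for s th t
 proof -
  have "open {t. line s th t : Om}"
   using open_vimage[OF Om(1), of "line s th"] unfolding line_def vimage_def
   by (simp add: continuous_intros)
  then obtain c where "!!t. t : {t. line s th t : Om} ==> good (line s th t, th) ==> D s th t = c"
  proof (rule const_on_good_points)
   show "AE t in lborel. good (line s th t, th)" using a(1) by (simp add: L_def)
   fix t assume gt: "good (line s th t, th)" and t: "t : {t. line s th t : Om}"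
   show "AE ta in lborel. ta >= 0 & t + ta : {t. line s th t : Om} --> D s th (t + ta) = D s th t"
    using gt[unfolded good_def]
   proof (eventually_elim, intro impI)
    fix ta assume q: "Q ta (line s th t, th)" "ta >= 0 & t + ta : {t. line s th t : Om}"
    then show "D s th (t + ta) = D s th t"
     using line_primitive_diff[of H s th ta t] a(1) t
     by (simp add: D_def Q_def L_def shift_def line_add)
   qed
  qed blast
  then have "\<forall>t. line s th t : Om --> good (line s th t, th) --> D s th t = C s th"
   unfolding C_def by (intro someI[of "%c. \<forall>t. line s th t : Om --> good (line s th t, th) --> D s th t = c"]) auto
  then show ?thesis using a by blast
 qed
 show ?thesis
 proof (rule that[of v])
  show "AE x in phase_space. fst x : Om --> v x = u x"
   using AE_phase_points[OF L] good
  proof (eventually_elim, intro impI)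
   fix x assume x: "L (fst x \<bullet> perp (snd x), snd x)" "AE ta in lborel. Q ta x" "fst x : Om"
   then have n: "norm (snd x) = 1" by (simp add: L_def)
   show "v x = u x"
    using C[OF x(1), of "fst x \<bullet> snd x"] x(2,3)
    by (simp add: v_def D_def line_of_point[OF n] good_def)
  qed
  show "AE x in lborel \<Otimes>\<^sub>M circle_measure. integrable lborel (%t. H (line (fst x) (snd x) t, snd x)) \<and>
    (\<exists>c. \<forall>t. line (fst x) (snd x) t : Om -->
     v (line (fst x) (snd x) t, snd x) = c + line_primitive H (fst x) (snd x) t)"
   using L by eventually_elim (auto simp: L_def v_def line_inner intro!: exI)
 qed
qed

section \<open>Boundary points, entry and exit, traces\<close>

locale convex_domain =
 fixes Om :: "plane set"
 assumes op: "open Om" and cv: "convex Om" and bd: "bounded Om"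
begin

lemma borel_domain[measurable]: "Om : sets borel"
 using op by simp

text \<open>If the backward ray missed the domain, a separating line would have to pass through the
  boundary point, and its normal would be an outer normal with nonpositive product with the
  direction. One point of the ray inside then puts the whole initial piece inside by
  convexity.\<close>

lemma outflow_enters:
 assumes "(\<zeta>, th) : outflow Om"
 shows "\<forall>\<^sub>F t in at_right 0. \<zeta> - t *\<^sub>R th : Om"
proof -
 have \<zeta>: "\<zeta> : closure Om" and n: "norm th = 1"
  and out: "!!\<nu>. outer_unit_normal Om \<zeta> \<nu> ==> \<nu> \<bullet> th > 0"
  using assms by (auto simp: outflow_def frontier_def)
 define R where "R = (%t. \<zeta> - t *\<^sub>R th) ` {0<..}"
 have "Om \<inter> R ~= {}"
 proof
  assume disj: "Om \<inter> R = {}"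
  have "convex R"
  proof -
   have "R = (%x. \<zeta> + x) ` ((%t. t *\<^sub>R (- th)) ` {0<..})" by (auto simp: R_def image_image)
   moreover have "convex ((%t::real. t *\<^sub>R (- th)) ` {0<..})"
    by (intro convex_linear_image convex_real_interval) (simp add: linear_iff algebra_simps)
   ultimately show ?thesis by (simp add: convex_translation)
  qed
  moreover have "Om ~= {}" using \<zeta> by auto
  moreover have "R ~= {}" by (auto simp: R_def)
  ultimately obtain a b where ab: "a ~= 0" "!!x. x : Om ==> a \<bullet> x <= b" "!!x. x : R ==> a \<bullet> x >= b"
   using separating_hyperplane_sets[OF cv _ _ _ disj] by metis
  have le: "a \<bullet> \<zeta> <= b"
  proof -
   have "closure Om \<subseteq> {x. a \<bullet> x <= b}"
    using ab(2) by (intro closure_minimal closed_halfspace_le) auto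
   then show ?thesis using \<zeta> by auto
  qed
  have ge: "a \<bullet> (\<zeta> - t *\<^sub>R th) >= b" if "t > 0" for t
   using ab(3)[of "\<zeta> - t *\<^sub>R th"] that by (auto simp: R_def)
  have "((%t. a \<bullet> (\<zeta> - t *\<^sub>R th)) \<longlongrightarrow> a \<bullet> (\<zeta> - 0 *\<^sub>R th)) (at_right 0)"
   by (intro tendsto_intros)
  then have "b <= a \<bullet> (\<zeta> - 0 *\<^sub>R th)"
  proof (rule tendsto_lowerbound)
   show "\<forall>\<^sub>F t in at_right 0. b <= a \<bullet> (\<zeta> - t *\<^sub>R th)"
    using eventually_at_right_less[of 0] by eventually_elim (rule ge)
  qed simp
  then have eq: "a \<bullet> \<zeta> = b" using le by simp
  have "outer_unit_normal Om \<zeta> (a /\<^sub>R norm a)"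
   unfolding outer_unit_normal_def
  proof (intro conjI ballI)
   show "norm (a /\<^sub>R norm a) = 1" using ab(1) by simp
   fix x assume "x : Om"
   from ab(2)[OF this] have "a \<bullet> (x - \<zeta>) <= 0" using eq by (simp add: inner_diff_right)
   then show "(a /\<^sub>R norm a) \<bullet> (x - \<zeta>) <= 0" by (simp add: mult_nonneg_nonpos)
  qed
  from out[OF this] have "a \<bullet> th > 0" using ab(1) by (simp add: zero_less_mult_iff)
  moreover have "a \<bullet> th <= 0" using ge[of 1] eq by (simp add: inner_diff_right)
  ultimately show False by simp
 qed
 then obtain T where T: "T > 0" "\<zeta> - T *\<^sub>R th : Om" by (auto simp: R_def)
 have "\<zeta> - t *\<^sub>R th : Om" if t: "0 < t" "t < T" for t
 proof -
  have "\<zeta> - (t / T) *\<^sub>R (\<zeta> - (\<zeta> - T *\<^sub>R th)) : interior Om"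
   using t T op by (intro mem_interior_closure_convex_shrink cv \<zeta>) (auto simp: interior_open)
  then show ?thesis using T op by (simp add: interior_open)
 qed
 then show ?thesis by (intro eventually_at_rightI[OF _ T(1)]) simp
qed

lemma inflow_outflow: "(\<zeta>, th) : inflow Om \<longleftrightarrow> (\<zeta>, - th) : outflow Om"
 by (auto simp: inflow_def outflow_def)

text \<open>A ball about the inner point lies in the domain, so one may move from there by
  \<open>e / 2\<close> along any outer normal \<open>\<nu>\<close>; the supporting inequality at
  that point reads \<open>e / 2 <= t * (\<nu> \<bullet> th)\<close>.\<close>

lemma outflowI:
 assumes "norm th = 1" "\<zeta> : frontier Om" "t > 0" "\<zeta> - t *\<^sub>R th : Om"
 shows "(\<zeta>, th) : outflow Om"
proof -
 have "\<nu> \<bullet> th > 0" if \<nu>: "outer_unit_normal Om \<zeta> \<nu>" for \<nu>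
 proof -
  from op assms(4) obtain e where e: "e > 0" "ball (\<zeta> - t *\<^sub>R th) e \<subseteq> Om"
   by (auto simp: open_contains_ball)
  have n: "norm \<nu> = 1" and le: "!!x. x : Om ==> \<nu> \<bullet> (x - \<zeta>) <= 0"
   using \<nu> by (auto simp: outer_unit_normal_def)
  have "\<zeta> - t *\<^sub>R th + (e / 2) *\<^sub>R \<nu> : Om"
   using e n by (auto intro!: subsetD[OF e(2)] simp: dist_norm)
  from le[OF this] have "\<nu> \<bullet> ((e / 2) *\<^sub>R \<nu> - t *\<^sub>R th) <= 0" by (simp add: algebra_simps)
  then have "e / 2 <= t * (\<nu> \<bullet> th)"
   using n by (simp add: inner_diff_right dot_square_norm)
  then have "t * (\<nu> \<bullet> th) > 0" using e(1) by linarith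
  then show ?thesis using assms(3) by (simp add: zero_less_mult_iff)
 qed
 then show ?thesis using assms by (auto simp: outflow_def)
qed

text \<open>The exit parameter is the supremum of the parameters inside. It is finite because the
  domain is bounded and is not attained because the domain is open.\<close>

lemma line_exit:
 assumes n: "norm th = 1" and "line s th t0 : Om"
 obtains \<beta> where "(line s th \<beta>, th) : outflow Om" "!!t. line s th t : Om ==> t < \<beta>"
proof -
 define I where "I = {t. line s th t : Om}"
 have cl: "continuous_on UNIV (line s th)" unfolding line_def by (intro continuous_intros)
 have I: "open I"
  using open_vimage[OF op cl] by (simp add: I_def vimage_def)
 obtain B where B: "!!x. x : Om ==> norm x <= B" using bd by (auto simp: bounded_iff)
 have tB: "t <= B" if "t : I" for t
 proof -
  have "t = line s th t \<bullet> th" using n by (simp add: line_inner)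
  also have "\<dots> <= norm (line s th t) * norm th" by (rule norm_cauchy_schwarz)
  also have "\<dots> <= B" using B that n by (simp add: I_def)
  finally show ?thesis .
 qed
 have ne: "I ~= {}" using assms by (auto simp: I_def)
 have bdd: "bdd_above I" by (rule bdd_aboveI) (rule tB)
 define \<beta> where "\<beta> = Sup I"
 have nI: "\<beta> \<notin> I"
 proof
  assume "\<beta> : I"
  then obtain e where "e > 0" and e: "ball \<beta> e \<subseteq> I" using I by (auto simp: open_contains_ball)
  then have "\<beta> + e / 2 : ball \<beta> e" by (simp add: dist_real_def)
  then have "\<beta> + e / 2 : I" using e by blast
  then have "\<beta> + e / 2 <= \<beta>" unfolding \<beta>_def using bdd by (rule cSup_upper)
  then show False using \<open>e > 0\<close> by simp
 qed
 have lt: "t < \<beta>" if "t : I" for t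
  using cSup_upper[OF that bdd] nI that by (metis \<beta>_def less_eq_real_def)
 have "\<beta> : closure I" unfolding \<beta>_def by (rule closure_contains_Sup[OF ne bdd])
 moreover have "line s th ` closure I \<subseteq> closure Om"
 proof (rule image_closure_subset)
  show "continuous_on (closure I) (line s th)" using cl continuous_on_subset by blast
  show "line s th ` I \<subseteq> closure Om" using closure_subset[of Om] by (auto simp: I_def)
 qed simp
 ultimately have "line s th \<beta> : closure Om" by blast
 moreover have "line s th \<beta> \<notin> Om" using nI by (simp add: I_def)
 ultimately have f: "line s th \<beta> : frontier Om" using op by (simp add: frontier_def interior_open)
 have "(line s th \<beta>, th) : outflow Om"
 proof (rule outflowI[OF n f])
  show "\<beta> - t0 > 0" using lt[of t0] assms by (simp add: I_def)
  show "line s th \<beta> - (\<beta> - t0) *\<^sub>R th : Om" using assms(2) by (simp add: line_def algebra_simps)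
 qed
 then show ?thesis using that lt by (auto simp: I_def)
qed

lemma line_uminus: "line s (- th) t = line (- s) th (- t)"
proof -
 have "perp (- th) = - perp th" by (simp add: vec_eq_iff forall_2)
 then show ?thesis by (simp add: line_def)
qed

text \<open>Reversing the direction turns an entry into an exit and negates both line
  coordinates.\<close>

lemma line_entry:
 assumes n: "norm th = 1" and "line s th t0 : Om"
 obtains \<alpha> where "(line s th \<alpha>, th) : inflow Om" "!!t. line s th t : Om ==> \<alpha> < t"
proof -
 have "line (- s) (- th) (- t0) : Om" using assms(2) by (simp add: line_uminus)
 with n obtain \<beta> where b: "(line (- s) (- th) \<beta>, - th) : outflow Om" "!!t. line (- s) (- th) t : Om ==> t < \<beta>"
  by (rule_tac line_exit[of "- th"]) auto
 show ?thesis
 proof (rule that[of "- \<beta>"])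
  show "(line s th (- \<beta>), th) : inflow Om" using b(1) by (simp add: inflow_outflow line_uminus)
  show "- \<beta> < t" if "line s th t : Om" for t using b(2)[of "- t"] that by (simp add: line_uminus)
 qed
qed

text \<open>Outflow (\<open>e = 1\<close>) and inflow (\<open>e = -1\<close>) traces are treated together.\<close>

definition enters :: "real => (plane \<times> plane) set => bool" where
 "enters e B \<longleftrightarrow> \<bar>e\<bar> = 1 & (\<forall>\<zeta> th. (\<zeta>, th) : B --> norm th = 1 & \<zeta> : frontier Om & (\<forall>\<^sub>F t in at_right 0. \<zeta> - (e * t) *\<^sub>R th : Om))"

definition trace_on :: "real => (plane \<times> plane) set => (plane \<times> plane => real) => (plane \<times> plane => real) => bool" where
 "trace_on e B v g \<longleftrightarrow> AE_boundary B (%\<zeta> th. ((%t. v (\<zeta> - (e * t) *\<^sub>R th, th)) \<longlongrightarrow> g (\<zeta>, th)) (at_right 0))"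

lemma enters_outflow: "enters 1 (outflow Om)"
 using outflow_enters by (auto simp: enters_def outflow_def)

lemma enters_inflow: "enters (- 1) (inflow Om)"
proof -
 have "(\<forall>\<^sub>F t in at_right 0. \<zeta> + t *\<^sub>R th : Om)" if "(\<zeta>, th) : inflow Om" for \<zeta> th
  using outflow_enters[of \<zeta> "- th"] that by (simp add: inflow_outflow)
 then show ?thesis by (auto simp: enters_def inflow_def)
qed

lemma has_outflow_trace_iff:
 "has_outflow_trace Om u g \<longleftrightarrow> (\<exists>v. (AE x in phase_space. fst x : Om --> v x = u x) & trace_on 1 (outflow Om) v g)"
 by (simp add: has_outflow_trace_def trace_on_def AE_phase_measure)

lemma has_inflow_trace_iff:
 "has_inflow_trace Om u g \<longleftrightarrow> (\<exists>v. (AE x in phase_space. fst x : Om --> v x = u x) & trace_on (- 1) (inflow Om) v g)"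
 by (simp add: has_inflow_trace_def trace_on_def AE_phase_measure)

text \<open>The two representatives agree at almost every point of almost every line, hence at
  points arbitrarily close to the boundary point, so the difference of the two limits is a limit of
  a function that is frequently zero.\<close>

lemma trace_unique:
 assumes e: "enters e B" and vw: "AE x in phase_space. fst x : Om --> v x = w x"
  and v: "trace_on e B v g" and w: "trace_on e B w h"
 shows "AE_boundary B (%\<zeta> th. g (\<zeta>, th) = h (\<zeta>, th))"
 unfolding AE_boundary_def
 using v[unfolded trace_on_def AE_boundary_def] w[unfolded trace_on_def AE_boundary_def] AE_phase_lines[OF vw]
proof eventually_elim
 fix y :: "real \<times> plane"
 assume 1: "case y of (s, th) => \<forall>\<zeta>. (\<zeta>, th) : B & \<zeta> \<bullet> perp th = s -->
   ((%t. v (\<zeta> - (e * t) *\<^sub>R th, th)) \<longlongrightarrow> g (\<zeta>, th)) (at_right 0)"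
  and 2: "case y of (s, th) => \<forall>\<zeta>. (\<zeta>, th) : B & \<zeta> \<bullet> perp th = s -->
   ((%t. w (\<zeta> - (e * t) *\<^sub>R th, th)) \<longlongrightarrow> h (\<zeta>, th)) (at_right 0)"
  and 3: "AE t in lborel. fst (line (fst y) (snd y) t, snd y) : Om -->
   v (line (fst y) (snd y) t, snd y) = w (line (fst y) (snd y) t, snd y)"
 have *: "g (\<zeta>, th) = h (\<zeta>, th)" if B: "(\<zeta>, th) : B" and y: "y = (\<zeta> \<bullet> perp th, th)" for \<zeta> th
 proof -
 from e B have n: "norm th = 1" and ev: "\<forall>\<^sub>F t in at_right 0. \<zeta> - (e * t) *\<^sub>R th : Om" and e1: "\<bar>e\<bar> = 1"
  by (auto simp: enters_def)
 have l: "\<zeta> - (e * t) *\<^sub>R th = line (\<zeta> \<bullet> perp th) th (\<zeta> \<bullet> th - e * t)" for t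
  using line_of_point[OF n, of \<zeta>] by (simp add: line_def algebra_simps)
 have lim: "((%t. v (\<zeta> - (e * t) *\<^sub>R th, th) - w (\<zeta> - (e * t) *\<^sub>R th, th)) \<longlongrightarrow> g (\<zeta>, th) - h (\<zeta>, th)) (at_right 0)"
  using 1 2 B unfolding y by (intro tendsto_diff) simp_all
 have fr: "\<exists>\<^sub>F t in at_right 0. v (\<zeta> - (e * t) *\<^sub>R th, th) - w (\<zeta> - (e * t) *\<^sub>R th, th) = 0"
  unfolding frequently_def
 proof
  let ?P = "%t. v (\<zeta> - (e * t) *\<^sub>R th, th) - w (\<zeta> - (e * t) *\<^sub>R th, th) ~= 0"
  assume "\<forall>\<^sub>F t in at_right (0::real). ?P t"
  with ev have "\<forall>\<^sub>F t in at_right 0. ?P t & \<zeta> - (e * t) *\<^sub>R th : Om" by eventually_elim auto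
  then obtain b where b: "b > 0" "!!t. 0 < t ==> t < b ==> ?P t & \<zeta> - (e * t) *\<^sub>R th : Om"
   by (auto simp: eventually_at_right_field)
  from e1 have "e ~= 0" by auto
  \<comment> \<open>The substitution reverses or keeps the orientation according to
    \<open>e\<close>; since \<open>e\<close> has modulus one, null sets of parameters correspond to
    null sets of \<open>t\<close>.\<close>
  have "AE t in lborel. line (\<zeta> \<bullet> perp th) th (\<zeta> \<bullet> th + (- e) * t) : Om -->
   v (line (\<zeta> \<bullet> perp th) th (\<zeta> \<bullet> th + (- e) * t), th) = w (line (\<zeta> \<bullet> perp th) th (\<zeta> \<bullet> th + (- e) * t), th)"
  proof -
   have "AE t in density (distr lborel borel (%x. \<zeta> \<bullet> th + (- e) * x)) (%_. ennreal \<bar>- e\<bar>). 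
    line (\<zeta> \<bullet> perp th) th t : Om --> v (line (\<zeta> \<bullet> perp th) th t, th) = w (line (\<zeta> \<bullet> perp th) th t, th)"
    using 3 \<open>e ~= 0\<close> by (subst lborel_real_affine[symmetric]) (auto simp: y)
   then have "AE t in distr lborel borel (%x. \<zeta> \<bullet> th + (- e) * x). 
    line (\<zeta> \<bullet> perp th) th t : Om --> v (line (\<zeta> \<bullet> perp th) th t, th) = w (line (\<zeta> \<bullet> perp th) th t, th)"
    using e1 by (simp add: AE_density)
   then show ?thesis by (rule AE_distrD[rotated]) simp
  qed
  then obtain t where t: "0 < t" "t < b" "line (\<zeta> \<bullet> perp th) th (\<zeta> \<bullet> th + (- e) * t) : Om -->
   v (line (\<zeta> \<bullet> perp th) th (\<zeta> \<bullet> th + (- e) * t), th) = w (line (\<zeta> \<bullet> perp th) th (\<zeta> \<bullet> th + (- e) * t), th)"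
   by (rule AE_lborel_exists_between[OF _ b(1)])
  have "\<zeta> - (e * t) *\<^sub>R th : Om" using b(2)[OF t(1,2)] ..
  then have "v (\<zeta> - (e * t) *\<^sub>R th, th) = w (\<zeta> - (e * t) *\<^sub>R th, th)"
   using t(3) unfolding l by simp
  with b(2)[OF t(1,2)] show False by simp
 qed
 have "g (\<zeta>, th) - h (\<zeta>, th) = 0"
  by (rule limit_frequently_eq[OF trivial_limit_at_right_real fr lim])
 then show "g (\<zeta>, th) = h (\<zeta>, th)" by simp
 qed
 show "case y of (s, th) => \<forall>\<zeta>. (\<zeta>, th) : B & \<zeta> \<bullet> perp th = s --> g (\<zeta>, th) = h (\<zeta>, th)"
  unfolding case_prod_beta by (intro allI impI, elim conjE, rule *) (simp_all add: prod_eq_iff)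
qed

end

section \<open>Absolute continuity along lines and boundary limits\<close>

lemma AE_phase_fst:
 assumes "AE z in lborel. P z"
 shows "AE x in phase_space. P (fst x)"
proof -
 from assms obtain N where N: "{z : space lborel. \<not> P z} \<subseteq> N" "N : null_sets lborel"
  by (auto simp: eventually_ae_filter)
 have "N \<times> space circle_measure : null_sets phase_space"
 proof (rule null_setsI)
  show s: "N \<times> space circle_measure : sets phase_space" using N(2) by auto
  have "emeasure phase_space (N \<times> space circle_measure) = emeasure lborel N * emeasure circle_measure (space circle_measure)"
   using N(2) by (intro circle.emeasure_pair_measure_Times) auto
  then show "emeasure phase_space (N \<times> space circle_measure) = 0" using N(2) by auto
 qed
 then show ?thesis
  by (rule AE_I') (use N(1) in \<open>auto simp: space_pair_measure\<close>)
qed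

lemma isCont_line_primitive:
 assumes H: "integrable lborel (%t. H (line s th t, th))"
 shows "isCont (line_primitive H s th) t"
 unfolding continuous_at_sequentially comp_def
proof (intro allI impI)
 fix x :: "nat => real" assume x: "x \<longlonglongrightarrow> t"
 have m: "(%r. indicator {..y} r * H (line s th r, th)) : borel_measurable lborel" for y
  using H by (intro borel_measurable_times) auto
 show "(%n. line_primitive H s th (x n)) \<longlonglongrightarrow> line_primitive H s th t"
  unfolding line_primitive_def
 proof (rule integral_dominated_convergence[where w="%r. norm (H (line s th r, th))"])
  show "integrable lborel (%r. norm (H (line s th r, th)))" using H by simp
  show "AE r in lborel. norm (indicator {..x n} r * H (line s th r, th)) <= norm (H (line s th r, th))" for n
   by (auto simp: indicator_def)
  show "AE r in lborel. (%n. indicator {..x n} r * H (line s th r, th)) \<longlonglongrightarrow> indicator {..t} r * H (line s th r, th)"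
   using AE_lborel_singleton[of t]
  proof eventually_elim
   fix r assume "r ~= t"
   have "\<forall>\<^sub>F n in sequentially. indicator {..x n} r = (indicator {..t} r :: real)"
   proof (cases "r < t")
    case True
    then show ?thesis using order_tendstoD(1)[OF x True] by (auto elim!: eventually_mono)
   next
    case False
    with \<open>r ~= t\<close> have "t < r" by simp
    from order_tendstoD(2)[OF x this] show ?thesis
     by eventually_elim (use \<open>t < r\<close> in simp)
   qed
   then have "(%n. indicator {..x n} r :: real) \<longlonglongrightarrow> indicator {..t} r"
    by (rule tendsto_eventually)
   then show "(%n. indicator {..x n} r * H (line s th r, th)) \<longlonglongrightarrow> indicator {..t} r * H (line s th r, th)"
    by (intro tendsto_mult tendsto_const)
  qed
 qed (use m in auto)
qed

context convex_domain begin

lemma entersD: "enters e B ==> (\<zeta>, th) : B ==> \<forall>\<^sub>F t in at_right 0. \<zeta> - (e * t) *\<^sub>R th : Om"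
 by (simp add: enters_def)

text \<open>The integrated form of: \<open>v\<close> is absolutely continuous along almost every
  line with derivative \<open>H\<close>. The constant may change from line to line.\<close>

definition characteristic :: "(plane \<times> plane => real) => (plane \<times> plane => real) => bool" where
 "characteristic v H \<longleftrightarrow> (AE y in lborel \<Otimes>\<^sub>M circle_measure. integrable lborel (%t. H (line (fst y) (snd y) t, snd y)) \<and>
    (\<exists>c. \<forall>t. line (fst y) (snd y) t : Om -->
     v (line (fst y) (snd y) t, snd y) = c + line_primitive H (fst y) (snd y) t))"

lemma characteristic_limit:
 assumes n: "norm th = 1" and H: "integrable lborel (%t. H (line s th t, th))"
  and v: "!!t. line s th t : Om ==> v (line s th t, th) = c + line_primitive H s th t"
  and \<zeta>: "\<zeta> = line s th \<beta>" and ev: "\<forall>\<^sub>F t in at_right 0. \<zeta> - (e * t) *\<^sub>R th : Om"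
 shows "((%t. v (\<zeta> - (e * t) *\<^sub>R th, th)) \<longlongrightarrow> c + line_primitive H s th \<beta>) (at_right 0)"
proof -
 have l: "\<zeta> - (e * t) *\<^sub>R th = line s th (\<beta> - e * t)" for t
  by (simp add: \<zeta> line_def algebra_simps)
 have "((%t. \<beta> - e * t) \<longlongrightarrow> \<beta> - e * 0) (at_right 0)" by (intro tendsto_intros)
 then have "((%t. c + line_primitive H s th (\<beta> - e * t)) \<longlongrightarrow> c + line_primitive H s th \<beta>) (at_right 0)"
  by (intro tendsto_intros isCont_tendsto_compose[OF isCont_line_primitive[OF H]]) simp
 moreover have "\<forall>\<^sub>F t in at_right 0. c + line_primitive H s th (\<beta> - e * t) = v (\<zeta> - (e * t) *\<^sub>R th, th)"
  using ev by eventually_elim (simp add: l v)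
 ultimately show ?thesis by (rule Lim_transform_eventually)
qed

lemma characteristic_trace:
 assumes e: "enters e B" and v: "characteristic v H"
 shows "trace_on e B v (%(\<zeta>, th). Lim (at_right 0) (%t. v (\<zeta> - (e * t) *\<^sub>R th, th)))"
 unfolding trace_on_def AE_boundary_def
 using v[unfolded characteristic_def]
proof eventually_elim
 fix y :: "real \<times> plane"
 assume y': "integrable lborel (%t. H (line (fst y) (snd y) t, snd y)) \<and>
   (\<exists>c. \<forall>t. line (fst y) (snd y) t : Om -->
    v (line (fst y) (snd y) t, snd y) = c + line_primitive H (fst y) (snd y) t)"
 have *: "((%t. v (\<zeta> - (e * t) *\<^sub>R th, th)) \<longlongrightarrow> Lim (at_right 0) (%t. v (\<zeta> - (e * t) *\<^sub>R th, th))) (at_right 0)"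
  if B: "(\<zeta>, th) : B" and y: "y = (\<zeta> \<bullet> perp th, th)" for \<zeta> th
 proof -
  from y' obtain c where c: "!!t. line (\<zeta> \<bullet> perp th) th t : Om ==>
    v (line (\<zeta> \<bullet> perp th) th t, th) = c + line_primitive H (\<zeta> \<bullet> perp th) th t"
   and H: "integrable lborel (%t. H (line (\<zeta> \<bullet> perp th) th t, th))"
   by (auto simp: y)
  from e B have n: "norm th = 1" and ev: "\<forall>\<^sub>F t in at_right 0. \<zeta> - (e * t) *\<^sub>R th : Om"
   by (auto simp: enters_def)
  have lim: "((%t. v (\<zeta> - (e * t) *\<^sub>R th, th)) \<longlongrightarrow> c + line_primitive H (\<zeta> \<bullet> perp th) th (\<zeta> \<bullet> th)) (at_right 0)"
   by (rule characteristic_limit[OF n H c line_of_point[OF n, symmetric] ev])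
  from tendsto_Lim[OF trivial_limit_at_right_real lim] lim show ?thesis by simp
 qed
 show "case y of (s, th) => \<forall>\<zeta>. (\<zeta>, th) : B & \<zeta> \<bullet> perp th = s -->
   ((%t. v (\<zeta> - (e * t) *\<^sub>R th, th)) \<longlongrightarrow> (case (\<zeta>, th) of (\<zeta>, th) => Lim (at_right 0) (%t. v (\<zeta> - (e * t) *\<^sub>R th, th)))) (at_right 0)"
  unfolding case_prod_beta fst_conv snd_conv by (intro allI impI, elim conjE, rule *) (simp_all add: prod_eq_iff)
qed

text \<open>The primitive vanishes up to the entry point, so a zero inflow trace makes the constant
  0; a zero outflow trace then makes the primitive vanish at the exit and beyond. The extension of
  \<open>v\<close> by zero is therefore a primitive of \<open>H\<close> on the entire line, which is
  the equation in the whole plane.\<close>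

lemma zero_trace_primitive:
 assumes out: "!!x. fst x \<notin> Om ==> H x = 0"
  and v: "characteristic v H"
  and tin: "trace_on (- 1) (inflow Om) v (%_. 0)" and tout: "trace_on 1 (outflow Om) v (%_. 0)"
 shows "AE y in lborel \<Otimes>\<^sub>M circle_measure. integrable lborel (%t. H (line (fst y) (snd y) t, snd y)) \<and>
  (\<forall>t. indicator Om (line (fst y) (snd y) t) * v (line (fst y) (snd y) t, snd y) = line_primitive H (fst y) (snd y) t)"
proof -
 have "AE x in lborel \<Otimes>\<^sub>M circle_measure. norm (snd x) = 1"
  by (intro AE_I2) (auto simp: space_pair_measure space_circle)
 then show ?thesis
  using v[unfolded characteristic_def] tin[unfolded trace_on_def AE_boundary_def] tout[unfolded trace_on_def AE_boundary_def]
 proof eventually_elim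
  fix y :: "real \<times> plane"
  obtain s th where y: "y = (s, th)" by (cases y)
  assume "norm (snd y) = 1"
   and 1: "integrable lborel (%t. H (line (fst y) (snd y) t, snd y)) \<and>
    (\<exists>c. \<forall>t. line (fst y) (snd y) t : Om -->
     v (line (fst y) (snd y) t, snd y) = c + line_primitive H (fst y) (snd y) t)"
   and 2: "case y of (s, th) => \<forall>\<zeta>. (\<zeta>, th) : inflow Om & \<zeta> \<bullet> perp th = s -->
     ((%t. v (\<zeta> - (- 1 * t) *\<^sub>R th, th)) \<longlongrightarrow> 0) (at_right 0)"
   and 3: "case y of (s, th) => \<forall>\<zeta>. (\<zeta>, th) : outflow Om & \<zeta> \<bullet> perp th = s -->
     ((%t. v (\<zeta> - (1 * t) *\<^sub>R th, th)) \<longlongrightarrow> 0) (at_right 0)"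
  then have n: "norm th = 1" and H: "integrable lborel (%t. H (line s th t, th))"
   by (auto simp: y)
  from 1 obtain c where c: "!!t. line s th t : Om ==> v (line s th t, th) = c + line_primitive H s th t"
   by (auto simp: y)
  have "\<forall>t. indicator Om (line s th t) * v (line s th t, th) = line_primitive H s th t"
  proof (cases "\<exists>t0. line s th t0 : Om")
   case False
   then show ?thesis using out by (simp add: line_primitive_def)
  next
   case True
   then obtain t0 where t0: "line s th t0 : Om" ..
   obtain \<alpha> where \<alpha>: "(line s th \<alpha>, th) : inflow Om" "!!t. line s th t : Om ==> \<alpha> < t"
    using line_entry[OF n t0] by blast
   obtain \<beta> where \<beta>: "(line s th \<beta>, th) : outflow Om" "!!t. line s th t : Om ==> t < \<beta>"
    using line_exit[OF n t0] by blast
   have p: "line s th t \<bullet> perp th = s" for t by (rule line_inner[OF n])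
   have "((%t. v (line s th \<alpha> - (- 1 * t) *\<^sub>R th, th)) \<longlongrightarrow> c + line_primitive H s th \<alpha>) (at_right 0)"
    by (rule characteristic_limit[OF n H c refl entersD[OF enters_inflow \<alpha>(1)]])
   moreover have "((%t. v (line s th \<alpha> - (- 1 * t) *\<^sub>R th, th)) \<longlongrightarrow> 0) (at_right 0)"
    using 2 \<alpha>(1) p by (auto simp: y)
   ultimately have a: "c + line_primitive H s th \<alpha> = 0"
    by (rule tendsto_unique[OF trivial_limit_at_right_real])
   have "((%t. v (line s th \<beta> - (1 * t) *\<^sub>R th, th)) \<longlongrightarrow> c + line_primitive H s th \<beta>) (at_right 0)"
    by (rule characteristic_limit[OF n H c refl entersD[OF enters_outflow \<beta>(1)]])
   moreover have "((%t. v (line s th \<beta> - (1 * t) *\<^sub>R th, th)) \<longlongrightarrow> 0) (at_right 0)"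
    using 3 \<beta>(1) p by (auto simp: y)
   ultimately have b: "c + line_primitive H s th \<beta> = 0"
    by (rule tendsto_unique[OF trivial_limit_at_right_real])
   have pa: "line_primitive H s th t = 0" if "t <= \<alpha>" for t
   proof -
    have "indicator {..t} r * H (line s th r, th) = 0" for r
    proof (cases "line s th r : Om")
     case True
     then have "\<not> r <= t" using \<alpha>(2)[OF True] that by simp
     then show ?thesis by simp
    qed (simp add: out)
    then show ?thesis by (simp only: line_primitive_def Bochner_Integration.integral_zero)
   qed
   have pb: "line_primitive H s th t = line_primitive H s th \<beta>" if "t >= \<beta>" for t
   proof -
    have "indicator {..t} r * H (line s th r, th) = indicator {..\<beta>} r * H (line s th r, th)" for r
    proof (cases "line s th r : Om")
     case True
     then have "r <= t" "r <= \<beta>" using \<beta>(2)[OF True] that by simp_all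
     then show ?thesis by simp
    qed (simp add: out)
    then show ?thesis by (simp only: line_primitive_def)
   qed
   have c0: "c = 0" using a pa[of \<alpha>] by simp
   show ?thesis
   proof
    fix t
    show "indicator Om (line s th t) * v (line s th t, th) = line_primitive H s th t"
    proof (cases "line s th t : Om")
     case True then show ?thesis using c c0 by simp
    next
     case False
     \<comment> \<open>Every parameter strictly between entry and exit belongs to the domain:
       \<open>p\<close> is taken just after the entry and \<open>q\<close> just before the exit, on
       both sides of \<open>t\<close>, and convexity does the rest.\<close>
     have "t <= \<alpha> \<or> \<beta> <= t"
     proof (rule ccontr)
      assume t: "\<not> ?thesis"
      have t0': "\<alpha> < t0" "t0 < \<beta>" using \<alpha>(2) \<beta>(2) t0 by auto
      have A: "\<forall>\<^sub>F r in at_right 0. line s th \<alpha> - (- 1 * r) *\<^sub>R th : Om"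
       by (rule entersD[OF enters_inflow \<alpha>(1)])
      then obtain e where e: "e > 0" and e': "\<forall>r>0. r < e --> line s th \<alpha> - (- 1 * r) *\<^sub>R th : Om"
       unfolding eventually_at_right_field by blast
      have eO: "line s th (\<alpha> + r) : Om" if "0 < r" "r < e" for r
       using e' that by (simp add: line_add)
      have B: "\<forall>\<^sub>F r in at_right 0. line s th \<beta> - (1 * r) *\<^sub>R th : Om"
       by (rule entersD[OF enters_outflow \<beta>(1)])
      then obtain d where d: "d > 0" and d': "\<forall>r>0. r < d --> line s th \<beta> - (1 * r) *\<^sub>R th : Om"
       unfolding eventually_at_right_field by blast
      have dO: "line s th (\<beta> - r) : Om" if "0 < r" "r < d" for r
      proof -
       have "line s th \<beta> - (1 * r) *\<^sub>R th : Om" using d' that by blast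
       then show ?thesis by (simp add: line_def algebra_simps)
      qed
      define p where "p = \<alpha> + min (e / 2) ((t - \<alpha>) / 2)"
      define q where "q = \<beta> - min (d / 2) ((\<beta> - t) / 2)"
      have t': "\<alpha> < t" "t < \<beta>" using t by auto
      have "line s th p : Om" unfolding p_def
       by (rule eO) (use e t' in \<open>auto simp: min_def\<close>)
      moreover have "line s th q : Om" unfolding q_def
       by (rule dO) (use d t' in \<open>auto simp: min_def\<close>)
      moreover have "p <= \<alpha> + (t - \<alpha>) / 2" "\<beta> - (\<beta> - t) / 2 <= q"
       using min.cobounded2[of "e / 2" "(t - \<alpha>) / 2"] min.cobounded2[of "d / 2" "(\<beta> - t) / 2"]
       unfolding p_def q_def by linarith+
      then have "p < t" "t < q" using t' by (auto simp: field_simps)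
      ultimately have pq: "line s th p : Om" "line s th q : Om" "p < t" "t < q" by auto
      have "line s th t = (1 - (t - p) / (q - p)) *\<^sub>R line s th p + ((t - p) / (q - p)) *\<^sub>R line s th q"
      proof -
       have "t = (1 - (t - p) / (q - p)) * p + ((t - p) / (q - p)) * q"
        using pq by (simp add: divide_simps) (simp add: algebra_simps)
       then have "t *\<^sub>R th = ((1 - (t - p) / (q - p)) * p + ((t - p) / (q - p)) * q) *\<^sub>R th" by simp
       then show ?thesis by (simp add: line_def algebra_simps)
      qed
      moreover have "\<dots> : Om"
       by (rule convexD_alt[OF cv pq(1,2)]) (use pq in \<open>auto simp: divide_simps\<close>)
      ultimately show False using False by simp
     qed
     then have "line_primitive H s th t = 0"
     proof
      assume "\<beta> <= t"
      from pb[OF this] show ?thesis using b c0 by simp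
     qed (rule pa)
     then show ?thesis using False by simp
    qed
   qed
  qed
  then show "integrable lborel (%t. H (line (fst y) (snd y) t, snd y)) \<and>
   (\<forall>t. indicator Om (line (fst y) (snd y) t) * v (line (fst y) (snd y) t, snd y) = line_primitive H (fst y) (snd y) t)"
   using H by (simp add: y)
 qed
qed

end

section \<open>The transport equation for functions cut off to the domain\<close>

locale transport_medium = convex_domain +
 fixes a :: "plane => real" and k :: "plane => real => real"
 assumes ca: "continuous_on (closure Om) a"
  and ck: "continuous_on (closure Om \<times> {-1..1}) (%(z, s). k z s)"
begin

definition cut :: "(plane \<times> plane => real) => plane \<times> plane => real" where
 "cut f x = indicator Om (fst x) * f x"

text \<open>The value that the transport equation prescribes for \<theta> \<bullet>
  \<nabla>u.\<close>

definition rhs :: "(plane \<times> plane => real) => (plane \<times> plane => real) => plane \<times> plane => real" where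
 "rhs f u x = f x - a (fst x) * u x + scattering k u (fst x) (snd x)"

lemma integrable_cut_iff: "integrable (phase_measure Om) f \<longleftrightarrow> integrable phase_space (cut f)"
 by (simp add: integrable_phase_measure cut_def[abs_def])

lemma a_bounded: obtains A where "A >= 0" "!!z. z : closure Om ==> \<bar>a z\<bar> <= A"
proof -
 have "compact (closure Om)" using bd by (simp add: compact_closure)
 from compact_imp_bounded[OF compact_continuous_image[OF ca this]]
 obtain A where A: "!!z. z : closure Om ==> \<bar>a z\<bar> <= A" by (auto simp: bounded_iff)
 show ?thesis
 proof (rule that[of "\<bar>A\<bar>"])
  show "\<bar>a z\<bar> <= \<bar>A\<bar>" if "z : closure Om" for z using A[OF that] by linarith
 qed simp
qed

lemma measurable_cut_a: "(%z. indicator Om z * a z) : borel_measurable borel"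
 using borel_measurable_continuous_on_indicator[OF borel_domain continuous_on_subset[OF ca closure_subset]] by simp

text \<open>The kernel is controlled only for positions in the closure and arguments in [-1, 1].
  Extension by zero makes it bounded and Borel everywhere, and products of unit vectors never leave
  that interval.\<close>

definition kx :: "plane => real => real" where
 "kx z s = indicator (closure Om \<times> {-1..1}) (z, s) * k z s"

lemma measurable_kx[measurable]: "(%p. kx (fst p) (snd p)) : borel_measurable (borel \<Otimes>\<^sub>M borel)"
proof -
 have "closed (closure Om \<times> {-1..1::real})" by (intro closed_Times) auto
 then have "closure Om \<times> {-1..1} : sets (borel :: (plane \<times> real) measure)" by (rule borel_closed)
 from borel_measurable_continuous_on_indicator[OF this ck]
 show ?thesis by (simp add: kx_def case_prod_beta' borel_prod)
qed

lemma kx_bounded: obtains B where "B >= 0" "!!z s. \<bar>kx z s\<bar> <= B"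
proof -
 have "compact (closure Om)" using bd by (simp add: compact_closure)
 then have "compact (closure Om \<times> {-1..1::real})" by (intro compact_Times) auto
 from compact_imp_bounded[OF compact_continuous_image[OF ck this]]
 obtain B where B: "\<forall>z\<in>closure Om. \<forall>s\<in>{-1..1}. \<bar>k z s\<bar> <= B" by (auto simp: bounded_iff)
 show ?thesis
 proof (rule that[of "\<bar>B\<bar>"])
  show "\<bar>kx z s\<bar> <= \<bar>B\<bar>" for z s
   using B by (auto simp: kx_def indicator_def intro: order_trans[OF _ abs_ge_self])
 qed simp
qed

lemma inner_circle:
 assumes "norm th = 1" "norm th' = 1" shows "th \<bullet> th' : {-1..1::real}"
 using Cauchy_Schwarz_ineq2[of th th'] assms by (auto simp: abs_le_iff)

lemma cut_scattering:
 assumes "norm (snd x) = 1"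
 shows "cut (%x. scattering k u (fst x) (snd x)) x = (\<integral>th'. kx (fst x) (snd x \<bullet> th') * cut u (fst x, th') \<partial>circle_measure)"
proof (cases "fst x : Om")
 case True
 have "scattering k u (fst x) (snd x) = (\<integral>th'. kx (fst x) (snd x \<bullet> th') * cut u (fst x, th') \<partial>circle_measure)"
  unfolding scattering_def
 proof (rule Bochner_Integration.integral_cong[OF refl])
  fix th' assume "th' : space circle_measure"
  then have "snd x \<bullet> th' : {-1..1}" using assms by (intro inner_circle) (auto simp: space_circle)
  moreover have "fst x : closure Om" using True closure_subset by blast
  ultimately show "k (fst x) (snd x \<bullet> th') * u (fst x, th') = kx (fst x) (snd x \<bullet> th') * cut u (fst x, th')"
   using True by (simp add: kx_def cut_def indicator_def)
 qed
 then show ?thesis using True by (simp add: cut_def)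
qed (simp add: cut_def)

text \<open>The scattered function is dominated by a bound of the kernel times the angular integral
  of \<open>\<bar>u\<bar>\<close>, which depends on the position alone and is integrable by
  Fubini.\<close>

lemma integrable_cut_scattering:
 assumes u: "integrable phase_space (cut u)"
 shows "integrable phase_space (cut (%x. scattering k u (fst x) (snd x)))"
proof -
 obtain B where B: "B >= 0" "!!z s. \<bar>kx z s\<bar> <= B" using kx_bounded by blast
 let ?w = "%x :: plane \<times> plane. (\<integral>th'. kx (fst x) (snd x \<bullet> th') * cut u (fst x, th') \<partial>circle_measure)"
 have [measurable]: "cut u : borel_measurable phase_space" using u by simp
 have mw: "(%p. kx (fst (fst p)) (snd (fst p) \<bullet> snd p) * cut u (fst (fst p), snd p)) : borel_measurable (phase_space \<Otimes>\<^sub>M circle_measure)"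
 proof -
  have [measurable]: "(%p. kx (fst (fst p)) (snd (fst p) \<bullet> snd p)) : borel_measurable (phase_space \<Otimes>\<^sub>M circle_measure)"
   using measurable_compose[of "%p. (fst (fst p), snd (fst p) \<bullet> snd p)" "phase_space \<Otimes>\<^sub>M circle_measure" "borel \<Otimes>\<^sub>M borel", OF _ measurable_kx]
   by simp
  show ?thesis by measurable
 qed
 have "integrable phase_space ?w"
 proof (rule Bochner_Integration.integrable_bound)
  have i: "integrable lborel (%z. \<integral>th'. \<bar>cut u (z, th')\<bar> \<partial>circle_measure)"
   using lc.integrable_fst'[OF integrable_norm[OF u]] by simp
  show "integrable phase_space (%x. B * (\<integral>th'. \<bar>cut u (fst x, th')\<bar> \<partial>circle_measure))"
  proof (rule integrable_mult_right, rule lc.Fubini_integrable)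
   show "(%x. \<integral>th'. \<bar>cut u (fst x, th')\<bar> \<partial>circle_measure) : borel_measurable phase_space"
    by measurable
   show "integrable lborel (%z. \<integral>th. norm (\<integral>th'. \<bar>cut u (fst (z, th), th')\<bar> \<partial>circle_measure) \<partial>circle_measure)"
    using i by (simp add: integral_circle_const)
   show "AE z in lborel. integrable circle_measure (%th. \<integral>th'. \<bar>cut u (fst (z, th), th')\<bar> \<partial>circle_measure)"
    by simp
  qed
  show "?w : borel_measurable phase_space"
   using circle.borel_measurable_lebesgue_integral[of "%x th'. kx (fst x) (snd x \<bullet> th') * cut u (fst x, th')" phase_space] mw
   by (simp add: case_prod_beta')
  have "AE z in lborel. integrable circle_measure (%th'. cut u (z, th'))"
   using lc.AE_integrable_fst'[OF u] .
  then have "AE x in phase_space. integrable circle_measure (%th'. cut u (fst x, th'))"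
   by (rule AE_phase_fst)
  then show "AE x in phase_space. norm (?w x) <= norm (B * (\<integral>th'. \<bar>cut u (fst x, th')\<bar> \<partial>circle_measure))"
  proof eventually_elim
   fix x :: "plane \<times> plane" assume ix: "integrable circle_measure (%th'. cut u (fst x, th'))"
   have "norm (?w x) <= (\<integral>th'. B * \<bar>cut u (fst x, th')\<bar> \<partial>circle_measure)"
   proof (rule order_trans[OF integral_norm_bound integral_mono'])
    show "integrable circle_measure (%th'. B * \<bar>cut u (fst x, th')\<bar>)" using ix by simp
    show "norm (kx (fst x) (snd x \<bullet> th') * cut u (fst x, th')) <= B * \<bar>cut u (fst x, th')\<bar>" for th'
     unfolding real_norm_def abs_mult by (intro mult_right_mono B abs_ge_zero)
    show "0 <= B * \<bar>cut u (fst x, th')\<bar>" for th' using B(1) by simp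
   qed
   then show "norm (?w x) <= norm (B * (\<integral>th'. \<bar>cut u (fst x, th')\<bar> \<partial>circle_measure))"
    using B(1) by simp
  qed
 qed
 then show ?thesis
  by (rule Bochner_Integration.integrable_cong[THEN iffD1, rotated 2]) (auto simp: cut_scattering space_phase)
qed

lemma integrable_cut_rhs:
 assumes u: "integrable phase_space (cut u)" and f: "integrable phase_space (cut f)"
 shows "integrable phase_space (cut (rhs f u))"
proof -
 obtain A where A: "A >= 0" "!!z. z : closure Om ==> \<bar>a z\<bar> <= A" using a_bounded by blast
 have "(%x. indicator Om (fst x) * a (fst x)) : borel_measurable phase_space"
  using measurable_compose[OF _ measurable_cut_a, of fst phase_space] by simp
 then have "integrable phase_space (%x. cut u x * (indicator Om (fst x) * a (fst x)))"
  by (rule integrable_mult_bounded[OF u, where C=A]) (use A closure_subset in \<open>auto simp: indicator_def\<close>)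
 then have "integrable phase_space (%x. cut f x - cut u x * (indicator Om (fst x) * a (fst x)) + cut (%x. scattering k u (fst x) (snd x)) x)"
  by (intro Bochner_Integration.integrable_add Bochner_Integration.integrable_diff f integrable_cut_scattering u)
 moreover have "cut f x - cut u x * (indicator Om (fst x) * a (fst x)) + cut (%x. scattering k u (fst x) (snd x)) x = cut (rhs f u) x" for x
  by (simp add: cut_def rhs_def algebra_simps indicator_def)
 ultimately show ?thesis by simp
qed

text \<open>All terms without a derivative of the test function are collected in \<open>rhs\<close>;
  this is the form that \<open>characteristic_representative\<close> takes.\<close>

lemma transport_equation_iff:
 assumes u: "integrable phase_space (cut u)" and f: "integrable phase_space (cut f)"
 shows "transport_equation Om a k f u \<longleftrightarrow> (\<forall>ph. phase_test_function Om ph -->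
   (\<integral>x. cut u x * transport_deriv ph x \<partial>phase_space) = - (\<integral>x. cut (rhs f u) x * ph x \<partial>phase_space))"
 unfolding transport_equation_def
proof (intro all_cong1 imp_cong refl)
 fix ph assume ph: "phase_test_function Om ph"
 then have s: "smooth ph" by (simp add: phase_test_function_def)
 obtain C where C: "C >= 0" "!!x. norm (snd x) = 1 ==> \<bar>ph x\<bar> <= C"
   "!!x. norm (snd x) = 1 ==> \<bar>transport_deriv ph x\<bar> <= C"
  using phase_test_function_bounded[OF ph] by blast
 have i1: "integrable phase_space (%x. cut u x * transport_deriv ph x)"
  by (rule integrable_mult_bounded[OF u, where C=C])
    (use C measurable_phase_continuous[OF continuous_transport_deriv[OF s]] in \<open>auto simp: space_phase\<close>)
 have i2: "integrable phase_space (%x. g x * ph x)" if "integrable phase_space g" for g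
  by (rule integrable_mult_bounded[OF that, where C=C])
    (use C measurable_phase_continuous[OF smooth_continuous[OF s]] in \<open>auto simp: space_phase\<close>)
 have "(\<integral>(z, th). - u (z, th) * frechet_derivative (%y. ph (y, th)) (at z) th
      + (a z * u (z, th) - scattering k u z th) * ph (z, th) \<partial>phase_measure Om)
   = (\<integral>x. - (cut u x * transport_deriv ph x) + (cut f x * ph x - cut (rhs f u) x * ph x) \<partial>phase_space)"
  unfolding integral_phase_measure[OF borel_domain]
  by (intro Bochner_Integration.integral_cong refl)
    (auto simp: frechet_slice[OF s] transport_deriv_def cut_def rhs_def indicator_def algebra_simps)
 also have "\<dots> = - (\<integral>x. cut u x * transport_deriv ph x \<partial>phase_space) +
   ((\<integral>x. cut f x * ph x \<partial>phase_space) - (\<integral>x. cut (rhs f u) x * ph x \<partial>phase_space))"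
  using i1 i2[OF f] i2[OF integrable_cut_rhs[OF u f]] by simp
 moreover have "(\<integral>(z, th). f (z, th) * ph (z, th) \<partial>phase_measure Om) = (\<integral>x. cut f x * ph x \<partial>phase_space)"
  unfolding integral_phase_measure[OF borel_domain]
  by (intro Bochner_Integration.integral_cong refl) (auto simp: cut_def)
 ultimately show "((\<integral>(z, th). - u (z, th) * frechet_derivative (%y. ph (y, th)) (at z) th
      + (a z * u (z, th) - scattering k u z th) * ph (z, th) \<partial>phase_measure Om)
   = (\<integral>(z, th). f (z, th) * ph (z, th) \<partial>phase_measure Om)) \<longleftrightarrow>
   ((\<integral>x. cut u x * transport_deriv ph x \<partial>phase_space) = - (\<integral>x. cut (rhs f u) x * ph x \<partial>phase_space))"
  by linarith
qed

lemma characteristic_solution: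
 assumes u: "integrable phase_space (cut u)" and f: "integrable phase_space (cut f)"
  and eq: "transport_equation Om a k f u"
 obtains v where "AE x in phase_space. fst x : Om --> v x = u x" "characteristic v (cut (rhs f u))"
proof -
 obtain v where v: "AE x in phase_space. fst x : Om --> v x = cut u x" "characteristic v (cut (rhs f u))"
  unfolding characteristic_def
  by (rule characteristic_representative[OF op cv u integrable_cut_rhs[OF u f]])
    (use eq transport_equation_iff[OF u f] in auto)
 moreover have "AE x in phase_space. fst x : Om --> v x = u x"
  using v(1) by eventually_elim (simp add: cut_def)
 ultimately show ?thesis using that by blast
qed

end

section \<open>Integrals and moments over the circle\<close>

lemma integral_circle:
 fixes F :: "plane => 'b::{banach, second_countable_topology}"
 assumes F: "F : borel_measurable circle_measure"
 shows "(\<integral>th. F th \<partial>circle_measure) = (1 / (2 * pi)) *\<^sub>R (\<integral>t. indicator {-pi..pi} t *\<^sub>R F (vector [cos t, sin t]) \<partial>lborel)"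
proof -
 have e: "emeasure lborel {-pi..pi} = ennreal (2 * pi)" by simp
 have u: "uniform_measure lborel {-pi..pi} = density lborel (%t. ennreal (indicator {-pi..pi} t / (2 * pi)))"
  unfolding uniform_measure_def e
  by (intro density_cong AE_I2) (auto simp: indicator_def divide_ennreal[symmetric] ennreal_1[symmetric] simp del: ennreal_1)
 have F': "F : borel_measurable (restrict_space borel (sphere 0 1))"
  using F measurable_cong_sets[OF sets_circle refl] by blast
 have m: "(%t. F (vector [cos t, sin t])) : borel_measurable lborel"
  using measurable_compose[OF cos_sin_measurable F'] by (simp add: measurable_def)
 have "(\<integral>th. F th \<partial>circle_measure) = (\<integral>t. F (vector [cos t, sin t]) \<partial>uniform_measure lborel {-pi..pi})"
  unfolding circle_measure_def by (rule integral_distr[OF cos_sin_measurable F'])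
 also have "\<dots> = (\<integral>t. (indicator {-pi..pi} t / (2 * pi)) *\<^sub>R F (vector [cos t, sin t]) \<partial>lborel)"
  unfolding u by (rule integral_density) (use m in auto)
 also have "\<dots> = (\<integral>t. (1 / (2 * pi)) *\<^sub>R (indicator {-pi..pi} t *\<^sub>R F (vector [cos t, sin t])) \<partial>lborel)"
  by (intro Bochner_Integration.integral_cong refl) simp
 finally show ?thesis by (simp only: Bochner_Integration.integral_scaleR_right)
qed

text \<open>The plane as the complex numbers. On the unit circle its powers are the angular
  exponentials, so integrals against them are Fourier coefficients; frequency vectors are read as
  complex numbers by the same map.\<close>

definition zeta :: "plane => complex" where
 "zeta th = Complex (th $ 1) (th $ 2)"

lemma Complex_eq_of_real: "Complex a b = of_real a + \<i> * of_real b"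
 by (simp add: complex_eq_iff)

lemma measurable_zeta[measurable (raw)]:
 "f : borel_measurable M ==> (%x. zeta (f x)) : borel_measurable M"
 by (erule measurable_compose)
   (auto simp: zeta_def[abs_def] Complex_eq_of_real intro!: borel_measurable_continuous_onI continuous_intros)

lemma norm_zeta: "norm (zeta th) = norm th"
 by (simp add: zeta_def complex_norm norm_vec_def L2_set_def UNIV_2)

lemma zeta_cos_sin: "zeta (vector [cos t, sin t]) = cis t"
 by (simp add: zeta_def cis.ctr)

lemma integral_zeta_power:
 assumes "n > 0"
 shows "(\<integral>th. zeta th ^ n \<partial>circle_measure) = 0"
proof -
 have "(\<integral>t. indicator {-pi..pi} t *\<^sub>R (zeta (vector [cos t, sin t]) ^ n) \<partial>lborel)
   = (\<integral>t. indicator {-pi..pi} t *\<^sub>R cis (real n * t) \<partial>lborel)"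
  by (simp add: zeta_cos_sin Complex.DeMoivre)
 also have "\<dots> = cis (real n * pi) / (\<i> * of_nat n) - cis (real n * (- pi)) / (\<i> * of_nat n)"
 proof (rule integral_FTC_atLeastAtMost)
  fix t :: real
  have c: "cis (real n * t) = exp (\<i> * of_real (real n * t))" for t by (rule cis_conv_exp)
  have "((%z. exp (\<i> * of_nat n * z)) has_field_derivative \<i> * of_nat n * exp (\<i> * of_nat n * of_real t)) (at (complex_of_real t))"
   by (auto intro!: derivative_eq_intros)
  from has_vector_derivative_real_field[OF this, of "{-pi..pi}"]
  have "((%t. exp (\<i> * of_real (real n * t))) has_vector_derivative
    (\<i> * of_nat n) * exp (\<i> * of_real (real n * t))) (at t within {-pi..pi})"
   by (simp add: mult.assoc)
  from has_vector_derivative_mult_right[OF this, of "1 / (\<i> * of_nat n)"]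
  show "((%t. cis (real n * t) / (\<i> * of_nat n)) has_vector_derivative cis (real n * t)) (at t within {-pi..pi})"
   using assms unfolding c by simp
  show "continuous_on {-pi..pi} (%t. cis (real n * t))"
   by (intro continuous_intros)
 qed simp
 also have "\<dots> = 0" using assms by (simp add: cis_mult[symmetric] complex_eq_iff sin_npi cis.ctr)
 finally show ?thesis by (subst integral_circle) auto
qed

lemma integrable_zeta_power: "integrable circle_measure (%th. zeta th ^ n)"
 by (rule circle_integrable_bounded[where B=1]) (auto simp: norm_power norm_zeta)

text \<open>The square of \<open>zeta th\<close> has the difference of the squared components as
  real part and twice their product as imaginary part, and its mean is zero; the sum of the squares
  is 1.\<close>

lemma circle_moments:
 "(\<integral>th. th $ i * th $ j \<partial>circle_measure) = (if i = j then 1 / 2 else 0)"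
proof -
 have bd: "\<bar>th $ i * th $ j\<bar> <= 1" if "norm th = 1" for th :: plane and i j
  using mult_mono[OF component_le_norm_cart[of th i] component_le_norm_cart[of th j]] that by (simp add: abs_mult)
 have i: "integrable circle_measure (%th. th $ i * th $ j)" for i j
  by (rule circle_integrable_bounded[where B=1]) (use bd in auto)
 have z: "zeta th ^ 2 = Complex (th $ 1 * th $ 1 - th $ 2 * th $ 2) (2 * (th $ 1 * th $ 2))" for th
  by (simp add: zeta_def power2_eq_square complex_eq_iff)
 have "(\<integral>th. th $ 1 * th $ 1 - th $ 2 * th $ 2 \<partial>circle_measure) = Re (\<integral>th. zeta th ^ 2 \<partial>circle_measure)"
  using integral_Re[OF integrable_zeta_power[of 2]] by (simp add: z)
 then have 1: "(\<integral>th. th $ 1 * th $ 1 \<partial>circle_measure) - (\<integral>th. th $ 2 * th $ 2 \<partial>circle_measure) = 0"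
  using i by (simp add: integral_zeta_power)
 have "(\<integral>th. 2 * (th $ 1 * th $ 2) \<partial>circle_measure) = Im (\<integral>th. zeta th ^ 2 \<partial>circle_measure)"
  using integral_Im[OF integrable_zeta_power[of 2]] by (simp add: z)
 then have 2: "(\<integral>th. th $ 1 * th $ 2 \<partial>circle_measure) = 0" by (simp add: integral_zeta_power)
 have "(\<integral>th. th $ 1 * th $ 1 \<partial>circle_measure) + (\<integral>th. th $ 2 * th $ 2 \<partial>circle_measure) = (\<integral>th. th $ 1 * th $ 1 + th $ 2 * th $ 2 \<partial>circle_measure)"
  using i by simp
 also have "\<dots> = (\<integral>th. 1 \<partial>circle_measure)"
 proof (intro Bochner_Integration.integral_cong refl)
  fix th assume "th : space circle_measure"
  then show "th $ 1 * th $ 1 + th $ 2 * th $ 2 = 1"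
   using norm_plane[of th] by (simp add: space_circle power2_eq_square)
 qed
 also have "\<dots> = 1" by (rule integral_circle_const)
 finally have 3: "(\<integral>th. th $ 1 * th $ 1 \<partial>circle_measure) + (\<integral>th. th $ 2 * th $ 2 \<partial>circle_measure) = 1" .
 have "i = 1 \<or> i = 2" "j = 1 \<or> j = 2" using exhaust_2 by auto
 then show ?thesis using 1 2 3 by (auto simp: mult.commute)
qed

lemma integrable_phase_fst:
 fixes F :: "plane => 'b::{banach, second_countable_topology}"
 assumes "integrable lborel F"
 shows "integrable phase_space (%x. F (fst x))"
proof (rule lc.Fubini_integrable)
 have [measurable]: "F : borel_measurable borel" using assms by simp
 show "(%x. F (fst x)) : borel_measurable phase_space" by measurable
 show "integrable lborel (%z. \<integral>th. norm (F (fst (z, th))) \<partial>circle_measure)"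
  using assms by (simp add: integral_circle_const)
 show "AE z in lborel. integrable circle_measure (%th. F (fst (z, th)))" by simp
qed

section \<open>Test functions that are only differentiable along lines\<close>

context convex_domain begin

text \<open>The weak equation extends to test functions with a bounded derivative along the
  direction. The difference quotient of \<open>ps\<close> is moved onto \<open>u\<close> by a shift,
  \<open>shift_identity\<close> expresses it through \<open>H\<close>, and the step tends to 0;
  dominated convergence on the side of \<open>u\<close> and Lipschitz continuity on the side of
  \<open>H\<close> give the two limits.\<close>

lemma weak_C1_test:
 fixes u H ps dps :: "plane \<times> plane => real"
 assumes u: "integrable phase_space u" and H: "integrable phase_space H"
  and weak: "!!ph. phase_test_function Om ph ==>
    (\<integral>x. u x * transport_deriv ph x \<partial>phase_space) = - (\<integral>x. H x * ph x \<partial>phase_space)"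
  and K: "compact K" "K \<subseteq> Om" "!!x. fst x \<notin> K ==> ps x = 0"
  and mps[measurable]: "ps : borel_measurable phase_space" and md[measurable]: "dps : borel_measurable phase_space"
  and bps: "!!x. norm (snd x) = 1 ==> \<bar>ps x\<bar> <= C"
  and bd: "!!x. norm (snd x) = 1 ==> \<bar>dps x\<bar> <= C"
  and der: "!!x. norm (snd x) = 1 ==> ((%r. ps (shift r x)) has_real_derivative dps x) (at 0)"
 shows "(\<integral>x. u x * dps x \<partial>phase_space) = - (\<integral>x. H x * ps x \<partial>phase_space)"
proof -
 have [measurable]: "u : borel_measurable phase_space" "H : borel_measurable phase_space"
  using u H by auto
 have C0: "C >= 0"
 proof -
  obtain th :: plane where "norm th = 1" using vector_choose_size[of 1] by auto
  then show ?thesis using bps[of "(0, th)"] by auto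
 qed
 have der': "((%r. ps (shift (- r) x)) has_real_derivative - dps (shift (- r) x)) (at r)" if "norm (snd x) = 1" for x r
 proof -
  have "((%q. ps (shift q (shift (- r) x))) has_real_derivative dps (shift (- r) x)) (at (r - r))"
   using der[of "shift (- r) x"] that by simp
  moreover have "((%q. r - q) has_real_derivative - 1) (at r)"
   by (auto intro!: derivative_eq_intros)
  ultimately have "((%q. ps (shift (r - q) (shift (- r) x))) has_real_derivative dps (shift (- r) x) * (- 1)) (at r)"
   by (rule DERIV_chain2)
  then show ?thesis by (simp add: shift_shift)
 qed
 have lip: "\<bar>ps (shift (- r) x) - ps x\<bar> <= C * r" if n: "norm (snd x) = 1" and r: "r >= 0" for x r
 proof (cases "r = 0")
  case False
  then have "r > 0" using r by simp
  then obtain q where "ps (shift (- r) x) - ps (shift (- 0) x) = (r - 0) * (- dps (shift (- q) x))"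
   using MVT2[of 0 r "%r. ps (shift (- r) x)" "%q. - dps (shift (- q) x)"] der'[OF n] by blast
  then have "\<bar>ps (shift (- r) x) - ps x\<bar> = r * \<bar>dps (shift (- q) x)\<bar>"
   using r by (simp add: abs_mult)
  also have "\<dots> <= r * C" using bd[of "shift (- q) x"] n r by (intro mult_left_mono) auto
  finally show ?thesis by (simp add: mult.commute)
 qed simp
 \<comment> \<open>Shifts of \<open>K\<close> by less than \<open>dl\<close> stay inside the domain,
   where \<open>shift_identity\<close> applies.\<close>
 obtain dl where dl: "dl > 0" "!!z y. z : K ==> norm y < dl ==> z + y : Om"
 proof -
  obtain e where e: "e > 0" "(\<Union>x\<in>K. ball x e) \<subseteq> Om"
   using compact_subset_open_imp_ball_epsilon_subset[OF K(1) op K(2)] by blast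
  show ?thesis
  proof (rule that[OF e(1)])
   fix z y :: plane assume "z : K" "norm y < e"
   then have "z + y : ball z e" by (simp add: dist_norm)
   then show "z + y : Om" using e(2) \<open>z : K\<close> by blast
  qed
 qed
 have iu: "integrable phase_space (%x. f x * ps (shift r x))" if "integrable phase_space f" for f r
  by (rule integrable_mult_bounded[OF that, where C=C]) (use bps[of "shift r _"] in \<open>auto simp: space_phase\<close>)
 define B where "B r = (\<integral>x. H x * ps (shift (- r) x) \<partial>phase_space)" for r
 define N where "N = (\<integral>x. \<bar>H x\<bar> \<partial>phase_space)"
 have Bl: "\<bar>B r - B 0\<bar> <= C * r * N" if "r >= 0" for r
 proof -
  have "B r - B 0 = (\<integral>x. H x * (ps (shift (- r) x) - ps x) \<partial>phase_space)"
   using iu[OF H, of "- r"] iu[OF H, of 0] by (simp add: B_def right_diff_distrib)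
  also have "norm \<dots> <= (\<integral>x. \<bar>H x\<bar> * (C * r) \<partial>phase_space)"
  proof (rule order_trans[OF integral_norm_bound integral_mono'])
   show "integrable phase_space (%x. \<bar>H x\<bar> * (C * r))" using H by simp
   show "norm (H x * (ps (shift (- r) x) - ps x)) <= \<bar>H x\<bar> * (C * r)" if "x : space phase_space" for x
    unfolding real_norm_def abs_mult
    using lip[of x r] that \<open>r >= 0\<close> by (intro mult_left_mono) (auto simp: space_phase)
   show "0 <= \<bar>H x\<bar> * (C * r)" for x using C0 that by simp
  qed
  finally show ?thesis by (simp add: N_def mult.commute)
 qed
 have mB[measurable]: "B : borel_measurable borel"
 proof -
  have "continuous_on UNIV (%r. B r)"
  proof -
   have "dist (B r) (B s) <= (C * N) * dist r s" for r s
   proof -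
    have "B r - B s = (\<integral>x. H x * (ps (shift (- r) x) - ps (shift (- s) x)) \<partial>phase_space)"
     using iu[OF H, of "- r"] iu[OF H, of "- s"] by (simp add: B_def right_diff_distrib)
    also have "norm \<dots> <= (\<integral>x. \<bar>H x\<bar> * (C * \<bar>r - s\<bar>) \<partial>phase_space)"
    proof (rule order_trans[OF integral_norm_bound integral_mono'])
     show "integrable phase_space (%x. \<bar>H x\<bar> * (C * \<bar>r - s\<bar>))" using H by simp
     show "norm (H x * (ps (shift (- r) x) - ps (shift (- s) x))) <= \<bar>H x\<bar> * (C * \<bar>r - s\<bar>)" if "x : space phase_space" for x
     proof -
      have n: "norm (snd x) = 1" using that by (auto simp: space_phase)
      have "\<bar>ps (shift (- r) x) - ps (shift (- s) x)\<bar> <= C * \<bar>r - s\<bar>"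
      proof (cases "r >= s")
       case True
       then show ?thesis using lip[of "shift (- s) x" "r - s"] n by (simp add: shift_shift)
      next
       case False
       then show ?thesis using lip[of "shift (- r) x" "s - r"] n by (simp add: shift_shift abs_minus_commute)
      qed
      then show ?thesis unfolding real_norm_def abs_mult by (intro mult_left_mono) auto
     qed
     show "0 <= \<bar>H x\<bar> * (C * \<bar>r - s\<bar>)" for x using C0 by simp
    qed
    finally show ?thesis by (simp add: N_def dist_real_def mult_ac)
   qed
   then show ?thesis
    by (intro lipschitz_on_continuous_on[of "C * N"] lipschitz_onI) (use C0 in \<open>auto simp: N_def\<close>)
  qed
  then show ?thesis by (rule borel_measurable_continuous_onI)
 qed
 \<comment> \<open>The test integral with the difference quotient in place of the derivative. Its
   limit is computed twice: as \<open>B 0\<close> through \<open>shift_identity\<close>, and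
   directly.\<close>
 define A where "A h = (\<integral>x. u x * ((ps (shift (- h) x) - ps x) / h) \<partial>phase_space)" for h
 have AB: "A h = (\<integral>r. indicator {0..h} r * B r \<partial>lborel) / h" if h: "0 < h" "h < dl" for h
 proof -
  have "A h = (\<integral>x. u x * ps (shift (- h) x) - u x * ps x \<partial>phase_space) / h"
   by (simp add: A_def right_diff_distrib)
  also have "(\<integral>x. u x * ps (shift (- h) x) - u x * ps x \<partial>phase_space)
    = (\<integral>x. u (shift h x) * ps x \<partial>phase_space) - (\<integral>x. u x * ps x \<partial>phase_space)"
   using integral_shift[of "%x. u x * ps (shift (- h) x)" h] iu[OF u, of "- h"] iu[OF u, of 0]
   by (simp add: shift_shift)
  also have "\<dots> = (\<integral>x. (u (shift h x) - u x) * ps x \<partial>phase_space)"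
   using iu[OF integrable_shift[OF u], of h 0] iu[OF u, of 0] by (simp add: left_diff_distrib)
  also have "\<dots> = (\<integral>x. (\<integral>r. indicator {0..h} r * H (shift r x) * ps x \<partial>lborel) \<partial>phase_space)"
  proof (rule integral_cong_AE)
   have w: "integrable (lborel \<Otimes>\<^sub>M phase_space) (%p. H (shift (1 * fst p) (snd p)) * (indicator {0..h} (fst p) * ps (snd p)))"
    by (rule integrable_shift_pair[OF H, where C=C and a=0 and b=h])
      (use bps in \<open>auto simp: indicator_def abs_mult\<close>)
   show "(%x. \<integral>r. indicator {0..h} r * H (shift r x) * ps x \<partial>lborel) : borel_measurable phase_space"
    using borel_measurable_integrable[OF ll.integrable_snd[of "%r x. H (shift (1 * r) x) * (indicator {0..h} r * ps x)"]] w
    by (simp add: case_prod_beta' mult_ac)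
   show "AE x in phase_space. (u (shift h x) - u x) * ps x = (\<integral>r. indicator {0..h} r * H (shift r x) * ps x \<partial>lborel)"
   proof -
    have "AE x in phase_space. fst x : Om & fst (shift h x) : Om -->
      u (shift h x) = u x + (\<integral>r. indicator {0..h} r * H (shift r x) \<partial>lborel)"
     by (intro shift_identity op cv u H weak less_imp_le[OF h(1)])
    moreover have "AE x in phase_space. norm (snd x) = 1" by (intro AE_I2) (auto simp: space_phase)
    ultimately show ?thesis
    proof eventually_elim
     fix x :: "plane \<times> plane"
     assume 1: "fst x : Om & fst (shift h x) : Om -->
       u (shift h x) = u x + (\<integral>r. indicator {0..h} r * H (shift r x) \<partial>lborel)" and n: "norm (snd x) = 1"
     show "(u (shift h x) - u x) * ps x = (\<integral>r. indicator {0..h} r * H (shift r x) * ps x \<partial>lborel)"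
     proof (cases "fst x : K")
      case True
      then have "fst x : Om" "fst (shift h x) : Om" using dl(2)[OF True, of "h *\<^sub>R snd x"] n h K(2) by auto
      then show ?thesis using 1 by simp
     qed (simp add: K(3))
    qed
   qed
  qed measurable
  also have "\<dots> = (\<integral>r. (\<integral>x. indicator {0..h} r * H (shift r x) * ps x \<partial>phase_space) \<partial>lborel)"
   using ll.Fubini_integral[of "%r x. indicator {0..h} r * H (shift r x) * ps x"]
    integrable_shift_pair[OF H, where C=C and a=0 and b=h and c=1 and w="%p. indicator {0..h} (fst p) * ps (snd p)"] bps
   by (simp add: case_prod_beta' mult_ac indicator_def abs_mult)
  also have "\<dots> = (\<integral>r. indicator {0..h} r * B r \<partial>lborel)"
   unfolding B_def
   using integral_shift[of "%x. H x * ps (shift (- _) x)"]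
   by (intro Bochner_Integration.integral_cong refl)
     (use integral_shift[of "%x. H x * ps (shift (- r) x)" r for r] in \<open>simp add: shift_shift mult.assoc\<close>)
  finally show ?thesis .
 qed
 have AB': "\<bar>A h - B 0\<bar> <= C * h * N" if h: "0 < h" "h < dl" for h
 proof -
  have iB: "integrable lborel (%r. indicator {0..h} r * (B r - B 0))"
  proof (rule Bochner_Integration.integrable_bound)
   show "integrable lborel (%r. indicator {0..h} r * (C * h * N))"
    using integrable_indicator_Icc[of 0 h] by simp
   have "C * r * N <= C * h * N" if "r <= h" for r
    using that C0 by (intro mult_right_mono mult_left_mono) (auto simp: N_def)
   then show "AE r in lborel. norm (indicator {0..h} r * (B r - B 0)) <= norm (indicator {0..h} r * (C * h * N))"
    using Bl by (intro AE_I2) (force simp: indicator_def intro: order_trans[OF _ order_trans[OF _ abs_ge_self]])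
  qed measurable
  have i0: "integrable lborel (%r. indicator {0..h} r * B 0)" using integrable_indicator_Icc[of 0 h] by simp
  have "(\<integral>r. indicator {0..h} r * B r \<partial>lborel) = (\<integral>r. indicator {0..h} r * (B r - B 0) + indicator {0..h} r * B 0 \<partial>lborel)"
   by (simp add: right_diff_distrib)
  also have "\<dots> = (\<integral>r. indicator {0..h} r * (B r - B 0) \<partial>lborel) + h * B 0"
   using iB i0 h by simp
  finally have "A h - B 0 = (\<integral>r. indicator {0..h} r * (B r - B 0) \<partial>lborel) / h"
   using AB[OF h] h by (simp add: field_simps)
  also have "\<bar>\<dots>\<bar> <= C * h * N"
  proof -
   have "norm (\<integral>r. indicator {0..h} r * (B r - B 0) \<partial>lborel) <= (\<integral>r. indicator {0..h} r * (C * h * N) \<partial>lborel)"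
   proof (rule order_trans[OF integral_norm_bound integral_mono'])
    show "integrable lborel (%r. indicator {0..h} r * (C * h * N))"
     using integrable_indicator_Icc[of 0 h] by simp
    show "norm (indicator {0..h} r * (B r - B 0)) <= indicator {0..h} r * (C * h * N)" for r
    proof (cases "r : {0..h}")
     case True
     then have "C * r * N <= C * h * N" using C0 by (intro mult_right_mono mult_left_mono) (auto simp: N_def)
     then show ?thesis using Bl[of r] True by simp
    qed simp
    show "0 <= indicator {0..h} r * (C * h * N)" for r using C0 h by (simp add: N_def)
   qed
   also have "\<dots> = h * (C * h * N)" using h by simp
   finally show ?thesis using h by (simp add: field_simps)
  qed
  finally show ?thesis .
 qed
 \<comment> \<open>The summand 2 keeps every step strictly below \<open>dl\<close>, the one with
   index 0 included.\<close>
 define hs where "hs n = dl / real (n + 2)" for n :: nat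
 have hs: "0 < hs n" "hs n < dl" for n
  using dl(1) divide_strict_left_mono[of 1 "real (n + 2)" dl] by (auto simp: hs_def)
 have hs0: "hs \<longlonglongrightarrow> 0"
  unfolding hs_def using LIMSEQ_ignore_initial_segment[OF lim_const_over_n[of dl], of 2] by simp
 have "(%n. A (hs n) - B 0) \<longlonglongrightarrow> 0"
 proof (rule Lim_null_comparison)
  show "\<forall>\<^sub>F n in sequentially. norm (A (hs n) - B 0) <= C * hs n * N" using AB'[OF hs] by simp
  show "(%n. C * hs n * N) \<longlonglongrightarrow> 0"
   using tendsto_mult[OF tendsto_mult[OF tendsto_const[of C] hs0] tendsto_const[of N]] by simp
 qed
 then have L1: "(%n. A (hs n)) \<longlonglongrightarrow> B 0" by (simp add: LIM_zero_iff)
 have L2: "(%n. A (hs n)) \<longlonglongrightarrow> (\<integral>x. u x * (- dps x) \<partial>phase_space)"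
  unfolding A_def
 proof (rule integral_dominated_convergence[where w="%x. C * \<bar>u x\<bar>"])
  show "integrable phase_space (%x. C * \<bar>u x\<bar>)" using u by simp
  show "AE x in phase_space. norm (u x * ((ps (shift (- hs n) x) - ps x) / hs n)) <= C * \<bar>u x\<bar>" for n
  proof (rule AE_I2)
   fix x assume "x : space phase_space"
   then have "\<bar>ps (shift (- hs n) x) - ps x\<bar> <= C * hs n" using lip[of x "hs n"] hs[of n] by (auto simp: space_phase)
   then have "\<bar>(ps (shift (- hs n) x) - ps x) / hs n\<bar> <= C" using hs[of n] by (simp add: field_simps)
   then have "\<bar>u x\<bar> * \<bar>(ps (shift (- hs n) x) - ps x) / hs n\<bar> <= \<bar>u x\<bar> * C" by (intro mult_left_mono) auto
   then show "norm (u x * ((ps (shift (- hs n) x) - ps x) / hs n)) <= C * \<bar>u x\<bar>"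
    by (simp only: real_norm_def abs_mult mult.commute)
  qed
  show "AE x in phase_space. (%n. u x * ((ps (shift (- hs n) x) - ps x) / hs n)) \<longlonglongrightarrow> u x * (- dps x)"
  proof (rule AE_I2)
   fix x assume "x : space phase_space"
   then have n: "norm (snd x) = 1" by (auto simp: space_phase)
   have "((%h. (ps (shift (- h) x) - ps x) / h) \<longlongrightarrow> - dps x) (at 0)"
    using der'[OF n, of 0] by (simp add: DERIV_def)
   moreover have "filterlim hs (at 0) sequentially"
    using hs0 hs(1) by (auto simp: filterlim_at less_imp_neq[symmetric] intro!: always_eventually)
   ultimately show "(%n. u x * ((ps (shift (- hs n) x) - ps x) / hs n)) \<longlonglongrightarrow> u x * (- dps x)"
    by (intro tendsto_mult tendsto_const) (rule filterlim_compose)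
  qed
 qed measurable
 from LIMSEQ_unique[OF L1 L2] show ?thesis by (simp add: B_def)
qed

end

section \<open>Weak gradients and the product rule\<close>

lemma Ck_UNIV_translate:
 fixes f :: "'a::euclidean_space => real"
 shows "Ck_closure n UNIV f ==> Ck_closure n UNIV (%x. f (x + c))"
proof (induction n arbitrary: f)
 case 0
 then show ?case
  using continuous_on_compose2[of UNIV f UNIV "%x. x + c", OF _ continuous_on_add[OF continuous_on_id continuous_on_const]]
  by simp
next
 case (Suc n)
 have d: "((%x. x + c) has_derivative (%h. h)) (at x)" for x by (auto intro!: derivative_eq_intros)
 have "((%x. f (x + c)) has_derivative (%h. frechet_derivative f (at (x + c)) h)) (at x)" for x
  using has_derivative_compose[OF d Ck_UNIV_E(1)[OF Suc.prems]] .
 then show ?case by (rule Ck_UNIV_I) (rule Suc.IH[OF Ck_UNIV_E(2)[OF Suc.prems]])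
qed

lemma smooth_slice:
 fixes ph :: "plane \<times> plane => real"
 assumes "smooth ph"
 shows "smooth (%z. ph (z, th))"
proof -
 have "smooth (%x. ph (x + (0, th)))" using assms by (simp add: smooth_def Ck_UNIV_translate)
 moreover have "bounded_linear (%z::plane. (z, 0::plane))"
  by (intro bounded_linear_Pair bounded_linear_ident bounded_linear_zero)
 ultimately have "smooth (%z. ph ((z, 0) + (0, th)))" using smooth_linear by blast
 then show ?thesis by simp
qed

lemma continuous_frechet_direction:
 assumes "smooth f"
 shows "continuous_on UNIV (%z. frechet_derivative f (at z) h)"
proof -
 have c: "continuous_on UNIV (%z. (z, h))" by (intro continuous_intros)
 from continuous_on_compose2[OF smooth_continuous_derivative[OF assms] c] show ?thesis by simp
qed

lemma component_le_1: "norm (th :: plane) = 1 ==> \<bar>th $ i\<bar> <= 1"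
 using component_le_norm_cart[of th i] by simp

lemma Basis_plane: "(Basis :: plane set) = {axis 1 1, axis 2 1}"
 by (auto simp: Basis_vec_def UNIV_2)

lemma inner_axis_plane: "(x :: plane) \<bullet> axis i 1 = x $ i"
 by (simp add: inner_axis)

lemma plane_expand: "(h :: plane) = h $ 1 *\<^sub>R axis 1 1 + h $ 2 *\<^sub>R axis 2 1"
 by (simp add: vec_eq_iff forall_2 axis_def)

lemma linear_plane:
 fixes D :: "plane => real"
 assumes "linear D" shows "D h = h $ 1 * D (axis 1 1) + h $ 2 * D (axis 2 1)"
 by (subst plane_expand[of h]) (simp add: linear_add[OF assms] linear_scale[OF assms])

lemma has_weak_gradient_iff:
 "has_weak_gradient Om q G \<longleftrightarrow> (\<forall>i. has_weak_partial Om (axis i 1) q (%z. G z $ i))"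
 by (simp add: has_weak_gradient_def Basis_plane inner_axis_plane forall_2)

lemma phase_test_fst:
 assumes "test_function Om ph"
 shows "phase_test_function Om (%x. ph (fst x))"
 using assms smooth_linear[OF bounded_linear_fst] by (auto simp: test_function_def phase_test_function_def)

lemma test_slice:
 assumes "phase_test_function Om ph"
 shows "test_function Om (%z. ph (z, th))"
 using assms smooth_slice by (auto simp: test_function_def phase_test_function_def)

lemma transport_deriv_fst:
 assumes "smooth ph"
 shows "transport_deriv (%x. ph (fst x)) x = frechet_derivative ph (at (fst x)) (snd x)"
proof -
 have "smooth (%x. ph (fst x))" using smooth_linear[OF bounded_linear_fst assms] .
 from frechet_slice[OF this, of "snd x" "fst x" "snd x"]
 show ?thesis by (simp add: transport_deriv_def)
qed

text \<open>Weighting with two components of the direction and averaging isolates one component,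
  with the factor 1/2; this is how a planar identity is read off from one on the phase
  space.\<close>

lemma integral_phase_moment:
 fixes F :: "plane => real"
 assumes F: "integrable lborel F"
 shows "(\<integral>x. F (fst x) * (snd x $ j * snd x $ i) \<partial>phase_space) = (if j = i then (\<integral>z. F z \<partial>lborel) / 2 else 0)"
  and "integrable phase_space (%x. F (fst x) * (snd x $ j * snd x $ i))"
proof -
 have bd: "\<bar>th $ i * th $ j\<bar> <= 1" if "norm th = 1" for th :: plane and i j
  using mult_mono[OF component_le_norm_cart[of th i] component_le_norm_cart[of th j]] that by (simp add: abs_mult)
 show int: "integrable phase_space (%x. F (fst x) * (snd x $ j * snd x $ i))"
  by (rule integrable_mult_bounded[OF integrable_phase_fst[OF F], where C=1]) (use bd in \<open>auto simp: space_phase\<close>)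
 have "(\<integral>x. F (fst x) * (snd x $ j * snd x $ i) \<partial>phase_space) = (\<integral>z. (\<integral>th. F z * (th $ j * th $ i) \<partial>circle_measure) \<partial>lborel)"
  using lc.integral_fst'[OF int] by simp
 also have "\<dots> = (\<integral>z. F z * (if j = i then 1 / 2 else 0) \<partial>lborel)"
  by (simp only: Bochner_Integration.integral_mult_right_zero circle_moments)
 also have "\<dots> = (if j = i then (\<integral>z. F z \<partial>lborel) / 2 else 0)" by simp
 finally show "(\<integral>x. F (fst x) * (snd x $ j * snd x $ i) \<partial>phase_space) = (if j = i then (\<integral>z. F z \<partial>lborel) / 2 else 0)" .
qed

context convex_domain begin

lemma weak_partial_unique:
 assumes "has_weak_partial Om i f g" "has_weak_partial Om i f g'"
 shows "AE z in lborel. z : Om --> g z = g' z"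
proof -
 have "AE z in lborel. z : Om --> g z - g' z = 0"
 proof (rule fundamental_lemma[where S=UNIV])
  have i: "integrable lborel (%z. indicator (cbox a b) z * g z)" "integrable lborel (%z. indicator (cbox a b) z * g' z)"
   if "cbox a b \<subseteq> Om" for a b
   using assms that by (auto simp: has_weak_partial_def locally_integrable_on_def set_integrable_def)
  fix a b :: plane assume ab: "cbox a b \<subseteq> Om"
  show "integrable lborel (%z. indicator (cbox a b) z * (g z - g' z))"
   using i[OF ab] by (simp add: right_diff_distrib)
  fix n
  have t: "test_function Om (box_bump n a b)"
   unfolding test_function_def
  proof (intro conjI exI[of _ "cbox a b"] allI impI smooth_box_bump compact_cbox ab)
   fix z assume "z \<notin> cbox a b"
   then show "box_bump n a b z = 0" using box_subset_cbox[of a b] by (intro box_bump_eq_0) blast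
  qed
  have b: "integrable lborel (%z. h z * box_bump n a b z)" and e: "(LINT z:Om|lborel. h z * box_bump n a b z) = (\<integral>z. h z * box_bump n a b z \<partial>lborel)"
   if "integrable lborel (%z. indicator (cbox a b) z * h z)" for h
  proof -
   have z: "box_bump n a b z = 0" if "z \<notin> cbox a b" for z
    using that box_subset_cbox[of a b] by (intro box_bump_eq_0) auto
   have "integrable lborel (%z. (indicator (cbox a b) z * h z) * box_bump n a b z)"
    by (rule integrable_mult_bounded[OF that, where C=1]) (use box_bump_bounds[of n a b] in auto)
   moreover have "(indicator (cbox a b) z * h z) * box_bump n a b z = h z * box_bump n a b z" for z
    using z[of z] by (cases "z : cbox a b") auto
   ultimately show "integrable lborel (%z. h z * box_bump n a b z)" by simp
   show "(LINT z:Om|lborel. h z * box_bump n a b z) = (\<integral>z. h z * box_bump n a b z \<partial>lborel)"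
    unfolding set_lebesgue_integral_def
    using z ab by (intro Bochner_Integration.integral_cong refl) (auto simp: indicator_def)
  qed
  from assms t have "(LINT z:Om|lborel. g z * box_bump n a b z) = (LINT z:Om|lborel. g' z * box_bump n a b z)"
   by (simp add: has_weak_partial_def)
  then show "(\<integral>z. (g z - g' z) * box_bump n a b z \<partial>lborel) = 0"
   using b[OF i(1)[OF ab]] b[OF i(2)[OF ab]] e[OF i(1)[OF ab]] e[OF i(2)[OF ab]] by (simp add: left_diff_distrib)
 qed (use op in auto)
 then show ?thesis by eventually_elim auto
qed

text \<open>Only derivatives along lines inside the domain are asked for, with a gradient continuous
  up to the boundary: what \<open>weak_C1_test\<close> consumes, and bounded because the closure is
  compact.\<close>

definition c1 :: "(plane => real) => (plane => plane) => bool" where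
 "c1 sg gm \<longleftrightarrow> continuous_on (closure Om) sg & continuous_on (closure Om) gm \<and>
   (\<forall>z\<in>Om. \<forall>th. ((%r. sg (z + r *\<^sub>R th)) has_real_derivative th \<bullet> gm z) (at 0))"

lemma Ck_closure_continuous: "Ck_closure n S f ==> continuous_on (closure S) f"
 by (cases n) auto

lemma continuous_vector2:
 assumes "continuous_on S f" "continuous_on S g"
 shows "continuous_on S (%x. vector [f x, g x] :: plane)"
proof -
 have eq: "(%x. vector [f x, g x] :: plane) = (%x. f x *\<^sub>R axis 1 1 + g x *\<^sub>R axis 2 1)"
  by (auto simp: vec_eq_iff forall_2 axis_def)
 show ?thesis unfolding eq by (intro continuous_intros assms)
qed

lemma c1_Ck:
 assumes "Ck_closure (Suc n) Om f"
 obtains gm where "c1 f gm"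
proof -
 from assms have c: "continuous_on (closure Om) f" and d: "!!x. x : Om ==> f differentiable (at x)"
  and g: "!!i. i : Basis ==> \<exists>g. (\<forall>x\<in>Om. g x = frechet_derivative f (at x) i) & Ck_closure n Om g"
  by auto
 have "axis 1 1 : (Basis :: plane set)" "axis 2 1 : (Basis :: plane set)" by (auto simp: Basis_plane)
 with g obtain g1 g2 where g1: "\<forall>x\<in>Om. g1 x = frechet_derivative f (at x) (axis 1 1)" "Ck_closure n Om g1"
  and g2: "\<forall>x\<in>Om. g2 x = frechet_derivative f (at x) (axis 2 1)" "Ck_closure n Om g2"
  by meson
 have "((%r. f (z + r *\<^sub>R th)) has_real_derivative th \<bullet> vector [g1 z, g2 z]) (at 0)" if z: "z : Om" for z th
 proof -
  have D: "(f has_derivative frechet_derivative f (at z)) (at (z + 0 *\<^sub>R th))"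
   using d[OF z] by (simp add: frechet_derivative_works)
  have "((%r. z + r *\<^sub>R th) has_derivative (%r. r *\<^sub>R th)) (at 0)"
   by (auto intro!: derivative_eq_intros)
  from has_derivative_compose[OF this D]
  have "((%r. f (z + r *\<^sub>R th)) has_derivative (%r. frechet_derivative f (at z) (r *\<^sub>R th))) (at 0)" .
  moreover have lin: "linear (frechet_derivative f (at z))" using D has_derivative_linear by blast
  have "frechet_derivative f (at z) (r *\<^sub>R th) = (th \<bullet> vector [g1 z, g2 z]) * r" for r
   using linear_plane[OF lin, of th] g1(1) g2(1) z by (simp add: linear_scale[OF lin] inner_plane)
  ultimately show ?thesis by (simp add: has_field_derivative_def)
 qed
 moreover have "continuous_on (closure Om) (%z. vector [g1 z, g2 z] :: plane)"
  by (intro continuous_vector2 Ck_closure_continuous[OF g1(2)] Ck_closure_continuous[OF g2(2)])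
 ultimately show ?thesis using that c unfolding c1_def by blast
qed

lemma c1_diff:
 assumes "c1 sg gm" "c1 sg' gm'" shows "c1 (%z. sg z - sg' z) (%z. gm z - gm' z)"
 using assms by (auto simp: c1_def inner_diff_right intro!: continuous_intros DERIV_diff)

lemma c1_inverse:
 assumes c: "c1 sg gm" and pos: "!!z. z : closure Om ==> sg z > 0"
 shows "c1 (%z. 1 / sg z) (%z. - (1 / (sg z)\<^sup>2) *\<^sub>R gm z)"
proof -
 have ne: "sg z ~= 0" if "z : closure Om" for z using pos[OF that] by simp
 have "((%r. 1 / sg (z + r *\<^sub>R th)) has_real_derivative th \<bullet> (- (1 / (sg z)\<^sup>2) *\<^sub>R gm z)) (at 0)" if z: "z : Om" for z th
 proof -
  have "sg (z + 0 *\<^sub>R th) ~= 0" using ne z closure_subset by auto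
  moreover have "((%r. sg (z + r *\<^sub>R th)) has_real_derivative th \<bullet> gm z) (at 0)" using c z by (auto simp: c1_def)
  ultimately show ?thesis
   by (auto intro!: derivative_eq_intros simp: power2_eq_square divide_simps)
 qed
 then show ?thesis using c ne by (auto simp: c1_def intro!: continuous_intros)
qed

lemma zeroth_coeff_integral:
 assumes "continuous_on {-pi..pi} (%t. k z (cos t))"
 shows "zeroth_coeff k z = integral {-pi..pi} (%t. k z (cos t)) / (2 * pi)"
 using set_borel_integral_eq_integral(2)[OF borel_integrable_atLeastAtMost'[OF assms]]
 by (simp add: zeroth_coeff_def)

text \<open>Differentiation under the integral over the angle. The kernel is used as a function of
  position and angle, the form in which its regularity is given.\<close>

lemma c1_zeroth_coeff:
 assumes "C3_kernel Om k"
 obtains gm where "c1 (zeroth_coeff k) gm"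
proof -
 define kp where "kp = (%(z, t). k z (cos t))"
 have C: "Ck_closure (Suc 2) (Om \<times> (UNIV :: real set)) kp"
  using assms by (simp add: C3_kernel_def kp_def eval_nat_numeral)
 have cl: "closure (Om \<times> (UNIV :: real set)) = closure Om \<times> UNIV" by (simp add: closure_Times)
 from C have c: "continuous_on (closure Om \<times> UNIV) kp" and d: "!!x. x : Om \<times> UNIV ==> kp differentiable (at x)"
  and g: "!!i. i : Basis ==> \<exists>g. (\<forall>x\<in>Om \<times> UNIV. g x = frechet_derivative kp (at x) i) & Ck_closure 2 (Om \<times> UNIV) g"
  unfolding Ck_closure.simps(2) cl by blast+
 have "(axis 1 1, 0) : (Basis :: (plane \<times> real) set)" "(axis 2 1, 0) : (Basis :: (plane \<times> real) set)"
  by (auto simp: Basis_prod_def Basis_plane)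
 with g obtain g1 g2 where g1: "\<forall>x\<in>Om \<times> UNIV. g1 x = frechet_derivative kp (at x) (axis 1 1, 0)" "Ck_closure 2 (Om \<times> UNIV) g1"
  and g2: "\<forall>x\<in>Om \<times> UNIV. g2 x = frechet_derivative kp (at x) (axis 2 1, 0)" "Ck_closure 2 (Om \<times> UNIV) g2"
  by meson
 have cg: "continuous_on (closure Om \<times> UNIV) g1" "continuous_on (closure Om \<times> UNIV) g2"
  using Ck_closure_continuous[OF g1(2)] Ck_closure_continuous[OF g2(2)] by (simp_all add: cl)
 have ci: "continuous_on (closure Om) (%z. integral {-pi..pi} (%t. f (z, t)))" if "continuous_on (closure Om \<times> UNIV) f" for f :: "plane \<times> real => real"
  using integral_continuous_on_param[of "closure Om" "-pi" pi "%z t. f (z, t)"] continuous_on_subset[OF that, of "closure Om \<times> {-pi..pi}"]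
  by (simp add: case_prod_unfold Sigma_mono)
 have z0: "zeroth_coeff k z = integral {-pi..pi} (%t. kp (z, t)) / (2 * pi)" if "z : closure Om" for z
 proof -
  have "continuous_on {-pi..pi} (%t. kp (z, t))"
   by (rule continuous_on_compose2[OF c]) (use that in \<open>auto intro!: continuous_intros\<close>)
  then show ?thesis using zeroth_coeff_integral[of k z] by (simp add: kp_def)
 qed
 define gm where "gm z = (vector [integral {-pi..pi} (%t. g1 (z, t)) / (2 * pi), integral {-pi..pi} (%t. g2 (z, t)) / (2 * pi)] :: plane)" for z
 have "c1 (zeroth_coeff k) gm"
  unfolding c1_def
 proof (intro conjI ballI allI)
  have "continuous_on (closure Om) (%z. integral {-pi..pi} (%t. kp (z, t)) / (2 * pi))"
   by (intro continuous_intros ci c) auto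
  then show "continuous_on (closure Om) (zeroth_coeff k)"
   by (rule continuous_on_eq) (simp add: z0)
  show "continuous_on (closure Om) gm"
   unfolding gm_def by (intro continuous_vector2 continuous_intros ci cg) auto
  fix z th assume z: "z : Om"
  \<comment> \<open>The Leibniz rule wants a convex parameter set, and openness turns the derivative
    within it into a derivative at 0.\<close>
  define U where "U = {r. z + r *\<^sub>R th : Om}"
  have U: "open U"
   unfolding U_def using open_vimage[OF op, of "%r. z + r *\<^sub>R th"] by (simp add: vimage_def continuous_intros)
  have U0: "0 : U" using z by (simp add: U_def)
  have Ucv: "convex U"
  proof (rule convexI)
   fix x y u v :: real assume "x : U" "y : U" and uv: "0 <= u" "0 <= v" "u + v = 1"
   then have "u *\<^sub>R (z + x *\<^sub>R th) + v *\<^sub>R (z + y *\<^sub>R th) : Om" by (intro convexD[OF cv]) (auto simp: U_def)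
   moreover have "u *\<^sub>R (z + x *\<^sub>R th) + v *\<^sub>R (z + y *\<^sub>R th) = (u + v) *\<^sub>R z + (u * x + v * y) *\<^sub>R th"
    by (simp add: algebra_simps)
   ultimately show "u *\<^sub>R x + v *\<^sub>R y : U" using uv by (simp add: U_def)
  qed
  have "((%r. integral (cbox (-pi) pi) (%t. kp (z + r *\<^sub>R th, t))) has_vector_derivative
    integral (cbox (-pi) pi) (%t. th $ 1 * g1 (z + 0 *\<^sub>R th, t) + th $ 2 * g2 (z + 0 *\<^sub>R th, t))) (at 0 within U)"
  proof (rule leibniz_rule_vector_derivative[OF _ _ _ U0 Ucv])
   fix r t assume r: "r : U"
   have D: "(kp has_derivative frechet_derivative kp (at (z + r *\<^sub>R th, t))) (at (z + r *\<^sub>R th, t))"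
    using d[of "(z + r *\<^sub>R th, t)"] r by (simp add: frechet_derivative_works U_def)
   have e: "((%r. (z + r *\<^sub>R th, t)) has_derivative (%h. (h *\<^sub>R th, 0))) (at r within U)"
    by (auto intro!: derivative_eq_intros)
   have lin: "linear (frechet_derivative kp (at (z + r *\<^sub>R th, t)))" using D has_derivative_linear by blast
   have "(h *\<^sub>R th, 0::real) = (h * th $ 1) *\<^sub>R (axis 1 1, 0) + (h * th $ 2) *\<^sub>R (axis 2 1, 0)" for h
    by (simp add: vec_eq_iff forall_2 axis_def)
   then have "frechet_derivative kp (at (z + r *\<^sub>R th, t)) (h *\<^sub>R th, 0) =
     h * (th $ 1 * g1 (z + r *\<^sub>R th, t) + th $ 2 * g2 (z + r *\<^sub>R th, t))" for h
    using g1(1) g2(1) r by (simp only: linear_add[OF lin] linear_scale[OF lin]) (simp add: U_def algebra_simps)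
   with has_derivative_in_compose[OF e has_derivative_at_withinI[OF D]]
   show "((%r. kp (z + r *\<^sub>R th, t)) has_vector_derivative th $ 1 * g1 (z + r *\<^sub>R th, t) + th $ 2 * g2 (z + r *\<^sub>R th, t)) (at r within U)"
    by (simp add: has_vector_derivative_def)
  next
   fix r assume r: "r : U"
   then have "z + r *\<^sub>R th : closure Om" using closure_subset by (auto simp: U_def)
   then show "(%t. kp (z + r *\<^sub>R th, t)) integrable_on cbox (-pi) pi"
    by (intro integrable_continuous continuous_on_compose2[OF c]) (auto intro!: continuous_intros)
  next
   show "continuous_on (U \<times> cbox (-pi) pi) (%(r, t). th $ 1 * g1 (z + r *\<^sub>R th, t) + th $ 2 * g2 (z + r *\<^sub>R th, t))"
    unfolding case_prod_unfold
    by (intro continuous_intros continuous_on_compose2[OF cg(1)] continuous_on_compose2[OF cg(2)])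
      (auto simp: U_def intro: subsetD[OF closure_subset])
  qed
  then have "((%r. integral {-pi..pi} (%t. kp (z + r *\<^sub>R th, t))) has_real_derivative
    integral {-pi..pi} (%t. th $ 1 * g1 (z, t) + th $ 2 * g2 (z, t))) (at 0)"
   using at_within_open[OF U0 U] by (simp add: has_real_derivative_iff_has_vector_derivative)
  moreover have "integral {-pi..pi} (%t. th $ 1 * g1 (z, t) + th $ 2 * g2 (z, t)) =
    th $ 1 * integral {-pi..pi} (%t. g1 (z, t)) + th $ 2 * integral {-pi..pi} (%t. g2 (z, t))"
  proof -
   have "z : closure Om" using z closure_subset by blast
   then have i: "(%t. g1 (z, t)) integrable_on {-pi..pi}" "(%t. g2 (z, t)) integrable_on {-pi..pi}"
    by (intro integrable_continuous_real continuous_on_compose2[OF cg(1)] continuous_on_compose2[OF cg(2)];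
      auto intro!: continuous_intros)+
   show ?thesis by (simp add: Henstock_Kurzweil_Integration.integral_add i integrable_on_mult_right)
  qed
  ultimately have "((%r. integral {-pi..pi} (%t. kp (z + r *\<^sub>R th, t)) / (2 * pi)) has_real_derivative th \<bullet> gm z) (at 0)"
   by (auto intro!: derivative_eq_intros simp: gm_def inner_plane add_divide_distrib)
  moreover have "\<forall>\<^sub>F r in nhds 0. zeroth_coeff k (z + r *\<^sub>R th) = integral {-pi..pi} (%t. kp (z + r *\<^sub>R th, t)) / (2 * pi)"
   using eventually_nhds_in_open[OF U U0]
   by eventually_elim (auto simp: U_def intro!: z0 intro: subsetD[OF closure_subset])
  ultimately show "((%r. zeroth_coeff k (z + r *\<^sub>R th)) has_real_derivative th \<bullet> gm z) (at 0)"
   by (subst DERIV_cong_ev[OF refl _ refl])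
 qed
 then show ?thesis using that by blast
qed

lemma bounded_closure:
 fixes f :: "plane => 'b::real_normed_vector"
 assumes "continuous_on (closure Om) f"
 obtains B where "B >= 0" "!!z. z : closure Om ==> norm (f z) <= B"
proof -
 have "compact (closure Om)" using bd by (simp add: compact_closure)
 from compact_imp_bounded[OF compact_continuous_image[OF assms this]]
 obtain B where B: "!!z. z : closure Om ==> norm (f z) <= B" by (auto simp: bounded_iff)
 show ?thesis
 proof (rule that[of "\<bar>B\<bar>"])
  show "norm (f z) <= \<bar>B\<bar>" if "z : closure Om" for z using B[OF that] by linarith
 qed simp
qed

lemma measurable_indicator_continuous:
 fixes f :: "plane => 'b::real_normed_vector"
 assumes "continuous_on (closure Om) f"
 shows "(%z. indicator Om z *\<^sub>R f z) : borel_measurable borel"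
 using borel_measurable_continuous_on_indicator[OF borel_domain continuous_on_subset[OF assms closure_subset]] .

definition int_on :: "(plane => real) => bool" where
 "int_on f \<longleftrightarrow> integrable lborel (%z. indicator Om z * f z)"

lemma int_on_locally: "int_on f ==> locally_integrable_on Om f"
 unfolding locally_integrable_on_def
proof (intro allI impI)
 fix K assume f: "int_on f" and K: "compact K & K \<subseteq> Om"
 have "integrable lborel (%z. (indicator Om z * f z) * indicator K z)"
  by (rule integrable_mult_bounded[OF f[unfolded int_on_def], where C=1]) (use K in \<open>auto simp: compact_imp_closed\<close>)
 moreover have "(indicator Om z * f z) * indicator K z = indicator K z *\<^sub>R f z" for z
  using K by (auto simp: indicator_def)
 ultimately show "set_integrable lborel K f" by (simp add: set_integrable_def)
qed

lemma int_on_add: "int_on f ==> int_on g ==> int_on (%z. f z + g z)"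
 by (simp add: int_on_def distrib_left)

lemma int_on_mult:
 assumes "int_on f" "continuous_on (closure Om) ta"
 shows "int_on (%z. f z * ta z)"
proof -
 obtain B where B: "B >= 0" "!!z. z : closure Om ==> norm (ta z) <= B" using bounded_closure[OF assms(2)] by blast
 have "integrable lborel (%z. (indicator Om z * f z) * (indicator Om z *\<^sub>R ta z))"
  by (rule integrable_mult_bounded[OF assms(1)[unfolded int_on_def], where C=B])
    (use measurable_indicator_continuous[OF assms(2)] B closure_subset in \<open>auto simp: indicator_def\<close>)
 moreover have "(%z. (indicator Om z * f z) * (indicator Om z *\<^sub>R ta z)) = (%z. indicator Om z * (f z * ta z))"
  by (auto simp: indicator_def)
 ultimately show ?thesis by (simp only: int_on_def)
qed

lemma int_on_phase:
 assumes "int_on f"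
 shows "integrable phase_space (%x. indicator Om (fst x) * f (fst x))"
 using integrable_phase_fst[OF assms[unfolded int_on_def]] .

lemma int_on_phase_inner:
 assumes "!!i. int_on (%z. g z $ i)"
 shows "integrable phase_space (%x. indicator Om (fst x) * (snd x \<bullet> g (fst x)))"
proof -
 have i: "integrable phase_space (%x. (indicator Om (fst x) * g (fst x) $ i) * snd x $ i)" for i
  by (rule integrable_mult_bounded[OF int_on_phase[OF assms[of i]], where C=1])
    (auto simp: space_phase intro: component_le_1)
 have "integrable phase_space (%x. (indicator Om (fst x) * g (fst x) $ 1) * snd x $ 1 + (indicator Om (fst x) * g (fst x) $ 2) * snd x $ 2)"
  by (intro Bochner_Integration.integrable_add i)
 then show ?thesis by (simp add: inner_plane algebra_simps)
qed

text \<open>With the direction fixed, a slice of the test function is an admissible planar one, and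
  the derivative in that direction is a combination of the two weak partial derivatives; integration
  over the direction comes last.\<close>

lemma weak_gradient_transport:
 assumes wg: "has_weak_gradient Om f g" and f: "int_on f" and g: "!!i. int_on (%z. g z $ i)"
  and ph: "phase_test_function Om ph"
 shows "(\<integral>x. indicator Om (fst x) * f (fst x) * transport_deriv ph x \<partial>phase_space) =
  - (\<integral>x. indicator Om (fst x) * (snd x \<bullet> g (fst x)) * ph x \<partial>phase_space)"
proof -
 have s: "smooth ph" using ph by (simp add: phase_test_function_def)
 obtain C where C: "C >= 0" "!!x. norm (snd x) = 1 ==> \<bar>ph x\<bar> <= C"
   "!!x. norm (snd x) = 1 ==> \<bar>transport_deriv ph x\<bar> <= C"
  using phase_test_function_bounded[OF ph] by blast
 have i1: "integrable phase_space (%x. indicator Om (fst x) * f (fst x) * transport_deriv ph x)"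
  by (rule integrable_mult_bounded[OF int_on_phase[OF f], where C=C])
    (use C measurable_phase_continuous[OF continuous_transport_deriv[OF s]] in \<open>auto simp: space_phase\<close>)
 have i2: "integrable phase_space (%x. indicator Om (fst x) * (snd x \<bullet> g (fst x)) * ph x)"
  by (rule integrable_mult_bounded[OF int_on_phase_inner[OF g], where C=C])
    (use C measurable_phase_continuous[OF smooth_continuous[OF s]] in \<open>auto simp: space_phase\<close>)
 have *: "(\<integral>z. indicator Om z * f z * transport_deriv ph (z, th) \<partial>lborel) =
   - (\<integral>z. indicator Om z * (th \<bullet> g z) * ph (z, th) \<partial>lborel)" for th
 proof -
  let ?ph = "%z. ph (z, th)"
  have t: "test_function Om ?ph" by (rule test_slice[OF ph])
  then have st: "smooth ?ph" by (simp add: test_function_def)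
  define \<eta> where "\<eta> = (%x :: plane \<times> plane. ?ph (fst x))"
  have "phase_test_function Om \<eta>" unfolding \<eta>_def by (rule phase_test_fst[OF t])
  then obtain D where D': "D >= 0" "!!x. norm (snd x) = 1 ==> \<bar>\<eta> x\<bar> <= D"
   "!!x. norm (snd x) = 1 ==> \<bar>transport_deriv \<eta> x\<bar> <= D"
   using phase_test_function_bounded by blast
  note D = D'(2,3)[unfolded \<eta>_def]
  \<comment> \<open>For \<open>th\<close> a coordinate direction the transport derivative of a
    function of position is its partial derivative, so one bound serves for both.\<close>
  have D1: "\<bar>frechet_derivative ?ph (at z) (axis i 1)\<bar> <= D" for z i
   using D(2)[of "(z, axis i 1)"] by (simp add: transport_deriv_fst[OF st] norm_axis_1)
  have D0: "\<bar>?ph z\<bar> <= D" for z using D(1)[of "(z, axis 1 1)"] by (simp add: norm_axis_1)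
  have cd: "continuous_on UNIV (%z. frechet_derivative ?ph (at z) (axis i 1))" for i
   by (rule continuous_frechet_direction[OF st])
  have j1: "integrable lborel (%z. indicator Om z * f z * frechet_derivative ?ph (at z) (axis i 1))" for i
   by (rule integrable_mult_bounded[OF f[unfolded int_on_def], where C=D])
     (use D1 borel_measurable_continuous_onI[OF cd] in auto)
  have j2: "integrable lborel (%z. indicator Om z * g z $ i * ?ph z)" for i
   by (rule integrable_mult_bounded[OF g[unfolded int_on_def], where C=D])
     (use D0 borel_measurable_continuous_onI[OF smooth_continuous[OF st]] in auto)
  have w: "(\<integral>z. indicator Om z * f z * frechet_derivative ?ph (at z) (axis i 1) \<partial>lborel) =
    - (\<integral>z. indicator Om z * g z $ i * ?ph z \<partial>lborel)" for i
   using wg t by (simp add: has_weak_gradient_iff has_weak_partial_def set_lebesgue_integral_def mult.assoc)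
  have lin: "linear (frechet_derivative ?ph (at z))" for z
   using has_derivative_linear[OF smooth_has_derivative[OF st]] .
  have e1: "indicator Om z * f z * transport_deriv ph (z, th) =
    th $ 1 * (indicator Om z * f z * frechet_derivative ?ph (at z) (axis 1 1)) + th $ 2 * (indicator Om z * f z * frechet_derivative ?ph (at z) (axis 2 1))" for z
   using linear_plane[OF lin, of z th] frechet_slice[OF s, of th z th]
   by (simp add: transport_deriv_def algebra_simps)
  have e2: "indicator Om z * (th \<bullet> g z) * ph (z, th) =
    th $ 1 * (indicator Om z * g z $ 1 * ?ph z) + th $ 2 * (indicator Om z * g z $ 2 * ?ph z)" for z
   by (simp add: inner_plane algebra_simps)
  show ?thesis unfolding e1 e2 using j1 j2 w by simp
 qed
 have "(\<integral>x. indicator Om (fst x) * f (fst x) * transport_deriv ph x \<partial>phase_space) =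
   (\<integral>th. (\<integral>z. indicator Om z * f z * transport_deriv ph (z, th) \<partial>lborel) \<partial>circle_measure)"
  using lc.integral_snd[of "%z th. indicator Om z * f z * transport_deriv ph (z, th)"] i1
  by (simp add: case_prod_beta')
 also have "\<dots> = - (\<integral>th. (\<integral>z. indicator Om z * (th \<bullet> g z) * ph (z, th) \<partial>lborel) \<partial>circle_measure)"
  unfolding * by simp
 also have "\<dots> = - (\<integral>x. indicator Om (fst x) * (snd x \<bullet> g (fst x)) * ph x \<partial>phase_space)"
  using lc.integral_snd[of "%z th. indicator Om z * (th \<bullet> g z) * ph (z, th)"] i2
  by (simp add: case_prod_beta')
 finally show ?thesis .
qed

text \<open>The product of the coefficient with a planar test function is only once differentiable,
  which \<open>weak_C1_test\<close> allows on the phase space. Hence the test function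
  \<open>ta z * ph z * th $ i\<close>: after averaging, the second moments of the direction leave
  exactly the i-th component of the product rule.\<close>

theorem weak_gradient_mult:
 assumes wg: "has_weak_gradient Om f g" and f: "int_on f" and g: "!!i. int_on (%z. g z $ i)"
  and c: "c1 ta gm"
 shows "has_weak_gradient Om (%z. f z * ta z) (%z. ta z *\<^sub>R g z + f z *\<^sub>R gm z)"
 unfolding has_weak_gradient_iff has_weak_partial_def
proof (intro allI conjI impI)
 fix i
 have ct: "continuous_on (closure Om) ta" and cg: "continuous_on (closure Om) gm"
  and der: "!!z th. z : Om ==> ((%r. ta (z + r *\<^sub>R th)) has_real_derivative th \<bullet> gm z) (at 0)"
  using c by (auto simp: c1_def)
 have cgi: "continuous_on (closure Om) (%z. gm z $ j)" for j by (intro continuous_intros cg)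
 show "locally_integrable_on Om (%z. f z * ta z)" by (intro int_on_locally int_on_mult f ct)
 have "int_on (%z. g z $ i * ta z + f z * gm z $ i)" by (intro int_on_add int_on_mult f g ct cgi)
 then show "locally_integrable_on Om (%z. (ta z *\<^sub>R g z + f z *\<^sub>R gm z) $ i)"
  using int_on_locally by (simp add: mult.commute)
 fix ph assume t: "test_function Om ph"
 then obtain K where s: "smooth ph" and K: "compact K" "K \<subseteq> Om" "!!z. z \<notin> K ==> ph z = 0"
  by (auto simp: test_function_def)
 define \<eta> where "\<eta> = (%x :: plane \<times> plane. ph (fst x))"
 have "phase_test_function Om \<eta>" unfolding \<eta>_def by (rule phase_test_fst[OF t])
 then obtain D where D': "D >= 0" "!!x. norm (snd x) = 1 ==> \<bar>\<eta> x\<bar> <= D"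
   "!!x. norm (snd x) = 1 ==> \<bar>transport_deriv \<eta> x\<bar> <= D"
  using phase_test_function_bounded by blast
 note D = D'(2,3)[unfolded \<eta>_def] and D0 = D'(1)
 obtain T where T: "T >= 0" "!!z. z : closure Om ==> norm (ta z) <= T" using bounded_closure[OF ct] by blast
 obtain G where G: "G >= 0" "!!z. z : closure Om ==> norm (gm z) <= G" using bounded_closure[OF cg] by blast
 define T0 where "T0 z = indicator Om z *\<^sub>R ta z" for z
 define G0 where "G0 z = indicator Om z *\<^sub>R gm z" for z
 have [measurable]: "T0 : borel_measurable borel" "G0 : borel_measurable borel"
  unfolding T0_def[abs_def] G0_def[abs_def] by (intro measurable_indicator_continuous ct cg)+
 have T0: "\<bar>T0 z\<bar> <= T" for z using T closure_subset by (auto simp: T0_def indicator_def)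
 have G0: "norm (G0 z) <= G" for z using G closure_subset by (auto simp: G0_def indicator_def)
 define ps where "ps x = T0 (fst x) * ph (fst x) * snd x $ i" for x :: "plane \<times> plane"
 define dps where "dps x = ((snd x \<bullet> G0 (fst x)) * ph (fst x) + T0 (fst x) * transport_deriv (%x. ph (fst x)) x) * snd x $ i" for x
 have mph[measurable]: "ph : borel_measurable borel" by (intro borel_measurable_continuous_onI smooth_continuous s)
 have mdt[measurable]: "transport_deriv (%x. ph (fst x)) : borel_measurable phase_space"
  by (intro measurable_phase_continuous continuous_transport_deriv smooth_linear[OF bounded_linear_fst s])
 have comp: "\<bar>snd x $ i\<bar> <= 1" if "norm (snd x) = 1" for x :: "plane \<times> plane"
  using component_le_norm_cart[of "snd x" i] that by simp
 have bpsi: "\<bar>ps x\<bar> <= T * D + G * D" if n: "norm (snd x) = 1" for x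
 proof -
  have "\<bar>ps x\<bar> <= T * D * 1" unfolding ps_def abs_mult
   using T0 D(1)[OF n] comp[OF n] T(1) D0 by (intro mult_mono) auto
  then show ?thesis using mult_nonneg_nonneg[OF G(1) D0] by linarith
 qed
 have bdpsi: "\<bar>dps x\<bar> <= T * D + G * D" if n: "norm (snd x) = 1" for x
 proof -
  have "\<bar>snd x \<bullet> G0 (fst x)\<bar> <= norm (snd x) * norm (G0 (fst x))" by (rule Cauchy_Schwarz_ineq2)
  then have "\<bar>snd x \<bullet> G0 (fst x)\<bar> <= G" using G0[of "fst x"] n by simp
  then have "\<bar>(snd x \<bullet> G0 (fst x)) * ph (fst x)\<bar> <= G * D" unfolding abs_mult
   using D(1)[OF n] G(1) by (intro mult_mono) auto
  moreover have "\<bar>T0 (fst x) * transport_deriv (%x. ph (fst x)) x\<bar> <= T * D" unfolding abs_mult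
   using T0 D(2)[OF n] T(1) by (intro mult_mono) auto
  ultimately have "\<bar>(snd x \<bullet> G0 (fst x)) * ph (fst x) + T0 (fst x) * transport_deriv (%x. ph (fst x)) x\<bar> * \<bar>snd x $ i\<bar> <= (T * D + G * D) * 1"
   using comp[OF n] by (intro mult_mono) auto
  then show ?thesis by (simp add: dps_def abs_mult)
 qed
 have derpsi: "((%r. ps (shift r x)) has_real_derivative dps x) (at 0)" for x
 proof (cases "fst x : Om")
  case True
  define U where "U = {r. fst x + r *\<^sub>R snd x : Om}"
  have U: "open U" "0 : U"
   unfolding U_def using open_vimage[OF op, of "%r. fst x + r *\<^sub>R snd x"] True
   by (auto simp: vimage_def continuous_intros)
  have "((%r. fst x + r *\<^sub>R snd x) has_derivative (%h. h *\<^sub>R snd x)) (at 0)"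
   by (auto intro!: derivative_eq_intros)
  from has_derivative_compose[OF this smooth_has_derivative[OF s]]
  have "((%r. ph (fst x + r *\<^sub>R snd x)) has_derivative (%h. frechet_derivative ph (at (fst x)) (h *\<^sub>R snd x))) (at 0)"
   by simp
  then have dph: "((%r. ph (fst x + r *\<^sub>R snd x)) has_real_derivative transport_deriv (%x. ph (fst x)) x) (at 0)"
   using linear_scale[OF has_derivative_linear[OF smooth_has_derivative[OF s]]]
   by (simp add: has_field_derivative_def transport_deriv_fst[OF s] mult_commute_abs)
  have "((%r. ta (fst x + r *\<^sub>R snd x) * ph (fst x + r *\<^sub>R snd x) * snd x $ i) has_real_derivative dps x) (at 0)"
   using DERIV_mult[OF DERIV_mult[OF der[OF True, of "snd x"] dph] DERIV_const[of "snd x $ i"]] True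
   by (simp add: dps_def T0_def G0_def algebra_simps)
  moreover have "\<forall>\<^sub>F r in nhds 0. ps (shift r x) = ta (fst x + r *\<^sub>R snd x) * ph (fst x + r *\<^sub>R snd x) * snd x $ i"
   using eventually_nhds_in_open[OF U] by eventually_elim (simp add: ps_def T0_def U_def)
  ultimately show ?thesis by (subst DERIV_cong_ev[OF refl _ refl])
 next
  case False
  \<comment> \<open>\<open>T0\<close> may jump at the boundary, but \<open>ph\<close> vanishes off
    \<open>K\<close>, so \<open>ps\<close> is zero near every point outside the domain.\<close>
  define U where "U = {r. fst x + r *\<^sub>R snd x : - K}"
  have "open (- K)" using K(1) by (simp add: compact_imp_closed open_Compl)
  then have U: "open U" "0 : U"
   unfolding U_def using open_vimage[of "- K" "%r. fst x + r *\<^sub>R snd x"] False K(2)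
   by (auto simp: vimage_def continuous_intros)
  have "\<forall>\<^sub>F r in nhds 0. ps (shift r x) = 0"
   using eventually_nhds_in_open[OF U] by eventually_elim (simp add: ps_def U_def K(3))
  moreover have "dps x = 0" using False by (simp add: dps_def T0_def G0_def)
  moreover have "((%r. 0) has_real_derivative 0) (at 0)" by simp
  ultimately show ?thesis by (subst DERIV_cong_ev[OF refl _ refl]) auto
 qed
 have main: "(\<integral>x. indicator Om (fst x) * f (fst x) * dps x \<partial>phase_space) = - (\<integral>x. indicator Om (fst x) * (snd x \<bullet> g (fst x)) * ps x \<partial>phase_space)"
 proof (rule weak_C1_test[OF int_on_phase[OF f] int_on_phase_inner[OF g] weak_gradient_transport[OF wg f g] K(1,2) _ _ _ bpsi bdpsi derpsi])
  show "ps x = 0" if "fst x \<notin> K" for x using K(3) that by (simp add: ps_def)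
  show "ps : borel_measurable phase_space" unfolding ps_def by measurable
  show "dps : borel_measurable phase_space" unfolding dps_def by measurable
 qed
 define dp where "dp j z = frechet_derivative ph (at z) (axis j 1)" for j z
 have lin: "linear (frechet_derivative ph (at z))" for z
  using has_derivative_linear[OF smooth_has_derivative[OF s]] .
 have Dp: "\<bar>dp j z\<bar> <= D" for z j
  using D(2)[of "(z, axis j 1)"] by (simp add: transport_deriv_fst[OF s] norm_axis_1 dp_def)
 have Dphi: "\<bar>ph z\<bar> <= D" for z using D(1)[of "(z, axis 1 1)"] by (simp add: norm_axis_1)
 have mdp: "dp j : borel_measurable borel" for j
  unfolding dp_def[abs_def]
  by (intro borel_measurable_continuous_onI continuous_frechet_direction s)
 have iphi: "integrable lborel (%z. indicator Om z * h z * ph z)" if "int_on h" for h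
  by (rule integrable_mult_bounded[OF that[unfolded int_on_def], where C=D]) (use Dphi in auto)
 have idp: "integrable lborel (%z. indicator Om z * h z * dp j z)" if "int_on h" for h j
  by (rule integrable_mult_bounded[OF that[unfolded int_on_def], where C=D]) (use Dp mdp in auto)
 define A where "A j z = indicator Om z * (f z * gm z $ j) * ph z + indicator Om z * (f z * ta z) * dp j z" for j z
 define B where "B j z = indicator Om z * (g z $ j * ta z) * ph z" for j z
 have iA: "integrable lborel (A j)" for j unfolding A_def
  by (intro Bochner_Integration.integrable_add iphi idp int_on_mult f ct cgi)
 have iB: "integrable lborel (B j)" for j unfolding B_def
  by (intro iphi int_on_mult g ct)
 have eA: "indicator Om (fst x) * f (fst x) * dps x = A 1 (fst x) * (snd x $ 1 * snd x $ i) + A 2 (fst x) * (snd x $ 2 * snd x $ i)" for x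
  unfolding dps_def A_def T0_def G0_def transport_deriv_fst[OF s] linear_plane[OF lin, of "fst x" "snd x"] dp_def
  by (simp add: inner_plane indicator_def algebra_simps)
 have eB: "indicator Om (fst x) * (snd x \<bullet> g (fst x)) * ps x = B 1 (fst x) * (snd x $ 1 * snd x $ i) + B 2 (fst x) * (snd x $ 2 * snd x $ i)" for x
  unfolding ps_def B_def T0_def
  by (simp add: inner_plane indicator_def algebra_simps)
 have "(\<integral>z. A i z \<partial>lborel) = - (\<integral>z. B i z \<partial>lborel)"
  using main integral_phase_moment[OF iA] integral_phase_moment[OF iB] exhaust_2[of i]
  unfolding eA eB by auto
 moreover have "(\<integral>z. A i z \<partial>lborel) = (\<integral>z. indicator Om z * (f z * gm z $ i) * ph z \<partial>lborel) + (\<integral>z. indicator Om z * (f z * ta z) * dp i z \<partial>lborel)"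
  unfolding A_def by (intro Bochner_Integration.integral_add iphi idp int_on_mult f ct cgi)
 moreover have "(LINT z:Om|lborel. (ta z *\<^sub>R g z + f z *\<^sub>R gm z) $ i * ph z) =
   (\<integral>z. B i z \<partial>lborel) + (\<integral>z. indicator Om z * (f z * gm z $ i) * ph z \<partial>lborel)"
  unfolding set_lebesgue_integral_def
  by (subst Bochner_Integration.integral_add[symmetric, OF iB iphi[OF int_on_mult[OF f cgi]]])
    (intro Bochner_Integration.integral_cong refl, simp add: B_def algebra_simps)
 moreover have "(LINT z:Om|lborel. f z * ta z * frechet_derivative ph (at z) (axis i 1)) = (\<integral>z. indicator Om z * (f z * ta z) * dp i z \<partial>lborel)"
  unfolding set_lebesgue_integral_def dp_def by (intro Bochner_Integration.integral_cong refl) simp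
 ultimately show "(LINT z:Om|lborel. f z * ta z * frechet_derivative ph (at z) (axis i 1)) =
   - (LINT z:Om|lborel. (ta z *\<^sub>R g z + f z *\<^sub>R gm z) $ i * ph z)"
  by linarith
qed

end

section \<open>Integrability classes and rotation invariance\<close>

lemma Lp_measurable: "Lp M p f ==> f : borel_measurable M"
 by (simp add: Lp_def)

lemma Lp_integrable:
 assumes "finite_measure M" "Lp M p f" "p >= 1"
 shows "integrable M f"
proof (rule Bochner_Integration.integrable_bound)
 interpret finite_measure M by fact
 show "integrable M (%x. 1 + \<bar>f x\<bar> powr p)"
  using assms by (intro Bochner_Integration.integrable_add) (auto simp: Lp_def)
 show "f : borel_measurable M" using assms by (simp add: Lp_def)
 have "\<bar>y\<bar> <= 1 + \<bar>y\<bar> powr p" for y :: real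
 proof (cases "\<bar>y\<bar> <= 1")
  case True then show ?thesis using powr_ge_zero[of "\<bar>y\<bar>" p] by linarith
 next
  case False
  then have "\<bar>y\<bar> powr 1 <= \<bar>y\<bar> powr p" using assms(3) by (intro powr_mono) auto
  then show ?thesis using False by simp
 qed
 then show "AE x in M. norm (f x) <= norm (1 + \<bar>f x\<bar> powr p)"
  by (intro AE_I2) (simp add: abs_of_nonneg add_nonneg_nonneg)
qed

lemma Lp_add:
 assumes f: "Lp M p f" and g: "Lp M p g" and p: "p >= 0"
 shows "Lp M p (%x. f x + g x)"
 unfolding Lp_def
proof
 have m: "f : borel_measurable M" "g : borel_measurable M" using f g by (auto simp: Lp_def)
 then show m': "(%x. f x + g x) : borel_measurable M" by simp
 show "integrable M (%x. \<bar>f x + g x\<bar> powr p)"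
 proof (rule Bochner_Integration.integrable_bound)
  show "integrable M (%x. 2 powr p * (\<bar>f x\<bar> powr p + \<bar>g x\<bar> powr p))"
   using f g by (intro integrable_mult_right Bochner_Integration.integrable_add) (auto simp: Lp_def)
  show "(%x. \<bar>f x + g x\<bar> powr p) : borel_measurable M" using m' by measurable
  have "\<bar>a + b\<bar> powr p <= 2 powr p * (\<bar>a\<bar> powr p + \<bar>b\<bar> powr p)" for a b :: real
  proof -
   have "\<bar>a + b\<bar> powr p <= (2 * max \<bar>a\<bar> \<bar>b\<bar>) powr p" using p by (intro powr_mono2) auto
   also have "\<dots> = 2 powr p * (max \<bar>a\<bar> \<bar>b\<bar>) powr p" by (simp add: powr_mult)
   also have "(max \<bar>a\<bar> \<bar>b\<bar>) powr p <= \<bar>a\<bar> powr p + \<bar>b\<bar> powr p" by (simp add: max_def)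
   finally show ?thesis by simp
  qed
  then show "AE x in M. norm (\<bar>f x + g x\<bar> powr p) <= norm (2 powr p * (\<bar>f x\<bar> powr p + \<bar>g x\<bar> powr p))"
   by (intro AE_I2) (simp add: abs_of_nonneg)
 qed
qed

lemma Lp_mult_bounded:
 assumes f: "Lp M p f" and g: "g : borel_measurable M" and b: "!!x. x : space M ==> \<bar>g x\<bar> <= B" and p: "p >= 0"
 shows "Lp M p (%x. f x * g x)"
 unfolding Lp_def
proof
 have m: "f : borel_measurable M" using f by (auto simp: Lp_def)
 then show m': "(%x. f x * g x) : borel_measurable M" using g by simp
 show "integrable M (%x. \<bar>f x * g x\<bar> powr p)"
 proof (rule Bochner_Integration.integrable_bound)
  show "integrable M (%x. \<bar>B\<bar> powr p * \<bar>f x\<bar> powr p)" using f by (auto simp: Lp_def)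
  show "(%x. \<bar>f x * g x\<bar> powr p) : borel_measurable M" using m' by measurable
  show "AE x in M. norm (\<bar>f x * g x\<bar> powr p) <= norm (\<bar>B\<bar> powr p * \<bar>f x\<bar> powr p)"
  proof (rule AE_I2)
   fix x assume x: "x : space M"
   have "\<bar>f x * g x\<bar> powr p <= (\<bar>B\<bar> * \<bar>f x\<bar>) powr p"
   proof (rule powr_mono2)
    have "\<bar>g x\<bar> <= \<bar>B\<bar>" using b[OF x] by linarith
    then show "\<bar>f x * g x\<bar> <= \<bar>B\<bar> * \<bar>f x\<bar>"
     using mult_right_mono[of "\<bar>g x\<bar>" "\<bar>B\<bar>" "\<bar>f x\<bar>"] by (simp add: abs_mult mult.commute)
   qed (use p in auto)
   then show "norm (\<bar>f x * g x\<bar> powr p) <= norm (\<bar>B\<bar> powr p * \<bar>f x\<bar> powr p)"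
    by (simp add: powr_mult)
  qed
 qed
qed

lemma Lp_AE_cong:
 assumes "Lp M p f" "g : borel_measurable M" "AE x in M. g x = f x"
 shows "Lp M p g"
 unfolding Lp_def
proof
 have "integrable M (%x. \<bar>f x\<bar> powr p)" using assms(1) by (simp add: Lp_def)
 moreover have "(%x. \<bar>f x\<bar> powr p) : borel_measurable M" "(%x. \<bar>g x\<bar> powr p) : borel_measurable M"
  using assms(1,2) by (auto simp: Lp_def)
 moreover have "AE x in M. \<bar>f x\<bar> powr p = \<bar>g x\<bar> powr p" using assms(3) by eventually_elim simp
 ultimately show "integrable M (%x. \<bar>g x\<bar> powr p)" using integrable_cong_AE by blast
qed (rule assms(2))

lemma integral_periodic:
 fixes f :: "real => real"
 assumes c: "continuous_on UNIV f" and per: "!!t. f (t + 2 * pi) = f t" and \<alpha>: "0 <= \<alpha>" "\<alpha> <= 2 * pi"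
 shows "integral {-pi..pi} (%t. f (t - \<alpha>)) = integral {-pi..pi} f"
proof -
 have i: "f integrable_on {a..b}" for a b
  by (intro integrable_continuous_real continuous_on_subset[OF c]) auto
 have sh: "integral {a + d..b + d} f = integral {a..b} (%t. f (t + d))" for a b d
  using Henstock_Kurzweil_Integration.integral_shift[of a d b f] continuous_on_subset[OF c] by (simp add: comp_def)
 have "integral {-pi..pi} (%t. f (t - \<alpha>)) = integral {-pi - \<alpha>..pi - \<alpha>} f"
  using sh[of "-pi" "-\<alpha>" pi] by simp
 also have "\<dots> = integral {-pi - \<alpha>..-pi} f + integral {-pi..pi - \<alpha>} f"
  using \<alpha> by (intro Henstock_Kurzweil_Integration.integral_combine[symmetric] i) auto
 also have "integral {-pi - \<alpha>..-pi} f = integral {pi - \<alpha>..pi} f"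
  using sh[of "-pi - \<alpha>" "2 * pi" "-pi"] by (simp add: per)
 also have "integral {pi - \<alpha>..pi} f + integral {-pi..pi - \<alpha>} f = integral {-pi..pi} f"
  using \<alpha> by (subst add.commute, intro Henstock_Kurzweil_Integration.integral_combine i) auto
 finally show ?thesis .
qed

text \<open>In angles the inner product is the cosine of a difference, and periodicity removes the
  angle of \<open>th\<close>. With \<open>g = k z\<close> this is the zeroth coefficient of the
  kernel.\<close>

lemma integral_circle_inner:
 fixes g :: "real => real"
 assumes g: "continuous_on {-1..1} g" and n: "norm th = 1"
 shows "(\<integral>th'. g (th \<bullet> th') \<partial>circle_measure) = (1 / (2 * pi)) * integral {-pi..pi} (%t. g (cos t))"
proof -
 have "(th $ 1)\<^sup>2 + (th $ 2)\<^sup>2 = 1" using norm_plane[of th] n by simp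
 from sincos_total_2pi[OF this] obtain \<alpha> where \<alpha>: "0 <= \<alpha>" "\<alpha> < 2 * pi" "th $ 1 = cos \<alpha>" "th $ 2 = sin \<alpha>" by metis
 define f where "f t = g (cos t)" for t
 have cf: "continuous_on UNIV f"
  unfolding f_def by (rule continuous_on_compose2[OF g]) (auto intro: continuous_intros)
 have dot: "th \<bullet> vector [cos t, sin t] = cos (t - \<alpha>)" for t
  by (simp add: inner_plane \<alpha> cos_diff mult.commute)
 define h where "h s = indicator {-1..1} s *\<^sub>R g s" for s
 have mh[measurable]: "h : borel_measurable borel"
  unfolding h_def[abs_def] by (rule borel_measurable_continuous_on_indicator[OF _ g]) simp
 have dd: "th \<bullet> th' : {-1..1}" if "norm th' = 1" for th'
  using Cauchy_Schwarz_ineq2[of th th'] n that by (auto simp: abs_le_iff)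
 have "(\<integral>th'. g (th \<bullet> th') \<partial>circle_measure) = (\<integral>th'. h (th \<bullet> th') \<partial>circle_measure)"
  by (intro Bochner_Integration.integral_cong refl) (use dd in \<open>auto simp: space_circle h_def\<close>)
 also have "\<dots> = (1 / (2 * pi)) *\<^sub>R (\<integral>t. indicator {-pi..pi} t *\<^sub>R h (th \<bullet> vector [cos t, sin t]) \<partial>lborel)"
  by (rule integral_circle) measurable
 also have "(\<integral>t. indicator {-pi..pi} t *\<^sub>R h (th \<bullet> vector [cos t, sin t]) \<partial>lborel) = (LINT t:{-pi..pi}|lborel. f (t - \<alpha>))"
  unfolding set_lebesgue_integral_def by (simp add: dot h_def f_def)
 also have "\<dots> = integral {-pi..pi} (%t. f (t - \<alpha>))"
  by (intro set_borel_integral_eq_integral borel_integrable_atLeastAtMost' continuous_on_compose2[OF cf] continuous_intros) auto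
 also have "\<dots> = integral {-pi..pi} f"
  using \<alpha> by (intro integral_periodic[OF cf]) (auto simp: f_def)
 finally show ?thesis by (simp add: f_def[abs_def])
qed

section \<open>Existence of the data\<close>

context convex_domain begin

abbreviation domain_measure :: "plane measure" where
 "domain_measure \<equiv> restrict_space lborel Om"

lemma finite_domain: "finite_measure domain_measure"
 using emeasure_bounded_finite[OF bd]
 by (intro finite_measureI) (simp add: space_restrict_space emeasure_restrict_space)

lemma finite_phase: "finite_measure (phase_measure Om)"
 by (rule finite_phase_measure[OF borel_domain bd])

lemma Lp_int_on: "Lp domain_measure p f ==> p >= 1 ==> int_on f"
 using Lp_integrable[OF finite_domain, of p f] by (simp add: int_on_def integrable_restrict_space)

lemma measurable_domain_iff:
 "(f :: plane => real) : borel_measurable domain_measure \<longleftrightarrow> (%z. indicator Om z * f z) : borel_measurable borel"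
 by (subst borel_measurable_restrict_space_iff) auto

lemma Lp_phase_fst:
 assumes "Lp domain_measure p f"
 shows "Lp (phase_measure Om) p (%x. f (fst x))"
 unfolding Lp_def
proof
 have m: "(%z. indicator Om z * f z) : borel_measurable borel"
  using assms by (simp add: Lp_def measurable_domain_iff)
 show "(%x. f (fst x)) : borel_measurable (phase_measure Om)"
  unfolding measurable_phase_measure[OF borel_domain]
  using measurable_compose[OF _ m, of fst phase_space] by simp
 have "integrable lborel (%z. indicator Om z * \<bar>f z\<bar> powr p)"
  using assms by (simp add: Lp_def integrable_restrict_space)
 from integrable_phase_fst[OF this] show "integrable (phase_measure Om) (%x. \<bar>f (fst x)\<bar> powr p)"
  by (simp add: integrable_phase_measure)
qed

lemma Lp_anisotropic:
 assumes f: "Lp domain_measure p f" and F: "!!i. Lp domain_measure p (%z. F z $ i)" and p: "p >= 0"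
 shows "Lp (phase_measure Om) p (anisotropic_source f F)"
proof -
 have ms: "(%x. snd x $ i) : borel_measurable (phase_measure Om)" for i
  unfolding phase_measure_def by measurable
 have "Lp (phase_measure Om) p (%x. F (fst x) $ i * snd x $ i)" for i
 proof (rule Lp_mult_bounded[OF Lp_phase_fst[OF F] ms _ p])
  fix x assume "x : space (phase_measure Om)"
  then have "norm (snd x) = 1" by (auto simp: phase_measure_def space_pair_measure space_circle)
  then show "\<bar>snd x $ i\<bar> <= 1" by (rule component_le_1)
 qed
 then have "Lp (phase_measure Om) p (%x. f (fst x) + (F (fst x) $ 1 * snd x $ 1 + F (fst x) $ 2 * snd x $ 2))"
  using p by (intro Lp_add Lp_phase_fst f) auto
 then show ?thesis by (simp add: anisotropic_source_def case_prod_beta' inner_plane mult.commute)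
qed

lemma sobolev_weak_gradient:
 assumes "sobolev (Suc n) p Om f"
 obtains g where "has_weak_gradient Om f g" "!!i. Lp domain_measure p (%z. g z $ i)"
proof -
 have S: "\<exists>g. has_weak_partial Om (axis i 1) f g & sobolev n p Om g" for i
  using assms exhaust_2[of i] by (auto simp: Basis_plane)
 from S obtain h where h: "!!i. has_weak_partial Om (axis i 1) f (h i)" "!!i. sobolev n p Om (h i)" by metis
 have "Lp domain_measure p (h i)" for i using h(2)[of i] by (cases n) auto
 then show ?thesis using that[of "%z. \<chi> i. h i z"] h(1) by (simp add: has_weak_gradient_iff)
qed

lemma sobolev_Lp: "sobolev n p Om f ==> Lp domain_measure p f"
 by (cases n) auto

lemma sobolev_field_Lp: "sobolev_field n p Om F ==> Lp domain_measure p (%z. F z $ i)"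
proof -
 assume F: "sobolev_field n p Om F"
 have "axis i 1 : (Basis :: plane set)" using exhaust_2[of i] by (auto simp: Basis_plane)
 then have "sobolev n p Om (%z. F z \<bullet> axis i 1)" using F unfolding sobolev_field_def by blast
 then show ?thesis using sobolev_Lp by (simp add: inner_axis_plane)
qed

lemma Ck_closure_continuous_gen:
 fixes S :: "'a::euclidean_space set"
 shows "Ck_closure n S f ==> continuous_on (closure S) f"
 by (cases n) auto

lemma has_weak_gradient_diff:
 assumes f: "has_weak_gradient Om f g" "int_on f" "!!i. int_on (%z. g z $ i)"
  and f': "has_weak_gradient Om f' g'" "int_on f'" "!!i. int_on (%z. g' z $ i)"
 shows "has_weak_gradient Om (%z. f z - f' z) (%z. g z - g' z)"
 unfolding has_weak_gradient_iff has_weak_partial_def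
proof (intro allI conjI impI)
 have id: "int_on (%z. h z - h' z)" if "int_on h" "int_on h'" for h h'
  using that by (simp add: int_on_def right_diff_distrib)
 fix i
 show "locally_integrable_on Om (%z. f z - f' z)" by (intro int_on_locally id f f')
 show "locally_integrable_on Om (%z. (g z - g' z) $ i)" using int_on_locally[OF id[OF f(3)[of i] f'(3)[of i]]] by simp
 fix ph assume t: "test_function Om ph"
 then have s: "smooth ph" by (simp add: test_function_def)
 define \<eta> where "\<eta> = (%x :: plane \<times> plane. ph (fst x))"
 have "phase_test_function Om \<eta>" unfolding \<eta>_def by (rule phase_test_fst[OF t])
 then obtain D where D': "D >= 0" "!!x. norm (snd x) = 1 ==> \<bar>\<eta> x\<bar> <= D"
   "!!x. norm (snd x) = 1 ==> \<bar>transport_deriv \<eta> x\<bar> <= D"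
  using phase_test_function_bounded by blast
 note D = D'(2,3)[unfolded \<eta>_def]
 have D1: "\<bar>frechet_derivative ph (at z) (axis i 1)\<bar> <= D" for z
  using D(2)[of "(z, axis i 1)"] by (simp add: transport_deriv_fst[OF s] norm_axis_1)
 have D0: "\<bar>ph z\<bar> <= D" for z using D(1)[of "(z, axis 1 1)"] by (simp add: norm_axis_1)
 have i1: "integrable lborel (%z. indicator Om z * h z * frechet_derivative ph (at z) (axis i 1))" if "int_on h" for h
  by (rule integrable_mult_bounded[OF that[unfolded int_on_def], where C=D])
    (use D1 borel_measurable_continuous_onI[OF continuous_frechet_direction[OF s]] in auto)
 have i2: "integrable lborel (%z. indicator Om z * h z * ph z)" if "int_on h" for h
  by (rule integrable_mult_bounded[OF that[unfolded int_on_def], where C=D])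
    (use D0 borel_measurable_continuous_onI[OF smooth_continuous[OF s]] in auto)
 have "(LINT z:Om|lborel. f z * frechet_derivative ph (at z) (axis i 1)) = - (LINT z:Om|lborel. g z $ i * ph z)"
  "(LINT z:Om|lborel. f' z * frechet_derivative ph (at z) (axis i 1)) = - (LINT z:Om|lborel. g' z $ i * ph z)"
  using f(1) f'(1) t by (auto simp: has_weak_gradient_iff has_weak_partial_def)
 then show "(LINT z:Om|lborel. (f z - f' z) * frechet_derivative ph (at z) (axis i 1)) = - (LINT z:Om|lborel. (g z - g' z) $ i * ph z)"
  using i1[OF f(2)] i1[OF f'(2)] i2[OF f(3)[of i]] i2[OF f'(3)[of i]]
  by (simp add: set_lebesgue_integral_def left_diff_distrib right_diff_distrib mult.assoc)
qed

text \<open>The chosen weak gradient is known only through its local integrability, while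
  \<open>Lp\<close> asks for measurability on the domain; countably many boxes cover the domain, and
  on each of them it is measurable.\<close>

lemma locally_integrable_measurable:
 assumes f: "locally_integrable_on Om f"
 shows "f : borel_measurable domain_measure"
proof -
 obtain D where D: "countable D" "!!a b. (a, b) : D ==> cbox a b \<subseteq> Om" "Om = (\<Union>(a, b)\<in>D. box a b)"
  using open_countable_cbox_cover[OF op] by blast
 show ?thesis
 proof (rule measurable_piecewise_restrict[where C="(%(a, b). box a b) ` D"])
  show "countable ((%(a, b). box a b) ` D)" using D(1) by simp
  show "S \<inter> space domain_measure : sets domain_measure" if "S : (%(a, b). box a b) ` D" for S
  proof -
   have "open S" using that by auto
   then have "S : sets lborel" by simp
   then show ?thesis unfolding sets_restrict_space
    by (rule image_eqI[rotated]) (simp add: space_restrict_space Int_commute)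
  qed
  show "space domain_measure \<subseteq> \<Union>((%(a, b). box a b) ` D)"
   by (subst space_restrict_space2) (simp_all add: D(3)[symmetric])
  fix S assume "S : (%(a, b). box a b) ` D"
  then obtain a b where ab: "(a, b) : D" "S = box a b" by auto
  have "set_integrable lborel (cbox a b) f" using f D(2)[OF ab(1)] by (simp add: locally_integrable_on_def)
  then have "(%z. indicator (cbox a b) z * f z) : borel_measurable borel" by (simp add: set_integrable_def)
  then have "(%z. indicator (box a b) z * (indicator (cbox a b) z * f z)) : borel_measurable borel" by measurable
  moreover have "(%z. indicator (box a b) z * (indicator (cbox a b) z * f z)) = (%z. indicator (box a b) z *\<^sub>R f z)"
   using box_subset_cbox[of a b] by (auto simp: indicator_def fun_eq_iff)
  ultimately have "f : borel_measurable (restrict_space borel (box a b))"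
   by (subst borel_measurable_restrict_space_iff) auto
  moreover have r: "restrict_space domain_measure S = restrict_space lborel (box a b)"
  proof -
   have "Om \<inter> S = box a b" using D(2)[OF ab(1)] box_subset_cbox[of a b] ab(2) by blast
   then show ?thesis by (subst restrict_restrict_space) (simp_all add: ab(2))
  qed
  moreover have e: "sets (restrict_space lborel (box a b)) = sets (restrict_space borel (box a b))"
   by (intro sets_restrict_space_cong) simp
  ultimately show "f : borel_measurable (restrict_space domain_measure S)"
   unfolding r by (subst measurable_cong_sets[OF e refl])
 qed
qed

end

context transport_medium begin

lemma Lp_cut: "Lp (phase_measure Om) p f ==> p >= 1 ==> integrable phase_space (cut f)"
 using Lp_integrable[OF finite_phase, of p f] by (simp add: integrable_cut_iff)

lemma solution_outflow_trace:
 assumes u: "transport_solution Om a k p f u" and f: "Lp (phase_measure Om) p f" and p: "p >= 1"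
 obtains g where "has_outflow_trace Om u g"
proof -
 have iu: "integrable phase_space (cut u)" and iF: "integrable phase_space (cut f)"
  using u f p by (auto simp: transport_solution_def intro: Lp_cut)
 have "transport_equation Om a k f u" using u by (simp add: transport_solution_def)
 then obtain v where "AE x in phase_space. fst x : Om --> v x = u x" "characteristic v (cut (rhs f u))"
  using characteristic_solution[OF iu iF] by blast
 then show ?thesis using characteristic_trace[OF enters_outflow] that unfolding has_outflow_trace_iff by blast
qed

text \<open>Justifies the choice made in \<open>boundary_data\<close>: well-posedness supplies a
  solution, and its representative along lines has limits at the outflow boundary.\<close>

lemma boundary_data_exists:
 assumes wp: "well_posed Om a k" and p: "p > 1"
  and f: "Lp domain_measure p f" and F: "!!i. Lp domain_measure p (%z. F z $ i)"
 shows "has_boundary_data Om a k p f F (boundary_data Om a k p f F)"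
proof -
 have L: "Lp (phase_measure Om) p (anisotropic_source f F)" using p by (intro Lp_anisotropic f F) simp
 with wp p obtain u where u: "transport_solution Om a k p (anisotropic_source f F) u"
  unfolding well_posed_def by blast
 obtain g where "has_outflow_trace Om u g" using solution_outflow_trace[OF u L] p by auto
 then have "has_boundary_data Om a k p f F g" using u by (auto simp: has_boundary_data_def)
 then show ?thesis unfolding boundary_data_def by (rule someI[of "has_boundary_data Om a k p f F"])
qed

text \<open>The angular integral is additive where both slices are integrable, which Fubini gives
  for almost every position only.\<close>

lemma AE_scattering_add:
 assumes u: "integrable phase_space (cut u)" and w: "integrable phase_space (cut w)"
 shows "AE x in phase_space. fst x : Om -->
  scattering k (%x. u x + w x) (fst x) (snd x) = scattering k u (fst x) (snd x) + scattering k w (fst x) (snd x)"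
proof -
 obtain B where B: "B >= 0" "!!z s. \<bar>kx z s\<bar> <= B" using kx_bounded by blast
 have "AE x in phase_space. norm (snd x) = 1" by (intro AE_I2) (auto simp: space_phase)
 with AE_phase_fst[OF lc.AE_integrable_fst'[OF u]] AE_phase_fst[OF lc.AE_integrable_fst'[OF w]]
 show ?thesis
 proof eventually_elim
  fix x :: "plane \<times> plane"
  assume i: "integrable circle_measure (%th'. cut u (fst x, th'))" "integrable circle_measure (%th'. cut w (fst x, th'))"
   and n: "norm (snd x) = 1"
  show "fst x : Om -->
   scattering k (%x. u x + w x) (fst x) (snd x) = scattering k u (fst x) (snd x) + scattering k w (fst x) (snd x)"
  proof
   assume z: "fst x : Om"
   have mk: "(%th'. kx (fst x) (snd x \<bullet> th')) : borel_measurable circle_measure"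
    using measurable_compose[of "%th'. (fst x, snd x \<bullet> th')" circle_measure "borel \<Otimes>\<^sub>M borel", OF _ measurable_kx] by simp
   have I: "integrable circle_measure (%th'. cut h (fst x, th') * kx (fst x) (snd x \<bullet> th'))"
    if "integrable circle_measure (%th'. cut h (fst x, th'))" for h
    by (rule integrable_mult_bounded[OF that mk]) (use B in auto)
   have S: "scattering k h (fst x) (snd x) = (\<integral>th'. cut h (fst x, th') * kx (fst x) (snd x \<bullet> th') \<partial>circle_measure)" for h
    using cut_scattering[OF n, of h] z by (simp add: cut_def mult.commute)
   have "cut (%x. u x + w x) y = cut u y + cut w y" for y by (simp add: cut_def distrib_left)
   then show "scattering k (%x. u x + w x) (fst x) (snd x) = scattering k u (fst x) (snd x) + scattering k w (fst x) (snd x)"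
    unfolding S using I[OF i(1)] I[OF i(2)] by (simp add: distrib_right)
  qed
 qed
qed

lemma scattering_fst:
 assumes z: "z : Om" and n: "norm th = 1"
 shows "scattering k (%x. q (fst x)) z th = zeroth_coeff k z * q z"
proof -
 have zc: "z : closure Om" using z by (rule subsetD[OF closure_subset])
 have c: "continuous_on {-1..1} (k z)"
 proof -
  have "continuous_on {-1..1} (%s. (z, s))" by (intro continuous_intros)
  from continuous_on_compose2[OF ck this] zc show ?thesis by auto
 qed
 have cc: "continuous_on {-pi..pi} (%t. k z (cos t))"
  by (rule continuous_on_compose2[OF c]) (auto intro: continuous_intros)
 show ?thesis
  unfolding scattering_def using integral_circle_inner[OF c n] zeroth_coeff_integral[of k z, OF cc] by simp
qed

text \<open>The weak equation for \<open>u\<close> and the weak gradient identity for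
  \<open>q\<close> are added under the test integral. By rotation invariance
  \<open>scattering_fst\<close> makes scattering act on \<open>q\<close> as a
  multiplication.\<close>

lemma add_isotropic_solution:
 assumes u: "integrable phase_space (cut u)" and f: "integrable phase_space (cut f)"
  and eq: "transport_equation Om a k f u"
  and wg: "has_weak_gradient Om q G" and q: "int_on q" and G: "!!i. int_on (%z. G z $ i)"
  and f': "integrable phase_space (cut f')"
  and src: "!!z th. z : Om ==> f' (z, th) = f (z, th) + (a z - zeroth_coeff k z) * q z + th \<bullet> G z"
 shows "transport_equation Om a k f' (%x. u x + q (fst x))"
proof -
 have cq: "cut (%x. q (fst x)) = (%x. indicator Om (fst x) * q (fst x))" by (auto simp: cut_def)
 have iq: "integrable phase_space (cut (%x. q (fst x)))" unfolding cq by (rule int_on_phase[OF q])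
 have cadd: "cut (%x. u x + q (fst x)) = (%x. cut u x + cut (%x. q (fst x)) x)" by (auto simp: cut_def distrib_left)
 have iuq: "integrable phase_space (cut (%x. u x + q (fst x)))" unfolding cadd using u iq by simp
 have iG: "integrable phase_space (%x. indicator Om (fst x) * (snd x \<bullet> G (fst x)))" by (rule int_on_phase_inner[OF G])
 have AEr: "AE x in phase_space. cut (rhs f' (%x. u x + q (fst x))) x = cut (rhs f u) x + indicator Om (fst x) * (snd x \<bullet> G (fst x))"
 proof -
  have "AE x in phase_space. norm (snd x) = 1" by (intro AE_I2) (auto simp: space_phase)
  with AE_scattering_add[OF u iq] show ?thesis
  proof eventually_elim
   fix x :: "plane \<times> plane"
   assume s: "fst x : Om --> scattering k (%x. u x + q (fst x)) (fst x) (snd x) =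
     scattering k u (fst x) (snd x) + scattering k (%x. q (fst x)) (fst x) (snd x)" and n: "norm (snd x) = 1"
   show "cut (rhs f' (%x. u x + q (fst x))) x = cut (rhs f u) x + indicator Om (fst x) * (snd x \<bullet> G (fst x))"
   proof (cases "fst x : Om")
    case True
    then show ?thesis using s scattering_fst[OF True n, of q] src[OF True, of "snd x"]
     by (simp add: cut_def rhs_def algebra_simps)
   qed (simp add: cut_def)
  qed
 qed
 show ?thesis
  unfolding transport_equation_iff[OF iuq f']
 proof (intro allI impI)
  fix ph assume ph: "phase_test_function Om ph"
  then have s: "smooth ph" by (simp add: phase_test_function_def)
  obtain C where C: "C >= 0" "!!x. norm (snd x) = 1 ==> \<bar>ph x\<bar> <= C"
    "!!x. norm (snd x) = 1 ==> \<bar>transport_deriv ph x\<bar> <= C"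
   using phase_test_function_bounded[OF ph] by blast
  have i1: "integrable phase_space (%x. h x * transport_deriv ph x)" if "integrable phase_space h" for h
   by (rule integrable_mult_bounded[OF that, where C=C])
     (use C measurable_phase_continuous[OF continuous_transport_deriv[OF s]] in \<open>auto simp: space_phase\<close>)
  have i2: "integrable phase_space (%x. h x * ph x)" if "integrable phase_space h" for h
   by (rule integrable_mult_bounded[OF that, where C=C])
     (use C measurable_phase_continuous[OF smooth_continuous[OF s]] in \<open>auto simp: space_phase\<close>)
  have m2: "(%x. h x * ph x) : borel_measurable phase_space" if "integrable phase_space h" for h
   using i2[OF that] by (rule borel_measurable_integrable)
  have "(\<integral>x. cut (%x. u x + q (fst x)) x * transport_deriv ph x \<partial>phase_space) =
    (\<integral>x. cut u x * transport_deriv ph x \<partial>phase_space) + (\<integral>x. cut (%x. q (fst x)) x * transport_deriv ph x \<partial>phase_space)"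
   unfolding cadd using i1[OF u] i1[OF iq] by (simp add: distrib_right)
  also have "\<dots> = - (\<integral>x. cut (rhs f u) x * ph x \<partial>phase_space) + - (\<integral>x. indicator Om (fst x) * (snd x \<bullet> G (fst x)) * ph x \<partial>phase_space)"
   using eq[unfolded transport_equation_iff[OF u f]] ph weak_gradient_transport[OF wg q G ph] by (simp add: cq)
  also have "\<dots> = - (\<integral>x. (cut (rhs f u) x + indicator Om (fst x) * (snd x \<bullet> G (fst x))) * ph x \<partial>phase_space)"
   using i2[OF integrable_cut_rhs[OF u f]] i2[OF iG] by (simp add: distrib_right)
  also have "\<dots> = - (\<integral>x. cut (rhs f' (%x. u x + q (fst x))) x * ph x \<partial>phase_space)"
  proof (intro arg_cong[where f=uminus] integral_cong_AE m2 integrable_cut_rhs[OF iuq f'] Bochner_Integration.integrable_add iG integrable_cut_rhs[OF u f])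
   show "AE x in phase_space. (cut (rhs f u) x + indicator Om (fst x) * (snd x \<bullet> G (fst x))) * ph x = cut (rhs f' (%x. u x + q (fst x))) x * ph x"
    using AEr by eventually_elim simp
  qed
  finally show "(\<integral>x. cut (%x. u x + q (fst x)) x * transport_deriv ph x \<partial>phase_space) =
    - (\<integral>x. cut (rhs f' (%x. u x + q (fst x))) x * ph x \<partial>phase_space)" .
 qed
qed

end

section \<open>Sources with the same data\<close>

theorem part_one:
 assumes Om: "strictly_convex_domain Om"
  and a: "Ck_closure 3 Om a" and k: "C3_kernel Om k" and wp: "well_posed Om a k"
  and sg: "sg = (%z. a z - zeroth_coeff k z)" and pos: "\<forall>z\<in>closure Om. sg z > 0"
  and p: "p > 4" and f: "sobolev 3 p Om f" and ft: "sobolev 3 p Om ft" and Ft: "sobolev_field 3 p Om Ft"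
  and C0: "C0_closure Om (%z. (f z - ft z) / sg z)"
  and G: "G = weak_gradient Om (%z. (f z - ft z) / sg z)" and F: "F = (%z. Ft z + G z)"
 shows "has_weak_gradient Om (%z. (f z - ft z) / sg z) G & sobolev_field 0 p Om F \<and>
   has_boundary_data Om a k p f F (boundary_data Om a k p f F) \<and>
   has_boundary_data Om a k p ft Ft (boundary_data Om a k p ft Ft) \<and>
   same_data Om (boundary_data Om a k p f F) (boundary_data Om a k p ft Ft)"
proof -
 interpret convex_domain Om
  using Om by unfold_locales (auto simp: strictly_convex_domain_def strictly_convex_def)
 have three: "3 = Suc 2" by simp
 define kp where "kp = (%(z, t). k z (cos t))"
 have ckp: "continuous_on (closure Om \<times> UNIV) kp"
  using Ck_closure_continuous_gen[OF k[unfolded C3_kernel_def]] by (simp add: kp_def closure_Times)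
 interpret transport_medium Om a k
 proof unfold_locales
  show "continuous_on (closure Om) a" by (rule Ck_closure_continuous[OF a])
  \<comment> \<open>Regularity is given in the angle, while the medium needs the kernel as a
    function of the cosine; \<open>arccos\<close> inverts the cosine continuously on
    [-1, 1].\<close>
  have "continuous_on (closure Om \<times> {-1..1}) (%x. kp (fst x, arccos (snd x)))"
   by (rule continuous_on_compose2[OF ckp]) (auto intro!: continuous_intros)
  then show "continuous_on (closure Om \<times> {-1..1}) (%(z, s). k z s)"
   by (rule continuous_on_eq) (auto simp: kp_def cos_arccos)
 qed
 obtain gma gmk where "c1 a gma" "c1 (zeroth_coeff k) gmk"
  using c1_Ck[of 2 a] a c1_zeroth_coeff[OF k] by (metis three)
 then have "c1 sg (%z. gma z - gmk z)" unfolding sg by (rule c1_diff)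
 then have "\<exists>gm. c1 (%z. 1 / sg z) gm" using c1_inverse pos by blast
 then obtain gm where gm: "c1 (%z. 1 / sg z) gm" by blast
 have cta: "continuous_on (closure Om) (%z. 1 / sg z)" and cgm: "continuous_on (closure Om) (%z. gm z $ i)" for i
  using gm by (auto simp: c1_def intro: continuous_intros)
 have Lf: "Lp domain_measure p f" "Lp domain_measure p ft" using f ft by (auto intro: sobolev_Lp)
 have LFt: "Lp domain_measure p (%z. Ft z $ i)" for i by (rule sobolev_field_Lp[OF Ft])
 obtain g gt where g: "has_weak_gradient Om f g" "!!i. Lp domain_measure p (%z. g z $ i)"
  and gt: "has_weak_gradient Om ft gt" "!!i. Lp domain_measure p (%z. gt z $ i)"
  using sobolev_weak_gradient[of 2 p f] sobolev_weak_gradient[of 2 p ft] f ft by (metis three)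
 have p0: "p >= 0" "p >= 1" "p > 1" using p by auto
 have L_mult: "Lp domain_measure p (%z. h z * ta z)" if h: "Lp domain_measure p h" and ta: "continuous_on (closure Om) ta" for h ta
 proof -
  obtain B where B: "B >= 0" "!!z. z : closure Om ==> norm (ta z) <= B" using bounded_closure[OF ta] by blast
  show ?thesis
  proof (rule Lp_mult_bounded[OF h _ _ p0(1)])
   show "ta : borel_measurable domain_measure"
    using measurable_indicator_continuous[OF ta] by (simp add: measurable_domain_iff)
   show "\<bar>ta x\<bar> <= B" if "x : space domain_measure" for x
    using B(2)[of x] that closure_subset by (auto simp: space_restrict_space)
  qed
 qed
 have L_minus: "Lp domain_measure p (%z. - h z)" if "Lp domain_measure p h" for h
  using that by (simp add: Lp_def)
 define q where "q z = (f z - ft z) / sg z" for z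
 define d where "d z = f z - ft z" for z
 have Ld: "Lp domain_measure p d"
  using Lp_add[OF Lf(1) L_minus[OF Lf(2)] p0(1)] by (simp add: d_def[abs_def])
 have Ldg: "Lp domain_measure p (%z. (g z - gt z) $ i)" for i
  using Lp_add[OF g(2) L_minus[OF gt(2)] p0(1)] by simp
 have wd: "has_weak_gradient Om d (%z. g z - gt z)"
  unfolding d_def[abs_def]
  by (intro has_weak_gradient_diff g(1) gt(1) Lp_int_on[OF _ p0(2)] Lf g(2) gt(2))
 \<comment> \<open>The product rule for \<open>d\<close> times \<open>1 / sg\<close> yields an
   explicit gradient with components in \<open>Lp\<close>; uniqueness of weak derivatives transfers
   the integrability to the chosen \<open>G\<close>.\<close>
 define G0 where "G0 z = (1 / sg z) *\<^sub>R (g z - gt z) + d z *\<^sub>R gm z" for z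
 have qe: "q = (%z. d z * (1 / sg z))" by (auto simp: q_def d_def)
 have wq: "has_weak_gradient Om q G0"
  unfolding qe G0_def[abs_def]
  by (intro weak_gradient_mult wd gm Lp_int_on[OF _ p0(2)] Ld Ldg)
 have LG0: "Lp domain_measure p (%z. G0 z $ i)" for i
 proof -
  have "Lp domain_measure p (%z. (g z - gt z) $ i * (1 / sg z) + d z * gm z $ i)"
   by (intro Lp_add L_mult Ldg Ld cta cgm p0)
  then show ?thesis by (simp add: G0_def[abs_def])
 qed
 have Gq: "G = weak_gradient Om q" by (simp add: G q_def[abs_def])
 have wG: "has_weak_gradient Om q G"
  unfolding Gq weak_gradient_def by (rule someI[of "has_weak_gradient Om q"]) (rule wq)
 have GG0: "AE z in domain_measure. G z $ i = G0 z $ i" for i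
  using weak_partial_unique[of "axis i 1" q "%z. G z $ i" "%z. G0 z $ i"] wG wq
  by (simp add: has_weak_gradient_iff AE_restrict_space_iff)
 have LG: "Lp domain_measure p (%z. G z $ i)" for i
 proof (rule Lp_AE_cong[OF LG0 _ GG0])
  show "(%z. G z $ i) : borel_measurable domain_measure"
   by (rule locally_integrable_measurable) (use wG in \<open>auto simp: has_weak_gradient_iff has_weak_partial_def\<close>)
 qed
 have LF: "Lp domain_measure p (%z. F z $ i)" for i
  using Lp_add[OF LFt LG p0(1)] by (simp add: F)
 have sF: "sobolev_field 0 p Om F"
  unfolding sobolev_field_def using LF by (auto simp: Basis_plane inner_axis_plane)
 have b1: "has_boundary_data Om a k p f F (boundary_data Om a k p f F)"
  by (rule boundary_data_exists[OF wp p0(3) Lf(1) LF])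
 have b2: "has_boundary_data Om a k p ft Ft (boundary_data Om a k p ft Ft)"
  by (rule boundary_data_exists[OF wp p0(3) Lf(2) LFt])
 let ?g1 = "boundary_data Om a k p f F" and ?g2 = "boundary_data Om a k p ft Ft"
 let ?s1 = "anisotropic_source f F" and ?s2 = "anisotropic_source ft Ft"
 from b1 obtain u1 where u1: "transport_solution Om a k p ?s1 u1" "has_outflow_trace Om u1 ?g1"
  by (auto simp: has_boundary_data_def)
 from b2 obtain u2 where u2: "transport_solution Om a k p ?s2 u2" "has_outflow_trace Om u2 ?g2"
  by (auto simp: has_boundary_data_def)
 have Ls1: "Lp (phase_measure Om) p ?s1" and Ls2: "Lp (phase_measure Om) p ?s2"
  by (intro Lp_anisotropic Lf LF LFt p0)+
 have Lq: "Lp domain_measure p q" unfolding qe by (intro L_mult Ld cta)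
 have Lu2: "Lp (phase_measure Om) p u2" using u2 by (simp add: transport_solution_def)
 have te: "transport_equation Om a k ?s1 (%x. u2 x + q (fst x))"
 proof (rule add_isotropic_solution[OF Lp_cut[OF Lu2 p0(2)] Lp_cut[OF Ls2 p0(2)] _ wG _ _ Lp_cut[OF Ls1 p0(2)]])
  show "transport_equation Om a k ?s2 u2" using u2 by (simp add: transport_solution_def)
  show "int_on q" by (rule Lp_int_on[OF Lq p0(2)])
  show "int_on (%z. G z $ i)" for i by (rule Lp_int_on[OF LG p0(2)])
  fix z th assume z: "z : Om"
  then have "sg z > 0" using pos closure_subset by blast
  then have "(a z - zeroth_coeff k z) * q z = f z - ft z" by (simp add: q_def sg)
  then show "?s1 (z, th) = ?s2 (z, th) + (a z - zeroth_coeff k z) * q z + th \<bullet> G z"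
   by (simp add: anisotropic_source_def F inner_add_right)
 qed
 \<comment> \<open>Traces are limits of pointwise values, so the continuous representative
   \<open>h\<close> enters them instead of \<open>q\<close>, which is fixed only up to null
   sets.\<close>
 from C0 obtain h where h: "continuous_on (closure Om) h" "!!\<zeta>. \<zeta> : frontier Om ==> h \<zeta> = 0"
  and qh: "AE z in domain_measure. q z = h z"
  by (auto simp: C0_closure_def q_def[abs_def])
 have qh': "AE x in phase_space. fst x : Om --> q (fst x) = h (fst x)"
  using qh by (intro AE_phase_fst) (simp add: AE_restrict_space_iff)
 have trace_add: "trace_on e B (%x. v x + h (fst x)) g" if e: "enters e B" and v: "trace_on e B v g" for e B v g
  unfolding trace_on_def AE_boundary_def
  using v[unfolded trace_on_def AE_boundary_def]
 proof eventually_elim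
  fix y :: "real \<times> plane"
  assume y: "case y of (s, th) => \<forall>\<zeta>. (\<zeta>, th) : B & \<zeta> \<bullet> perp th = s --> ((%t. v (\<zeta> - (e * t) *\<^sub>R th, th)) \<longlongrightarrow> g (\<zeta>, th)) (at_right 0)"
  have hl: "((%t. h (\<zeta> - (e * t) *\<^sub>R th)) \<longlongrightarrow> 0) (at_right 0)" if "(\<zeta>, th) : B" for \<zeta> th
  proof -
   have \<zeta>: "\<zeta> : frontier Om" using e that by (auto simp: enters_def)
   then have "\<zeta> : closure Om" by (simp add: frontier_def)
   with h(1) have ch: "(h \<longlongrightarrow> h \<zeta>) (at \<zeta> within closure Om)" by (simp add: continuous_on_def)
   have "((%t. \<zeta> - (e * t) *\<^sub>R th) \<longlongrightarrow> \<zeta> - (e * 0) *\<^sub>R th) (at_right 0)" by (intro tendsto_intros)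
   then have l: "((%t. \<zeta> - (e * t) *\<^sub>R th) \<longlongrightarrow> \<zeta>) (at_right 0)" by simp
   have "\<zeta> \<notin> Om" using \<zeta> op by (simp add: frontier_def interior_open)
   have "\<forall>\<^sub>F t in at_right 0. \<zeta> - (e * t) *\<^sub>R th : closure Om & \<zeta> - (e * t) *\<^sub>R th ~= \<zeta>"
    using entersD[OF e that]
   proof eventually_elim
    fix t assume t: "\<zeta> - (e * t) *\<^sub>R th : Om"
    have "\<zeta> - (e * t) *\<^sub>R th ~= \<zeta>" using t \<open>\<zeta> \<notin> Om\<close> by metis
    then show "\<zeta> - (e * t) *\<^sub>R th : closure Om & \<zeta> - (e * t) *\<^sub>R th ~= \<zeta>"
     using subsetD[OF closure_subset t] by blast
   qed
   then have "filterlim (%t. \<zeta> - (e * t) *\<^sub>R th) (at \<zeta> within closure Om) (at_right 0)"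
    unfolding filterlim_at using l by blast
   from filterlim_compose[OF ch this] show ?thesis using h(2)[OF \<zeta>] by simp
  qed
  show "case y of (s, th) => \<forall>\<zeta>. (\<zeta>, th) : B & \<zeta> \<bullet> perp th = s -->
    ((%t. v (\<zeta> - (e * t) *\<^sub>R th, th) + h (fst (\<zeta> - (e * t) *\<^sub>R th, th))) \<longlongrightarrow> g (\<zeta>, th)) (at_right 0)"
   unfolding case_prod_beta
  proof (intro allI impI, elim conjE)
   fix \<zeta> assume B: "(\<zeta>, snd y) : B" and s: "\<zeta> \<bullet> perp (snd y) = fst y"
   have "((%t. v (\<zeta> - (e * t) *\<^sub>R snd y, snd y)) \<longlongrightarrow> g (\<zeta>, snd y)) (at_right 0)"
    using y B s unfolding case_prod_beta by blast
   from tendsto_add[OF this hl[OF B]]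
   show "((%t. v (\<zeta> - (e * t) *\<^sub>R snd y, snd y) + h (fst (\<zeta> - (e * t) *\<^sub>R snd y, snd y))) \<longlongrightarrow> g (\<zeta>, snd y)) (at_right 0)"
    by simp
  qed
 qed
 have rep_add: "AE x in phase_space. fst x : Om --> v x + h (fst x) = u2 x + q (fst x)"
  if "AE x in phase_space. fst x : Om --> v x = u2 x" for v
  using that qh' by eventually_elim auto
 have tin: "has_inflow_trace Om (%x. u2 x + q (fst x)) (%_. 0)"
 proof -
  have "has_inflow_trace Om u2 (%_. 0)" using u2 by (simp add: transport_solution_def)
  then obtain v where v: "AE x in phase_space. fst x : Om --> v x = u2 x" "trace_on (- 1) (inflow Om) v (%_. 0)"
   unfolding has_inflow_trace_iff by blast
  show ?thesis unfolding has_inflow_trace_iff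
   by (intro exI[of _ "%x. v x + h (fst x)"] conjI rep_add[OF v(1)] trace_add[OF enters_inflow v(2)])
 qed
 have sol: "transport_solution Om a k p ?s1 (%x. u2 x + q (fst x))"
  unfolding transport_solution_def using te tin Lp_add[OF Lu2 Lp_phase_fst[OF Lq] p0(1)] by simp
 \<comment> \<open>The solution behind \<open>boundary_data\<close> was chosen; uniqueness
   identifies it with the constructed \<open>u2 + q\<close>.\<close>
 have uniq: "AE x in phase_space. fst x : Om --> u1 x = u2 x + q (fst x)"
 proof -
  obtain u where "!!v. transport_solution Om a k p ?s1 v ==> (AE x in phase_measure Om. v x = u x)"
   using wp p0(3) Ls1 unfolding well_posed_def by blast
  from this[OF u1(1)] this[OF sol] show ?thesis
   unfolding AE_phase_measure[OF borel_domain] by eventually_elim auto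
 qed
 obtain v1 where v1: "AE x in phase_space. fst x : Om --> v1 x = u1 x" "trace_on 1 (outflow Om) v1 ?g1"
  using u1(2) unfolding has_outflow_trace_iff by blast
 obtain v2 where v2: "AE x in phase_space. fst x : Om --> v2 x = u2 x" "trace_on 1 (outflow Om) v2 ?g2"
  using u2(2) unfolding has_outflow_trace_iff by blast
 have "AE x in phase_space. fst x : Om --> v1 x = v2 x + h (fst x)"
  using v1(1) rep_add[OF v2(1)] uniq by eventually_elim auto
 from trace_unique[OF enters_outflow this v1(2) trace_add[OF enters_outflow v2(2)]]
 have "same_data Om ?g1 ?g2" by (simp add: same_data_def)
 then show ?thesis using wG sF b1 b2 by (simp add: q_def[abs_def])
qed

section \<open>Functions of the direction with nonnegative modes\<close>

lemma bounded_integrable_mult: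
 fixes V g :: "'a => complex"
 assumes V: "integrable M V" and m: "g : borel_measurable M" and b: "!!x. x : space M ==> norm (g x) <= B"
 shows "integrable M (%x. g x * V x)"
proof (rule Bochner_Integration.integrable_bound[of M "%x. B * norm (V x)"])
 show "integrable M (%x. B * norm (V x))" using V by simp
 show "(%x. g x * V x) : borel_measurable M" using V m by simp
 show "AE x in M. norm (g x * V x) <= norm (B * norm (V x))"
 proof (rule AE_I2)
  fix x assume "x : space M"
  then have "norm (g x) * norm (V x) <= \<bar>B\<bar> * norm (V x)" using b[of x] by (intro mult_right_mono) auto
  then show "norm (g x * V x) <= norm (B * norm (V x))" by (simp add: norm_mult abs_mult)
 qed
qed

text \<open>The Hardy class of bounded functions, encoded by its action as multipliers: taking
  \<open>V = zeta\<close> in the last clause shows that all negative Fourier coefficients of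
  \<open>g\<close> vanish. In this form closure under products and bounded limits is immediate,
  without any Fourier series of \<open>g\<close>.\<close>

definition hardy :: "(plane => complex) => bool" where
 "hardy g \<longleftrightarrow> g : borel_measurable circle_measure & (\<exists>B. \<forall>th. norm th = 1 --> norm (g th) <= B) \<and>
   (\<forall>V. integrable circle_measure V --> (\<forall>n. (\<integral>th. V th * zeta th ^ n \<partial>circle_measure) = 0) -->
    (\<forall>n. (\<integral>th. g th * V th * zeta th ^ n \<partial>circle_measure) = 0))"

lemma hardy_measurable: "hardy g ==> g : borel_measurable circle_measure"
 by (simp add: hardy_def)

lemma hardyD:
 "hardy g ==> integrable circle_measure V ==> (!!n. (\<integral>th. V th * zeta th ^ n \<partial>circle_measure) = 0) ==>
  (\<integral>th. g th * V th * zeta th ^ n \<partial>circle_measure) = 0"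
 by (simp add: hardy_def)

lemma hardy_integrable:
 assumes "hardy g" "integrable circle_measure V"
 shows "integrable circle_measure (%th. g th * V th)"
proof -
 from assms(1) obtain B where "!!th. norm th = 1 ==> norm (g th) <= B" by (auto simp: hardy_def)
 then show ?thesis
  by (intro bounded_integrable_mult[OF assms(2) hardy_measurable[OF assms(1)], of B]) (auto simp: space_circle)
qed

lemma integrable_mult_zeta_power:
 assumes "integrable circle_measure V"
 shows "integrable circle_measure (%th. V th * zeta th ^ n)"
 using bounded_integrable_mult[OF assms, of "%th. zeta th ^ n" 1]
 by (simp add: space_circle norm_power norm_zeta mult.commute)

lemma hardyI:
 assumes "g : borel_measurable circle_measure" "!!th. norm th = 1 ==> norm (g th) <= B"
  and "!!V n. integrable circle_measure V ==> (!!n. (\<integral>th. V th * zeta th ^ n \<partial>circle_measure) = 0) ==>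
    (\<integral>th. g th * V th * zeta th ^ n \<partial>circle_measure) = 0"
 shows "hardy g"
 unfolding hardy_def using assms(1,3) assms(2) by blast

lemma hardy_const: "hardy (%_. c)"
 by (rule hardyI[where B="norm c"]) (simp_all add: mult.assoc)

lemma hardy_zeta: "hardy zeta"
proof (rule hardyI[where B=1])
 fix V :: "plane => complex" and n assume "!!n. (\<integral>th. V th * zeta th ^ n \<partial>circle_measure) = 0"
 from this[of "Suc n"] show "(\<integral>th. zeta th * V th * zeta th ^ n \<partial>circle_measure) = 0"
  by (simp add: mult_ac)
qed (auto simp: norm_zeta)

lemma hardy_add:
 assumes f: "hardy f" and g: "hardy g"
 shows "hardy (%th. f th + g th)"
proof -
 from f g obtain A B where A: "!!th. norm th = 1 ==> norm (f th) <= A" and B: "!!th. norm th = 1 ==> norm (g th) <= B"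
  by (auto simp: hardy_def)
 show ?thesis
 proof (rule hardyI[where B="A + B"])
  show "(%th. f th + g th) : borel_measurable circle_measure" using f g by (auto simp: hardy_def)
  show "norm (f th + g th) <= A + B" if "norm th = 1" for th
   using A[OF that] B[OF that] norm_triangle_ineq[of "f th" "g th"] by linarith
  fix V n assume V: "integrable circle_measure V" "!!n. (\<integral>th. V th * zeta th ^ n \<partial>circle_measure) = 0"
  show "(\<integral>th. (f th + g th) * V th * zeta th ^ n \<partial>circle_measure) = 0"
   using hardyD[OF f V] hardyD[OF g V]
    integrable_mult_zeta_power[OF hardy_integrable[OF f V(1)]] integrable_mult_zeta_power[OF hardy_integrable[OF g V(1)]]
   by (simp add: distrib_right)
 qed
qed

lemma hardy_mult:
 assumes f: "hardy f" and g: "hardy g"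
 shows "hardy (%th. f th * g th)"
proof -
 from f g obtain A B where A: "!!th. norm th = 1 ==> norm (f th) <= A" and B: "!!th. norm th = 1 ==> norm (g th) <= B"
  by (auto simp: hardy_def)
 show ?thesis
 proof (rule hardyI[where B="A * B"])
  show "(%th. f th * g th) : borel_measurable circle_measure" using f g by (auto simp: hardy_def)
  show "norm (f th * g th) <= A * B" if "norm th = 1" for th
   unfolding norm_mult using A[OF that] B[OF that] order_trans[OF norm_ge_zero A[OF that]] by (intro mult_mono) auto
  fix V n assume V: "integrable circle_measure V" "!!n. (\<integral>th. V th * zeta th ^ n \<partial>circle_measure) = 0"
  show "(\<integral>th. f th * g th * V th * zeta th ^ n \<partial>circle_measure) = 0"
   using hardyD[OF f hardy_integrable[OF g V(1)] hardyD[OF g V]] by (simp add: mult.assoc)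
 qed
qed

lemma hardy_power: "hardy g ==> hardy (%th. g th ^ n)"
 by (induction n) (auto intro: hardy_const hardy_mult)

lemma hardy_sum: "(!!i. i : I ==> hardy (f i)) ==> hardy (%th. \<Sum>i\<in>I. f i th)"
 by (induction I rule: infinite_finite_induct) (auto intro: hardy_const hardy_add)

text \<open>Dominated convergence, with \<open>B * norm (V th)\<close> as majorant. The exponential
  series, the geometric series and the limit of the kernels all pass through here.\<close>

lemma hardy_limit:
 assumes h: "!!j. hardy (g j)" and b: "!!j th. norm th = 1 ==> norm (g j th) <= B"
  and lim: "!!th. norm th = 1 ==> (%j. g j th) \<longlonglongrightarrow> G th"
 shows "hardy G"
proof (rule hardyI[where B=B])
 show m: "G : borel_measurable circle_measure"
  by (rule borel_measurable_LIMSEQ_metric[of g]) (auto simp: space_circle lim intro: hardy_measurable h)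
 show bG: "norm (G th) <= B" if "norm th = 1" for th
  by (rule LIMSEQ_le_const2[OF tendsto_norm[OF lim[OF that]]]) (use b[OF that] in auto)
 fix V n assume V: "integrable circle_measure V" "!!n. (\<integral>th. V th * zeta th ^ n \<partial>circle_measure) = 0"
 have "(%j. \<integral>th. g j th * V th * zeta th ^ n \<partial>circle_measure) \<longlonglongrightarrow> (\<integral>th. G th * V th * zeta th ^ n \<partial>circle_measure)"
 proof (rule integral_dominated_convergence[where w="%th. B * norm (V th)"])
  show "integrable circle_measure (%th. B * norm (V th))" using V by simp
  show "(%th. G th * V th * zeta th ^ n) : borel_measurable circle_measure" using m V by measurable
  show "(%th. g j th * V th * zeta th ^ n) : borel_measurable circle_measure" for j
   using hardy_measurable[OF h[of j]] V by measurable
  show "AE th in circle_measure. (%j. g j th * V th * zeta th ^ n) \<longlonglongrightarrow> G th * V th * zeta th ^ n"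
   by (intro AE_I2 tendsto_mult tendsto_const lim) (auto simp: space_circle)
  show "AE th in circle_measure. norm (g j th * V th * zeta th ^ n) <= B * norm (V th)" for j
   by (intro AE_I2) (auto simp: space_circle norm_mult norm_power norm_zeta intro!: mult_right_mono b)
 qed
 then show "(\<integral>th. G th * V th * zeta th ^ n \<partial>circle_measure) = 0"
  using hardyD[OF h V] by (simp add: LIMSEQ_const_iff)
qed

text \<open>The partial sums of the exponential series are bounded by \<open>exp B\<close> uniformly
  in the direction. Applied to \<open>g\<close> and to \<open>- g\<close>, this covers the
  integrating factor and its inverse.\<close>

lemma hardy_exp:
 assumes g: "hardy g"
 shows "hardy (%th. exp (g th))"
proof -
 from g obtain B where B: "!!th. norm th = 1 ==> norm (g th) <= B" by (auto simp: hardy_def)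
 show ?thesis
 proof (rule hardy_limit[where B="exp B" and g="%j th. \<Sum>k<j. (1 / fact k) * g th ^ k"])
  show "hardy (%th. \<Sum>k<j. (1 / fact k) * g th ^ k)" for j
   by (intro hardy_sum hardy_mult hardy_const hardy_power g)
  fix th :: plane assume n: "norm th = 1"
  have "(%k. g th ^ k /\<^sub>R fact k) sums exp (g th)" by (rule exp_converges)
  then show "(%j. \<Sum>k<j. (1 / fact k) * g th ^ k) \<longlonglongrightarrow> exp (g th)"
   by (simp add: sums_def scaleR_conv_of_real divide_inverse)
  have B0: "B >= 0" using B[OF n] norm_ge_zero order_trans by blast
  show "norm (\<Sum>k<j. (1 / fact k) * g th ^ k) <= exp B" for j
  proof -
   have "norm (\<Sum>k<j. (1 / fact k) * g th ^ k) <= (\<Sum>k<j. norm ((1 / fact k) * g th ^ k))" by (rule norm_sum)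
   also have "\<dots> <= (\<Sum>k<j. B ^ k /\<^sub>R fact k)"
    by (intro sum_mono) (auto simp: norm_mult norm_power norm_divide divide_simps intro!: power_mono B n)
   also have "\<dots> <= exp B"
    using exp_converges[of B] B0 by (intro sum_le_suminf[THEN order_trans]) (auto simp: sums_iff)
   finally show ?thesis .
  qed
 qed
qed

text \<open>With \<open>x th\<close>, whose modulus is the constant \<open>r < 1\<close>, the
  fraction is \<open>zeta th * w / A\<close> times a geometric series in \<open>x th\<close>, and
  only nonnegative powers of \<open>zeta th\<close> occur.\<close>

lemma hardy_fraction:
 assumes A: "A > (norm w)\<^sup>2"
 shows "hardy (%th. zeta th * w / (complex_of_real A - (zeta th * w)\<^sup>2))"
proof -
 have A0: "A > 0" using A zero_le_power2[of "norm w"] by linarith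
 define r where "r = (norm w)\<^sup>2 / A"
 have r: "0 <= r" "r < 1" using A A0 by (auto simp: r_def)
 define x where "x th = (zeta th * w)\<^sup>2 / of_real A" for th
 have nx: "norm (x th) = r" if "norm th = 1" for th
  using that A0 by (simp add: x_def r_def norm_divide norm_power norm_mult norm_zeta power_mult_distrib)
 have hx: "hardy x"
 proof -
  have "hardy (%th. (zeta th * w) * (zeta th * w) * (1 / of_real A))"
   by (intro hardy_mult hardy_zeta hardy_const)
  then show ?thesis by (simp add: x_def[abs_def] power2_eq_square)
 qed
 show ?thesis
 proof (rule hardy_limit[where B="norm w / A * (1 / (1 - r))" and g="%j th. zeta th * (w / of_real A) * (\<Sum>k<j. x th ^ k)"])
  show "hardy (%th. zeta th * (w / of_real A) * (\<Sum>k<j. x th ^ k))" for j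
   by (intro hardy_sum hardy_mult hardy_const hardy_power hardy_zeta hx)
  fix th :: plane assume n: "norm th = 1"
  have ne: "1 - x th ~= 0" using nx[OF n] r by auto
  have "(%k. x th ^ k) sums (1 / (1 - x th))" using nx[OF n] r by (intro geometric_sums) auto
  then have "(%j. zeta th * (w / of_real A) * (\<Sum>k<j. x th ^ k)) \<longlonglongrightarrow> zeta th * (w / of_real A) * (1 / (1 - x th))"
   by (intro tendsto_mult tendsto_const) (simp add: sums_def)
  moreover have "complex_of_real A * (1 - x th) = complex_of_real A - (zeta th * w)\<^sup>2"
   using A0 by (simp add: x_def right_diff_distrib)
  ultimately show "(%j. zeta th * (w / of_real A) * (\<Sum>k<j. x th ^ k)) \<longlonglongrightarrow> zeta th * w / (complex_of_real A - (zeta th * w)\<^sup>2)"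
   using A0 ne by (simp add: divide_simps mult_ac)
  show "norm (zeta th * (w / of_real A) * (\<Sum>k<j. x th ^ k)) <= norm w / A * (1 / (1 - r))" for j
  proof -
   have "norm (\<Sum>k<j. x th ^ k) <= (\<Sum>k<j. r ^ k)"
    using norm_sum[of "%k. x th ^ k" "{..<j}"] nx[OF n] by (simp add: norm_power)
   also have "\<dots> <= 1 / (1 - r)"
    using geometric_sums[of r] r by (intro sum_le_suminf[THEN order_trans]) (auto simp: sums_iff)
   finally have "norm w / A * norm (\<Sum>k<j. x th ^ k) <= norm w / A * (1 / (1 - r))"
    using A0 by (intro mult_left_mono) auto
   then show ?thesis using n A0 by (simp add: norm_mult norm_zeta norm_divide)
  qed
 qed
qed

text \<open>Fubini moves the angular integral inside, where it vanishes for each parameter;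
  \<open>w\<close> dominates uniformly in the direction.\<close>

lemma hardy_integral:
 fixes kp :: "plane => plane => complex"
 assumes m: "(%x. kp (fst x) (snd x)) : borel_measurable (lborel \<Otimes>\<^sub>M circle_measure)"
  and h: "!!y. hardy (kp y)" and b: "!!y th. norm th = 1 ==> norm (kp y th) <= w y" and w: "integrable lborel w"
 shows "hardy (%th. \<integral>y. kp y th \<partial>lborel)"
proof (rule hardyI[where B="\<integral>y. w y \<partial>lborel"])
 note [measurable] = m
 have w0: "w y >= 0" for y
 proof -
  obtain th :: plane where "norm th = 1" using vector_choose_size[of 1] by auto
  from order_trans[OF norm_ge_zero b[OF this]] show ?thesis .
 qed
 show "(%th. \<integral>y. kp y th \<partial>lborel) : borel_measurable circle_measure"
  using m by (intro lborel.borel_measurable_lebesgue_integral) (simp add: case_prod_beta' measurable_pair_swap_iff[of _ circle_measure])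
 show "norm (\<integral>y. kp y th \<partial>lborel) <= (\<integral>y. w y \<partial>lborel)" if "norm th = 1" for th
  by (rule order_trans[OF integral_norm_bound integral_mono'[OF w]]) (use b[OF that] w0 in auto)
 fix V n assume V: "integrable circle_measure V" "!!n. (\<integral>th. V th * zeta th ^ n \<partial>circle_measure) = 0"
 have mV[measurable]: "V : borel_measurable circle_measure" using V by simp
 have int: "integrable phase_space (%x. kp (fst x) (snd x) * V (snd x) * zeta (snd x) ^ n)"
 proof (rule Bochner_Integration.integrable_bound)
  show "integrable phase_space (%x. w (fst x) * norm (V (snd x)))"
  proof (rule lc.Fubini_integrable)
   have [measurable]: "w : borel_measurable borel" using w by simp
   show "(%x. w (fst x) * norm (V (snd x))) : borel_measurable phase_space" by measurable
   show "integrable lborel (%y. \<integral>th. norm (w (fst (y, th)) * norm (V (snd (y, th)))) \<partial>circle_measure)"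
    using w by (simp add: abs_mult)
   show "AE y in lborel. integrable circle_measure (%th. w (fst (y, th)) * norm (V (snd (y, th))))"
    using V(1) by simp
  qed
  show "(%x. kp (fst x) (snd x) * V (snd x) * zeta (snd x) ^ n) : borel_measurable phase_space" by measurable
  show "AE x in phase_space. norm (kp (fst x) (snd x) * V (snd x) * zeta (snd x) ^ n) <= norm (w (fst x) * norm (V (snd x)))"
   using w0 b by (intro AE_I2) (auto simp: space_phase norm_mult norm_power norm_zeta abs_mult intro!: mult_right_mono)
 qed
 have "(\<integral>th. (\<integral>y. kp y th \<partial>lborel) * V th * zeta th ^ n \<partial>circle_measure) = (\<integral>th. (\<integral>y. kp y th * V th * zeta th ^ n \<partial>lborel) \<partial>circle_measure)"
  by simp
 also have "\<dots> = (\<integral>y. (\<integral>th. kp y th * V th * zeta th ^ n \<partial>circle_measure) \<partial>lborel)"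
  using lc.Fubini_integral[of "%y th. kp y th * V th * zeta th ^ n"] int by (simp add: case_prod_beta')
 also have "\<dots> = 0" using hardyD[OF h V] by simp
 finally show "(\<integral>th. (\<integral>y. kp y th \<partial>lborel) * V th * zeta th ^ n \<partial>circle_measure) = 0" .
qed

section \<open>Uniqueness of the Fourier transform for compact support\<close>

text \<open>Real trigonometric polynomials with arbitrary frequencies. The product formulas make
  them an algebra, so Stone-Weierstrass applies on compact sets.\<close>

inductive_set trig_functions :: "(plane => real) set" where
 cos: "(%z. cos (\<xi> \<bullet> z)) : trig_functions"
| sin: "(%z. sin (\<xi> \<bullet> z)) : trig_functions"
| add: "f : trig_functions ==> g : trig_functions ==> (%z. f z + g z) : trig_functions"
| scale: "f : trig_functions ==> (%z. c * f z) : trig_functions"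

lemma trig_diff:
 assumes "f : trig_functions" "g : trig_functions"
 shows "(%z. f z - g z) : trig_functions"
 using trig_functions.add[OF assms(1) trig_functions.scale[OF assms(2), of "- 1"]] by simp

lemma trig_mult_cos: "g : trig_functions ==> (%z. cos (\<xi> \<bullet> z) * g z) : trig_functions"
proof (induction rule: trig_functions.induct)
 case (cos \<eta>)
 have "(%z. (1/2) * (cos ((\<xi> - \<eta>) \<bullet> z) + cos ((\<xi> + \<eta>) \<bullet> z))) : trig_functions"
  by (intro trig_functions.intros)
 then show ?case by (simp add: cos_times_cos inner_diff_left inner_add_left)
next
 case (sin \<eta>)
 have "(%z. (1/2) * (sin ((\<xi> + \<eta>) \<bullet> z) - sin ((\<xi> - \<eta>) \<bullet> z))) : trig_functions"
  by (intro trig_functions.intros trig_diff)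
 then show ?case by (simp add: cos_times_sin inner_diff_left inner_add_left)
next
 case (add f g) then show ?case using trig_functions.add by (simp add: distrib_left)
next
 case (scale f c) then show ?case using trig_functions.scale by (simp add: mult.left_commute)
qed

lemma trig_mult_sin: "g : trig_functions ==> (%z. sin (\<xi> \<bullet> z) * g z) : trig_functions"
proof (induction rule: trig_functions.induct)
 case (cos \<eta>)
 show ?case using trig_mult_cos[OF trig_functions.sin[of \<xi>], of \<eta>] by (simp add: mult.commute)
next
 case (sin \<eta>)
 have "(%z. (1/2) * (cos ((\<xi> - \<eta>) \<bullet> z) - cos ((\<xi> + \<eta>) \<bullet> z))) : trig_functions"
  by (intro trig_functions.intros trig_diff)
 then show ?case by (simp add: sin_times_sin inner_diff_left inner_add_left)
next
 case (add f g) then show ?case using trig_functions.add by (simp add: distrib_left)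
next
 case (scale f c) then show ?case using trig_functions.scale by (simp add: mult.left_commute)
qed

lemma trig_mult: "f : trig_functions ==> g : trig_functions ==> (%z. f z * g z) : trig_functions"
proof (induction rule: trig_functions.induct)
 case (add f h) then show ?case using trig_functions.add by (simp add: distrib_right)
next
 case (scale f c) then show ?case using trig_functions.scale by (simp add: mult.assoc)
qed (auto intro: trig_mult_cos trig_mult_sin)

lemma trig_continuous: "f : trig_functions ==> continuous_on S f"
 by (induction rule: trig_functions.induct) (auto intro!: continuous_intros)

lemma trig_bounded: "f : trig_functions ==> \<exists>B. \<forall>z. \<bar>f z\<bar> <= B"
proof (induction rule: trig_functions.induct)
 case (add f g)
 then obtain A B where "\<forall>z. \<bar>f z\<bar> <= A" "\<forall>z. \<bar>g z\<bar> <= B" by auto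
 then have "\<forall>z. \<bar>f z + g z\<bar> <= A + B" by (intro allI order_trans[OF abs_triangle_ineq] add_mono) auto
 then show ?case by blast
next
 case (scale f c)
 then obtain A where "\<forall>z. \<bar>f z\<bar> <= A" by auto
 then have "\<forall>z. \<bar>c * f z\<bar> <= \<bar>c\<bar> * A" by (simp add: abs_mult mult_left_mono)
 then show ?case by blast
qed (auto intro!: exI[of _ 1])

lemma trig_const: "(%_. c) : trig_functions"
 using trig_functions.scale[OF trig_functions.cos[of 0], of c] by simp

text \<open>The frequency is scaled so that the phases at \<open>x\<close> and \<open>y\<close>
  differ by pi. Sine and cosine then both change sign, and they cannot both be zero.\<close>

lemma trig_separates:
 assumes "x ~= y"
 shows "\<exists>f\<in>trig_functions. f x ~= f y"
proof -
 define \<xi> where "\<xi> = (pi / (norm (x - y))\<^sup>2) *\<^sub>R (x - y)"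
 have "\<xi> \<bullet> (x - y) = pi" using \<open>x ~= y\<close> by (simp add: \<xi>_def dot_square_norm)
 then have e: "\<xi> \<bullet> x = \<xi> \<bullet> y + pi" unfolding inner_diff_right by linarith
 have "cos (\<xi> \<bullet> x) ~= cos (\<xi> \<bullet> y) \<or> sin (\<xi> \<bullet> x) ~= sin (\<xi> \<bullet> y)"
 proof (rule ccontr)
  assume "\<not> ?thesis"
  then have "cos (\<xi> \<bullet> y) = 0" "sin (\<xi> \<bullet> y) = 0" by (simp_all add: e)
  then show False using sin_cos_squared_add[of "\<xi> \<bullet> y"] by simp
 qed
 then show ?thesis
  using trig_functions.cos[of \<xi>] trig_functions.sin[of \<xi>] by (elim disjE) (rule bexI, assumption+)+
qed

text \<open>On the compact set \<open>K\<close> every bump is a uniform limit of trigonometric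
  functions, against which \<open>g\<close> integrates to zero; off \<open>K\<close> there is
  nothing to approximate.\<close>

lemma fourier_unique_real:
 fixes g :: "plane => real"
 assumes g: "integrable lborel g" and K: "compact K" "!!z. z \<notin> K ==> g z = 0"
  and c: "!!\<xi>. (\<integral>z. g z * cos (\<xi> \<bullet> z) \<partial>lborel) = 0" and s: "!!\<xi>. (\<integral>z. g z * sin (\<xi> \<bullet> z) \<partial>lborel) = 0"
 shows "AE z in lborel. g z = 0"
proof -
 have mt: "f : borel_measurable borel" if "f : trig_functions" for f
  by (intro borel_measurable_continuous_onI trig_continuous that)
 have it: "integrable lborel (%z. g z * f z)" if f: "f : trig_functions" for f
 proof -
  obtain B where "\<forall>z. \<bar>f z\<bar> <= B" using trig_bounded[OF f] by blast
  then show ?thesis by (intro integrable_mult_bounded[OF g, where C=B]) (use mt[OF f] in auto)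
 qed
 have z: "(\<integral>z. g z * f z \<partial>lborel) = 0" if "f : trig_functions" for f
  using that
 proof (induction rule: trig_functions.induct)
  case (add f h) then show ?case using it[OF add(1)] it[OF add(2)] by (simp add: distrib_left)
 next
  case (scale f c) then show ?case by (simp add: mult.left_commute)
 qed (auto simp: c s)
 interpret function_ring_on trig_functions K
  by (rule function_ring_on.intro[OF K(1) trig_continuous trig_functions.add trig_mult trig_const trig_separates])
 have "AE z in lborel. z : UNIV --> g z = 0"
 proof (rule fundamental_lemma[where S=UNIV])
  fix a b :: plane and n
  show "integrable lborel (%z. indicator (cbox a b) z * g z)"
   using integrable_mult_bounded[OF g, of "indicator (cbox a b)" 1] by (simp add: mult.commute)
  let ?ph = "box_bump n a b"
  have ib: "integrable lborel (%z. g z * ?ph z)"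
   by (rule integrable_mult_bounded[OF g, where C=1]) (use box_bump_bounds[of n a b] in auto)
  have "continuous_on K ?ph" using smooth_continuous[OF smooth_box_bump] continuous_on_subset by blast
  from Stone_Weierstrass[OF this] obtain F where F: "!!j. F j : trig_functions" "LIM j sequentially. F j :> uniformly_on K ?ph"
   by auto
  define N where "N = (\<integral>z. \<bar>g z\<bar> \<partial>lborel)"
  have "\<bar>\<integral>z. g z * ?ph z \<partial>lborel\<bar> <= e * N" if e: "e > 0" for e
  proof -
   have "\<forall>\<^sub>F j in sequentially. \<forall>z\<in>K. dist (F j z) (?ph z) < e"
    using F(2) e unfolding uniform_limit_iff by blast
   then obtain j where "\<forall>z\<in>K. dist (F j z) (?ph z) < e"
    using eventually_happens'[OF sequentially_bot] by blast
   then have j: "dist (F j z) (?ph z) < e" if "z : K" for z using that by blast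
   have "(\<integral>z. g z * ?ph z \<partial>lborel) = (\<integral>z. g z * ?ph z \<partial>lborel) - (\<integral>z. g z * F j z \<partial>lborel)" by (simp add: z[OF F(1)])
   also have "\<dots> = (\<integral>z. g z * (?ph z - F j z) \<partial>lborel)"
    unfolding right_diff_distrib by (rule Bochner_Integration.integral_diff[OF ib it[OF F(1)], symmetric])
   also have "norm \<dots> <= (\<integral>z. e * \<bar>g z\<bar> \<partial>lborel)"
   proof (rule order_trans[OF integral_norm_bound integral_mono'])
    show "integrable lborel (%z. e * \<bar>g z\<bar>)" using g by simp
    show "norm (g z * (?ph z - F j z)) <= e * \<bar>g z\<bar>" for z
    proof (cases "z : K")
     case True
     then have "\<bar>?ph z - F j z\<bar> <= e" using j[OF True] by (simp add: dist_real_def abs_minus_commute)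
     then have "\<bar>g z\<bar> * \<bar>?ph z - F j z\<bar> <= \<bar>g z\<bar> * e" by (intro mult_left_mono) auto
     then show ?thesis by (simp add: abs_mult mult.commute)
    qed (simp add: K(2))
    show "0 <= e * \<bar>g z\<bar>" for z using e by simp
   qed
   finally show ?thesis unfolding N_def by simp
  qed
  note bnd = this
  have N: "N >= 0" by (simp add: N_def)
  have "\<bar>\<integral>z. g z * ?ph z \<partial>lborel\<bar> <= 0"
  proof (rule field_le_epsilon)
   fix e :: real assume e: "e > 0"
   \<comment> \<open>Division by \<open>N + 1\<close> instead of \<open>N\<close> covers the case
     \<open>N = 0\<close>.\<close>
   have "\<bar>\<integral>z. g z * ?ph z \<partial>lborel\<bar> <= (e / (N + 1)) * N" by (rule bnd) (use e N in simp)
   also have "\<dots> <= e" using e N by (simp add: divide_simps)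
   finally show "\<bar>\<integral>z. g z * ?ph z \<partial>lborel\<bar> <= 0 + e" by linarith
  qed
  then show "(\<integral>z. g z * ?ph z \<partial>lborel) = 0" by simp
 qed auto
 then show ?thesis by simp
qed

text \<open>The frequency 0 is left out because the recurrence between modes says nothing there;
  continuity of the transform recovers it.\<close>

lemma fourier_unique:
 fixes g :: "plane => complex"
 assumes g: "integrable lborel g" and K: "compact K" "!!z. z \<notin> K ==> g z = 0"
  and f: "!!\<xi>. \<xi> ~= 0 ==> (\<integral>z. g z * cis (- (\<xi> \<bullet> z)) \<partial>lborel) = 0"
 shows "AE z in lborel. g z = 0"
proof -
 have ic: "integrable lborel (%z. cis (- (\<xi> \<bullet> z)) * g z)" for \<xi>
 proof (rule bounded_integrable_mult[OF g, where B=1])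
  show "(%z. cis (- (\<xi> \<bullet> z))) : borel_measurable lborel"
   by (simp, intro borel_measurable_continuous_onI continuous_intros)
 qed simp
 have ic': "integrable lborel (%z. g z * cis (- (\<xi> \<bullet> z)))" for \<xi> using ic[of \<xi>] by (simp add: mult.commute)
 have all: "(\<integral>z. g z * cis (- (\<xi> \<bullet> z)) \<partial>lborel) = 0" for \<xi>
 proof (cases "\<xi> = 0")
  case True
  \<comment> \<open>Nonzero frequencies tending to 0 along a coordinate axis.\<close>
  define x where "x j = inverse (real (Suc j)) *\<^sub>R (axis 1 1 :: plane)" for j :: nat
  have x0: "x j ~= 0" for j by (simp add: x_def)
  have xl: "(%j. x j) \<longlonglongrightarrow> 0 *\<^sub>R axis 1 1"
   unfolding x_def by (intro tendsto_scaleR LIMSEQ_inverse_real_of_nat tendsto_const)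
  have "(%j. \<integral>z. g z * cis (- (x j \<bullet> z)) \<partial>lborel) \<longlonglongrightarrow> (\<integral>z. g z * cis (- ((0 *\<^sub>R axis 1 1) \<bullet> z)) \<partial>lborel)"
  proof (rule integral_dominated_convergence[where w="%z. norm (g z)"])
   show "AE z in lborel. (%j. g z * cis (- (x j \<bullet> z))) \<longlonglongrightarrow> g z * cis (- ((0 *\<^sub>R axis 1 1) \<bullet> z))"
    by (intro AE_I2 tendsto_intros xl)
  qed (use g ic' in \<open>auto simp: norm_mult intro: borel_measurable_integrable\<close>)
  then show ?thesis using f[OF x0] True by (simp add: LIMSEQ_const_iff)
 qed (rule f)
 have cosz: "(\<integral>z. g z * of_real (cos (\<xi> \<bullet> z)) \<partial>lborel) = 0" and sinz: "(\<integral>z. g z * of_real (sin (\<xi> \<bullet> z)) \<partial>lborel) = 0"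
  and icos: "integrable lborel (%z. g z * of_real (cos (\<xi> \<bullet> z)))" and isin: "integrable lborel (%z. g z * of_real (sin (\<xi> \<bullet> z)))" for \<xi>
 proof -
  \<comment> \<open>As \<open>g\<close> is complex valued, cosine and sine integrals are not real
    and imaginary parts of the transform; they are combinations of its values at
    \<open>\<xi>\<close> and \<open>- \<xi>\<close>.\<close>
  let ?P = "%z. g z * cis (- (\<xi> \<bullet> z))" and ?N = "%z. g z * cis (- ((- \<xi>) \<bullet> z))"
  have c: "(%z. g z * of_real (cos (\<xi> \<bullet> z))) = (%z. (?P z + ?N z) * (1 / 2))"
   by (rule ext) (auto simp: complex_eq_iff field_simps)
  have s: "(%z. g z * of_real (sin (\<xi> \<bullet> z))) = (%z. (?N z - ?P z) * (- \<i> / 2))"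
   by (rule ext) (auto simp: complex_eq_iff field_simps)
  note P = ic'[of \<xi>] and N = ic'[of "- \<xi>"]
  show "integrable lborel (%z. g z * of_real (cos (\<xi> \<bullet> z)))"
   unfolding c by (intro integrable_mult_left Bochner_Integration.integrable_add P N)
  show "integrable lborel (%z. g z * of_real (sin (\<xi> \<bullet> z)))"
   unfolding s by (intro integrable_mult_left Bochner_Integration.integrable_diff P N)
  show "(\<integral>z. g z * of_real (cos (\<xi> \<bullet> z)) \<partial>lborel) = 0"
   unfolding c integral_mult_left_zero Bochner_Integration.integral_add[OF P N] all by simp
  show "(\<integral>z. g z * of_real (sin (\<xi> \<bullet> z)) \<partial>lborel) = 0"
   unfolding s integral_mult_left_zero Bochner_Integration.integral_diff[OF N P] all by simp
 qed
 have "AE z in lborel. Re (g z) = 0"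
 proof (rule fourier_unique_real[OF _ K(1)])
  show "integrable lborel (%z. Re (g z))" using g by simp
  show "(\<integral>z. Re (g z) * cos (\<xi> \<bullet> z) \<partial>lborel) = 0" for \<xi>
   using integral_Re[OF icos[of \<xi>]] cosz[of \<xi>] by simp
  show "(\<integral>z. Re (g z) * sin (\<xi> \<bullet> z) \<partial>lborel) = 0" for \<xi>
   using integral_Re[OF isin[of \<xi>]] sinz[of \<xi>] by simp
 qed (simp add: K)
 moreover have "AE z in lborel. Im (g z) = 0"
 proof (rule fourier_unique_real[OF _ K(1)])
  show "integrable lborel (%z. Im (g z))" using g by simp
  show "(\<integral>z. Im (g z) * cos (\<xi> \<bullet> z) \<partial>lborel) = 0" for \<xi>
   using integral_Im[OF icos[of \<xi>]] cosz[of \<xi>] by simp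
  show "(\<integral>z. Im (g z) * sin (\<xi> \<bullet> z) \<partial>lborel) = 0" for \<xi>
   using integral_Im[OF isin[of \<xi>]] sinz[of \<xi>] by simp
 qed (simp add: K)
 ultimately show ?thesis by eventually_elim (simp add: complex_eq_iff)
qed

section \<open>Limits of the Poisson kernel and its conjugate\<close>

lemma cauchy_density:
 "integrable lborel (%x::real. 1 / (1 + x\<^sup>2))" "(\<integral>x. 1 / (1 + x\<^sup>2) \<partial>(lborel :: real measure)) = pi"
proof -
 have nz: "1 + x\<^sup>2 ~= 0" for x :: real using zero_le_power2[of x] by linarith
 have lim: "((arctan \<circ> real_of_ereal) \<longlongrightarrow> pi / 2) (at_left \<infinity>)" "((arctan \<circ> real_of_ereal) \<longlongrightarrow> - (pi / 2)) (at_right (- \<infinity>))"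
  unfolding ereal_tendsto_simps using tendsto_arctan_at_top tendsto_arctan_at_bot by simp_all
 have ev: "einterval (- \<infinity>) \<infinity> = UNIV" by (auto simp: einterval_def)
 have *: "set_integrable lborel (einterval (- \<infinity>) \<infinity>) (%x::real. 1 / (1 + x\<^sup>2))"
  "(LBINT x=-\<infinity>..\<infinity>. 1 / (1 + x\<^sup>2)) = pi / 2 - (- (pi / 2))"
  by (rule interval_integral_FTC_nonneg[OF _ _ _ _ lim(2,1)]; use nz in \<open>auto intro!: derivative_eq_intros continuous_intros simp: divide_inverse\<close>)+
 show "integrable lborel (%x::real. 1 / (1 + x\<^sup>2))" using *(1) unfolding ev set_integrable_def by simp
 show "(\<integral>x. 1 / (1 + x\<^sup>2) \<partial>(lborel :: real measure)) = pi"
  using *(2) unfolding interval_lebesgue_integral_def ev set_lebesgue_integral_def by simp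
qed

abbreviation real_plane :: "(real \<times> real) measure" where
 "real_plane \<equiv> lborel \<Otimes>\<^sub>M lborel"

lemma integrable_product:
 fixes f g :: "real => real"
 assumes f: "integrable lborel f" and g: "integrable lborel g"
 shows "integrable real_plane (%p. f (fst p) * g (snd p))"
proof (rule lborel_pair.Fubini_integrable)
 have [measurable]: "f : borel_measurable borel" "g : borel_measurable borel" using f g by auto
 show "(%p. f (fst p) * g (snd p)) : borel_measurable real_plane" by measurable
 show "integrable lborel (%x. \<integral>y. norm (f (fst (x, y)) * g (snd (x, y))) \<partial>lborel)" using f by (simp add: abs_mult)
 show "AE x in lborel. integrable lborel (%y. f (fst (x, y)) * g (snd (x, y)))" using g by simp
qed

lemma integrable_box:
 fixes f :: "real \<times> real => real"
 assumes m: "f : borel_measurable real_plane"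
  and b: "!!p. \<bar>f p\<bar> <= C * (indicator {-T..T} (fst p) * indicator {-T..T} (snd p))"
 shows "integrable real_plane f"
proof (rule Bochner_Integration.integrable_bound[OF _ m])
 show "integrable real_plane (%p. C * (indicator {-T..T} (fst p) * indicator {-T..T} (snd p)))"
  by (intro integrable_mult_right integrable_product integrable_indicator_Icc)
 show "AE p in real_plane. norm (f p) <= norm (C * (indicator {-T..T} (fst p) * indicator {-T..T} (snd p)))"
  by (rule AE_I2) (use b in \<open>auto intro: order_trans[OF _ abs_ge_self]\<close>)
qed

text \<open>With \<open>conj_poisson\<close> this is the real and negative imaginary part of 1 / (2
  pi (dl t + i s)). Removing the disc of radius \<open>dl\<close> makes the kernels bounded; since
  the disc is invariant under rotations, the cut does not depend on the direction and spoils no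
  expansion in it.\<close>

definition poisson :: "real => real \<times> real => real" where
 "poisson dl = (%(s, t). (if s\<^sup>2 + t\<^sup>2 > dl\<^sup>2 then dl * t / (dl\<^sup>2 * t\<^sup>2 + s\<^sup>2) else 0) / (2 * pi))"

definition conj_poisson :: "real => real \<times> real => real" where
 "conj_poisson dl = (%(s, t). (if s\<^sup>2 + t\<^sup>2 > dl\<^sup>2 then s / (dl\<^sup>2 * t\<^sup>2 + s\<^sup>2) else 0) / (2 * pi))"

lemma measurable_poisson[measurable]: "poisson dl : borel_measurable (borel \<Otimes>\<^sub>M borel)"
 "conj_poisson dl : borel_measurable (borel \<Otimes>\<^sub>M borel)"
 unfolding poisson_def conj_poisson_def by measurable

lemma poisson_kernel_bound:
 fixes dl s t :: real
 assumes dl: "0 < dl" "dl < 1" and st: "s\<^sup>2 + t\<^sup>2 > dl\<^sup>2"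
 shows "dl\<^sup>2 * t\<^sup>2 + s\<^sup>2 > 0" "(dl * t)\<^sup>2 + s\<^sup>2 > (dl\<^sup>2)\<^sup>2"
proof -
 have "(dl\<^sup>2)\<^sup>2 < dl\<^sup>2 * (s\<^sup>2 + t\<^sup>2)" unfolding power2_eq_square[of "dl\<^sup>2"] using dl st by (intro mult_strict_left_mono) auto
 also have "dl\<^sup>2 * s\<^sup>2 <= 1 * s\<^sup>2" using dl by (intro mult_right_mono) (auto simp: power_le_one)
 then have "dl\<^sup>2 * (s\<^sup>2 + t\<^sup>2) <= (dl * t)\<^sup>2 + s\<^sup>2" by (simp add: distrib_left power_mult_distrib)
 finally show 1: "(dl * t)\<^sup>2 + s\<^sup>2 > (dl\<^sup>2)\<^sup>2" .
 have "(dl\<^sup>2)\<^sup>2 > 0" using dl by simp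
 then show "dl\<^sup>2 * t\<^sup>2 + s\<^sup>2 > 0" using 1 unfolding power_mult_distrib by linarith
qed

lemma poisson_bound:
 assumes dl: "0 < dl" "dl < 1"
 shows "\<bar>poisson dl p\<bar> <= 1 / dl\<^sup>2" "\<bar>conj_poisson dl p\<bar> <= 1 / dl\<^sup>2"
proof -
 obtain s t where p: "p = (s, t)" by fastforce
 have *: "\<bar>x / (dl\<^sup>2 * t\<^sup>2 + s\<^sup>2) / (2 * pi)\<bar> <= 1 / dl\<^sup>2"
  if st: "s\<^sup>2 + t\<^sup>2 > dl\<^sup>2" and x: "x\<^sup>2 <= (dl * t)\<^sup>2 + s\<^sup>2" for x
 proof -
  define D where "D = (dl * t)\<^sup>2 + s\<^sup>2"
  have D: "D > (dl\<^sup>2)\<^sup>2" "D > 0" using poisson_kernel_bound[OF dl st] by (auto simp: D_def power_mult_distrib)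
  define r where "r = sqrt D"
  have r: "r\<^sup>2 = D" "r > 0" using D by (auto simp: r_def)
  have "\<bar>x\<bar> <= r" using x unfolding r_def D_def by (intro real_le_rsqrt) simp
  moreover have "dl\<^sup>2 <= r" unfolding r_def using D by (intro real_le_rsqrt) simp
  ultimately have "\<bar>x\<bar> * dl\<^sup>2 <= r * r" by (intro mult_mono) (use r in auto)
  then have 1: "\<bar>x\<bar> / D <= 1 / dl\<^sup>2" using r D dl by (simp add: divide_simps power2_eq_square mult_ac)
  have "2 * pi >= 1" using pi_gt3 by linarith
  then have "\<bar>x\<bar> / D / (2 * pi) <= \<bar>x\<bar> / D / 1" using D by (intro divide_left_mono) auto
  with 1 show ?thesis using D by (simp add: D_def[symmetric] power_mult_distrib[symmetric] abs_mult)
 qed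
 show "\<bar>poisson dl p\<bar> <= 1 / dl\<^sup>2" "\<bar>conj_poisson dl p\<bar> <= 1 / dl\<^sup>2"
  using *[of "dl * t"] *[of s] by (auto simp: p poisson_def conj_poisson_def)
qed

lemma integral_swap_fst:
 fixes f :: "real \<times> real => real"
 assumes "integrable real_plane f"
 shows "(\<integral>p. f p \<partial>real_plane) = (\<integral>t. (\<integral>s. f (s, t) \<partial>lborel) \<partial>lborel)"
  and "(\<integral>p. f p \<partial>real_plane) = (\<integral>s. (\<integral>t. f (s, t) \<partial>lborel) \<partial>lborel)"
 using lborel_pair.integral_snd[of "%s t. f (s, t)"] lborel_pair.integral_fst'[OF assms] assms by simp_all

text \<open>A coefficient seen in the coordinates of one direction. Lipschitz continuity in the
  offset \<open>s\<close> is what a principal value needs, and the constants are named so that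
  bounds come out uniform in the direction.\<close>

locale box_function =
 fixes B :: "real \<times> real => real" and N T \<Lambda> :: real
 assumes cB: "continuous_on UNIV B" and bB: "!!p. \<bar>B p\<bar> <= N" and N0: "N >= 0" and T0: "T > 0" and L0: "\<Lambda> >= 0"
  and zB: "!!s t. T < \<bar>s\<bar> \<or> T < \<bar>t\<bar> ==> B (s, t) = 0"
  and lB: "!!s s' t. \<bar>B (s, t) - B (s', t)\<bar> <= \<Lambda> * \<bar>s - s'\<bar>"
begin

lemma mB[measurable]: "B : borel_measurable (borel \<Otimes>\<^sub>M borel)"
 unfolding borel_prod by (rule borel_measurable_continuous_onI[OF cB])

lemma B_box: "\<bar>B p\<bar> <= N * (indicator {-T..T} (fst p) * indicator {-T..T} (snd p))"
proof (cases p)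
 case (Pair s t)
 then show ?thesis using bB[of p] zB[of s t] by (cases "T < \<bar>s\<bar> \<or> T < \<bar>t\<bar>") (auto simp: indicator_def abs_le_iff)
qed

lemma kernel_integrable:
 assumes m: "k : borel_measurable (borel \<Otimes>\<^sub>M borel)" and b: "!!p. \<bar>k p\<bar> <= C"
 shows "integrable real_plane (%p. k p * B p)"
proof (rule integrable_box[where C="C * N" and T=T])
 show "(%p. k p * B p) : borel_measurable real_plane" using m by measurable
 show "\<bar>k p * B p\<bar> <= C * N * (indicator {-T..T} (fst p) * indicator {-T..T} (snd p))" for p
  unfolding abs_mult mult.assoc using b[of p] by (intro mult_mono[OF b B_box]) auto
qed

text \<open>The substitution s = dl \<bar>t\<bar> x turns the kernel into the Cauchy density in
  \<open>x\<close>; \<open>dl\<close> survives only in the cut and in the argument of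
  \<open>B\<close>.\<close>

lemma poisson_substitution:
 assumes dl: "0 < dl"
 shows "(\<integral>s. poisson dl (s, t) * B (s, t) \<partial>lborel) =
  (\<integral>x. (if (dl * \<bar>t\<bar> * x)\<^sup>2 + t\<^sup>2 > dl\<^sup>2 then sgn t / (1 + x\<^sup>2) else 0) / (2 * pi) * B (dl * \<bar>t\<bar> * x, t) \<partial>lborel)"
proof (cases "t = 0")
 case True then show ?thesis by (simp add: poisson_def cong: if_cong)
next
 case False
 define c where "c = dl * \<bar>t\<bar>"
 have c: "c > 0" using False dl by (simp add: c_def)
 have "(\<integral>s. poisson dl (s, t) * B (s, t) \<partial>lborel) = \<bar>c\<bar> *\<^sub>R (\<integral>x. poisson dl (0 + c * x, t) * B (0 + c * x, t) \<partial>lborel)"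
  using c by (intro lborel_integral_real_affine) auto
 also have "\<dots> = (\<integral>x. c * (poisson dl (c * x, t) * B (c * x, t)) \<partial>lborel)" using c by simp
 also have "\<dots> = (\<integral>x. (if (c * x)\<^sup>2 + t\<^sup>2 > dl\<^sup>2 then sgn t / (1 + x\<^sup>2) else 0) / (2 * pi) * B (c * x, t) \<partial>lborel)"
 proof (intro Bochner_Integration.integral_cong refl)
  fix x :: real
  have "1 + x\<^sup>2 > 0" using zero_le_power2[of x] by linarith
  have "dl\<^sup>2 * t\<^sup>2 + (c * x)\<^sup>2 = c\<^sup>2 * (1 + x\<^sup>2)" by (simp add: c_def power_mult_distrib distrib_left)
  moreover have "c * (dl * t) = c\<^sup>2 * sgn t" by (simp add: c_def power2_eq_square abs_sgn sgn_real_def)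
  ultimately have "c * (dl * t / (dl\<^sup>2 * t\<^sup>2 + (c * x)\<^sup>2)) = sgn t / (1 + x\<^sup>2)"
   using c \<open>1 + x\<^sup>2 > 0\<close> by simp
  then show "c * (poisson dl (c * x, t) * B (c * x, t)) =
    (if (c * x)\<^sup>2 + t\<^sup>2 > dl\<^sup>2 then sgn t / (1 + x\<^sup>2) else 0) / (2 * pi) * B (c * x, t)"
   by (simp add: poisson_def)
 qed
 finally show ?thesis unfolding c_def .
qed

lemma eventually_small:
 fixes dl :: "nat => real" and x :: real
 assumes "dl \<longlonglongrightarrow> 0" "x ~= 0" shows "\<forall>\<^sub>F j in sequentially. (dl j)\<^sup>2 < x\<^sup>2"
proof -
 have "(%j. (dl j)\<^sup>2) \<longlonglongrightarrow> 0\<^sup>2" by (intro tendsto_power assms)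
 then show ?thesis by (rule order_tendstoD(2)) (use assms(2) in simp)
qed

text \<open>After the substitution a fixed multiple of the Cauchy density dominates. In the limit
  the mass, of total \<open>sgn t / 2\<close>, sits at \<open>s = 0\<close>; the bound is
  \<open>N / (2 pi)\<close> times the mass pi of the density times the length
  \<open>2 T\<close>.\<close>

lemma poisson_limit:
 fixes dl :: "nat => real"
 assumes dl: "!!j. 0 < dl j" "!!j. dl j < 1" and lim: "dl \<longlonglongrightarrow> 0"
 shows "(%j. \<integral>p. poisson (dl j) p * B p \<partial>real_plane) \<longlonglongrightarrow> (\<integral>t. sgn t * B (0, t) \<partial>lborel) / 2"
  and "\<bar>\<integral>p. poisson (dl j) p * B p \<partial>real_plane\<bar> <= N * T"
proof -
 define g where "g j p = (if (dl j * \<bar>snd p\<bar> * fst p)\<^sup>2 + (snd p)\<^sup>2 > (dl j)\<^sup>2 then sgn (snd p) / (1 + (fst p)\<^sup>2) else 0) / (2 * pi)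
   * B (dl j * \<bar>snd p\<bar> * fst p, snd p)" for j p
 define G where "G p = sgn (snd p) / (1 + (fst p)\<^sup>2) / (2 * pi) * B (0, snd p)" for p :: "real \<times> real"
 define w where "w p = N / (2 * pi) * (1 / (1 + (fst p)\<^sup>2) * indicator {-T..T} (snd p))" for p :: "real \<times> real"
 have iw: "integrable real_plane w"
  unfolding w_def by (intro integrable_mult_right integrable_product integrable_indicator_Icc cauchy_density)
 have pos: "1 + x\<^sup>2 > 0" for x :: real using zero_le_power2[of x] by linarith
 have mg: "g j : borel_measurable real_plane" for j unfolding g_def by measurable
 have mG: "G : borel_measurable real_plane" unfolding G_def by measurable
 have gw: "norm (g j p) <= w p" for j p
 proof -
  define c where "c = (if (dl j * \<bar>snd p\<bar> * fst p)\<^sup>2 + (snd p)\<^sup>2 > (dl j)\<^sup>2 then sgn (snd p) / (1 + (fst p)\<^sup>2) else 0)"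
  have "\<bar>c\<bar> <= 1 / (1 + (fst p)\<^sup>2)" using pos[of "fst p"] by (simp add: c_def sgn_real_def)
  moreover have "\<bar>B (dl j * \<bar>snd p\<bar> * fst p, snd p)\<bar> <= N * indicator {-T..T} (snd p)"
   using bB[of "(dl j * \<bar>snd p\<bar> * fst p, snd p)"] zB[of "dl j * \<bar>snd p\<bar> * fst p" "snd p"]
   by (cases "T < \<bar>snd p\<bar>") (auto simp: indicator_def)
  ultimately have "\<bar>c\<bar> * \<bar>B (dl j * \<bar>snd p\<bar> * fst p, snd p)\<bar> <= 1 / (1 + (fst p)\<^sup>2) * (N * indicator {-T..T} (snd p))"
   using pos[of "fst p"] by (intro mult_mono) auto
  then have "\<bar>c\<bar> * \<bar>B (dl j * \<bar>snd p\<bar> * fst p, snd p)\<bar> / (2 * pi) <= 1 / (1 + (fst p)\<^sup>2) * (N * indicator {-T..T} (snd p)) / (2 * pi)"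
   by (intro divide_right_mono) auto
  moreover have "g j p = c / (2 * pi) * B (dl j * \<bar>snd p\<bar> * fst p, snd p)" by (simp only: g_def c_def)
  ultimately show ?thesis by (simp add: w_def abs_mult mult_ac)
 qed
 have gG: "(%j. g j p) \<longlonglongrightarrow> G p" for p
 proof (cases "snd p = 0")
  case True then show ?thesis by (simp add: g_def G_def)
 next
  case False
  have "(%j. (dl j * \<bar>snd p\<bar> * fst p, snd p)) \<longlonglongrightarrow> (0 * \<bar>snd p\<bar> * fst p, snd p)"
   by (intro tendsto_intros lim)
  then have 1: "(%j. B (dl j * \<bar>snd p\<bar> * fst p, snd p)) \<longlonglongrightarrow> B (0 * \<bar>snd p\<bar> * fst p, snd p)"
   using cB by (intro isCont_tendsto_compose[of _ B]) (auto simp: continuous_on_eq_continuous_at)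
  have "(%j. sgn (snd p) / (1 + (fst p)\<^sup>2) / (2 * pi) * B (dl j * \<bar>snd p\<bar> * fst p, snd p)) \<longlonglongrightarrow> G p"
   unfolding G_def using tendsto_mult[OF tendsto_const 1, of "sgn (snd p) / (1 + (fst p)\<^sup>2) / (2 * pi)"] by simp
  moreover have "\<forall>\<^sub>F j in sequentially. sgn (snd p) / (1 + (fst p)\<^sup>2) / (2 * pi) * B (dl j * \<bar>snd p\<bar> * fst p, snd p) = g j p"
   using eventually_small[OF lim False]
  proof eventually_elim
   fix j assume "(dl j)\<^sup>2 < (snd p)\<^sup>2"
   then have "(dl j)\<^sup>2 < (dl j * \<bar>snd p\<bar> * fst p)\<^sup>2 + (snd p)\<^sup>2" using zero_le_power2[of "dl j * \<bar>snd p\<bar> * fst p"] by linarith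
   then show "sgn (snd p) / (1 + (fst p)\<^sup>2) / (2 * pi) * B (dl j * \<bar>snd p\<bar> * fst p, snd p) = g j p" by (simp add: g_def)
  qed
  ultimately show ?thesis by (rule Lim_transform_eventually)
 qed
 have ig: "integrable real_plane (g j)" for j
  by (rule Bochner_Integration.integrable_bound[OF iw mg], rule AE_I2, rule order_trans[OF gw]) simp
 have eq: "(\<integral>p. poisson (dl j) p * B p \<partial>real_plane) = (\<integral>p. g j p \<partial>real_plane)" for j
 proof -
  have "integrable real_plane (%p. poisson (dl j) p * B p)"
   by (rule kernel_integrable[OF measurable_poisson(1) poisson_bound(1)[OF dl]])
  from integral_swap_fst(1)[OF this] show ?thesis
   unfolding integral_swap_fst(1)[OF ig[of j]] poisson_substitution[OF dl(1)] by (simp only: g_def fst_conv snd_conv)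
 qed
 have lim': "(%j. \<integral>p. g j p \<partial>real_plane) \<longlonglongrightarrow> (\<integral>p. G p \<partial>real_plane)" "integrable real_plane G"
  by (rule integral_dominated_convergence[where s=g and w=w] integrable_dominated_convergence[where s=g and w=w],
    fact mG, fact mg, fact iw; use gG gw in simp)+
 have "(\<integral>p. G p \<partial>real_plane) = (\<integral>t. (\<integral>x. G (x, t) \<partial>lborel) \<partial>lborel)" by (rule integral_swap_fst(1)[OF lim'(2)])
 also have "\<dots> = (\<integral>t. sgn t * B (0, t) / 2 \<partial>lborel)"
 proof (intro Bochner_Integration.integral_cong refl)
  fix t :: real
  have "(\<integral>x. G (x, t) \<partial>lborel) = (\<integral>x. 1 / (1 + x\<^sup>2) * (sgn t * B (0, t) / (2 * pi)) \<partial>lborel)"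
   by (intro Bochner_Integration.integral_cong refl) (simp add: G_def)
  also have "\<dots> = pi * (sgn t * B (0, t) / (2 * pi))"
   by (simp only: integral_mult_left_zero cauchy_density(2))
  finally show "(\<integral>x. G (x, t) \<partial>lborel) = sgn t * B (0, t) / 2" by simp
 qed
 also have "\<dots> = (\<integral>t. sgn t * B (0, t) \<partial>lborel) / 2" by simp
 finally have eG: "(\<integral>p. G p \<partial>real_plane) = (\<integral>t. sgn t * B (0, t) \<partial>lborel) / 2" .
 show "(%j. \<integral>p. poisson (dl j) p * B p \<partial>real_plane) \<longlonglongrightarrow> (\<integral>t. sgn t * B (0, t) \<partial>lborel) / 2"
  using lim'(1) unfolding eq eG .
 have "norm (\<integral>p. g j p \<partial>real_plane) <= (\<integral>p. w p \<partial>real_plane)"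
  by (rule order_trans[OF integral_norm_bound integral_mono'[OF iw]]) (use gw order_trans[OF norm_ge_zero gw] in auto)
 also have "\<dots> = (\<integral>t. (\<integral>x. w (x, t) \<partial>lborel) \<partial>lborel)" by (rule integral_swap_fst(1)[OF iw])
 also have "\<dots> = (\<integral>t. indicator {-T..T} t * (N / 2) \<partial>lborel)"
 proof (intro Bochner_Integration.integral_cong refl)
  fix t :: real
  have "(\<integral>x. w (x, t) \<partial>lborel) = (\<integral>x. 1 / (1 + x\<^sup>2) * (N / (2 * pi) * indicator {-T..T} t) \<partial>lborel)"
   by (intro Bochner_Integration.integral_cong refl) (simp add: w_def)
  also have "\<dots> = pi * (N / (2 * pi) * indicator {-T..T} t)"
   by (simp only: integral_mult_left_zero cauchy_density(2))
  finally show "(\<integral>x. w (x, t) \<partial>lborel) = indicator {-T..T} t * (N / 2)" by simp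
 qed
 also have "\<dots> = N * T" using T0 by simp
 finally show "\<bar>\<integral>p. poisson (dl j) p * B p \<partial>real_plane\<bar> <= N * T" unfolding eq by simp
qed

lemma reflect_fst:
 fixes f :: "real \<times> real => real"
 assumes f: "integrable real_plane f" and f': "integrable real_plane (%p. f (- fst p, snd p))"
 shows "(\<integral>p. f (- fst p, snd p) \<partial>real_plane) = (\<integral>p. f p \<partial>real_plane)"
proof -
 have "(\<integral>s. f (s, t) \<partial>lborel) = (\<integral>s. f (- s, t) \<partial>lborel)" for t
  using lborel_integral_real_affine[of "-1" "%s. f (s, t)" 0] by simp
 then show ?thesis unfolding integral_swap_fst(1)[OF f] integral_swap_fst(1)[OF f'] by simp
qed

text \<open>The kernel is odd in \<open>s\<close>, so \<open>B\<close> may be replaced by half of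
  its odd difference \<open>D\<close>, and the Lipschitz bound on \<open>D\<close> compensates the
  singularity 1 / s. The limit is a principal value written as an absolutely convergent
  integral.\<close>

lemma conj_poisson_limit:
 fixes dl :: "nat => real"
 assumes dl: "!!j. 0 < dl j" "!!j. dl j < 1" and lim: "dl \<longlonglongrightarrow> 0"
 shows "(%j. \<integral>p. conj_poisson (dl j) p * B p \<partial>real_plane) \<longlonglongrightarrow> (\<integral>p. (B p - B (- fst p, snd p)) / fst p \<partial>real_plane) / (4 * pi)"
  and "\<bar>\<integral>p. conj_poisson (dl j) p * B p \<partial>real_plane\<bar> <= 4 * \<Lambda> * T\<^sup>2"
proof -
 define D where "D p = B p - B (- fst p, snd p)" for p
 have Dz: "D p = 0" if "T < \<bar>fst p\<bar> \<or> T < \<bar>snd p\<bar>" for p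
  using zB[of "fst p" "snd p"] zB[of "- fst p" "snd p"] that by (simp add: D_def)
 have DL: "\<bar>D p\<bar> <= 2 * \<Lambda> * \<bar>fst p\<bar>" for p
  using lB[of "fst p" "snd p" "- fst p"] by (simp add: D_def)
 have [measurable]: "D : borel_measurable (borel \<Otimes>\<^sub>M borel)" unfolding D_def by measurable
 have eq: "(\<integral>p. conj_poisson (dl j) p * B p \<partial>real_plane) = (\<integral>p. conj_poisson (dl j) p * D p \<partial>real_plane) / 2"
  and iD: "integrable real_plane (%p. conj_poisson (dl j) p * D p)" for j
 proof -
  let ?k = "conj_poisson (dl j)"
  have odd: "?k (- fst p, snd p) = - ?k p" for p by (simp add: conj_poisson_def case_prod_beta)
  have i: "integrable real_plane (%p. ?k p * B p)"
   by (rule kernel_integrable[OF measurable_poisson(2) poisson_bound(2)[OF dl]])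
  have i': "integrable real_plane (%p. ?k (- fst p, snd p) * B (- fst p, snd p))"
  proof (rule integrable_box[where C="1 / (dl j)\<^sup>2 * N" and T=T])
   show "(%p. ?k (- fst p, snd p) * B (- fst p, snd p)) : borel_measurable real_plane" by measurable
   show "\<bar>?k (- fst p, snd p) * B (- fst p, snd p)\<bar> <= 1 / (dl j)\<^sup>2 * N * (indicator {-T..T} (fst p) * indicator {-T..T} (snd p))" for p
    using mult_mono[OF poisson_bound(2)[OF dl(1,2), of j "(- fst p, snd p)"] B_box[of "(- fst p, snd p)"]]
    by (auto simp: abs_mult indicator_def split: if_splits)
  qed
  have i'': "integrable real_plane (%p. ?k p * B (- fst p, snd p))" using i' unfolding odd by simp
  have r: "(\<integral>p. ?k p * B p \<partial>real_plane) = - (\<integral>p. ?k p * B (- fst p, snd p) \<partial>real_plane)"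
   using reflect_fst[OF i i'] unfolding odd by simp
  show "integrable real_plane (%p. ?k p * D p)"
   unfolding D_def right_diff_distrib by (rule Bochner_Integration.integrable_diff[OF i i''])
  show "(\<integral>p. ?k p * B p \<partial>real_plane) = (\<integral>p. ?k p * D p \<partial>real_plane) / 2"
   unfolding D_def right_diff_distrib Bochner_Integration.integral_diff[OF i i''] using r by simp
 qed
 define w where "w p = \<Lambda> * (indicator {-T..T} (fst p) * indicator {-T..T} (snd p))" for p :: "real \<times> real"
 have iw: "integrable real_plane w"
  unfolding w_def by (intro integrable_mult_right integrable_product integrable_indicator_Icc)
 have kw: "norm (conj_poisson (dl j) p * D p) <= w p" for j p
 proof (cases "T < \<bar>fst p\<bar> \<or> T < \<bar>snd p\<bar>")
  case True then show ?thesis using Dz[OF True] L0 by (simp add: w_def)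
 next
  case False
  have w: "w p = \<Lambda>" using False by (auto simp: w_def indicator_def)
  show ?thesis
  proof (cases "(fst p)\<^sup>2 + (snd p)\<^sup>2 > (dl j)\<^sup>2")
   case True
   let ?D = "(dl j)\<^sup>2 * (snd p)\<^sup>2 + (fst p)\<^sup>2"
   have D0: "?D > 0" by (rule poisson_kernel_bound(1)[OF dl True])
   have "\<bar>fst p\<bar> * \<bar>D p\<bar> <= \<bar>fst p\<bar> * (2 * \<Lambda> * \<bar>fst p\<bar>)" by (intro mult_left_mono DL) auto
   also have "\<dots> = 2 * \<Lambda> * (fst p)\<^sup>2" by (simp add: power2_eq_square abs_mult[symmetric])
   also have "\<dots> <= 2 * \<Lambda> * ?D" using L0 by (intro mult_left_mono) auto
   finally have "\<bar>fst p\<bar> * \<bar>D p\<bar> / ?D <= 2 * \<Lambda>" using D0 by (simp add: pos_divide_le_eq)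
   then have "\<bar>fst p\<bar> * \<bar>D p\<bar> / ?D / (2 * pi) <= 2 * \<Lambda> / (2 * pi)" by (intro divide_right_mono) auto
   also have "\<dots> <= \<Lambda>" using mult_left_mono[OF _ L0, of 1 pi] pi_gt3 by (simp add: divide_simps)
   finally show ?thesis using True D0 by (simp add: w conj_poisson_def case_prod_beta abs_mult)
  qed (use L0 w in \<open>simp add: conj_poisson_def case_prod_beta\<close>)
 qed
 have ptw: "(%j. conj_poisson (dl j) p * D p) \<longlonglongrightarrow> D p / fst p / (2 * pi)" for p
 proof (cases "fst p = 0")
  case True then show ?thesis by (simp add: conj_poisson_def case_prod_beta cong: if_cong)
 next
  case False
  have "(%j. fst p / ((dl j)\<^sup>2 * (snd p)\<^sup>2 + (fst p)\<^sup>2) / (2 * pi) * D p) \<longlonglongrightarrow> fst p / (0\<^sup>2 * (snd p)\<^sup>2 + (fst p)\<^sup>2) / (2 * pi) * D p"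
   using False by (intro tendsto_intros lim) auto
  also have "fst p / (0\<^sup>2 * (snd p)\<^sup>2 + (fst p)\<^sup>2) / (2 * pi) * D p = D p / fst p / (2 * pi)"
   using False by (simp add: power2_eq_square)
  finally have l: "(%j. fst p / ((dl j)\<^sup>2 * (snd p)\<^sup>2 + (fst p)\<^sup>2) / (2 * pi) * D p) \<longlonglongrightarrow> D p / fst p / (2 * pi)" .
  have "\<forall>\<^sub>F j in sequentially. fst p / ((dl j)\<^sup>2 * (snd p)\<^sup>2 + (fst p)\<^sup>2) / (2 * pi) * D p = conj_poisson (dl j) p * D p"
   using eventually_small[OF lim False]
  proof eventually_elim
   fix j assume "(dl j)\<^sup>2 < (fst p)\<^sup>2"
   then have "(dl j)\<^sup>2 < (fst p)\<^sup>2 + (snd p)\<^sup>2" using zero_le_power2[of "snd p"] by linarith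
   then show "fst p / ((dl j)\<^sup>2 * (snd p)\<^sup>2 + (fst p)\<^sup>2) / (2 * pi) * D p = conj_poisson (dl j) p * D p"
    by (simp add: conj_poisson_def case_prod_beta)
  qed
  with l show ?thesis by (rule Lim_transform_eventually)
 qed
 have mD: "(%p. D p / fst p / (2 * pi)) : borel_measurable real_plane" by measurable
 have "(%j. \<integral>p. conj_poisson (dl j) p * D p \<partial>real_plane) \<longlonglongrightarrow> (\<integral>p. D p / fst p / (2 * pi) \<partial>real_plane)"
  using integral_dominated_convergence[OF mD borel_measurable_integrable[OF iD] iw] ptw kw by auto
 from tendsto_divide[OF this tendsto_const[of 2]]
 show "(%j. \<integral>p. conj_poisson (dl j) p * B p \<partial>real_plane) \<longlonglongrightarrow> (\<integral>p. (B p - B (- fst p, snd p)) / fst p \<partial>real_plane) / (4 * pi)"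
  unfolding eq integral_divide_zero by (simp add: D_def)
 have "norm (\<integral>p. conj_poisson (dl j) p * D p \<partial>real_plane) <= (\<integral>p. w p \<partial>real_plane)"
  by (rule order_trans[OF integral_norm_bound integral_mono'[OF iw]]) (use kw order_trans[OF norm_ge_zero kw] in auto)
 also have "\<dots> = (\<integral>t. (\<integral>x. w (x, t) \<partial>lborel) \<partial>lborel)" by (rule integral_swap_fst(1)[OF iw])
 also have "\<dots> = 4 * \<Lambda> * T\<^sup>2" using T0 by (simp add: w_def power2_eq_square)
 finally show "\<bar>\<integral>p. conj_poisson (dl j) p * B p \<partial>real_plane\<bar> <= 4 * \<Lambda> * T\<^sup>2" unfolding eq using L0 by simp
qed

end

section \<open>The integrating exponent\<close>

lemma hardy_cong:
 assumes "!!th. norm th = 1 ==> f th = g th" "hardy f"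
 shows "hardy g"
proof -
 have m: "f : borel_measurable circle_measure \<longleftrightarrow> g : borel_measurable circle_measure"
  by (rule measurable_cong) (simp add: assms(1) space_circle)
 have i: "(\<integral>th. f th * V th * zeta th ^ n \<partial>circle_measure) = (\<integral>th. g th * V th * zeta th ^ n \<partial>circle_measure)" for V n
  by (rule Bochner_Integration.integral_cong) (simp_all add: assms(1) space_circle)
 from assms(2) obtain C where "!!th. norm th = 1 ==> norm (f th) <= C" by (auto simp: hardy_def)
 then show ?thesis
  by (intro hardyI[of g C]) (use m hardy_measurable[OF assms(2)] hardyD[OF assms(2)] in \<open>simp_all add: assms(1)[symmetric] i[symmetric]\<close>)
qed

lemma zeta_cnj:
 "zeta th * cnj (zeta y) = Complex (y \<bullet> th) (- (y \<bullet> perp th))"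
 by (simp add: zeta_def inner_plane complex_eq_iff algebra_simps)

lemma norm_coordinates: "norm th = 1 ==> (norm y)\<^sup>2 = (y \<bullet> perp th)\<^sup>2 + (y \<bullet> th)\<^sup>2"
 using norm_line[of th "y \<bullet> perp th" "y \<bullet> th"] line_of_point[of th y] by simp

text \<open>The kernel is \<open>1 / (2 \<pi> (dl t + \<i> s))\<close> with \<open>s = y \<bullet> perp th\<close>, \<open>t = y \<bullet> th\<close>. With
 \<open>c = \<zeta>(th) cnj \<zeta>(y) = t - \<i> s\<close> and \<open>q = (1 - dl) / (1 + dl)\<close> it is a multiple of
 \<open>1 / (cnj c - q c) = c / (\<bar>c\<bar>\<^sup>2 - q c\<^sup>2)\<close>, whose geometric expansion has only positive powers of \<open>\<zeta>(th)\<close>.\<close>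

lemma hardy_poisson:
 assumes dl: "0 < dl" "dl < 1"
 shows "hardy (%th. Complex (poisson dl (y \<bullet> perp th, y \<bullet> th)) (- conj_poisson dl (y \<bullet> perp th, y \<bullet> th)))"
proof (cases "(norm y)\<^sup>2 > dl\<^sup>2")
 case False
 show ?thesis
 proof (rule hardy_cong[OF _ hardy_const[of 0]])
  fix th :: plane assume n: "norm th = 1"
  show "0 = Complex (poisson dl (y \<bullet> perp th, y \<bullet> th)) (- conj_poisson dl (y \<bullet> perp th, y \<bullet> th))"
   using False unfolding norm_coordinates[OF n] by (simp add: poisson_def conj_poisson_def complex_eq_iff cong: if_cong)
 qed
next
 case True
 define q where "q = (1 - dl) / (1 + dl)"
 have q: "0 < q" "q < 1" using dl by (auto simp: q_def)
 define A where "A = (norm y)\<^sup>2 / q"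
 define C where "C = 1 / (pi * q * (1 + dl))"
 have ny: "(norm y)\<^sup>2 > 0" using True zero_le_power2[of dl] by linarith
 have "(norm y)\<^sup>2 * q < (norm y)\<^sup>2 * 1" using ny q by (intro mult_strict_left_mono) auto
 then have A: "A > (norm (cnj (zeta y)))\<^sup>2" using q by (simp add: A_def norm_zeta pos_less_divide_eq)
 show ?thesis
 proof (rule hardy_cong[OF _ hardy_mult[OF hardy_const[of "of_real C"] hardy_fraction[OF A]]])
  fix th :: plane assume n: "norm th = 1"
  define s t c where "s = y \<bullet> perp th" and "t = y \<bullet> th" and "c = zeta th * cnj (zeta y)"
  have c: "c = Complex t (- s)" unfolding c_def s_def t_def by (rule zeta_cnj)
  have st: "s\<^sup>2 + t\<^sup>2 = (norm y)\<^sup>2" using norm_coordinates[OF n, of y] by (simp add: s_def t_def)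
  then have st': "s\<^sup>2 + t\<^sup>2 > dl\<^sup>2" using True by simp
  define d where "d = Complex (dl * t) s"
  have "c ~= 0" "d ~= 0" using st ny poisson_kernel_bound(1)[OF dl st'] dl by (auto simp: c d_def complex_eq_iff)
  have cc: "complex_of_real (s\<^sup>2 + t\<^sup>2) = c * cnj c" by (simp add: c complex_eq_iff power2_eq_square)
  have d1: "complex_of_real (1 + dl) ~= 0" unfolding of_real_eq_0_iff using dl by simp
  have q1: "q * (1 + dl) = 1 - dl" using dl by (simp add: q_def)
  have "(t - q * t) * (1 + dl) = t * (1 + dl) - t * (q * (1 + dl))" "(s + q * s) * (1 + dl) = s * (1 + dl) + s * (q * (1 + dl))"
   by (simp_all add: algebra_simps)
  then have q2: "(t - q * t) * (1 + dl) = 2 * (dl * t)" "(s + q * s) * (1 + dl) = 2 * s"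
   unfolding q1 by (simp_all add: algebra_simps)
  have d: "(cnj c - of_real q * c) * of_real (1 + dl) = 2 * d"
  proof -
   have "cnj c - of_real q * c = Complex (t - q * t) (s + q * s)" by (simp add: c complex_eq_iff)
   moreover have "Complex x y * of_real u = Complex (x * u) (y * u)" for x y u by (simp add: complex_eq_iff)
   moreover have "2 * d = Complex (2 * (dl * t)) (2 * s)" by (simp add: d_def complex_eq_iff)
   ultimately show ?thesis by (simp only: q2)
  qed
  have "of_real A = c * cnj c / of_real q" unfolding A_def st[symmetric] of_real_divide cc by simp
  then have "of_real A - c\<^sup>2 = c * (cnj c - of_real q * c) / of_real q"
   using q by (simp add: field_simps power2_eq_square)
  then have "c / (of_real A - c\<^sup>2) = of_real q / (cnj c - of_real q * c)"
   using \<open>c ~= 0\<close> by simp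
  also have "\<dots> = of_real q * of_real (1 + dl) / (2 * d)"
   unfolding d[symmetric] using d1 by (rule mult_divide_mult_cancel_right[symmetric])
  finally have "of_real C * (c / (of_real A - c\<^sup>2)) = of_real C * (of_real q * of_real (1 + dl) / (2 * d))" by simp
  also have "\<dots> = of_real (C * q * (1 + dl) / 2) * inverse d"
   by (simp only: of_real_mult of_real_divide of_real_inverse of_real_numeral divide_inverse inverse_mult_distrib mult_ac)
  also have "C * q * (1 + dl) / 2 = 1 / (2 * pi)" using q dl by (simp add: C_def)
  also have "of_real (1 / (2 * pi)) * inverse d = Complex (poisson dl (s, t)) (- conj_poisson dl (s, t))"
   using st' by (simp add: d_def complex_inverse poisson_def conj_poisson_def power_mult_distrib complex_eq_iff)
  finally show "of_real C * (zeta th * cnj (zeta y) / (of_real A - (zeta th * cnj (zeta y))\<^sup>2)) =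
    Complex (poisson dl (y \<bullet> perp th, y \<bullet> th)) (- conj_poisson dl (y \<bullet> perp th, y \<bullet> th))"
   unfolding c_def s_def t_def .
 qed
qed

lemma integral_line_coordinates:
 fixes f :: "plane => 'b::{banach, second_countable_topology}"
 assumes n: "norm th = 1" and f: "f : borel_measurable borel"
 shows "(\<integral>y. f y \<partial>lborel) = (\<integral>p. f (line (fst p) th (snd p)) \<partial>real_plane)"
proof -
 have "(\<integral>y. f y \<partial>lborel) = (\<integral>y. f y \<partial>distr real_plane borel (%(s, t). line s th t))"
  unfolding distr_line[OF n] ..
 also have "\<dots> = (\<integral>p. f (case p of (s, t) => line s th t) \<partial>real_plane)"
  using f by (intro integral_distr) measurable
 finally show ?thesis by (simp add: case_prod_beta)
qed

lemma integral_Complex: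
 fixes f g :: "'a => real"
 assumes "integrable M f" "integrable M g"
 shows "(\<integral>x. Complex (f x) (g x) \<partial>M) = Complex (\<integral>x. f x \<partial>M) (\<integral>x. g x \<partial>M)"
 using assms by (simp add: Complex_eq_of_real)

lemma abs_coordinate_le:
 assumes "norm th = 1" shows "\<bar>y \<bullet> th\<bar> <= norm y" "\<bar>y \<bullet> perp th\<bar> <= norm y"
proof -
 have "(y \<bullet> th)\<^sup>2 <= (norm y)\<^sup>2" "(y \<bullet> perp th)\<^sup>2 <= (norm y)\<^sup>2" unfolding norm_coordinates[OF assms] by auto
 then show "\<bar>y \<bullet> th\<bar> <= norm y" "\<bar>y \<bullet> perp th\<bar> <= norm y" using abs_le_square_iff[of _ "norm y"] by auto
qed

text \<open>A Lipschitz coefficient of compact support on the whole plane, so that it can be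
  integrated over complete lines and convolved with the kernels.\<close>

locale attenuation =
 fixes A :: "plane => real" and \<Lambda> N R :: real
 assumes lip: "!!x y. \<bar>A x - A y\<bar> <= \<Lambda> * norm (x - y)" and bA: "!!x. \<bar>A x\<bar> <= N"
  and sA: "!!x. R < norm x ==> A x = 0" and R0: "R > 0" and L0: "\<Lambda> >= 0" and N0: "N >= 0"
begin

lemma contA: "continuous_on S A"
proof (rule continuous_on_subset[of UNIV])
 have "\<Lambda>-lipschitz_on UNIV A"
  by (rule lipschitz_onI) (use lip L0 in \<open>auto simp: dist_norm\<close>)
 then show "continuous_on UNIV A" by (rule lipschitz_on_continuous_on)
qed simp

lemma mA[measurable]: "A : borel_measurable borel"
 by (rule borel_measurable_continuous_onI[OF contA])

lemma zA: "norm th = 1 ==> R < \<bar>s\<bar> \<or> R < \<bar>t\<bar> ==> A (line s th t) = 0"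
 using abs_coordinate_le[of th "line s th t"] line_inner[of th s t] by (intro sA) auto

lemma lipA: "norm th = 1 ==> \<bar>A (line s th t) - A (line s' th t)\<bar> <= \<Lambda> * \<bar>s - s'\<bar>"
proof -
 assume n: "norm th = 1"
 have "line s th t - line s' th t = line (s - s') th 0" by (simp add: line_def algebra_simps)
 moreover have "norm (line (s - s') th 0) = \<bar>s - s'\<bar>"
  using norm_line[OF n, of "s - s'" 0] by (metis abs_norm_cancel power2_eq_iff_nonneg abs_ge_zero norm_ge_zero power2_abs add_0_right power_zero_numeral)
 ultimately show ?thesis using lip[of "line s th t" "line s' th t"] by simp
qed

text \<open>The support radius doubles because both the centre and the points where \<open>A\<close>
  does not vanish have coordinates of size at most \<open>R\<close>.\<close>

lemma box:
 assumes n: "norm th = 1" and "\<bar>sg\<bar> <= R" "\<bar>t0\<bar> <= R"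
 shows "box_function (%p. A (line (sg - fst p) th (t0 - snd p))) N (2 * R) \<Lambda>"
proof
 show "continuous_on UNIV (%p. A (line (sg - fst p) th (t0 - snd p)))"
  unfolding line_def by (intro continuous_on_compose2[OF contA[of UNIV]] continuous_intros) auto
 show "\<bar>A (line (sg - fst (s, t)) th (t0 - snd (s, t))) - A (line (sg - fst (s', t)) th (t0 - snd (s', t)))\<bar> <= \<Lambda> * \<bar>s - s'\<bar>" for s s' t
  using lipA[OF n, of "sg - s" "t0 - t" "sg - s'"] by (simp add: abs_minus_commute)
 show "A (line (sg - fst (s, t)) th (t0 - snd (s, t))) = 0" if "2 * R < \<bar>s\<bar> \<or> 2 * R < \<bar>t\<bar>" for s t
  using that assms(2,3) by (intro zA[OF n]) (auto simp: abs_if split: if_splits)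
qed (use bA R0 L0 N0 in auto)

text \<open>A primitive of \<open>A\<close> along the line, normalised symmetrically between the two
  ends; this is the limit that the Poisson kernels produce.\<close>

definition attenuation_re :: "real => plane => real => real" where
 "attenuation_re s th t = (\<integral>ta. sgn (t - ta) * A (line s th ta) \<partial>lborel) / 2"

text \<open>Half the Hilbert transform, in the offset \<open>s\<close>, of the integrals of
  \<open>A\<close> over parallel lines. The symmetric difference keeps the integrand bounded and
  doubles the principal value, hence 4 pi.\<close>

definition attenuation_im :: "real => plane => real" where
 "attenuation_im s th = (\<integral>p. (A (line (s - fst p) th (snd p)) - A (line (s + fst p) th (snd p))) / fst p \<partial>real_plane) / (4 * pi)"

definition integrating_exponent :: "plane => plane => complex" where
 "integrating_exponent z th = Complex (attenuation_re (z \<bullet> perp th) th (z \<bullet> th)) (- attenuation_im (z \<bullet> perp th) th)"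

text \<open>The integral in the second coordinate runs over the whole line, so the reflection and
  translation of the parameter by \<open>t0\<close> change nothing: the limit depends on the line
  only.\<close>

lemma attenuation_im_shift:
 assumes n: "norm th = 1" and sg: "\<bar>sg\<bar> <= R" and t0: "\<bar>t0\<bar> <= R"
 shows "(\<integral>p. (A (line (sg - fst p) th (t0 - snd p)) - A (line (sg + fst p) th (t0 - snd p))) / fst p \<partial>real_plane) / (4 * pi)
  = attenuation_im sg th"
proof -
 define F where "F p = (A (line (sg - fst p) th (snd p)) - A (line (sg + fst p) th (snd p))) / fst p" for p
 have [measurable]: "F : borel_measurable (borel \<Otimes>\<^sub>M borel)" unfolding F_def by measurable
 have b: "\<bar>F (s, t)\<bar> <= 2 * \<Lambda>" for s t
  using lipA[OF n, of "sg - s" t "sg + s"] L0 by (cases "s = 0") (auto simp: F_def divide_simps)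
 have z: "F (s, t) = 0" if "2 * R < \<bar>s\<bar> \<or> R < \<bar>t\<bar>" for s t
  using that sg zA[OF n, of "sg - s" t] zA[OF n, of "sg + s" t] by (auto simp: F_def abs_if split: if_splits)
 have "integrable real_plane (%p. F (fst p, c - snd p)) & integrable real_plane (%p. F (fst p, snd p))" if c: "\<bar>c\<bar> <= R" for c
 proof (intro conjI)
  show "integrable real_plane (%p. F (fst p, c - snd p))"
  proof (rule integrable_box[where C="2 * \<Lambda>" and T="2 * R"])
   show "(%p. F (fst p, c - snd p)) : borel_measurable real_plane" by measurable
   show "\<bar>F (fst p, c - snd p)\<bar> <= 2 * \<Lambda> * (indicator {- (2 * R)..2 * R} (fst p) * indicator {- (2 * R)..2 * R} (snd p))" for p
    using b[of "fst p" "c - snd p"] z[of "fst p" "c - snd p"] c L0 by (cases "2 * R < \<bar>fst p\<bar> \<or> 2 * R < \<bar>snd p\<bar>") (auto simp: indicator_def abs_if split: if_splits)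
  qed
  show "integrable real_plane (%p. F (fst p, snd p))"
  proof (rule integrable_box[where C="2 * \<Lambda>" and T="2 * R"])
   show "(%p. F (fst p, snd p)) : borel_measurable real_plane" by measurable
   show "\<bar>F (fst p, snd p)\<bar> <= 2 * \<Lambda> * (indicator {- (2 * R)..2 * R} (fst p) * indicator {- (2 * R)..2 * R} (snd p))" for p
    using b[of "fst p" "snd p"] z[of "fst p" "snd p"] R0 L0 by (cases "2 * R < \<bar>fst p\<bar> \<or> 2 * R < \<bar>snd p\<bar>") (auto simp: indicator_def abs_if split: if_splits)
  qed
 qed
 then have i: "integrable real_plane (%p. F (fst p, t0 - snd p))" "integrable real_plane (%p. F (fst p, snd p))"
  using t0 by blast+
 have "(\<integral>t. F (s, t) \<partial>lborel) = (\<integral>t. F (s, t0 - t) \<partial>lborel)" for s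
  using lborel_integral_real_affine[of "-1" "%t. F (s, t)" t0] by simp
 then have "(\<integral>p. F (fst p, t0 - snd p) \<partial>real_plane) = (\<integral>p. F (fst p, snd p) \<partial>real_plane)"
  unfolding integral_swap_fst(2)[OF i(1)] integral_swap_fst(2)[OF i(2)] by simp
 then show ?thesis by (simp add: F_def attenuation_im_def)
qed

text \<open>\<open>h j\<close> is the convolution of \<open>A\<close> with a kernel that has
  nonnegative modes for every displacement, hence a superposition of such functions. The bounds in
  the kernel limits do not depend on \<open>j\<close>, so \<open>hardy_limit\<close> carries the
  property to the exponent.\<close>

lemma integrating_exponent_hardy:
 assumes z: "norm z <= R"
 shows "hardy (integrating_exponent z)" and "norm th = 1 ==> norm (integrating_exponent z th) <= N * (2 * R) + 4 * \<Lambda> * (2 * R)\<^sup>2"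
proof -
 define dl where "dl j = inverse (real (Suc (Suc j)))" for j
 have dl: "0 < dl j" "dl j < 1" for j by (auto simp: dl_def divide_simps)
 have dll: "dl \<longlonglongrightarrow> 0" unfolding dl_def using LIMSEQ_inverse_real_of_nat by (rule LIMSEQ_Suc)
 let ?k = "%j y th. Complex (poisson (dl j) (y \<bullet> perp th, y \<bullet> th)) (- conj_poisson (dl j) (y \<bullet> perp th, y \<bullet> th))"
 define h where "h j th = (\<integral>y. ?k j y th * of_real (A (z - y)) \<partial>lborel)" for j th
 \<comment> \<open>The integrand vanishes for displacements longer than \<open>2 R\<close>, since
   \<open>z\<close> and the support of \<open>A\<close> are within \<open>R\<close> of the origin;
   the kernel bound depends on \<open>j\<close>, which is harmless for fixed
   \<open>j\<close>.\<close>
 have hh: "hardy (h j)" for j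
  unfolding h_def
 proof (rule hardy_integral[where w="%y. indicator (cball 0 (2 * R)) y * (2 / (dl j)\<^sup>2 * N)"])
  show "(%x. ?k j (fst x) (snd x) * of_real (A (z - fst x))) : borel_measurable (lborel \<Otimes>\<^sub>M circle_measure)"
   unfolding Complex_eq_of_real by measurable
  show "hardy (%th. ?k j y th * of_real (A (z - y)))" for y
   by (intro hardy_mult hardy_const hardy_poisson dl)
  show "norm (?k j y th * of_real (A (z - y))) <= indicator (cball 0 (2 * R)) y * (2 / (dl j)\<^sup>2 * N)" for y th
  proof (cases "norm y <= 2 * R")
   case True
   have "norm (?k j y th) <= 2 / (dl j)\<^sup>2"
    using poisson_bound[OF dl, of j "(y \<bullet> perp th, y \<bullet> th)"] cmod_le[of "?k j y th"] by simp
   then have "norm (?k j y th) * \<bar>A (z - y)\<bar> <= 2 / (dl j)\<^sup>2 * N" using bA N0 by (intro mult_mono) auto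
   then show ?thesis using True by (simp add: norm_mult)
  next
   case False
   then have "R < norm (z - y)" using z norm_triangle_ineq2[of y z] by (simp add: norm_minus_commute)
   then show ?thesis using sA False by simp
  qed
  show "integrable lborel (%y::plane. indicator (cball 0 (2 * R)) y * (2 / (dl j)\<^sup>2 * N))"
   by (intro integrable_mult_left integrable_real_indicator emeasure_bounded_finite) auto
 qed
 have *: "norm (h j th) <= N * (2 * R) + 4 * \<Lambda> * (2 * R)\<^sup>2 & (%j. h j th) \<longlonglongrightarrow> integrating_exponent z th" if n: "norm th = 1" for j th
 proof -
  define sg t0 where "sg = z \<bullet> perp th" and "t0 = z \<bullet> th"
  have b: "\<bar>sg\<bar> <= R" "\<bar>t0\<bar> <= R" using abs_coordinate_le[OF n, of z] z by (auto simp: sg_def t0_def)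
  have zl: "z - line s th t = line (sg - s) th (t0 - t)" for s t
   using line_of_point[OF n, of z] by (simp add: sg_def t0_def line_def algebra_simps)
  interpret box_function "%p. A (line (sg - fst p) th (t0 - snd p))" N "2 * R" \<Lambda> by (rule box[OF n b])
  let ?B = "%p. A (line (sg - fst p) th (t0 - snd p))"
  have hj: "h j th = Complex (\<integral>p. poisson (dl j) p * ?B p \<partial>real_plane) (- (\<integral>p. conj_poisson (dl j) p * ?B p \<partial>real_plane))" for j
  proof -
   have "h j th = (\<integral>p. ?k j (line (fst p) th (snd p)) th * of_real (A (z - line (fst p) th (snd p))) \<partial>real_plane)"
    unfolding h_def Complex_eq_of_real by (rule integral_line_coordinates[OF n]) measurable
   also have "\<dots> = (\<integral>p. Complex (poisson (dl j) p * ?B p) (- (conj_poisson (dl j) p * ?B p)) \<partial>real_plane)"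
    by (intro Bochner_Integration.integral_cong refl) (simp add: line_inner[OF n] zl complex_eq_iff)
   also have "\<dots> = Complex (\<integral>p. poisson (dl j) p * ?B p \<partial>real_plane) (\<integral>p. - (conj_poisson (dl j) p * ?B p) \<partial>real_plane)"
    by (intro integral_Complex Bochner_Integration.integrable_minus kernel_integrable[OF measurable_poisson(1) poisson_bound(1)[OF dl]]
      kernel_integrable[OF measurable_poisson(2) poisson_bound(2)[OF dl]])
   finally show ?thesis by simp
  qed
  note P = poisson_limit[OF dl dll] and Q = conj_poisson_limit[OF dl dll]
  have "norm (h j th) <= N * (2 * R) + 4 * \<Lambda> * (2 * R)\<^sup>2"
   using cmod_le[of "h j th"] P(2)[of j] Q(2)[of j] by (simp add: hj)
  moreover have "(%j. h j th) \<longlonglongrightarrow> integrating_exponent z th"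
  proof -
   have "(\<integral>t. sgn t * A (line sg th (t0 - t)) \<partial>lborel) / 2 = attenuation_re sg th t0"
    using lborel_integral_real_affine[of "-1" "%t. sgn (t0 - t) * A (line sg th t)" t0] by (simp add: attenuation_re_def)
   then have 1: "(%j. \<integral>p. poisson (dl j) p * ?B p \<partial>real_plane) \<longlonglongrightarrow> attenuation_re sg th t0" using P(1) by simp
   have 2: "(%j. \<integral>p. conj_poisson (dl j) p * ?B p \<partial>real_plane) \<longlonglongrightarrow> attenuation_im sg th"
    using Q(1) attenuation_im_shift[OF n b] by simp
   show ?thesis unfolding hj integrating_exponent_def sg_def[symmetric] t0_def[symmetric]
    by (intro tendsto_Complex tendsto_minus 1 2)
  qed
  ultimately show ?thesis by blast
 qed
 show "hardy (integrating_exponent z)"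
  by (rule hardy_limit[of h, OF hh]) (use * in blast)+
 show "norm (integrating_exponent z th) <= N * (2 * R) + 4 * \<Lambda> * (2 * R)\<^sup>2" if n: "norm th = 1"
  by (rule LIMSEQ_le_const2[OF tendsto_norm[OF conjunct2[OF *[OF n]]]]) (use *[OF n] in blast)
qed

lemma integrating_exponent_measurable:
 "(%x. integrating_exponent (fst x) (snd x)) : borel_measurable phase_space"
proof -
 have 1: "(%x. \<integral>ta. sgn (fst x \<bullet> snd x - ta) * A (line (fst x \<bullet> perp (snd x)) (snd x) ta) \<partial>lborel) : borel_measurable phase_space"
  by (rule lborel.borel_measurable_lebesgue_integral) measurable
 have 2: "(%x. \<integral>p. (A (line (fst x \<bullet> perp (snd x) - fst p) (snd x) (snd p)) - A (line (fst x \<bullet> perp (snd x) + fst p) (snd x) (snd p))) / fst p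
   \<partial>real_plane) : borel_measurable phase_space"
  by (rule lborel_pair.borel_measurable_lebesgue_integral) measurable
 show ?thesis
  unfolding integrating_exponent_def Complex_eq_of_real attenuation_re_def attenuation_im_def using 1 2 by measurable
qed

text \<open>The imaginary part is constant on the line, and the real part differs from an ordinary
  primitive of \<open>A\<close> by a constant.\<close>

lemma integrating_exponent_deriv:
 assumes n: "norm th = 1"
 shows "((%t. integrating_exponent (line s th t) th) has_vector_derivative of_real (A (line s th t0))) (at t0)"
proof -
 define f where "f ta = A (line s th ta)" for ta
 have fc: "continuous_on S f" for S
  unfolding f_def line_def by (intro continuous_on_compose2[OF contA[of UNIV]] continuous_intros) auto
 have mf[measurable]: "f : borel_measurable borel" by (rule borel_measurable_continuous_onI[OF fc])
 have fz: "f ta = 0" if "R < \<bar>ta\<bar>" for ta using zA[OF n, of s ta] that by (simp add: f_def)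
 \<comment> \<open>The interval contains the support of \<open>A\<close> on the line and has
   \<open>t0\<close> in its interior.\<close>
 define a b where "a = - R - \<bar>t0\<bar> - 1" and "b = R + \<bar>t0\<bar> + 1"
 have re: "attenuation_re s th t = integral {a..t} f - integral {a..b} f / 2" if t: "a < t" "t < b" for t
 proof -
  have io: "integrable lborel (%ta. indicator {a..t} ta *\<^sub>R f ta)" for t
   using borel_integrable_atLeastAtMost'[OF fc, of a t] by (simp add: set_integrable_def)
  have eq: "integral {a..t} f = (\<integral>ta. indicator {a..t} ta *\<^sub>R f ta \<partial>lborel)" for t
   using set_borel_integral_eq_integral(2)[OF borel_integrable_atLeastAtMost'[OF fc, of a t]] by (simp add: set_lebesgue_integral_def)
  have "(\<integral>ta. sgn (t - ta) * f ta \<partial>lborel) = (\<integral>ta. 2 * (indicator {a..t} ta *\<^sub>R f ta) - indicator {a..b} ta *\<^sub>R f ta \<partial>lborel)"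
  proof (rule integral_cong_AE)
   show "AE ta in lborel. sgn (t - ta) * f ta = 2 * (indicator {a..t} ta *\<^sub>R f ta) - indicator {a..b} ta *\<^sub>R f ta"
    using AE_lborel_singleton[of t]
   proof eventually_elim
    fix ta assume "ta ~= t"
    show "sgn (t - ta) * f ta = 2 * (indicator {a..t} ta *\<^sub>R f ta) - indicator {a..b} ta *\<^sub>R f ta"
    proof (cases "R < \<bar>ta\<bar>")
     case False
     then have "a <= ta" "ta <= b" by (auto simp: a_def b_def)
     then show ?thesis using \<open>ta ~= t\<close> by (simp add: indicator_def sgn_real_def)
    qed (simp add: fz)
   qed
   show "(%ta. sgn (t - ta) * f ta) : borel_measurable lborel" by measurable
  qed measurable
  also have "\<dots> = 2 * integral {a..t} f - integral {a..b} f"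
   unfolding eq using io[of t] io[of b] by simp
  finally show ?thesis by (simp add: attenuation_re_def f_def)
 qed
 have ab: "a < t0" "t0 < b" using R0 by (auto simp: a_def b_def)
 have "((%u. integral {a..u} f) has_vector_derivative f t0) (at t0 within {a..b})"
  by (rule integral_has_vector_derivative[OF fc]) (use ab in auto)
 then have "((%u. integral {a..u} f) has_vector_derivative f t0) (at t0)"
  using ab at_within_interior[of t0 "{a..b}"] by simp
 then have d: "((%u. integral {a..u} f - integral {a..b} f / 2) has_vector_derivative f t0) (at t0)"
  by (auto intro!: derivative_eq_intros)
 have "(attenuation_re s th has_vector_derivative f t0) (at t0)"
  by (rule has_vector_derivative_transform_within_open[OF d, of "{a<..<b}"]) (use ab re in auto)
 then have "((%t. of_real (attenuation_re s th t) + (- (\<i> * of_real (attenuation_im s th)))) has_vector_derivative of_real (f t0) + 0) (at t0)"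
  by (intro has_vector_derivative_add has_vector_derivative_of_real has_vector_derivative_const)
   (simp add: has_real_derivative_iff_has_vector_derivative)
 then show ?thesis
  by (simp add: integrating_exponent_def line_inner[OF n] Complex_eq_of_real f_def)
qed

end

section \<open>Testing on whole lines\<close>

text \<open>Fubini over the region \<open>r <= t\<close> replaces the product rule, as
  \<open>f\<close> is only integrable. The boundary term is the total integral of \<open>f\<close>
  times \<open>ps T\<close>, and that integral is zero.\<close>

lemma primitive_by_parts:
 fixes f :: "real => real" and ps ps' :: "real => complex"
 assumes f: "integrable lborel f" and fz: "!!r. T < \<bar>r\<bar> ==> f r = 0"
  and P: "!!t. P t = (\<integral>r. indicator {..t} r * f r \<partial>lborel)" and Pz: "!!t. T < \<bar>t\<bar> ==> P t = 0"
  and d: "!!t. (ps has_vector_derivative ps' t) (at t)" and c: "continuous_on UNIV ps'" and T: "T > 0"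
 shows "(\<integral>t. of_real (P t) * ps' t \<partial>lborel) = - (\<integral>r. of_real (f r) * ps r \<partial>lborel)"
proof -
 have cps: "continuous_on UNIV ps"
  using d by (auto simp: continuous_on_eq_continuous_at intro: has_vector_derivative_continuous)
 have bound: "\<exists>C. \<forall>t. \<bar>t\<bar> <= T --> norm (g t) <= C" if "continuous_on UNIV g" for g :: "real => complex"
 proof -
  have "compact (g ` {-T..T})" by (intro compact_continuous_image continuous_on_subset[OF that]) auto
  then obtain C where C: "\<forall>x\<in>g ` {-T..T}. norm x <= C" using compact_imp_bounded bounded_iff by blast
  have "norm (g t) <= C" if "\<bar>t\<bar> <= T" for t using C that by (auto simp: abs_le_iff)
  then show ?thesis by blast
 qed
 from bound[OF c] obtain C where C: "!!t. \<bar>t\<bar> <= T ==> norm (ps' t) <= C" by blast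
 from bound[OF cps] obtain D where D: "!!t. \<bar>t\<bar> <= T ==> norm (ps t) <= D" by blast
 have [measurable]: "f : borel_measurable borel" "ps : borel_measurable borel" "ps' : borel_measurable borel"
  using f borel_measurable_continuous_onI[OF c] borel_measurable_continuous_onI[OF cps] by auto
 define k where "k r t = of_real (indicator {..t} r * f r * indicator {-T..T} t) * ps' t" for r t
 have ik: "integrable real_plane (%(r, t). k r t)"
 proof (rule Bochner_Integration.integrable_bound)
  show "integrable real_plane (%p. \<bar>f (fst p)\<bar> * (C * indicator {-T..T} (snd p)))"
   by (intro integrable_product integrable_mult_right integrable_indicator_Icc integrable_abs f)
  show "(%(r, t). k r t) : borel_measurable real_plane" unfolding k_def case_prod_beta indicator_def atMost_iff atLeastAtMost_iff by measurable
  have kb: "norm (k r t) <= \<bar>f r\<bar> * (C * indicator {-T..T} t)" for r t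
  proof (cases "\<bar>t\<bar> <= T")
   case True
   then have t: "t : {-T..T}" by (simp add: abs_le_iff)
   have "\<bar>f r\<bar> * norm (ps' t) <= \<bar>f r\<bar> * C" by (intro mult_left_mono C True) auto
   moreover have "norm (k r t) <= \<bar>f r\<bar> * norm (ps' t)" by (simp add: k_def norm_mult indicator_def mult_right_mono)
   ultimately show ?thesis using t by simp
  qed (auto simp: k_def indicator_def)
  show "AE p in real_plane. norm (case p of (r, t) => k r t) <= norm (\<bar>f (fst p)\<bar> * (C * indicator {-T..T} (snd p)))"
   unfolding case_prod_beta real_norm_def by (rule AE_I2, rule order_trans[OF kb abs_ge_self])
 qed
 have kr: "(\<integral>r. k r t \<partial>lborel) = of_real (P t) * ps' t" for t
 proof -
  have "(\<integral>r. k r t \<partial>lborel) = (\<integral>r. complex_of_real (indicator {..t} r * f r) \<partial>lborel) * (of_real (indicator {-T..T} t) * ps' t)"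
   by (simp only: integral_mult_left_zero[symmetric] k_def of_real_mult mult.assoc)
  also have "(\<integral>r. complex_of_real (indicator {..t} r * f r) \<partial>lborel) = of_real (P t)"
   unfolding P by (rule integral_complex_of_real)
  finally show ?thesis using Pz[of t] by (cases "T < \<bar>t\<bar>") (auto simp: indicator_def)
 qed
 have kt: "(\<integral>t. k r t \<partial>lborel) = of_real (f r) * (ps T - ps r)" for r
 proof (cases "T < \<bar>r\<bar>")
  case True then show ?thesis by (simp add: k_def fz)
 next
  case False
  then have r: "- T <= r" "r <= T" by auto
  have "(\<integral>t. k r t \<partial>lborel) = (\<integral>t. of_real (f r) * (indicator {r..T} t *\<^sub>R ps' t) \<partial>lborel)"
   using r by (intro Bochner_Integration.integral_cong refl) (auto simp: k_def indicator_def)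
  also have "\<dots> = of_real (f r) * (\<integral>t. indicator {r..T} t *\<^sub>R ps' t \<partial>lborel)" by (rule integral_mult_right_zero)
  also have "(\<integral>t. indicator {r..T} t *\<^sub>R ps' t \<partial>lborel) = ps T - ps r"
   by (rule integral_FTC_Icc[OF r(2)])
    (rule has_vector_derivative_at_within[OF d], rule continuous_on_subset[OF c subset_UNIV])
  finally show ?thesis .
 qed
 \<comment> \<open>The value of the primitive at \<open>T + 1\<close> is the total integral;
   vanishing of \<open>P\<close> is known only strictly beyond \<open>T\<close>.\<close>
 have "(\<integral>r. f r \<partial>lborel) = (\<integral>r. indicator {..T + 1} r * f r \<partial>lborel)"
  by (intro Bochner_Integration.integral_cong refl) (use fz in \<open>auto simp: indicator_def\<close>)
 then have f0: "(\<integral>r. f r \<partial>lborel) = 0" using P[of "T + 1"] Pz[of "T + 1"] T by simp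
 have i1: "integrable lborel (%r. of_real (f r) * ps T)" using f by simp
 have i2: "integrable lborel (%r. of_real (f r) * ps r)"
 proof (rule Bochner_Integration.integrable_bound[of lborel "%r. D * f r"])
  show "AE r in lborel. norm (of_real (f r) * ps r) <= norm (D * f r)"
  proof (rule AE_I2)
   fix r
   show "norm (of_real (f r) * ps r) <= norm (D * f r)"
   proof (cases "T < \<bar>r\<bar>")
    case False
    then have "\<bar>f r\<bar> * norm (ps r) <= \<bar>f r\<bar> * \<bar>D\<bar>" using D[of r] by (intro mult_left_mono) auto
    then show ?thesis by (simp add: norm_mult abs_mult mult.commute)
   qed (simp add: fz)
  qed
 qed (use f in auto)
 have "(\<integral>t. of_real (P t) * ps' t \<partial>lborel) = (\<integral>t. (\<integral>r. k r t \<partial>lborel) \<partial>lborel)" by (simp add: kr)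
 also have "\<dots> = (\<integral>r. (\<integral>t. k r t \<partial>lborel) \<partial>lborel)" by (rule lborel_pair.Fubini_integral[OF ik])
 also have "\<dots> = (\<integral>r. of_real (f r) * ps T - of_real (f r) * ps r \<partial>lborel)" by (simp add: kt right_diff_distrib)
 also have "\<dots> = (\<integral>r. complex_of_real (f r) * ps T \<partial>lborel) - (\<integral>r. of_real (f r) * ps r \<partial>lborel)"
  by (rule Bochner_Integration.integral_diff[OF i1 i2])
 also have "(\<integral>r. complex_of_real (f r) * ps T \<partial>lborel) = 0"
  using f0 by (simp add: integral_complex_of_real)
 finally show ?thesis by simp
qed

lemma AE_boundary_mp:
 assumes "AE_boundary B P" "AE_boundary B Q" "!!\<zeta> th. P \<zeta> th ==> Q \<zeta> th ==> X \<zeta> th"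
 shows "AE_boundary B X"
 using assms(1,2) unfolding AE_boundary_def
proof eventually_elim
 fix y assume "case y of (s, th) => \<forall>\<zeta>. (\<zeta>, th) : B & \<zeta> \<bullet> perp th = s --> P \<zeta> th"
  "case y of (s, th) => \<forall>\<zeta>. (\<zeta>, th) : B & \<zeta> \<bullet> perp th = s --> Q \<zeta> th"
 then show "case y of (s, th) => \<forall>\<zeta>. (\<zeta>, th) : B & \<zeta> \<bullet> perp th = s --> X \<zeta> th"
  unfolding case_prod_beta using assms(3) by blast
qed

context convex_domain begin

lemma trace_on_cong:
 assumes "trace_on e B v g" "AE_boundary B (%\<zeta> th. g (\<zeta>, th) = h (\<zeta>, th))"
 shows "trace_on e B v h"
 unfolding trace_on_def by (rule AE_boundary_mp[OF assms[unfolded trace_on_def]]) simp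

lemma trace_on_diff:
 assumes "trace_on e B v g" "trace_on e B w h"
 shows "trace_on e B (%x. v x - w x) (%x. g x - h x)"
 unfolding trace_on_def by (rule AE_boundary_mp[OF assms[unfolded trace_on_def]]) (rule tendsto_diff)

lemma characteristic_diff:
 assumes "characteristic v H" "characteristic w J"
 shows "characteristic (%x. v x - w x) (%x. H x - J x)"
 using assms unfolding characteristic_def
proof eventually_elim
 case (elim y)
 then obtain c d where i: "integrable lborel (%t. H (line (fst y) (snd y) t, snd y))" "integrable lborel (%t. J (line (fst y) (snd y) t, snd y))"
  and c: "!!t. line (fst y) (snd y) t : Om ==> v (line (fst y) (snd y) t, snd y) = c + line_primitive H (fst y) (snd y) t"
  and d: "!!t. line (fst y) (snd y) t : Om ==> w (line (fst y) (snd y) t, snd y) = d + line_primitive J (fst y) (snd y) t"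
  by blast
 have ii: "integrable lborel (%r. indicator {..t} r * H (line (fst y) (snd y) r, snd y))"
  "integrable lborel (%r. indicator {..t} r * J (line (fst y) (snd y) r, snd y))" for t
  using integrable_mult_indicator[OF _ i(1), of "{..t}"] integrable_mult_indicator[OF _ i(2), of "{..t}"] by simp_all
 have lp: "line_primitive (%x. H x - J x) (fst y) (snd y) t = line_primitive H (fst y) (snd y) t - line_primitive J (fst y) (snd y) t" for t
  unfolding line_primitive_def right_diff_distrib by (rule Bochner_Integration.integral_diff[OF ii])
 show ?case
 proof (intro conjI exI[of _ "c - d"] allI impI)
  show "integrable lborel (%t. H (line (fst y) (snd y) t, snd y) - J (line (fst y) (snd y) t, snd y))"
   by (rule Bochner_Integration.integrable_diff[OF i])
 qed (simp add: c d lp)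
qed

text \<open>A trace may be realised by any representative, whereas the line formula belongs to a
  particular one. That one has a trace of its own, and uniqueness identifies the two.\<close>

lemma trace_transfer:
 assumes e: "enters e B" and v: "characteristic v H"
  and vu: "AE x in phase_space. fst x : Om --> v x = u x" and wu: "AE x in phase_space. fst x : Om --> w x = u x"
  and w: "trace_on e B w g"
 shows "trace_on e B v g"
proof -
 have "AE x in phase_space. fst x : Om --> v x = w x" using vu wu by eventually_elim simp
 from trace_unique[OF e this characteristic_trace[OF e v] w] show ?thesis
  by (rule trace_on_cong[OF characteristic_trace[OF e v]])
qed

text \<open>Extended by zero, \<open>w\<close> equals the primitive of \<open>H\<close> on complete
  lines, so no boundary terms arise and the test function may be any bounded function that is
  continuously differentiable along lines. Exponentials in space times powers of \<open>zeta\<close>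
  times an integrating factor are of this kind.\<close>

lemma zero_trace_test:
 fixes \<Psi> \<Psi>' :: "plane \<times> plane => complex" and H w v :: "plane \<times> plane => real"
 assumes R: "!!z. z : Om ==> norm z <= R" "R > 0"
  and w: "integrable phase_space w" and H: "integrable phase_space H"
  and wz: "!!x. fst x \<notin> Om ==> w x = 0" and Hz: "!!x. fst x \<notin> Om ==> H x = 0"
  and prim: "AE y in lborel \<Otimes>\<^sub>M circle_measure. integrable lborel (%t. H (line (fst y) (snd y) t, snd y)) \<and>
   (\<forall>t. indicator Om (line (fst y) (snd y) t) * v (line (fst y) (snd y) t, snd y) = line_primitive H (fst y) (snd y) t)"
  and vw: "AE x in phase_space. indicator Om (fst x) * v x = w x"
  and m: "\<Psi> : borel_measurable phase_space" "\<Psi>' : borel_measurable phase_space"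
  and b: "!!x. fst x : Om ==> norm (snd x) = 1 ==> norm (\<Psi> x) <= C"
  and b': "!!x. fst x : Om ==> norm (snd x) = 1 ==> norm (\<Psi>' x) <= C"
  and d: "!!s th t. norm th = 1 ==> ((%t. \<Psi> (line s th t, th)) has_vector_derivative \<Psi>' (line s th t, th)) (at t)"
  and c: "!!s th. norm th = 1 ==> continuous_on UNIV (%t. \<Psi>' (line s th t, th))"
 shows "(\<integral>x. of_real (w x) * \<Psi>' x \<partial>phase_space) = - (\<integral>x. of_real (H x) * \<Psi> x \<partial>phase_space)"
proof -
 note [measurable] = m
 have [measurable]: "w : borel_measurable phase_space" "H : borel_measurable phase_space" using w H by auto
 have int: "integrable phase_space (%x. of_real (g x) * h x)"
  if g: "integrable phase_space g" "!!x. fst x \<notin> Om ==> g x = 0" and h: "h : borel_measurable phase_space"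
   and hb: "!!x. fst x : Om ==> norm (snd x) = 1 ==> norm (h x) <= C" for g :: "plane \<times> plane => real" and h :: "plane \<times> plane => complex"
 proof (rule Bochner_Integration.integrable_bound[of _ "%x. C * g x"])
  show "integrable phase_space (%x. C * g x)" using g by simp
  have [measurable]: "g : borel_measurable phase_space" using g by auto
  show "(%x. of_real (g x) * h x) : borel_measurable phase_space" using h by measurable
  show "AE x in phase_space. norm (of_real (g x) * h x) <= norm (C * g x)"
  proof (rule AE_I2)
   fix x assume "x : space phase_space"
   then have n: "norm (snd x) = 1" by (auto simp: space_phase)
   show "norm (of_real (g x) * h x) <= norm (C * g x)"
   proof (cases "fst x : Om")
    case True
    have "\<bar>g x\<bar> * norm (h x) <= \<bar>g x\<bar> * \<bar>C\<bar>" using hb[OF True n] by (intro mult_left_mono) auto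
    then show ?thesis by (simp add: norm_mult abs_mult mult.commute)
   qed (simp add: g)
  qed
 qed
 have i1: "integrable phase_space (%x. of_real (w x) * \<Psi>' x)" by (rule int[OF w wz m(2) b'])
 have i2: "integrable phase_space (%x. - (of_real (H x) * \<Psi> x))" by (intro Bochner_Integration.integrable_minus int[OF H Hz m(1) b])
 have meas: "(%y. \<integral>t. f (line (fst y) (snd y) t, snd y) \<partial>lborel) : borel_measurable (lborel \<Otimes>\<^sub>M circle_measure)"
  if "integrable phase_space f" for f :: "plane \<times> plane => complex"
  using borel_measurable_integrable[OF integrable_phase_lines[OF that]]
  by (intro lborel.borel_measurable_lebesgue_integral) (simp add: case_prod_beta')
 have "(\<integral>x. of_real (w x) * \<Psi>' x \<partial>phase_space) = (\<integral>y. (\<integral>t. of_real (w (line (fst y) (snd y) t, snd y)) * \<Psi>' (line (fst y) (snd y) t, snd y) \<partial>lborel)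
   \<partial>(lborel \<Otimes>\<^sub>M circle_measure))" by (rule integral_phase_lines[OF i1])
 also have "\<dots> = (\<integral>y. (\<integral>t. - (of_real (H (line (fst y) (snd y) t, snd y)) * \<Psi> (line (fst y) (snd y) t, snd y)) \<partial>lborel)
   \<partial>(lborel \<Otimes>\<^sub>M circle_measure))"
 proof (rule integral_cong_AE[OF meas[OF i1] meas[OF i2]])
  show "AE y in lborel \<Otimes>\<^sub>M circle_measure.
   (\<integral>t. of_real (w (line (fst y) (snd y) t, snd y)) * \<Psi>' (line (fst y) (snd y) t, snd y) \<partial>lborel) =
   (\<integral>t. - (of_real (H (line (fst y) (snd y) t, snd y)) * \<Psi> (line (fst y) (snd y) t, snd y)) \<partial>lborel)"
   using prim AE_phase_lines[OF vw] AE_space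
  proof eventually_elim
   case (elim y)
   obtain s th where y: "y = (s, th)" by fastforce
   have n: "norm th = 1" using elim(3) by (auto simp: y space_pair_measure space_circle)
   have out: "line s th t \<notin> Om" if "R < \<bar>t\<bar>" for t
    using R(1)[of "line s th t"] abs_coordinate_le(1)[OF n, of "line s th t"] that by (auto simp: line_inner[OF n])
   have iH: "integrable lborel (%t. H (line s th t, th))" using elim(1) by (simp add: y)
   have pr: "indicator Om (line s th t) * v (line s th t, th) = line_primitive H s th t" for t using elim(1) by (simp add: y)
   have mt: "(%t. (line s th t, th)) : lborel \<rightarrow>\<^sub>M phase_space"
    by (rule measurable_Pair) (use n in \<open>auto simp: space_circle\<close>)
   have ml: "line_primitive H s th : borel_measurable borel"
    by (rule borel_measurable_continuous_onI) (simp add: continuous_on_eq_continuous_at isCont_line_primitive[OF iH])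
   have "(\<integral>t. of_real (w (line s th t, th)) * \<Psi>' (line s th t, th) \<partial>lborel) = (\<integral>t. of_real (line_primitive H s th t) * \<Psi>' (line s th t, th) \<partial>lborel)"
   proof (rule integral_cong_AE)
    show "(%t. of_real (w (line s th t, th)) * \<Psi>' (line s th t, th)) : borel_measurable lborel"
     by (rule measurable_compose[OF mt]) measurable
    show "(%t. of_real (line_primitive H s th t) * \<Psi>' (line s th t, th)) : borel_measurable lborel"
     using ml measurable_compose[OF mt m(2)] by simp
    show "AE t in lborel. of_real (w (line s th t, th)) * \<Psi>' (line s th t, th) = of_real (line_primitive H s th t) * \<Psi>' (line s th t, th)"
     using elim(2) unfolding y fst_conv snd_conv pr by eventually_elim simp
   qed
   also have "\<dots> = - (\<integral>t. of_real (H (line s th t, th)) * \<Psi> (line s th t, th) \<partial>lborel)"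
   proof (rule primitive_by_parts[OF iH, where T=R])
    show "line_primitive H s th t = (\<integral>r. indicator {..t} r * H (line s th r, th) \<partial>lborel)" for t by (simp add: line_primitive_def)
    show "line_primitive H s th t = 0" if "R < \<bar>t\<bar>" for t using pr[of t] out[OF that] by simp
   qed (use R(2) out Hz d[OF n] c[OF n] in auto)
   finally show ?case by (simp add: y)
  qed
 qed
 also have "\<dots> = (\<integral>x. - (of_real (H x) * \<Psi> x) \<partial>phase_space)" by (rule integral_phase_lines[OF i2, symmetric])
 finally show ?thesis by simp
qed

text \<open>The mean value theorem along segments, which convexity keeps inside the domain, with the
  bound of the gradient on the closure.\<close>

lemma c1_lipschitz:
 assumes c: "c1 a gm"
 obtains L where "L >= 0" "L-lipschitz_on (closure Om) a"
proof -
 have ca: "continuous_on (closure Om) a" and cg: "continuous_on (closure Om) gm"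
  and d: "!!z th. z : Om ==> ((%r. a (z + r *\<^sub>R th)) has_real_derivative th \<bullet> gm z) (at 0)" using c by (auto simp: c1_def)
 obtain L where L: "L >= 0" "!!z. z : closure Om ==> norm (gm z) <= L" using bounded_closure[OF cg] by blast
 have "L-lipschitz_on Om a"
 proof (rule lipschitz_onI[OF _ L(1)])
  fix x y assume x: "x : Om" and y: "y : Om"
  define p where "p r = x + r *\<^sub>R (y - x)" for r
  have pO: "p r : Om" if "0 <= r" "r <= 1" for r
   using convexD_alt[OF cv x y that] by (simp add: p_def algebra_simps)
  have dp: "((%r. a (p r)) has_real_derivative (y - x) \<bullet> gm (p r)) (at r)" if "0 <= r" "r <= 1" for r
  proof -
   have "((%q. a (p r + q *\<^sub>R (y - x))) has_real_derivative (y - x) \<bullet> gm (p r)) (at 0)" by (rule d[OF pO[OF that]])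
   moreover have "p r + q *\<^sub>R (y - x) = p (q + r)" for q by (simp add: p_def algebra_simps)
   ultimately show ?thesis using DERIV_shift[of "%r. a (p r)" _ 0 r] by simp
  qed
  obtain r where r: "0 < r" "r < 1" "a (p 1) - a (p 0) = (1 - 0) * ((y - x) \<bullet> gm (p r))"
   using MVT2[of 0 1 "%r. a (p r)" "%r. (y - x) \<bullet> gm (p r)"] dp by auto
  have "\<bar>(y - x) \<bullet> gm (p r)\<bar> <= norm (y - x) * norm (gm (p r))" by (rule Cauchy_Schwarz_ineq2)
  also have "\<dots> <= norm (y - x) * L"
   using pO[of r] r by (intro mult_left_mono L(2) subsetD[OF closure_subset]) auto
  finally show "dist (a x) (a y) <= L * dist x y"
   using r(3) by (simp add: p_def dist_norm dist_real_def norm_minus_commute mult.commute abs_minus_commute)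
 qed
 from lipschitz_on_closure[OF this ca] L(1) that show ?thesis by blast
qed

text \<open>\<open>a\<close> is composed with the nearest point projection, which does not increase
  distances because the closure is convex, and multiplied by a cutoff that falls linearly to zero at
  distance 1. The cutoff has Lipschitz constant 2, hence \<open>L + 2 * N\<close>, and the support
  grows by 1.\<close>

lemma attenuation_extension:
 assumes c: "c1 a gm" and ne: "Om ~= {}"
 obtains A \<Lambda> N R where "attenuation A \<Lambda> N R" "!!z. z : Om ==> A z = a z" "!!z. z : Om ==> norm z <= R"
proof -
 obtain L where L: "L >= 0" "L-lipschitz_on (closure Om) a" using c1_lipschitz[OF c] by blast
 obtain N where N: "N >= 0" "!!z. z : closure Om ==> norm (a z) <= N" using bounded_closure c by (metis c1_def)
 obtain R where R: "R > 0" "!!z. z : closure Om ==> norm z <= R" 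
  using compact_imp_bounded[of "closure Om"] bd unfolding compact_closure bounded_pos by blast
 define \<pi> where "\<pi> = closest_point (closure Om)"
 have cne: "closure Om ~= {}" using ne by simp
 have \<pi>in: "\<pi> z : closure Om" for z unfolding \<pi>_def by (rule closest_point_in_set[OF closed_closure cne])
 have \<pi>l: "norm (\<pi> x - \<pi> y) <= norm (x - y)" for x y
  using closest_point_lipschitz[OF convex_closure[OF cv] closed_closure cne, of x y] by (simp add: \<pi>_def dist_norm)
 define kp where "kp z = max 0 (1 - norm (z - \<pi> z))" for z
 have kpb: "0 <= kp z" "kp z <= 1" for z by (auto simp: kp_def)
 have kpl: "\<bar>kp x - kp y\<bar> <= 2 * norm (x - y)" for x y
 proof -
  have "\<bar>norm (x - \<pi> x) - norm (y - \<pi> y)\<bar> <= norm ((x - \<pi> x) - (y - \<pi> y))" by (rule norm_triangle_ineq3)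
  also have "(x - \<pi> x) - (y - \<pi> y) = (x - y) - (\<pi> x - \<pi> y)" by simp
  also have "norm \<dots> <= norm (x - y) + norm (\<pi> x - \<pi> y)" by (rule norm_triangle_ineq4)
  also have "\<dots> <= 2 * norm (x - y)" using \<pi>l[of x y] by simp
  finally show ?thesis unfolding kp_def by linarith
 qed
 have al: "\<bar>a (\<pi> x) - a (\<pi> y)\<bar> <= L * norm (x - y)" for x y
 proof -
  have "\<bar>a (\<pi> x) - a (\<pi> y)\<bar> <= L * norm (\<pi> x - \<pi> y)"
   using lipschitz_onD[OF L(2) \<pi>in \<pi>in, of x y] by (simp add: dist_norm)
  also have "\<dots> <= L * norm (x - y)" by (intro mult_left_mono \<pi>l L)
  finally show ?thesis .
 qed
 show ?thesis
 proof (rule that[of "%z. a (\<pi> z) * kp z" "L + 2 * N" N "R + 1"])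
  show "attenuation (%z. a (\<pi> z) * kp z) (L + 2 * N) N (R + 1)"
  proof
   fix x y
   have "a (\<pi> x) * kp x - a (\<pi> y) * kp y = (a (\<pi> x) - a (\<pi> y)) * kp x + a (\<pi> y) * (kp x - kp y)" by (simp add: algebra_simps)
   also have "\<bar>\<dots>\<bar> <= \<bar>a (\<pi> x) - a (\<pi> y)\<bar> * \<bar>kp x\<bar> + \<bar>a (\<pi> y)\<bar> * \<bar>kp x - kp y\<bar>"
    by (rule order_trans[OF abs_triangle_ineq]) (simp add: abs_mult)
   also have "\<dots> <= (L * norm (x - y)) * 1 + N * (2 * norm (x - y))"
    using N(2)[OF \<pi>in, of y] kpb[of x] L N by (intro add_mono mult_mono al kpl) auto
   finally show "\<bar>a (\<pi> x) * kp x - a (\<pi> y) * kp y\<bar> <= (L + 2 * N) * norm (x - y)" by (simp add: algebra_simps)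
  next
   fix x
   have "\<bar>a (\<pi> x)\<bar> * \<bar>kp x\<bar> <= N * 1" using N(2)[OF \<pi>in, of x] kpb[of x] N by (intro mult_mono) auto
   then show "\<bar>a (\<pi> x) * kp x\<bar> <= N" by (simp add: abs_mult)
  next
   fix x :: plane assume "R + 1 < norm x"
   then have "1 <= norm (x - \<pi> x)" using R(2)[OF \<pi>in, of x] norm_triangle_ineq2[of x "\<pi> x"] by linarith
   then show "a (\<pi> x) * kp x = 0" by (simp add: kp_def)
  qed (use R L N in auto)
  fix z assume z: "z : Om"
  then have zc: "z : closure Om" by (rule subsetD[OF closure_subset])
  then have "\<pi> z = z" unfolding \<pi>_def by (rule closest_point_self)
  then show "a (\<pi> z) * kp z = a z" by (simp add: kp_def)
  show "norm z <= R + 1" using R(2)[OF zc] by simp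
 qed
qed

end

section \<open>The difference of two solutions with the same data\<close>

context transport_medium begin

text \<open>Inflow traces vanish for both solutions and outflow traces agree, so the difference of
  their line representatives has zero trace on both sides. Its derivative along lines is the
  difference of two \<open>rhs\<close> terms, which is the \<open>rhs\<close> of the difference up
  to a null set.\<close>

lemma zero_data_identity:
 fixes \<Psi> \<Psi>' :: "plane \<times> plane => complex"
 assumes u: "transport_solution Om a k p s u" "has_outflow_trace Om u g" and u': "transport_solution Om a k p s' u'" "has_outflow_trace Om u' g'"
  and same: "same_data Om g g'" and s: "integrable phase_space (cut s)" and s': "integrable phase_space (cut s')" and p: "p > 1"
  and R: "!!z. z : Om ==> norm z <= R" "R > 0"
  and \<Psi>: "\<Psi> : borel_measurable phase_space" "\<Psi>' : borel_measurable phase_space"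
   "!!x. fst x : Om ==> norm (snd x) = 1 ==> norm (\<Psi> x) <= C"
   "!!x. fst x : Om ==> norm (snd x) = 1 ==> norm (\<Psi>' x) <= C"
   "!!s th t. norm th = 1 ==> ((%t. \<Psi> (line s th t, th)) has_vector_derivative \<Psi>' (line s th t, th)) (at t)"
   "!!s th. norm th = 1 ==> continuous_on UNIV (%t. \<Psi>' (line s th t, th))"
 shows "(\<integral>x. of_real (cut (%x. u x - u' x) x) * \<Psi>' x \<partial>phase_space) =
  - (\<integral>x. of_real (cut (rhs (%x. s x - s' x) (%x. u x - u' x)) x) * \<Psi> x \<partial>phase_space)"
proof -
 have iu: "integrable phase_space (cut u)" and iu': "integrable phase_space (cut u')"
  using u(1) u'(1) p by (auto simp: transport_solution_def intro: Lp_cut)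
 have cut_diff: "cut (%x. f x - h x) = (%x. cut f x - cut h x)" for f h by (auto simp: cut_def algebra_simps)
 have iw: "integrable phase_space (cut (%x. u x - u' x))" and isd: "integrable phase_space (cut (%x. s x - s' x))"
  unfolding cut_diff using iu iu' s s' by simp_all
 obtain v where v: "AE x in phase_space. fst x : Om --> v x = u x" "characteristic v (cut (rhs s u))"
  using characteristic_solution[OF iu s] u(1) by (auto simp: transport_solution_def)
 obtain v' where v': "AE x in phase_space. fst x : Om --> v' x = u' x" "characteristic v' (cut (rhs s' u'))"
  using characteristic_solution[OF iu' s'] u'(1) by (auto simp: transport_solution_def)
 have traces: "trace_on (- 1) (inflow Om) y (%_. 0) & trace_on 1 (outflow Om) y l"
  if "characteristic y J" "AE x in phase_space. fst x : Om --> y x = q x" "has_inflow_trace Om q (%_. 0)" "has_outflow_trace Om q l" for y J q l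
 proof -
  from that(3) obtain w where "AE x in phase_space. fst x : Om --> w x = q x" "trace_on (- 1) (inflow Om) w (%_. 0)"
   unfolding has_inflow_trace_iff by blast
  moreover from that(4) obtain w' where "AE x in phase_space. fst x : Om --> w' x = q x" "trace_on 1 (outflow Om) w' l"
   unfolding has_outflow_trace_iff by blast
  ultimately show ?thesis using trace_transfer[OF enters_inflow that(1,2)] trace_transfer[OF enters_outflow that(1,2)] by blast
 qed
 have t: "trace_on (- 1) (inflow Om) v (%_. 0)" "trace_on 1 (outflow Om) v g"
  using traces[OF v(2,1) _ u(2)] u(1) by (auto simp: transport_solution_def)
 have t': "trace_on (- 1) (inflow Om) v' (%_. 0)" "trace_on 1 (outflow Om) v' g'"
  using traces[OF v'(2,1) _ u'(2)] u'(1) by (auto simp: transport_solution_def)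
 define H where "H x = cut (rhs s u) x - cut (rhs s' u') x" for x
 have ch: "characteristic (%x. v x - v' x) H" unfolding H_def by (rule characteristic_diff[OF v(2) v'(2)])
 have tin: "trace_on (- 1) (inflow Om) (%x. v x - v' x) (%_. 0)" using trace_on_diff[OF t(1) t'(1)] by simp
 have tout: "trace_on 1 (outflow Om) (%x. v x - v' x) (%_. 0)"
 proof (rule trace_on_cong[OF trace_on_diff[OF t(2) t'(2)]])
  show "AE_boundary (outflow Om) (%\<zeta> th. g (\<zeta>, th) - g' (\<zeta>, th) = 0)"
   using same[unfolded same_data_def] by (rule AE_boundary_mp[OF _ same[unfolded same_data_def]]) simp
 qed
 have H0: "H x = 0" if "fst x \<notin> Om" for x using that by (simp add: H_def cut_def)
 have iH: "integrable phase_space H" unfolding H_def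
  by (intro Bochner_Integration.integrable_diff integrable_cut_rhs iu iu' s s')
 have "(\<integral>x. of_real (cut (%x. u x - u' x) x) * \<Psi>' x \<partial>phase_space) = - (\<integral>x. of_real (H x) * \<Psi> x \<partial>phase_space)"
 proof (rule zero_trace_test[OF R iw iH _ H0 zero_trace_primitive[OF H0 ch tin tout] _ \<Psi>])
  show "AE x in phase_space. indicator Om (fst x) * (v x - v' x) = cut (%x. u x - u' x) x"
   using v(1) v'(1) by eventually_elim (auto simp: cut_def indicator_def)
 qed (simp_all add: cut_def)
 also have "(\<integral>x. of_real (H x) * \<Psi> x \<partial>phase_space) = (\<integral>x. of_real (cut (rhs (%x. s x - s' x) (%x. u x - u' x)) x) * \<Psi> x \<partial>phase_space)"
 proof (rule integral_cong_AE)
  have [measurable]: "H : borel_measurable phase_space" using iH by auto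
  show "(%x. of_real (H x) * \<Psi> x) : borel_measurable phase_space" using \<Psi>(1) by measurable
  have "cut (rhs (%x. s x - s' x) (%x. u x - u' x)) : borel_measurable phase_space" using integrable_cut_rhs[OF iw isd] by auto
  then show "(%x. of_real (cut (rhs (%x. s x - s' x) (%x. u x - u' x)) x) * \<Psi> x) : borel_measurable phase_space" using \<Psi>(1) by measurable
  show "AE x in phase_space. of_real (H x) * \<Psi> x = of_real (cut (rhs (%x. s x - s' x) (%x. u x - u' x)) x) * \<Psi> x"
   using AE_scattering_add[OF iu' iw]
  proof eventually_elim
   case (elim x)
   show ?case
   proof (cases "fst x : Om")
    case True
    then have "scattering k u (fst x) (snd x) = scattering k u' (fst x) (snd x) + scattering k (%x. u x - u' x) (fst x) (snd x)"
     using elim by simp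
    then have "H x = cut (rhs (%x. s x - s' x) (%x. u x - u' x)) x" using True by (simp add: H_def cut_def rhs_def algebra_simps)
    then show ?thesis by simp
   qed (simp add: H_def cut_def)
  qed
 qed
 finally show ?thesis .
qed

end

section \<open>Removal of the attenuation and vanishing of modes\<close>

text \<open>In angles the product is a multiple of \<open>cos (t - \<alpha>)\<close>. Its zeros lie
  in the countable set \<open>Z\<close>, which is taken larger than the zero set for
  simplicity.\<close>

lemma AE_circle_inner_nonzero:
 assumes \<xi>: "\<xi> ~= 0"
 shows "AE th in circle_measure. \<xi> \<bullet> th ~= 0"
proof -
 define r \<alpha> where "r = norm \<xi>" and "\<alpha> = Arg (zeta \<xi>)"
 have r: "r > 0" using \<xi> by (simp add: r_def)
 have "zeta \<xi> = rcis r \<alpha>" using rcis_cmod_Arg[of "zeta \<xi>"] by (simp add: r_def \<alpha>_def norm_zeta)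
 then have x: "\<xi> $ 1 = r * cos \<alpha>" "\<xi> $ 2 = r * sin \<alpha>" by (simp_all add: zeta_def rcis_def complex_eq_iff)
 define Z where "Z = (%i. \<alpha> + of_int i * (pi / 2)) ` (UNIV :: int set)"
 have "Z : null_sets lborel" unfolding Z_def by (intro countable_imp_null_set_lborel) auto
 then have "AE t in lborel. t \<notin> Z" by (rule AE_not_in)
 then have "AE t in lborel. \<xi> \<bullet> vector [cos t, sin t] ~= 0"
 proof eventually_elim
  fix t assume t: "t \<notin> Z"
  have "\<xi> \<bullet> vector [cos t, sin t] = r * cos (t - \<alpha>)" by (simp add: inner_plane x cos_diff algebra_simps)
  moreover have "cos (t - \<alpha>) ~= 0"
  proof
   assume "cos (t - \<alpha>) = 0"
   then obtain i :: int where "t - \<alpha> = of_int i * (pi / 2)" using cos_zero_iff_int by blast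
   then have "t = \<alpha> + of_int i * (pi / 2)" by simp
   with t show False unfolding Z_def by blast
  qed
  ultimately show "\<xi> \<bullet> vector [cos t, sin t] ~= 0" using r by simp
 qed
 then have "AE t in uniform_measure lborel {-pi..pi}. \<xi> \<bullet> vector [cos t, sin t] ~= 0"
  by (intro AE_uniform_measureI) auto
 then show ?thesis unfolding circle_measure_def
  by (subst AE_distr_iff[OF cos_sin_measurable]) (auto simp: space_restrict_space sets_restrict_space)
qed

lemma geometric_mean_limit:
 fixes w :: complex
 assumes w: "norm w = 1" "w ~= 1"
 shows "(%J. (\<Sum>j<J. w ^ j) / of_nat J) \<longlonglongrightarrow> 0"
proof (rule Lim_null_comparison)
 show "(%J. (2 / norm (w - 1)) / real J) \<longlonglongrightarrow> 0" by (rule lim_const_over_n)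
 have "norm ((\<Sum>j<J. w ^ j) / of_nat J) <= (2 / norm (w - 1)) / real J" for J
 proof -
  have "norm (w ^ J - 1) <= 2" using norm_triangle_ineq4[of "w ^ J" 1] w by (simp add: norm_power)
  then have "norm (\<Sum>j<J. w ^ j) <= 2 / norm (w - 1)"
   unfolding geometric_sum[OF w(2)] norm_divide by (intro divide_right_mono) auto
  then show ?thesis unfolding norm_divide norm_of_nat by (intro divide_right_mono) auto
 qed
 then show "\<forall>\<^sub>F J in sequentially. norm ((\<Sum>j<J. w ^ j) / of_nat J) <= (2 / norm (w - 1)) / real J" by simp
qed

lemma geometric_mean_bound:
 fixes w :: complex
 assumes w: "norm w = 1"
 shows "norm ((\<Sum>j<J. w ^ j) / of_nat J) <= 1"
proof -
 have "norm (\<Sum>j<J. w ^ j) <= real J" using norm_sum[of "%j. w ^ j" "{..<J}"] w by (simp add: norm_power)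
 then show ?thesis unfolding norm_divide norm_of_nat by (cases "J = 0") auto
qed

lemma zeta_cnj_same: "norm th = 1 ==> zeta th * cnj (zeta th) = 1"
 by (simp add: complex_norm_square[symmetric] norm_zeta)

text \<open>The inner product is a cosine, so multiplication by it couples modes two apart.
  Centering at \<open>Suc n\<close> keeps the lower power nonnegative.\<close>

lemma zeta_inner:
 assumes n: "norm th = 1"
 shows "complex_of_real (\<xi> \<bullet> th) * zeta th ^ Suc n = (cnj (zeta \<xi>) * zeta th ^ (n + 2) + zeta \<xi> * zeta th ^ n) / 2"
proof -
 have "complex_of_real (\<xi> \<bullet> th) = (zeta th * cnj (zeta \<xi>) + cnj (zeta th) * zeta \<xi>) / 2"
  by (simp add: zeta_def inner_plane complex_eq_iff algebra_simps)
 note e = this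
 have "complex_of_real (\<xi> \<bullet> th) * zeta th ^ Suc n
   = (cnj (zeta \<xi>) * zeta th ^ (n + 2) + zeta \<xi> * zeta th ^ n * (zeta th * cnj (zeta th))) / 2"
  unfolding e by (simp add: power2_eq_square field_simps power_add)
 then show ?thesis by (simp add: zeta_cnj_same[OF n])
qed

text \<open>Absorbing the m-th power of \<open>zeta\<close> into \<open>V\<close> turns vanishing
  from \<open>m\<close> on into vanishing from 0 on, which is the form used in
  \<open>hardy\<close>.\<close>

lemma hardy_shift:
 assumes "hardy g" "integrable circle_measure V" "!!n. n >= m ==> (\<integral>th. V th * zeta th ^ n \<partial>circle_measure) = 0" "n >= m"
 shows "(\<integral>th. g th * V th * zeta th ^ n \<partial>circle_measure) = 0"
proof -
 have "(\<integral>th. g th * (V th * zeta th ^ m) * zeta th ^ (n - m) \<partial>circle_measure) = 0"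
 proof (rule hardyD[OF assms(1) integrable_mult_zeta_power[OF assms(2)]])
  show "(\<integral>th. V th * zeta th ^ m * zeta th ^ j \<partial>circle_measure) = 0" for j
   using assms(3)[of "m + j"] by (simp add: power_add mult.assoc)
 qed
 moreover have "zeta th ^ m * zeta th ^ (n - m) = zeta th ^ n" for th using assms(4) by (simp add: power_add[symmetric])
 ultimately show ?thesis by (simp add: mult.assoc)
qed

lemma phase_fubini: "integrable phase_space F ==> (\<integral>x. F x \<partial>phase_space) = (\<integral>z. (\<integral>th. F (z, th) \<partial>circle_measure) \<partial>lborel)"
 for F :: "plane \<times> plane => 'b::{banach, second_countable_topology}"
 by (rule lc.integral_fst'[symmetric])

text \<open>\<open>W\<close> stands for a difference of two solutions with equal data and
  \<open>S\<close> for the difference of their sources; the equation and the zero traces are present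
  only through \<open>ident\<close>.\<close>

locale vanishing_data = transport_medium Om a k + attenuation A \<Lambda> N R
 for Om a k A \<Lambda> N R +
 fixes W S :: "plane \<times> plane => real"
 assumes A_eq: "!!z. z : Om ==> A z = a z" and inR: "!!z. z : Om ==> norm z <= R"
  and iW: "integrable phase_space (cut W)" and iS: "integrable phase_space (cut S)"
  and ident: "!!(\<Psi> :: plane \<times> plane => complex) \<Psi>' C. \<Psi> : borel_measurable phase_space ==> \<Psi>' : borel_measurable phase_space ==>
   (!!x. fst x : Om ==> norm (snd x) = 1 ==> norm (\<Psi> x) <= C) ==>
   (!!x. fst x : Om ==> norm (snd x) = 1 ==> norm (\<Psi>' x) <= C) ==>
   (!!s th t. norm th = 1 ==> ((%t. \<Psi> (line s th t, th)) has_vector_derivative \<Psi>' (line s th t, th)) (at t)) ==>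
   (!!s th. norm th = 1 ==> continuous_on UNIV (%t. \<Psi>' (line s th t, th))) ==>
   (\<integral>x. of_real (cut W x) * \<Psi>' x \<partial>phase_space) = - (\<integral>x. of_real (cut (rhs S W) x) * \<Psi> x \<partial>phase_space)"
begin

abbreviation KW :: "plane \<times> plane => real" where
 "KW x \<equiv> scattering k W (fst x) (snd x)"

definition factor :: "plane \<times> plane => complex" where
 "factor x = exp (integrating_exponent (fst x) (snd x))"

definition wave :: "nat => plane => plane \<times> plane => complex" where
 "wave n \<xi> x = factor x * zeta (snd x) ^ n * cis (- (\<xi> \<bullet> fst x))"

definition K where "K = N * (2 * R) + 4 * \<Lambda> * (2 * R)\<^sup>2"

lemma measurable_factor[measurable]: "factor : borel_measurable phase_space"
 unfolding factor_def using integrating_exponent_measurable by measurable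

lemma measurable_wave[measurable]: "wave n \<xi> : borel_measurable phase_space"
 unfolding wave_def cis_conv_exp by measurable

lemma hardy_factor:
 assumes "z : Om"
 shows "hardy (%th. factor (z, th))" "hardy (%th. exp (- integrating_exponent z th))"
proof -
 note h = integrating_exponent_hardy(1)[OF inR[OF assms]]
 show "hardy (%th. factor (z, th))" using hardy_exp[OF h] by (simp add: factor_def)
 show "hardy (%th. exp (- integrating_exponent z th))" using hardy_exp[OF hardy_mult[OF hardy_const[of "- 1"] h]] by simp
qed

lemma norm_factor: "fst x : Om ==> norm (snd x) = 1 ==> norm (factor x) <= exp K"
 unfolding factor_def K_def using integrating_exponent_hardy(2)[OF inR, of "fst x" "snd x"]
 by (intro order_trans[OF norm_exp]) simp

lemma norm_wave: "fst x : Om ==> norm (snd x) = 1 ==> norm (wave n \<xi> x) <= exp K"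
 using norm_factor[of x] by (simp add: wave_def norm_mult norm_power norm_zeta)

lemma integrable_cut_mult:
 fixes h :: "plane \<times> plane => complex"
 assumes g: "integrable phase_space (cut g)" and h: "h : borel_measurable phase_space"
  and b: "!!x. fst x : Om ==> norm (snd x) = 1 ==> norm (h x) <= C"
 shows "integrable phase_space (%x. of_real (cut g x) * h x)"
proof (rule Bochner_Integration.integrable_bound[of _ "%x. C * cut g x"])
 show "integrable phase_space (%x. C * cut g x)" using g by simp
 have [measurable]: "cut g : borel_measurable phase_space" using g by auto
 show "(%x. of_real (cut g x) * h x) : borel_measurable phase_space" using h by measurable
 show "AE x in phase_space. norm (of_real (cut g x) * h x) <= norm (C * cut g x)"
 proof (rule AE_I2)
  fix x assume "x : space phase_space"
  then have n: "norm (snd x) = 1" by (auto simp: space_phase)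
  show "norm (of_real (cut g x) * h x) <= norm (C * cut g x)"
  proof (cases "fst x : Om")
   case True
   have "\<bar>cut g x\<bar> * norm (h x) <= \<bar>cut g x\<bar> * \<bar>C\<bar>" using b[OF True n] by (intro mult_left_mono) auto
   then show ?thesis by (simp add: norm_mult abs_mult mult.commute)
  qed (simp add: cut_def)
 qed
qed

text \<open>Along a line the derivative of \<open>wave n \<xi>\<close> is
  \<open>A - \<i> (\<xi> \<bullet> \<theta>)\<close> times itself. The part with \<open>A\<close>
  cancels the absorption in \<open>rhs\<close>, and the spatial frequency replaces the
  gradient.\<close>

lemma wave_identity:
 "\<i> * (\<integral>x. of_real (cut W x) * (of_real (\<xi> \<bullet> snd x) * wave n \<xi> x) \<partial>phase_space) =
  (\<integral>x. of_real (cut (%x. S x + KW x) x) * wave n \<xi> x \<partial>phase_space)"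
proof -
 define d where "d x = (of_real (A (fst x)) - \<i> * of_real (\<xi> \<bullet> snd x)) * wave n \<xi> x" for x
 have md[measurable]: "d : borel_measurable phase_space" unfolding d_def by measurable
 have deriv: "((%t. wave n \<xi> (line s th t, th)) has_vector_derivative d (line s th t0, th)) (at t0)" if th: "norm th = 1" for s th t0
 proof -
  define E where "E t = integrating_exponent (line s th t) th + \<i> * of_real (- (\<xi> \<bullet> line s th t))" for t
  have "((%t. - (\<xi> \<bullet> line s th t)) has_real_derivative - (\<xi> \<bullet> th)) (at t0)"
   by (auto simp: line_def inner_add_right intro!: derivative_eq_intros)
  then have "(E has_vector_derivative of_real (A (line s th t0)) + \<i> * of_real (- (\<xi> \<bullet> th))) (at t0)"
   unfolding E_def
   by (intro has_vector_derivative_add integrating_exponent_deriv[OF th] has_vector_derivative_mult_right has_vector_derivative_of_real)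
  from field_vector_diff_chain_at[OF this DERIV_exp]
  have "((%t. exp (E t)) has_vector_derivative (of_real (A (line s th t0)) + \<i> * of_real (- (\<xi> \<bullet> th))) * exp (E t0)) (at t0)"
   by (simp add: o_def)
  then have "((%t. exp (E t) * zeta th ^ n) has_vector_derivative
    (of_real (A (line s th t0)) + \<i> * of_real (- (\<xi> \<bullet> th))) * exp (E t0) * zeta th ^ n) (at t0)"
   by (rule has_vector_derivative_mult_left)
  moreover have "wave n \<xi> (line s th t, th) = exp (E t) * zeta th ^ n" for t
   unfolding wave_def factor_def E_def exp_add cis_conv_exp fst_conv snd_conv by (simp only: mult_ac)
  ultimately show ?thesis by (simp add: d_def mult.assoc)
 qed
 have cont: "continuous_on UNIV (%t. d (line s th t, th))" if th: "norm th = 1" for s th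
 proof -
  have "continuous_on UNIV (%t. wave n \<xi> (line s th t, th))"
   using has_vector_derivative_continuous[OF deriv[OF th]] by (simp add: continuous_on_eq_continuous_at)
  moreover have "continuous_on UNIV (%t. A (line s th t))"
   unfolding line_def by (intro continuous_on_compose2[OF contA[of UNIV]] continuous_intros) auto
  ultimately show ?thesis unfolding d_def fst_conv snd_conv by (intro continuous_intros)
 qed
 have db: "norm (d x) <= (N + norm \<xi>) * exp K" if "fst x : Om" "norm (snd x) = 1" for x
 proof -
  have "norm (of_real (A (fst x)) - \<i> * of_real (\<xi> \<bullet> snd x)) <= \<bar>A (fst x)\<bar> + \<bar>\<xi> \<bullet> snd x\<bar>"
   by (rule order_trans[OF norm_triangle_ineq4]) (simp add: norm_mult)
  also have "\<dots> <= N + norm \<xi>" using bA[of "fst x"] Cauchy_Schwarz_ineq2[of \<xi> "snd x"] that by simp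
  finally show ?thesis unfolding d_def norm_mult using norm_wave[OF that, of n \<xi>] N0 by (intro mult_mono) auto
 qed
 define C where "C = max (exp K) ((N + norm \<xi>) * exp K)"
 have *: "(\<integral>x. of_real (cut W x) * d x \<partial>phase_space) = - (\<integral>x. of_real (cut (rhs S W) x) * wave n \<xi> x \<partial>phase_space)"
  by (rule ident[where C=C, OF measurable_wave md])
   (use norm_wave db deriv cont in \<open>auto simp: C_def le_max_iff_disj\<close>)
 let ?u = "wave n \<xi>"
 have iK: "integrable phase_space (cut KW)" by (rule integrable_cut_scattering[OF iW])
 have iSK: "integrable phase_space (cut (%x. S x + KW x))"
  using Bochner_Integration.integrable_add[OF iS iK] by (simp add: cut_def[abs_def] distrib_left)
 have i1: "integrable phase_space (%x. of_real (cut W x) * (of_real (A (fst x)) * ?u x))"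
 proof (rule integrable_cut_mult[OF iW])
  show "norm (of_real (A (fst x)) * ?u x) <= N * exp K" if "fst x : Om" "norm (snd x) = 1" for x
   unfolding norm_mult using norm_wave[OF that] bA N0 by (intro mult_mono) auto
 qed measurable
 have i2: "integrable phase_space (%x. of_real (cut W x) * (of_real (\<xi> \<bullet> snd x) * ?u x))"
 proof (rule integrable_cut_mult[OF iW])
  show "norm (of_real (\<xi> \<bullet> snd x) * ?u x) <= norm \<xi> * exp K" if "fst x : Om" "norm (snd x) = 1" for x
   unfolding norm_mult using norm_wave[OF that] Cauchy_Schwarz_ineq2[of \<xi> "snd x"] that by (intro mult_mono) auto
 qed measurable
 have i3: "integrable phase_space (%x. of_real (cut (%x. S x + KW x) x) * ?u x)"
  by (rule integrable_cut_mult[OF iSK measurable_wave norm_wave])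
 have "(\<integral>x. of_real (cut W x) * d x \<partial>phase_space) = (\<integral>x. of_real (cut W x) * (of_real (A (fst x)) * ?u x)
   - \<i> * (of_real (cut W x) * (of_real (\<xi> \<bullet> snd x) * ?u x)) \<partial>phase_space)"
  by (intro Bochner_Integration.integral_cong refl) (simp add: d_def algebra_simps)
 also have "\<dots> = (\<integral>x. of_real (cut W x) * (of_real (A (fst x)) * ?u x) \<partial>phase_space)
   - \<i> * (\<integral>x. of_real (cut W x) * (of_real (\<xi> \<bullet> snd x) * ?u x) \<partial>phase_space)"
  using i1 i2 by simp
 finally have 1: "(\<integral>x. of_real (cut W x) * d x \<partial>phase_space) = \<dots>" .
 have "(\<integral>x. of_real (cut (rhs S W) x) * ?u x \<partial>phase_space) = (\<integral>x. of_real (cut (%x. S x + KW x) x) * ?u x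
   - of_real (cut W x) * (of_real (A (fst x)) * ?u x) \<partial>phase_space)"
  by (intro Bochner_Integration.integral_cong refl) (auto simp: cut_def rhs_def A_eq indicator_def algebra_simps)
 also have "\<dots> = (\<integral>x. of_real (cut (%x. S x + KW x) x) * ?u x \<partial>phase_space) - (\<integral>x. of_real (cut W x) * (of_real (A (fst x)) * ?u x) \<partial>phase_space)"
  using i3 i1 by simp
 finally show ?thesis using * unfolding 1 by (simp add: algebra_simps)
qed

text \<open>Since \<open>W\<close> is real, the integrals against nonnegative powers carry all
  Fourier coefficients, the others being complex conjugates.\<close>

definition mode :: "nat => plane => complex" where
 "mode n z = (\<integral>th. of_real (cut W (z, th)) * zeta th ^ n \<partial>circle_measure)"

definition fmode :: "nat => plane => complex" where
 "fmode n \<xi> = (\<integral>x. of_real (cut W x) * wave n \<xi> x \<partial>phase_space)"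

text \<open>From index \<open>m\<close> on neither source nor scattering contributes, so only
  transport and absorption act there. The integrating factor does not bring such contributions back,
  having no negative modes.\<close>

definition sourceless :: "nat => bool" where
 "sourceless m \<longleftrightarrow> (AE z in lborel. \<forall>n\<ge>m. (\<integral>th. of_real (cut (%x. S x + KW x) (z, th)) * zeta th ^ n \<partial>circle_measure) = 0)"

lemma integrable_wave: "integrable phase_space (%x. of_real (cut W x) * wave n \<xi> x)"
 by (rule integrable_cut_mult[OF iW measurable_wave norm_wave])

text \<open>\<open>hardy_shift\<close> makes the right side of \<open>wave_identity\<close> vanish
  at the index \<open>Suc n\<close>, and \<open>zeta_inner\<close> splits the left side into its two
  neighbours. The lower neighbour lies one below the index where the source vanishes.\<close>

lemma recurrence:
 assumes m: "sourceless m" and n: "Suc n >= m"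
 shows "cnj (zeta \<xi>) * fmode (n + 2) \<xi> + zeta \<xi> * fmode n \<xi> = 0"
proof -
 have iSK: "integrable phase_space (cut (%x. S x + KW x))"
  using Bochner_Integration.integrable_add[OF iS integrable_cut_scattering[OF iW]] by (simp add: cut_def[abs_def] distrib_left)
 have "(\<integral>x. of_real (cut (%x. S x + KW x) x) * wave (Suc n) \<xi> x \<partial>phase_space) =
  (\<integral>z. (\<integral>th. of_real (cut (%x. S x + KW x) (z, th)) * wave (Suc n) \<xi> (z, th) \<partial>circle_measure) \<partial>lborel)"
  by (rule phase_fubini[OF integrable_cut_mult[OF iSK measurable_wave norm_wave]])
 also have "\<dots> = 0"
 proof (rule integral_eq_zero_AE)
  show "AE z in lborel. (\<integral>th. of_real (cut (%x. S x + KW x) (z, th)) * wave (Suc n) \<xi> (z, th) \<partial>circle_measure) = 0"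
   using m[unfolded sourceless_def] lc.AE_integrable_fst'[OF iSK]
  proof eventually_elim
   case (elim z)
   show ?case
   proof (cases "z : Om")
    case True
    have "(\<integral>th. factor (z, th) * of_real (cut (%x. S x + KW x) (z, th)) * zeta th ^ Suc n \<partial>circle_measure) = 0"
     by (rule hardy_shift[OF hardy_factor(1)[OF True], of _ m]) (use elim n in auto)
    then have "cis (- (\<xi> \<bullet> z)) * (\<integral>th. factor (z, th) * of_real (cut (%x. S x + KW x) (z, th)) * zeta th ^ Suc n \<partial>circle_measure) = 0"
     by simp
    then show ?thesis unfolding integral_mult_right_zero[symmetric] by (simp only: wave_def fst_conv snd_conv mult_ac)
   qed (simp add: cut_def)
  qed
 qed
 finally have "(\<integral>x. of_real (cut W x) * (of_real (\<xi> \<bullet> snd x) * wave (Suc n) \<xi> x) \<partial>phase_space) = 0"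
  using wave_identity[of \<xi> "Suc n"] by simp
 moreover have "(\<integral>x. of_real (cut W x) * (of_real (\<xi> \<bullet> snd x) * wave (Suc n) \<xi> x) \<partial>phase_space) =
   (\<integral>x. cnj (zeta \<xi>) / 2 * (of_real (cut W x) * wave (n + 2) \<xi> x) + zeta \<xi> / 2 * (of_real (cut W x) * wave n \<xi> x) \<partial>phase_space)"
 proof (intro Bochner_Integration.integral_cong refl)
  fix x assume "x : space phase_space"
  then have x: "norm (snd x) = 1" by (auto simp: space_phase)
  have "of_real (\<xi> \<bullet> snd x) * wave (Suc n) \<xi> x = (of_real (\<xi> \<bullet> snd x) * zeta (snd x) ^ Suc n) * (factor x * cis (- (\<xi> \<bullet> fst x)))"
   by (simp only: wave_def mult_ac)
  also have "\<dots> = cnj (zeta \<xi>) / 2 * wave (n + 2) \<xi> x + zeta \<xi> / 2 * wave n \<xi> x"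
   unfolding zeta_inner[OF x] wave_def by (simp add: field_simps)
  finally have e: "of_real (\<xi> \<bullet> snd x) * wave (Suc n) \<xi> x = cnj (zeta \<xi>) / 2 * wave (n + 2) \<xi> x + zeta \<xi> / 2 * wave n \<xi> x" .
  show "of_real (cut W x) * (of_real (\<xi> \<bullet> snd x) * wave (Suc n) \<xi> x) =
   cnj (zeta \<xi>) / 2 * (of_real (cut W x) * wave (n + 2) \<xi> x) + zeta \<xi> / 2 * (of_real (cut W x) * wave n \<xi> x)"
   unfolding e distrib_left by (simp only: mult_ac)
 qed
 moreover have "\<dots> = cnj (zeta \<xi>) / 2 * fmode (n + 2) \<xi> + zeta \<xi> / 2 * fmode n \<xi>"
  unfolding fmode_def using integrable_wave[of "n + 2" \<xi>] integrable_wave[of n \<xi>] by simp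
 ultimately show ?thesis by (simp add: field_simps)
qed

text \<open>By the recurrence \<open>fmode (n + 2 j) = \<mu>\<^sup>j fmode n\<close> with \<open>\<bar>\<mu>\<bar> = 1\<close>, so \<open>fmode n\<close> is also the integral
 against the ergodic means of the powers of \<open>cnj \<mu> \<zeta>\<^sup>2\<close>, which tend to 0 almost everywhere.\<close>

lemma fmode_vanishes:
 assumes m: "sourceless m" and n: "Suc n >= m" and \<xi>: "\<xi> ~= 0"
 shows "fmode n \<xi> = 0"
proof -
 define x where "x = zeta \<xi>"
 have x0: "x ~= 0" using \<xi> norm_zeta[of \<xi>] by (auto simp: x_def)
 define \<mu> where "\<mu> = - x / cnj x"
 have nl: "norm \<mu> = 1" using x0 by (simp add: \<mu>_def norm_divide)
 have step: "fmode (i + 2) \<xi> = \<mu> * fmode i \<xi>" if "Suc i >= m" for i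
  using recurrence[OF m that, of \<xi>] x0 by (simp add: \<mu>_def x_def[symmetric] field_simps add_eq_0_iff)
 have pw: "fmode (n + 2 * j) \<xi> = \<mu> ^ j * fmode n \<xi>" for j
 proof (induction j)
  case (Suc j)
  have "fmode (n + 2 * Suc j) \<xi> = fmode (n + 2 * j + 2) \<xi>" by (simp add: algebra_simps)
  also have "\<dots> = \<mu> * fmode (n + 2 * j) \<xi>" by (rule step) (use n in simp)
  finally show ?case using Suc by simp
 qed simp
 define w where "w y = cnj \<mu> * (zeta (snd y))\<^sup>2" for y :: "plane \<times> plane"
 define G where "G y = of_real (cut W y) * wave n \<xi> y" for y
 define F where "F J y = G y * ((\<Sum>j<J. w y ^ j) / of_nat J)" for J y
 have nw: "norm (w y) = 1" if "y : space phase_space" for y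
  using that nl by (auto simp: w_def norm_mult norm_power norm_zeta space_phase)
 have iG: "integrable phase_space G" unfolding G_def by (rule integrable_wave)
 have [measurable]: "G : borel_measurable phase_space" using iG by auto
 have mF: "F J : borel_measurable phase_space" for J unfolding F_def w_def by measurable
 have lam: "cnj \<mu> * \<mu> = 1" using nl by (simp add: complex_norm_square[symmetric] mult.commute)
 have Fint: "(\<integral>y. F J y \<partial>phase_space) = fmode n \<xi>" if "J > 0" for J
 proof -
  have t: "(\<integral>y. G y * w y ^ j \<partial>phase_space) = fmode n \<xi>" "integrable phase_space (%y. G y * w y ^ j)" for j
  proof -
   have e: "(%y. G y * w y ^ j) = (%y. cnj \<mu> ^ j * (of_real (cut W y) * wave (n + 2 * j) \<xi> y))"
    
    unfolding G_def w_def wave_def power_add power_mult power_mult_distrib by (simp only: mult_ac)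
   show "integrable phase_space (%y. G y * w y ^ j)" unfolding e using integrable_wave by simp
   have "cnj \<mu> ^ j * (\<mu> ^ j * fmode n \<xi>) = fmode n \<xi>"
    unfolding mult.assoc[symmetric] power_mult_distrib[symmetric] lam by simp
   then show "(\<integral>y. G y * w y ^ j \<partial>phase_space) = fmode n \<xi>" unfolding e using pw[of j] by (simp add: fmode_def)
  qed
  have "(\<integral>y. F J y \<partial>phase_space) = (\<integral>y. (\<Sum>j<J. G y * w y ^ j) / of_nat J \<partial>phase_space)"
   by (simp add: F_def sum_distrib_left)
  also have "\<dots> = (\<Sum>j<J. \<integral>y. G y * w y ^ j \<partial>phase_space) / of_nat J"
   using t(2) by simp
  also have "\<dots> = fmode n \<xi>" using that by (simp add: t)
  finally show ?thesis .
 qed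
 have "(%J. \<integral>y. F J y \<partial>phase_space) \<longlonglongrightarrow> (\<integral>y. 0 \<partial>phase_space)"
 proof (rule integral_dominated_convergence[where w="%y. norm (G y)"])
  show "AE y in phase_space. norm (F J y) <= norm (G y)" for J
  proof (rule AE_I2)
   fix y assume "y : space phase_space"
   from mult_left_mono[OF geometric_mean_bound[OF nw[OF this], of J] norm_ge_zero[of "G y"]]
   show "norm (F J y) <= norm (G y)" unfolding F_def norm_mult[of "G y"] by simp
  qed
  have "AE y in phase_space. \<xi> \<bullet> snd y ~= 0"
  proof (rule lc.AE_pair_measure)
   show "{y : space phase_space. \<xi> \<bullet> snd y ~= 0} : sets phase_space" by measurable
   show "AE z in lborel. AE th in circle_measure. \<xi> \<bullet> snd (z, th) ~= 0"
    using AE_circle_inner_nonzero[OF \<xi>] by simp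
  qed
  then show "AE y in phase_space. (%J. F J y) \<longlonglongrightarrow> 0"
   using AE_space
  proof eventually_elim
   case (elim y)
   have n1: "norm (snd y) = 1" using elim(2) by (auto simp: space_phase)
   \<comment> \<open>Equality would make the direction orthogonal to \<open>\<xi>\<close>, which
     happens on a null set only.\<close>
   have "w y ~= 1"
   proof
    assume "w y = 1"
    then have "\<mu> * (cnj \<mu> * (zeta (snd y))\<^sup>2) = \<mu>" by (simp add: w_def)
    then have "(zeta (snd y))\<^sup>2 = \<mu>" using lam by (simp add: mult.assoc[symmetric] mult.commute[of \<mu>])
    then have z2: "zeta (snd y) ^ (0 + 2) = \<mu>" by (simp add: power2_eq_square)
    have "cnj x * zeta (snd y) ^ (0 + 2) + x * zeta (snd y) ^ 0 = 0" unfolding z2 using x0 by (simp add: \<mu>_def)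
    then have "of_real (\<xi> \<bullet> snd y) * zeta (snd y) ^ Suc 0 = 0" unfolding zeta_inner[OF n1] x_def by simp
    then show False using elim(1) norm_zeta[of "snd y"] n1 by auto
   qed
   then show ?case unfolding F_def using tendsto_mult[OF tendsto_const geometric_mean_limit[OF nw[OF elim(2)]], of "G y"] by simp
  qed
 qed (use iG mF in auto)
 moreover have "\<forall>\<^sub>F J in sequentially. (\<integral>y. F J y \<partial>phase_space) = fmode n \<xi>"
  using eventually_gt_at_top[of 0] by eventually_elim (rule Fint)
 ultimately have "(%J::nat. fmode n \<xi>) \<longlonglongrightarrow> 0" by (simp add: tendsto_cong)
 then show ?thesis by (simp add: LIMSEQ_const_iff)
qed

text \<open>Fourier uniqueness kills the modes of \<open>factor * W\<close> from
  \<open>m - 1\<close> on, and multiplication by the inverse factor, again of nonnegative modes,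
  returns to \<open>W\<close>. Each application gains one index, which drives the descent.\<close>

lemma mode_vanishes:
 assumes m: "sourceless m"
 shows "AE z in lborel. \<forall>n. Suc n >= m --> mode n z = 0"
proof -
 define am where "am n z = (\<integral>th. factor (z, th) * of_real (cut W (z, th)) * zeta th ^ n \<partial>circle_measure)" for n z
 have i: "integrable phase_space (%x. of_real (cut W x) * (factor x * zeta (snd x) ^ n))" for n
 proof (rule integrable_cut_mult[OF iW])
  show "norm (factor x * zeta (snd x) ^ n) <= exp K" if "fst x : Om" "norm (snd x) = 1" for x
   using norm_factor[OF that] that by (simp add: norm_mult norm_power norm_zeta)
 qed measurable
 have ame: "am n = (%z. \<integral>th. of_real (cut W (z, th)) * (factor (z, th) * zeta (snd (z, th)) ^ n) \<partial>circle_measure)" for n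
  by (rule ext) (simp add: am_def mult_ac)
 have am0: "AE z in lborel. am n z = 0" if n: "Suc n >= m" for n
 proof (rule fourier_unique[where K="closure Om"])
  show "integrable lborel (am n)" unfolding ame using lc.integrable_fst'[OF i[of n]] by simp
  show "compact (closure Om)" using bd by simp
  show "am n z = 0" if "z \<notin> closure Om" for z
  proof -
   have "z \<notin> Om" using that subsetD[OF closure_subset, of z Om] by blast
   then show ?thesis by (simp add: am_def cut_def)
  qed
  fix \<xi> :: plane assume \<xi>: "\<xi> ~= 0"
  have "fmode n \<xi> = (\<integral>z. (\<integral>th. of_real (cut W (z, th)) * wave n \<xi> (z, th) \<partial>circle_measure) \<partial>lborel)"
   unfolding fmode_def by (rule phase_fubini[OF integrable_wave])
  also have "\<dots> = (\<integral>z. am n z * cis (- (\<xi> \<bullet> z)) \<partial>lborel)"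
  proof (intro Bochner_Integration.integral_cong refl)
   fix z
   show "(\<integral>th. of_real (cut W (z, th)) * wave n \<xi> (z, th) \<partial>circle_measure) = am n z * cis (- (\<xi> \<bullet> z))"
    unfolding am_def integral_mult_left_zero[symmetric] by (simp only: wave_def fst_conv snd_conv mult_ac)
  qed
  finally show "(\<integral>z. am n z * cis (- (\<xi> \<bullet> z)) \<partial>lborel) = 0" using fmode_vanishes[OF m n \<xi>] by simp
 qed
 have all: "AE z in lborel. \<forall>n. Suc n >= m --> am n z = 0"
  unfolding AE_all_countable using am0 by auto
 show ?thesis
  using all lc.AE_integrable_fst'[OF iW]
 proof eventually_elim
  case (elim z)
  show ?case
  proof (cases "z : Om")
   case True
   have ic: "integrable circle_measure (%th. complex_of_real (cut W (z, th)))" using elim(2) by simp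
   show ?thesis
   proof (intro allI impI)
    fix n assume n: "Suc n >= m"
    have "(\<integral>th. exp (- integrating_exponent z th) * (factor (z, th) * of_real (cut W (z, th))) * zeta th ^ n \<partial>circle_measure) = 0"
     by (rule hardy_shift[OF hardy_factor(2)[OF True] hardy_integrable[OF hardy_factor(1)[OF True] ic], of "m - 1"])
      (use elim(1) n in \<open>auto simp: am_def\<close>)
    moreover have "exp (- integrating_exponent z th) * (factor (z, th) * of_real (cut W (z, th))) = of_real (cut W (z, th))" for th
     unfolding mult.assoc[symmetric] by (simp add: factor_def exp_add[symmetric])
    ultimately show "mode n z = 0" by (simp add: mode_def)
   qed
  qed (simp add: mode_def cut_def)
 qed
qed

end

section \<open>Kernels with finitely many modes\<close>

lemma circle_mean: "(\<integral>th. th $ i \<partial>circle_measure) = 0"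
proof -
 have i: "integrable circle_measure zeta" using integrable_zeta_power[of 1] by simp
 have e: "(\<integral>th. zeta th \<partial>circle_measure) = 0" using integral_zeta_power[of 1] by simp
 have "(\<integral>th. th $ 1 \<partial>circle_measure) = 0" "(\<integral>th. th $ 2 \<partial>circle_measure) = 0"
  using integral_Re[OF i] integral_Im[OF i] unfolding e by (simp_all add: zeta_def)
 then show ?thesis using exhaust_2[of i] by auto
qed

lemma circle_integrable_component:
 "integrable circle_measure (%th. th $ i)" "integrable circle_measure (%th. th $ i * th $ j)"
proof -
 show "integrable circle_measure (%th. th $ i)"
  by (rule circle_integrable_bounded[where B=1]) (auto simp: component_le_1)
 show "integrable circle_measure (%th. th $ i * th $ j)"
 proof (rule circle_integrable_bounded[where B=1])
  show "norm (th $ i * th $ j) <= 1" if "norm th = 1" for th :: plane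
   using mult_mono[OF component_le_1[OF that, of i] component_le_1[OF that, of j]] by (simp add: abs_mult)
 qed measurable
qed

lemma cis_cosines: "complex_of_real (2 * cos (x - y)) = cis x * cnj (cis y) + cnj (cis x) * cis y"
 by (simp add: complex_eq_iff cos_diff)

locale vanishing_source = vanishing_data +
 fixes f :: "plane => real" and \<Phi> :: "plane => plane" and M :: nat and kp :: "nat => plane => real"
 assumes S_eq: "!!x. S x = f (fst x) + snd x \<bullet> \<Phi> (fst x)" and if0: "int_on f" and i\<Phi>: "!!i. int_on (%z. \<Phi> z $ i)"
  and kern: "!!z t. z : closure Om ==> k z (cos t) = kp 0 z + 2 * (\<Sum>n=1..M. kp n z * cos (real n * t))"
  and ckp: "continuous_on (closure Om) (kp 0)" and pos: "!!z. z : closure Om ==> a z - kp 0 z > 0" and M1: "M >= 1"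
begin

lemma kernel_zeta:
 assumes z: "z : Om" and n: "norm th = 1" "norm th' = 1"
 shows "complex_of_real (k z (th \<bullet> th')) = of_real (kp 0 z) +
  (\<Sum>m=1..M. of_real (kp m z) * (zeta th ^ m * cnj (zeta th' ^ m) + cnj (zeta th ^ m) * zeta th' ^ m))"
proof -
 define \<alpha> \<beta> where "\<alpha> = Arg (zeta th)" and "\<beta> = Arg (zeta th')"
 have \<alpha>: "zeta th = cis \<alpha>" and \<beta>: "zeta th' = cis \<beta>"
  using rcis_cmod_Arg[of "zeta th"] rcis_cmod_Arg[of "zeta th'"] n by (simp_all add: \<alpha>_def \<beta>_def norm_zeta rcis_def)
 have "th \<bullet> th' = Re (zeta th' * cnj (zeta th))" by (simp add: zeta_cnj)
 then have c: "th \<bullet> th' = cos (\<alpha> - \<beta>)" by (simp add: \<alpha> \<beta> cos_diff mult.commute)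
 have zc: "z : closure Om" by (rule subsetD[OF closure_subset z])
 have p: "zeta th ^ m = cis (real m * \<alpha>)" "zeta th' ^ m = cis (real m * \<beta>)" for m by (simp_all only: \<alpha> \<beta> Complex.DeMoivre)
 have "complex_of_real (k z (th \<bullet> th')) = of_real (kp 0 z) + (\<Sum>m=1..M. of_real (kp m z) * of_real (2 * cos (real m * (\<alpha> - \<beta>))))"
  unfolding c kern[OF zc] by (simp add: sum_distrib_left mult_ac)
 also have "\<dots> = of_real (kp 0 z) + (\<Sum>m=1..M. of_real (kp m z) * (zeta th ^ m * cnj (zeta th' ^ m) + cnj (zeta th ^ m) * zeta th' ^ m))"
  unfolding p cis_cosines[symmetric] right_diff_distrib ..
 finally show ?thesis .
qed

text \<open>Each cosine of an angle difference splits into products of exponentials of the two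
  angles, so the scattered function only involves the modes of \<open>W\<close> up to
  \<open>M\<close>; negative modes enter as conjugates because \<open>W\<close> is real.\<close>

lemma scattering_modes:
 assumes z: "z : Om" and i: "integrable circle_measure (%th. cut W (z, th))" and n: "norm th = 1"
 shows "complex_of_real (KW (z, th)) = of_real (kp 0 z) * mode 0 z +
  (\<Sum>m=1..M. of_real (kp m z) * (zeta th ^ m * cnj (mode m z) + cnj (zeta th ^ m) * mode m z))"
proof -
 define V where "V th' = complex_of_real (cut W (z, th'))" for th'
 have iV: "integrable circle_measure V" unfolding V_def using i by simp
 have iz: "integrable circle_measure (%th'. V th' * zeta th' ^ m)" for m by (rule integrable_mult_zeta_power[OF iV])
 have ic: "integrable circle_measure (%th'. cnj (V th' * zeta th' ^ m))" for m using iz[of m] by (simp del: complex_cnj_mult)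
 have "complex_of_real (KW (z, th)) = (\<integral>th'. of_real (k z (th \<bullet> th') * W (z, th')) \<partial>circle_measure)"
  unfolding scattering_def fst_conv snd_conv by (rule integral_complex_of_real[symmetric])
 also have "\<dots> = (\<integral>th'. of_real (kp 0 z) * V th' + (\<Sum>m=1..M. of_real (kp m z) * zeta th ^ m * cnj (V th' * zeta th' ^ m)
   + of_real (kp m z) * cnj (zeta th ^ m) * (V th' * zeta th' ^ m)) \<partial>circle_measure)"
 proof (intro Bochner_Integration.integral_cong refl)
  fix th' assume "th' : space circle_measure"
  then have n': "norm th' = 1" by (simp add: space_circle)
  have "complex_of_real (k z (th \<bullet> th') * W (z, th')) = of_real (k z (th \<bullet> th')) * V th'" using z by (simp add: V_def cut_def)
  also have "\<dots> = of_real (kp 0 z) * V th' + (\<Sum>m=1..M. of_real (kp m z) * (zeta th ^ m * cnj (zeta th' ^ m) + cnj (zeta th ^ m) * zeta th' ^ m) * V th')"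
   unfolding kernel_zeta[OF z n n'] distrib_right sum_distrib_right ..
  also have "(\<Sum>m=1..M. of_real (kp m z) * (zeta th ^ m * cnj (zeta th' ^ m) + cnj (zeta th ^ m) * zeta th' ^ m) * V th') =
   (\<Sum>m=1..M. of_real (kp m z) * zeta th ^ m * cnj (V th' * zeta th' ^ m) + of_real (kp m z) * cnj (zeta th ^ m) * (V th' * zeta th' ^ m))"
   by (intro sum.cong refl) (simp add: V_def algebra_simps)
  finally show "complex_of_real (k z (th \<bullet> th') * W (z, th')) = of_real (kp 0 z) * V th' +
   (\<Sum>m=1..M. of_real (kp m z) * zeta th ^ m * cnj (V th' * zeta th' ^ m) + of_real (kp m z) * cnj (zeta th ^ m) * (V th' * zeta th' ^ m))" .
 qed
 also have "\<dots> = (\<integral>th'. of_real (kp 0 z) * V th' \<partial>circle_measure) + (\<Sum>m=1..M. (\<integral>th'. of_real (kp m z) * zeta th ^ m * cnj (V th' * zeta th' ^ m) \<partial>circle_measure)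
   + (\<integral>th'. of_real (kp m z) * cnj (zeta th ^ m) * (V th' * zeta th' ^ m) \<partial>circle_measure))"
  by (subst Bochner_Integration.integral_add, (intro integrable_mult_right iV Bochner_Integration.integrable_sum Bochner_Integration.integrable_add ic iz)+,
    subst Bochner_Integration.integral_sum, (intro integrable_mult_right Bochner_Integration.integrable_add ic iz)+,
    subst Bochner_Integration.integral_add, (intro integrable_mult_right ic iz)+, rule refl)
 also have "\<dots> = of_real (kp 0 z) * (\<integral>th'. V th' \<partial>circle_measure) + (\<Sum>m=1..M. of_real (kp m z) * zeta th ^ m * cnj (\<integral>th'. V th' * zeta th' ^ m \<partial>circle_measure)
   + of_real (kp m z) * cnj (zeta th ^ m) * (\<integral>th'. V th' * zeta th' ^ m \<partial>circle_measure))"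
  by (simp only: integral_mult_right_zero Bochner_Integration.integral_cnj)
 finally show ?thesis by (simp add: mode_def V_def[symmetric] algebra_simps)
qed

text \<open>The source has angular order at most 1, hence the bound \<open>m >= 2\<close>. In the
  n-th mode of the scattering term only the n-th mode of \<open>W\<close> can survive, which is zero
  by hypothesis up to \<open>M\<close> and absent above.\<close>

lemma sourceless_modes:
 assumes m: "m >= 2" and z: "AE z in lborel. \<forall>n. m <= n & n <= M --> mode n z = 0"
 shows "sourceless m"
 unfolding sourceless_def
 using z lc.AE_integrable_fst'[OF iW]
proof eventually_elim
 case (elim z)
 show ?case
 proof (intro allI impI)
  fix n assume n: "n >= m"
  show "(\<integral>th. of_real (cut (%x. S x + KW x) (z, th)) * zeta th ^ n \<partial>circle_measure) = 0"
  proof (cases "z : Om")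
   case True
   define y where "y = zeta (\<Phi> z)"
   have e: "of_real (cut (%x. S x + KW x) (z, th)) * zeta th ^ n =
     (of_real (f z) + of_real (kp 0 z) * mode 0 z) * zeta th ^ n + cnj y / 2 * zeta th ^ Suc n + y / 2 * zeta th ^ (n - 1)
     + (\<Sum>j=1..M. (of_real (kp j z) * cnj (mode j z)) * zeta th ^ (j + n) + (of_real (kp j z) * mode j z) * zeta th ^ (n - j))"
    if th: "norm th = 1" for th
   proof -
    obtain l where l: "n = Suc l" using n m by (cases n) auto
    have 1: "complex_of_real (th \<bullet> \<Phi> z) * zeta th ^ n = cnj y / 2 * zeta th ^ Suc n + y / 2 * zeta th ^ (n - 1)"
     using zeta_inner[OF th, of "\<Phi> z" l] by (simp add: l y_def inner_commute field_simps)
    have 2: "of_real (kp j z) * (zeta th ^ j * cnj (mode j z) + cnj (zeta th ^ j) * mode j z) * zeta th ^ n =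
      (of_real (kp j z) * cnj (mode j z)) * zeta th ^ (j + n) + (of_real (kp j z) * mode j z) * zeta th ^ (n - j)" if j: "j : {1..M}" for j
    proof -
     \<comment> \<open>Subtraction is truncated: for \<open>j < m\<close> one has
       \<open>j <= n\<close> and the power is genuine, while for \<open>j >= m\<close> the mode
       itself is zero.\<close>
     have "mode j z * (cnj (zeta th ^ j) * zeta th ^ n) = mode j z * zeta th ^ (n - j)"
     proof (cases "j < m")
      case True
      then have "zeta th ^ n = zeta th ^ j * zeta th ^ (n - j)" using n by (simp add: power_add[symmetric])
      moreover have "cnj (zeta th ^ j) * zeta th ^ j = 1"
       using zeta_cnj_same[OF th] by (simp add: power_mult_distrib[symmetric] mult.commute)
      ultimately show ?thesis by (simp add: mult.assoc[symmetric])
     qed (use elim j in simp)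
     then have "of_real (kp j z) * (mode j z * (cnj (zeta th ^ j) * zeta th ^ n)) = of_real (kp j z) * (mode j z * zeta th ^ (n - j))" by simp
     then show ?thesis unfolding distrib_left distrib_right power_add by (simp only: mult_ac)
    qed
    have "of_real (cut (%x. S x + KW x) (z, th)) = of_real (f z) + of_real (th \<bullet> \<Phi> z) + complex_of_real (KW (z, th))"
     using True by (simp add: cut_def S_eq)
    then have "of_real (cut (%x. S x + KW x) (z, th)) * zeta th ^ n =
      (of_real (f z) + of_real (kp 0 z) * mode 0 z) * zeta th ^ n + of_real (th \<bullet> \<Phi> z) * zeta th ^ n +
      (\<Sum>j=1..M. of_real (kp j z) * (zeta th ^ j * cnj (mode j z) + cnj (zeta th ^ j) * mode j z) * zeta th ^ n)"
     unfolding scattering_modes[OF True elim(2) th] sum_distrib_right[symmetric] by (simp only: distrib_right add_ac)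
    also have "(\<Sum>j=1..M. of_real (kp j z) * (zeta th ^ j * cnj (mode j z) + cnj (zeta th ^ j) * mode j z) * zeta th ^ n) =
     (\<Sum>j=1..M. (of_real (kp j z) * cnj (mode j z)) * zeta th ^ (j + n) + (of_real (kp j z) * mode j z) * zeta th ^ (n - j))"
     by (intro sum.cong refl 2)
    finally show ?thesis unfolding 1 by (simp only: add.assoc)
   qed
   note ii = integrable_mult_right[OF integrable_zeta_power]
   have term0: "(\<integral>th. (of_real (kp j z) * cnj (mode j z)) * zeta th ^ (j + n) + (of_real (kp j z) * mode j z) * zeta th ^ (n - j) \<partial>circle_measure) = 0"
    if j: "j : {1..M}" for j
   proof -
    have "mode j z * (\<integral>th. zeta th ^ (n - j) \<partial>circle_measure) = 0"
     using integral_zeta_power[of "n - j"] elim(1) j n by (cases "j < n") auto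
    moreover have "(\<integral>th. zeta th ^ (j + n) \<partial>circle_measure) = 0" using j by (intro integral_zeta_power) auto
    ultimately show ?thesis
     unfolding Bochner_Integration.integral_add[OF ii ii] integral_mult_right_zero by (simp add: mult.assoc)
   qed
   have isum: "integrable circle_measure (%th. \<Sum>j=1..M. (of_real (kp j z) * cnj (mode j z)) * zeta th ^ (j + n) + (of_real (kp j z) * mode j z) * zeta th ^ (n - j))"
    by (intro Bochner_Integration.integrable_sum Bochner_Integration.integrable_add ii)
   have "(\<integral>th. of_real (cut (%x. S x + KW x) (z, th)) * zeta th ^ n \<partial>circle_measure) =
    (\<integral>th. (of_real (f z) + of_real (kp 0 z) * mode 0 z) * zeta th ^ n + cnj y / 2 * zeta th ^ Suc n + y / 2 * zeta th ^ (n - 1)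
     + (\<Sum>j=1..M. (of_real (kp j z) * cnj (mode j z)) * zeta th ^ (j + n) + (of_real (kp j z) * mode j z) * zeta th ^ (n - j)) \<partial>circle_measure)"
    by (intro Bochner_Integration.integral_cong refl e) (simp add: space_circle)
   also have "\<dots> = (\<integral>th. (of_real (f z) + of_real (kp 0 z) * mode 0 z) * zeta th ^ n \<partial>circle_measure) + (\<integral>th. cnj y / 2 * zeta th ^ Suc n \<partial>circle_measure)
     + (\<integral>th. y / 2 * zeta th ^ (n - 1) \<partial>circle_measure)
     + (\<integral>th. (\<Sum>j=1..M. (of_real (kp j z) * cnj (mode j z)) * zeta th ^ (j + n) + (of_real (kp j z) * mode j z) * zeta th ^ (n - j)) \<partial>circle_measure)"
    by (simp only: Bochner_Integration.integral_add Bochner_Integration.integrable_add ii isum)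
   also have "(\<integral>th. (\<Sum>j=1..M. (of_real (kp j z) * cnj (mode j z)) * zeta th ^ (j + n) + (of_real (kp j z) * mode j z) * zeta th ^ (n - j)) \<partial>circle_measure) = 0"
    by (subst Bochner_Integration.integral_sum) (intro Bochner_Integration.integrable_add ii, intro sum.neutral ballI term0)
   finally show ?thesis
    unfolding integral_mult_right_zero using integral_zeta_power[of n] integral_zeta_power[of "Suc n"] integral_zeta_power[of "n - 1"] n m by simp
  qed (simp add: cut_def)
 qed
qed

text \<open>The descent starts at \<open>M + 1\<close>, where the condition on modes is empty. It
  stops at 2, below which the vector field shows in the source; one last use of
  \<open>mode_vanishes\<close> still reaches the mode 1.\<close>

lemma modes_vanish: "AE z in lborel. \<forall>n\<ge>1. mode n z = 0"
proof -
 have "sourceless 2"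
 proof (rule inc_induct[of 2 "M + 1"])
  show "sourceless (M + 1)"
  proof (rule sourceless_modes)
   show "AE z in lborel. \<forall>n. M + 1 <= n & n <= M --> mode n z = 0" by (rule AE_I2) auto
  qed (use M1 in simp)
  fix n assume "2 <= n" "sourceless (Suc n)"
  show "sourceless n"
  proof (rule sourceless_modes[OF \<open>2 <= n\<close>])
   show "AE z in lborel. \<forall>j. n <= j & j <= M --> mode j z = 0"
    using mode_vanishes[OF \<open>sourceless (Suc n)\<close>] by eventually_elim simp
  qed
 qed (use M1 in simp)
 from mode_vanishes[OF this] show ?thesis by eventually_elim (simp add: numeral_2_eq_2)
qed

section \<open>The mean over directions and its gradient\<close>

definition avg :: "plane => real" where
 "avg z = (\<integral>th. cut W (z, th) \<partial>circle_measure)"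

lemma avg_outside: "z \<notin> Om ==> avg z = 0"
 by (simp add: avg_def cut_def)

lemma integrable_avg: "integrable lborel avg"
 unfolding avg_def using lc.integrable_fst'[OF iW] by simp

text \<open>Real and imaginary parts of the modes 1 and 2 give the moments of first and second
  order. Testing with 1 and with the components of the direction sees \<open>W\<close> through these
  alone, so they stand in for the statement that \<open>W\<close> does not depend on the
  direction.\<close>

lemma AE_moments:
 "AE z in lborel. (\<forall>i. (\<integral>th. cut W (z, th) * th $ i \<partial>circle_measure) = 0) \<and>
   (\<forall>i j. (\<integral>th. cut W (z, th) * (th $ i * th $ j) \<partial>circle_measure) = (if i = j then avg z / 2 else 0)) \<and>
   integrable circle_measure (%th. cut W (z, th)) \<and>
   (z : Om --> (\<forall>th. norm th = 1 --> KW (z, th) = kp 0 z * avg z))"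
 using modes_vanish lc.AE_integrable_fst'[OF iW]
proof eventually_elim
 case (elim z)
 define V where "V th = cut W (z, th)" for th
 have iV: "integrable circle_measure V" using elim(2) by (simp add: V_def[abs_def])
 have iz: "integrable circle_measure (%th. complex_of_real (V th) * zeta th ^ n)" for n
  by (rule integrable_mult_zeta_power) (use iV in simp)
 have re: "(\<integral>th. V th * Re (zeta th ^ n) \<partial>circle_measure) = 0" and im: "(\<integral>th. V th * Im (zeta th ^ n) \<partial>circle_measure) = 0"
  and ire: "integrable circle_measure (%th. V th * Re (zeta th ^ n))" if "n >= 1" for n
  using integral_Re[OF iz[of n]] integral_Im[OF iz[of n]] integrable_Re[OF iz[of n]] elim(1) that
  by (auto simp: mode_def V_def)
 have one: "(\<integral>th. V th * th $ i \<partial>circle_measure) = 0" for i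
  using re[of 1] im[of 1] exhaust_2[of i] by (auto simp: zeta_def)
 have z2: "Re (zeta th ^ 2) = (th $ 1)\<^sup>2 - (th $ 2)\<^sup>2" "Im (zeta th ^ 2) = 2 * th $ 1 * th $ 2" for th
  by (simp_all add: zeta_def Re_power2 Im_power2)
 have offd: "(\<integral>th. V th * (th $ 1 * th $ 2) \<partial>circle_measure) = 0"
 proof -
  have "(\<integral>th. V th * (th $ 1 * th $ 2) \<partial>circle_measure) = (\<integral>th. V th * Im (zeta th ^ 2) / 2 \<partial>circle_measure)"
   by (intro Bochner_Integration.integral_cong refl) (simp add: z2)
  then show ?thesis using im[of 2] by simp
 qed
 have diag: "(\<integral>th. V th * (th $ 1 * th $ 1) \<partial>circle_measure) = avg z / 2" "(\<integral>th. V th * (th $ 2 * th $ 2) \<partial>circle_measure) = avg z / 2"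
 proof -
  have h: "A = (v + (A - B)) / 2" "B = (v - (A - B)) / 2" if "v = A + B" for A B v :: real using that by simp_all
  have e: "V th = V th * (th $ 1 * th $ 1) + V th * (th $ 2 * th $ 2)" if "th : space circle_measure" for th
  proof -
   have "(th $ 1)\<^sup>2 + (th $ 2)\<^sup>2 = 1" using norm_plane[of th] that by (simp add: space_circle)
   then show ?thesis unfolding power2_eq_square distrib_left[symmetric] by simp
  qed
  have "(\<integral>th. V th * (th $ 1 * th $ 1) \<partial>circle_measure) = (\<integral>th. (V th + V th * Re (zeta th ^ 2)) / 2 \<partial>circle_measure)"
   unfolding z2 unfolding power2_eq_square right_diff_distrib by (intro Bochner_Integration.integral_cong refl h(1)[OF e])
  moreover have "(\<integral>th. V th * (th $ 2 * th $ 2) \<partial>circle_measure) = (\<integral>th. (V th - V th * Re (zeta th ^ 2)) / 2 \<partial>circle_measure)"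
   unfolding z2 unfolding power2_eq_square right_diff_distrib by (intro Bochner_Integration.integral_cong refl h(2)[OF e])
  ultimately show "(\<integral>th. V th * (th $ 1 * th $ 1) \<partial>circle_measure) = avg z / 2" "(\<integral>th. V th * (th $ 2 * th $ 2) \<partial>circle_measure) = avg z / 2"
   using iV re[of 2] ire[of 2] by (simp_all add: avg_def V_def[symmetric])
 qed
 have mom: "(\<integral>th. V th * (th $ i * th $ j) \<partial>circle_measure) = (if i = j then avg z / 2 else 0)" for i j
 proof -
  have offd': "(\<integral>th. V th * (th $ 2 * th $ 1) \<partial>circle_measure) = 0"
   using offd by (simp only: mult.commute[of "_ $ 2" "_ $ 1"])
  show ?thesis using exhaust_2[of i] exhaust_2[of j] by (elim disjE) (simp_all add: offd offd' diag)
 qed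
 have kw: "KW (z, th) = kp 0 z * avg z" if z: "z : Om" and n: "norm th = 1" for th
 proof -
  have "mode 0 z = of_real (avg z)" unfolding mode_def avg_def by (simp add: integral_complex_of_real)
  then have "complex_of_real (KW (z, th)) = of_real (kp 0 z * avg z)"
   unfolding scattering_modes[OF z elim(2) n] using elim(1) by simp
  then show ?thesis unfolding of_real_eq_iff .
 qed
 show ?case by (intro conjI allI impI; fact one[unfolded V_def] mom[unfolded V_def] elim(2) kw)
qed

end

context vanishing_source begin

text \<open>\<open>ident\<close> for real test functions that are a product in position and
  direction. The factor \<open>c = 1\<close> will give the scalar equation, and \<open>c\<close> a
  component of the direction the vector equation.\<close>

lemma weak_identity:
 fixes c :: "plane => real"
 assumes ph: "test_function Om ph" and mc: "c : borel_measurable borel" and bc: "!!th. norm th = 1 ==> \<bar>c th\<bar> <= 1"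
 shows "(\<integral>x. cut W x * (frechet_derivative ph (at (fst x)) (snd x) * c (snd x)) \<partial>phase_space) =
   - (\<integral>x. cut (rhs S W) x * (ph (fst x) * c (snd x)) \<partial>phase_space)"
  and "integrable phase_space (%x. cut W x * (frechet_derivative ph (at (fst x)) (snd x) * c (snd x)))"
  and "integrable phase_space (%x. cut (rhs S W) x * (ph (fst x) * c (snd x)))"
proof -
 have sm: "smooth ph" using ph by (simp add: test_function_def)
 let ?D = "%x. frechet_derivative ph (at (fst x)) (snd x)"
 note pt = phase_test_fst[OF ph]
 have td: "transport_deriv (%x. ph (fst x)) = ?D" by (rule ext) (rule transport_deriv_fst[OF sm])
 obtain C where C: "C >= 0" "!!x :: plane \<times> plane. norm (snd x) = 1 ==> \<bar>ph (fst x)\<bar> <= C"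
  "!!x. norm (snd x) = 1 ==> \<bar>?D x\<bar> <= C"
 proof (rule phase_test_function_bounded[OF pt])
  fix C :: real assume 0: "C >= 0" and 1: "!!x :: plane \<times> plane. norm (snd x) = 1 ==> \<bar>ph (fst x)\<bar> <= C"
   and 2: "!!x. norm (snd x) = 1 ==> \<bar>transport_deriv (%x. ph (fst x)) x\<bar> <= C"
  show thesis by (rule that[OF 0 1 2[unfolded td]])
 qed
 have mp: "ph : borel_measurable borel" by (rule borel_measurable_continuous_onI[OF smooth_continuous[OF sm]])
 have mD: "?D : borel_measurable phase_space"
 proof -
  from measurable_phase_continuous[OF continuous_transport_deriv[OF conjunct1[OF pt[unfolded phase_test_function_def]]]] show ?thesis by (simp only: td)
 qed
 have b1: "\<bar>?D x * c (snd x)\<bar> <= C" and b2: "\<bar>ph (fst x) * c (snd x)\<bar> <= C" if "norm (snd x) = 1" for x :: "plane \<times> plane"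
  using mult_mono[OF C(3)[OF that] bc[OF that] C(1) abs_ge_zero] mult_mono[OF C(2)[OF that] bc[OF that] C(1) abs_ge_zero]
  unfolding abs_mult by (simp_all only: mult_1_right)
 have mcs: "(%x. c (snd x)) : borel_measurable phase_space" by (rule measurable_compose[OF _ mc]) measurable
 have mps: "(%x. ph (fst x)) : borel_measurable phase_space" by (rule measurable_compose[OF _ mp]) measurable
 have m1: "(%x. ?D x * c (snd x)) : borel_measurable phase_space" by (rule borel_measurable_times[OF mD mcs])
 have m2: "(%x. ph (fst x) * c (snd x)) : borel_measurable phase_space" by (rule borel_measurable_times[OF mps mcs])
 have irhs: "integrable phase_space (cut (rhs S W))" by (rule integrable_cut_rhs[OF iW iS])
 show i1: "integrable phase_space (%x. cut W x * (?D x * c (snd x)))"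
  by (rule integrable_mult_bounded[OF iW m1, of C], unfold real_norm_def, rule b1) (auto simp: space_phase)
 show i2: "integrable phase_space (%x. cut (rhs S W) x * (ph (fst x) * c (snd x)))"
  by (rule integrable_mult_bounded[OF irhs m2, of C], unfold real_norm_def, rule b2) (auto simp: space_phase)
 have "(\<integral>x. complex_of_real (cut W x) * of_real (?D x * c (snd x)) \<partial>phase_space) =
   - (\<integral>x. of_real (cut (rhs S W) x) * of_real (ph (fst x) * c (snd x)) \<partial>phase_space)"
 proof (rule ident[where C=C])
  show "(%x. complex_of_real (ph (fst x) * c (snd x))) : borel_measurable phase_space" using m2 by (rule measurable_compose) measurable
  show "(%x. complex_of_real (?D x * c (snd x))) : borel_measurable phase_space" using m1 by (rule measurable_compose) measurable
  show "norm (complex_of_real (ph (fst x) * c (snd x))) <= C" "norm (complex_of_real (?D x * c (snd x))) <= C" if "norm (snd x) = 1" for x :: "plane \<times> plane"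
   unfolding norm_of_real by (rule b2[OF that], rule b1[OF that])
  fix th :: plane and s :: real
  have dph: "((%t. ph (line s th t)) has_real_derivative frechet_derivative ph (at (line s th t)) th) (at t)" for t
  proof -
   have l: "(line s th has_derivative (%r. r *\<^sub>R th)) (at t)"
    unfolding line_def[abs_def] by (auto intro!: derivative_eq_intros)
   have "((%t. ph (line s th t)) has_derivative (%r. frechet_derivative ph (at (line s th t)) (r *\<^sub>R th))) (at t)"
    by (rule has_derivative_compose[OF l smooth_has_derivative[OF sm]])
   moreover have "(%r. frechet_derivative ph (at (line s th t)) (r *\<^sub>R th)) = (*) (frechet_derivative ph (at (line s th t)) th)"
    using linear_scale[OF has_derivative_linear[OF smooth_has_derivative[OF sm, of "line s th t"]]] by (simp add: fun_eq_iff mult.commute)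
   ultimately show ?thesis by (simp only: has_field_derivative_def)
  qed
  show "((%t. complex_of_real (ph (fst (line s th t, th)) * c (snd (line s th t, th)))) has_vector_derivative
    of_real (?D (line s th t, th) * c (snd (line s th t, th)))) (at t)" for t
   unfolding fst_conv snd_conv by (rule has_vector_derivative_of_real[OF DERIV_cmult_right[OF dph]])
  have "continuous_on UNIV (%t. frechet_derivative ph (at (line s th t)) th)"
   unfolding line_def by (intro continuous_on_compose2[OF continuous_frechet_direction[OF sm]] continuous_intros) auto
  then show "continuous_on UNIV (%t. complex_of_real (?D (line s th t, th) * c (snd (line s th t, th))))"
   unfolding fst_conv snd_conv by (intro continuous_intros)
 qed
 then show "(\<integral>x. cut W x * (?D x * c (snd x)) \<partial>phase_space) = - (\<integral>x. cut (rhs S W) x * (ph (fst x) * c (snd x)) \<partial>phase_space)"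
  unfolding of_real_mult[symmetric] integral_complex_of_real of_real_minus[symmetric] of_real_eq_iff .
qed

lemma AE_rhs_moments:
 "AE z in lborel. (\<integral>th. cut (rhs S W) (z, th) \<partial>circle_measure) = indicator Om z * (f z - (a z - kp 0 z) * avg z) \<and>
   (\<forall>j. (\<integral>th. cut (rhs S W) (z, th) * th $ j \<partial>circle_measure) = indicator Om z * (\<Phi> z $ j / 2))"
 using AE_moments
proof eventually_elim
 case (elim z)
 show ?case
 proof (cases "z : Om")
  case True
  define C where "C = f z + kp 0 z * avg z"
  have one: "(\<integral>th. cut W (z, th) * th $ i \<partial>circle_measure) = 0" for i using elim by blast
  have iV: "integrable circle_measure (%th. cut W (z, th))" using elim by blast
  have iVj: "integrable circle_measure (%th. cut W (z, th) * th $ j)" for j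
   by (rule integrable_mult_bounded[OF iV, of _ 1]) (auto simp: space_circle component_le_1)
  have e: "cut (rhs S W) (z, th) = C + (\<Phi> z $ 1 * th $ 1 + \<Phi> z $ 2 * th $ 2) - a z * cut W (z, th)"
   if "th : space circle_measure" for th
  proof -
   have "KW (z, th) = kp 0 z * avg z" using elim True that by (auto simp: space_circle)
   then show ?thesis using True by (simp add: cut_def rhs_def S_eq C_def inner_plane mult.commute)
  qed
  note ci = circle_integrable_component
  have ic: "integrable circle_measure (%th. C)" by (rule circle_integrable_bounded[where B="\<bar>C\<bar>"]) auto
  have "(\<integral>th. cut (rhs S W) (z, th) \<partial>circle_measure) = (\<integral>th. C + (\<Phi> z $ 1 * th $ 1 + \<Phi> z $ 2 * th $ 2) - a z * cut W (z, th) \<partial>circle_measure)"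
   by (intro Bochner_Integration.integral_cong refl e)
  also have "\<dots> = C + (\<Phi> z $ 1 * 0 + \<Phi> z $ 2 * 0) - a z * avg z"
   by (simp only: Bochner_Integration.integral_add Bochner_Integration.integral_diff Bochner_Integration.integrable_add integrable_mult_right
     ic ci iV integral_mult_right_zero circle_mean integral_circle_const avg_def)
  finally have 1: "(\<integral>th. cut (rhs S W) (z, th) \<partial>circle_measure) = f z - (a z - kp 0 z) * avg z"
   by (simp add: C_def algebra_simps)
  have 2: "(\<integral>th. cut (rhs S W) (z, th) * th $ j \<partial>circle_measure) = \<Phi> z $ j / 2" for j
  proof -
   have "(\<integral>th. cut (rhs S W) (z, th) * th $ j \<partial>circle_measure) = (\<integral>th. C * th $ j + (\<Phi> z $ 1 * (th $ 1 * th $ j) + \<Phi> z $ 2 * (th $ 2 * th $ j))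
     - a z * (cut W (z, th) * th $ j) \<partial>circle_measure)"
    by (intro Bochner_Integration.integral_cong refl) (simp add: e algebra_simps)
   also have "\<dots> = C * 0 + (\<Phi> z $ 1 * (if 1 = j then 1 / 2 else 0) + \<Phi> z $ 2 * (if 2 = j then 1 / 2 else 0)) - a z * 0"
    by (simp only: Bochner_Integration.integral_add Bochner_Integration.integral_diff Bochner_Integration.integrable_add integrable_mult_right
      ci iVj integral_mult_right_zero circle_mean circle_moments one)
   finally show ?thesis using exhaust_2[of j] by (elim disjE) simp_all
  qed
  show ?thesis using True by (simp add: 1 2)
 qed (simp add: cut_def)
qed

lemma AE_transport_moments:
 assumes ph: "test_function Om ph"
 shows "AE z in lborel. (\<integral>th. cut W (z, th) * frechet_derivative ph (at z) th \<partial>circle_measure) = 0 \<and>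
  (\<forall>j. (\<integral>th. cut W (z, th) * (frechet_derivative ph (at z) th * th $ j) \<partial>circle_measure) = avg z * frechet_derivative ph (at z) (axis j 1) / 2)"
 using AE_moments
proof eventually_elim
 case (elim z)
 have sm: "smooth ph" using ph by (simp add: test_function_def)
 define E where "E j = frechet_derivative ph (at z) (axis j 1)" for j
 have D: "frechet_derivative ph (at z) th = th $ 1 * E 1 + th $ 2 * E 2" for th
  unfolding E_def by (rule linear_plane[OF has_derivative_linear[OF smooth_has_derivative[OF sm]]])
 have one: "(\<integral>th. cut W (z, th) * th $ i \<partial>circle_measure) = 0" for i using elim by blast
 have two: "(\<integral>th. cut W (z, th) * (th $ i * th $ j) \<partial>circle_measure) = (if i = j then avg z / 2 else 0)" for i j using elim by blast
 have iV: "integrable circle_measure (%th. cut W (z, th))" using elim by blast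
 have i1: "integrable circle_measure (%th. cut W (z, th) * th $ j)" for j
  by (rule integrable_mult_bounded[OF iV, of _ 1]) (auto simp: space_circle component_le_1)
 have i2: "integrable circle_measure (%th. cut W (z, th) * (th $ i * th $ j))" for i j
  using integrable_mult_bounded[OF i1[of i], of "%th. th $ j" 1] by (simp add: space_circle component_le_1 mult.assoc)
 have "(\<integral>th. cut W (z, th) * frechet_derivative ph (at z) th \<partial>circle_measure) =
   (\<integral>th. E 1 * (cut W (z, th) * th $ 1) + E 2 * (cut W (z, th) * th $ 2) \<partial>circle_measure)"
  by (intro Bochner_Integration.integral_cong refl) (simp add: D algebra_simps)
 also have "\<dots> = E 1 * 0 + E 2 * 0"
  by (simp only: Bochner_Integration.integral_add integrable_mult_right i1 integral_mult_right_zero one)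
 finally have 1: "(\<integral>th. cut W (z, th) * frechet_derivative ph (at z) th \<partial>circle_measure) = 0" by simp
 have 2: "(\<integral>th. cut W (z, th) * (frechet_derivative ph (at z) th * th $ j) \<partial>circle_measure) = avg z * E j / 2" for j
 proof -
  have "(\<integral>th. cut W (z, th) * (frechet_derivative ph (at z) th * th $ j) \<partial>circle_measure) =
    (\<integral>th. E 1 * (cut W (z, th) * (th $ 1 * th $ j)) + E 2 * (cut W (z, th) * (th $ 2 * th $ j)) \<partial>circle_measure)"
   by (intro Bochner_Integration.integral_cong refl) (simp add: D algebra_simps)
  also have "\<dots> = E 1 * (if 1 = j then avg z / 2 else 0) + E 2 * (if 2 = j then avg z / 2 else 0)"
   by (simp only: Bochner_Integration.integral_add integrable_mult_right i2 integral_mult_right_zero two)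
  finally show ?thesis using exhaust_2[of j] by (elim disjE) simp_all
 qed
 show ?case by (intro conjI allI 1 2[unfolded E_def])
qed

lemma phase_fubini_AE:
 fixes F :: "plane \<times> plane => real"
 assumes F: "integrable phase_space F" and g: "g : borel_measurable borel" and e: "AE z in lborel. (\<integral>th. F (z, th) \<partial>circle_measure) = g z"
 shows "(\<integral>x. F x \<partial>phase_space) = (\<integral>z. g z \<partial>lborel)"
 unfolding phase_fubini[OF F]
 by (rule integral_cong_AE[OF borel_measurable_integrable[OF lc.integrable_fst'[OF F]] _ e]) (use g in simp)

text \<open>For \<open>c = 1\<close> the transport term has odd order in the direction and averages
  to zero, so \<open>avg\<close> must be the quotient. For \<open>c\<close> the j-th component, the
  second moments put the same factor 1/2 on the transport term and on the field, and what remains is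
  the definition of a weak partial derivative.\<close>

theorem has_weak_gradient_quotient: "has_weak_gradient Om (%z. f z / (a z - kp 0 z)) \<Phi>"
proof -
 define sg where "sg z = a z - kp 0 z" for z
 have csg: "continuous_on (closure Om) sg" unfolding sg_def by (intro continuous_intros ca ckp)
 have psg: "sg z > 0" if "z : closure Om" for z using pos[OF that] by (simp add: sg_def)
 have "(%z. indicator Om z * avg z) = avg" by (rule ext) (auto simp: indicator_def avg_outside)
 then have iavg: "int_on avg" using integrable_avg by (simp add: int_on_def)
 define d where "d z = indicator Om z * (f z - sg z * avg z)" for z
 have id: "integrable lborel d"
  using Bochner_Integration.integrable_diff[OF if0[unfolded int_on_def] int_on_mult[OF iavg csg, unfolded int_on_def]]
  by (simp add: d_def[abs_def] algebra_simps)
 have md: "d : borel_measurable borel" using id by auto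
 have mph: "ph : borel_measurable borel" if "test_function Om ph" for ph
  using that by (intro borel_measurable_continuous_onI smooth_continuous) (simp add: test_function_def)
 have zero: "(\<integral>z. d z * ph z \<partial>lborel) = 0" if ph: "test_function Om ph" for ph
 proof -
  have one: "\<bar>1::real\<bar> <= 1" by simp
  note w = weak_identity[where c="%_. 1", OF ph borel_measurable_const one]
  have "(\<integral>x. cut W x * (frechet_derivative ph (at (fst x)) (snd x) * 1) \<partial>phase_space) = (\<integral>z. 0 \<partial>(lborel :: plane measure))"
  proof (rule phase_fubini_AE[OF w(2)])
   show "AE z in lborel. (\<integral>th. cut W (z, th) * (frechet_derivative ph (at (fst (z, th))) (snd (z, th)) * 1) \<partial>circle_measure) = 0"
    using AE_transport_moments[OF ph] by eventually_elim simp
  qed (rule borel_measurable_const)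
  moreover have "(\<integral>x. cut (rhs S W) x * (ph (fst x) * 1) \<partial>phase_space) = (\<integral>z. d z * ph z \<partial>lborel)"
  proof (rule phase_fubini_AE[OF w(3)])
   show "AE z in lborel. (\<integral>th. cut (rhs S W) (z, th) * (ph (fst (z, th)) * 1) \<partial>circle_measure) = d z * ph z"
    using AE_rhs_moments by eventually_elim (simp add: d_def sg_def)
  qed (rule borel_measurable_times[OF md mph[OF ph]])
  ultimately show ?thesis using w(1) by simp
 qed
 \<comment> \<open>\<open>d\<close> is the residual of the scalar equation; bumps in closed boxes
   inside the domain are admissible in \<open>zero\<close>.\<close>
 have d0: "AE z in lborel. z : Om --> d z = 0"
 proof (rule fundamental_lemma[where S=UNIV])
  fix a b :: plane assume ab: "cbox a b \<subseteq> Om"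
  show "integrable lborel (%z. indicator (cbox a b) z * d z)"
   using integrable_mult_indicator[OF _ id, of "cbox a b"] by simp
  fix n
  have "test_function Om (box_bump n a b)"
   unfolding test_function_def
  proof (intro conjI exI[of _ "cbox a b"] allI impI smooth_box_bump compact_cbox ab)
   fix z assume "z \<notin> cbox a b"
   then show "box_bump n a b z = 0" using box_subset_cbox[of a b] by (intro box_bump_eq_0) blast
  qed
  then show "(\<integral>z. d z * box_bump n a b z \<partial>lborel) = 0" by (rule zero)
 qed (use op in auto)
 define q where "q z = f z / sg z" for z
 have iq: "int_on q"
 proof -
  have "continuous_on (closure Om) (%z. 1 / sg z)"
   by (intro continuous_on_divide continuous_on_const csg) (use psg in force)
  from int_on_mult[OF if0 this] show ?thesis by (simp add: q_def[abs_def])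
 qed
 have aq: "AE z in lborel. indicator Om z * q z = avg z"
  using d0
 proof eventually_elim
  case (elim z)
  show ?case
  proof (cases "z : Om")
   case True
   then have "sg z > 0" by (intro psg subsetD[OF closure_subset])
   moreover have "f z = sg z * avg z" using elim True by (simp add: d_def)
   ultimately show ?thesis using True by (simp add: q_def)
  qed (simp add: avg_outside)
 qed
 have "has_weak_gradient Om q \<Phi>"
  unfolding has_weak_gradient_iff has_weak_partial_def
 proof (intro allI conjI impI int_on_locally iq i\<Phi>)
  fix j :: 2 and ph assume ph: "test_function Om ph"
  have sm: "smooth ph" using ph by (simp add: test_function_def)
  let ?D = "%z. frechet_derivative ph (at z) (axis j 1)"
  have mD: "?D : borel_measurable borel" by (rule borel_measurable_continuous_onI[OF continuous_frechet_direction[OF sm]])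
  have mj: "(%th::plane. th $ j) : borel_measurable borel" by measurable
  note w = weak_identity[OF ph mj component_le_1]
  have mavg: "avg : borel_measurable borel" using integrable_avg by auto
  have m\<Phi>: "(%z. indicator Om z * \<Phi> z $ j) : borel_measurable borel" using i\<Phi>[of j] by (auto simp: int_on_def)
  have mq: "(%z. indicator Om z * q z) : borel_measurable borel" using iq by (auto simp: int_on_def)
  have l: "(\<integral>x. cut W x * (frechet_derivative ph (at (fst x)) (snd x) * snd x $ j) \<partial>phase_space) = (\<integral>z. avg z * ?D z / 2 \<partial>lborel)"
  proof (rule phase_fubini_AE[OF w(2)])
   show "AE z in lborel. (\<integral>th. cut W (z, th) * (frechet_derivative ph (at (fst (z, th))) (snd (z, th)) * snd (z, th) $ j) \<partial>circle_measure) = avg z * ?D z / 2"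
    using AE_transport_moments[OF ph] by eventually_elim simp
  qed (use borel_measurable_times[OF mavg mD] in measurable)
  have r: "(\<integral>x. cut (rhs S W) x * (ph (fst x) * snd x $ j) \<partial>phase_space) = (\<integral>z. (indicator Om z * \<Phi> z $ j) * ph z / 2 \<partial>lborel)"
  proof (rule phase_fubini_AE[OF w(3)])
   show "AE z in lborel. (\<integral>th. cut (rhs S W) (z, th) * (ph (fst (z, th)) * snd (z, th) $ j) \<partial>circle_measure) = (indicator Om z * \<Phi> z $ j) * ph z / 2"
    using AE_rhs_moments
   proof eventually_elim
    case (elim z)
    have "(\<integral>th. cut (rhs S W) (z, th) * (ph z * th $ j) \<partial>circle_measure) = ph z * (\<integral>th. cut (rhs S W) (z, th) * th $ j \<partial>circle_measure)"
     unfolding integral_mult_right_zero[symmetric] by (simp only: mult_ac)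
    then show ?case using elim by simp
   qed
  qed (use borel_measurable_times[OF m\<Phi> mph[OF ph]] in measurable)
  have "(\<integral>z. avg z * ?D z \<partial>lborel) = - (\<integral>z. (indicator Om z * \<Phi> z $ j) * ph z \<partial>lborel)"
   using w(1) unfolding l r integral_divide_zero by simp
  moreover have "(\<integral>z. (indicator Om z * q z) * ?D z \<partial>lborel) = (\<integral>z. avg z * ?D z \<partial>lborel)"
  proof (rule integral_cong_AE)
   show "AE z in lborel. (indicator Om z * q z) * ?D z = avg z * ?D z" using aq by eventually_elim simp
  qed (use borel_measurable_times[OF mavg mD] borel_measurable_times[OF mq mD] in simp_all)
  ultimately show "(LINT z:Om|lborel. q z * ?D z) = - (LINT z:Om|lborel. \<Phi> z $ j * ph z)"
   unfolding set_lebesgue_integral_def real_scaleR_def mult.assoc by simp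
 qed
 then show ?thesis by (simp add: q_def[abs_def] sg_def)
qed

end

section \<open>Equal data determine the field\<close>

theorem part_two:
 assumes Om: "strictly_convex_domain Om" and M: "M >= 1"
  and kern: "\<forall>z\<in>closure Om. \<forall>t. k z (cos t) = kp 0 z + 2 * (\<Sum>n=1..M. kp n z * cos (real n * t))"
  and a: "Ck_closure 3 Om a" and kp: "\<forall>n\<le>M. Ck_closure 3 Om (kp n)" and wp: "well_posed Om a k"
  and sg: "sg = (%z. a z - kp 0 z)" and pos: "\<forall>z\<in>closure Om. sg z > 0"
  and p: "p > 4" and f: "sobolev 3 p Om f" and F: "sobolev_field 3 p Om F"
  and ft: "sobolev 3 p Om ft" and Ft: "sobolev_field 3 p Om Ft"
  and same: "same_data Om (boundary_data Om a k p f F) (boundary_data Om a k p ft Ft)"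
  and G: "G = weak_gradient Om (%z. (f z - ft z) / sg z)"
 shows "has_weak_gradient Om (%z. (f z - ft z) / sg z) G & (AE z in restrict_space lborel Om. F z = Ft z + G z)"
proof -
 interpret convex_domain Om
  using Om by unfold_locales (auto simp: strictly_convex_domain_def strictly_convex_def)
 have three: "3 = Suc 2" by simp
 have ckp: "continuous_on (closure Om) (kp n)" if "n <= M" for n
  using kp that by (intro Ck_closure_continuous[of 3]) blast
 interpret transport_medium Om a k
 proof unfold_locales
  show "continuous_on (closure Om) a" by (rule Ck_closure_continuous[OF a])
  \<comment> \<open>The kernel is given only through its cosine expansion; with
    \<open>arccos\<close> the expansion shows continuity as a function of the cosine.\<close>
  have "continuous_on (closure Om \<times> {-1..1}) (%x. kp 0 (fst x) + 2 * (\<Sum>n=1..M. kp n (fst x) * cos (real n * arccos (snd x))))"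
   by (intro continuous_on_add continuous_on_mult continuous_on_sum continuous_on_const continuous_on_cos
     continuous_on_compose2[OF ckp] continuous_on_fst continuous_on_id continuous_on_compose2[OF continuous_on_arccos'] continuous_on_snd) auto
  then show "continuous_on (closure Om \<times> {-1..1}) (%(z, s). k z s)"
  proof (rule continuous_on_eq)
   fix x assume x: "x : closure Om \<times> {-1..1::real}"
   then have "cos (arccos (snd x)) = snd x" by (intro cos_arccos) auto
   then show "kp 0 (fst x) + 2 * (\<Sum>n=1..M. kp n (fst x) * cos (real n * arccos (snd x))) = (case x of (z, s) => k z s)"
    using kern[rule_format, of "fst x" "arccos (snd x)"] x by (auto simp: case_prod_beta)
  qed
 qed
 have p1: "p >= 0" "p >= 1" "p > 1" using p by auto
 have Lf: "Lp domain_measure p f" "Lp domain_measure p ft" using f ft by (auto intro: sobolev_Lp)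
 have LF: "Lp domain_measure p (%z. F z $ i)" "Lp domain_measure p (%z. Ft z $ i)" for i
  by (rule sobolev_field_Lp[OF F], rule sobolev_field_Lp[OF Ft])
 define s s' where "s = anisotropic_source f F" and "s' = anisotropic_source ft Ft"
 have "has_boundary_data Om a k p f F (boundary_data Om a k p f F)" by (rule boundary_data_exists[OF wp p1(3) Lf(1) LF(1)])
 then obtain u where u: "transport_solution Om a k p s u" "has_outflow_trace Om u (boundary_data Om a k p f F)"
  unfolding has_boundary_data_def s_def by blast
 have "has_boundary_data Om a k p ft Ft (boundary_data Om a k p ft Ft)" by (rule boundary_data_exists[OF wp p1(3) Lf(2) LF(2)])
 then obtain u' where u': "transport_solution Om a k p s' u'" "has_outflow_trace Om u' (boundary_data Om a k p ft Ft)"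
  unfolding has_boundary_data_def s'_def by blast
 have ss: "integrable phase_space (cut s)" unfolding s_def by (rule Lp_cut[OF Lp_anisotropic[OF Lf(1) LF(1) p1(1)] p1(2)])
 have ss': "integrable phase_space (cut s')" unfolding s'_def by (rule Lp_cut[OF Lp_anisotropic[OF Lf(2) LF(2) p1(1)] p1(2)])
 have iu: "integrable phase_space (cut u)" "integrable phase_space (cut u')"
  using u(1) u'(1) p1(2) by (auto simp: transport_solution_def intro: Lp_cut)
 have cut_diff: "cut (%x. g x - h x) = (%x. cut g x - cut h x)" for g h by (auto simp: cut_def algebra_simps)
 obtain gm where gm: "c1 a gm" using c1_Ck[of 2 a] a by (metis three)
 have "Om ~= {}" using Om by (simp add: strictly_convex_domain_def)
 then obtain A \<Lambda> N R where att: "attenuation A \<Lambda> N R" and A: "!!z. z : Om ==> A z = a z" and R: "!!z. z : Om ==> norm z <= R"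
  using attenuation_extension[OF gm] by blast
 interpret attenuation A \<Lambda> N R by (rule att)
 have ints: "int_on (%z. g z - h z)" if "Lp domain_measure p g" "Lp domain_measure p h" for g h
  using Bochner_Integration.integrable_diff[OF Lp_int_on[OF that(1) p1(2), unfolded int_on_def] Lp_int_on[OF that(2) p1(2), unfolded int_on_def]]
  by (simp add: int_on_def right_diff_distrib)
 \<comment> \<open>The two transport equations and the equality of the data enter through
   \<open>zero_data_identity\<close>, which discharges the remaining assumption
   \<open>ident\<close>.\<close>
 interpret vs: vanishing_source Om a k A \<Lambda> N R "%x. u x - u' x" "%x. s x - s' x" "%z. f z - ft z" "%z. F z - Ft z" M kp
 proof unfold_locales
  show "integrable phase_space (cut (%x. u x - u' x))" unfolding cut_diff using iu by simp
  show "integrable phase_space (cut (%x. s x - s' x))" unfolding cut_diff using ss ss' by simp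
  show "s x - s' x = f (fst x) - ft (fst x) + snd x \<bullet> (F (fst x) - Ft (fst x))" for x
   by (simp add: s_def s'_def anisotropic_source_def case_prod_beta inner_diff_right)
  show "int_on (%z. (F z - Ft z) $ i)" for i using ints[OF LF(1)[of i] LF(2)[of i]] by simp
  show "0 < a z - kp 0 z" if "z : closure Om" for z using pos that by (simp add: sg)
  show "A z = a z" "norm z <= R" if "z : Om" for z using A[OF that] R[OF that] by simp_all
  show "int_on (%z. f z - ft z)" by (rule ints[OF Lf])
  show "k z (cos t) = kp 0 z + 2 * (\<Sum>n=1..M. kp n z * cos (real n * t))" if "z : closure Om" for z t using kern that by blast
  show "continuous_on (closure Om) (kp 0)" "M >= 1" using ckp[of 0] M by simp_all
 qed (rule zero_data_identity[OF u u' same ss ss' p1(3) R R0])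
 let ?q = "%z. (f z - ft z) / sg z"
 have q: "has_weak_gradient Om ?q (%z. F z - Ft z)" using vs.has_weak_gradient_quotient unfolding sg .
 \<comment> \<open>The field difference is one weak gradient of the quotient, which justifies the
   choice of \<open>G\<close>; uniqueness of weak derivatives then identifies the two almost
   everywhere.\<close>
 have wG: "has_weak_gradient Om ?q G" unfolding G weak_gradient_def by (rule someI[where P="has_weak_gradient Om ?q", OF q])
 have "AE z in lborel. \<forall>i. z : Om --> G z $ i = (F z - Ft z) $ i"
  unfolding AE_all_countable
  by (intro allI weak_partial_unique[OF wG[unfolded has_weak_gradient_iff, rule_format] q[unfolded has_weak_gradient_iff, rule_format]])
 then have "AE z in lborel. z : Om --> F z = Ft z + G z"
  by eventually_elim (simp add: vec_eq_iff)
 then show ?thesis using wG by (simp add: AE_restrict_space_iff)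
qed

theorem theorem5p1:
  fixes \<Omega> :: "(real ^ 2) set"
  assumes "strictly_convex_domain \<Omega>"
  shows
    "(\<forall>(a :: real ^ 2 \<Rightarrow> real) (k :: real ^ 2 \<Rightarrow> real \<Rightarrow> real) (\<sigma> :: real ^ 2 \<Rightarrow> real) (p :: real)
        (f\<^sub>0 :: real ^ 2 \<Rightarrow> real) (ft :: real ^ 2 \<Rightarrow> real) (Ft :: real ^ 2 \<Rightarrow> real ^ 2).
       Ck_closure 3 \<Omega> a \<and> C3_kernel \<Omega> k \<and> well_posed \<Omega> a k \<and>
       \<sigma> = (\<lambda>z. a z - zeroth_coeff k z) \<and> (\<forall>z\<in>closure \<Omega>. \<sigma> z > 0) \<and>
       p > 4 \<and> sobolev 3 p \<Omega> f\<^sub>0 \<and> sobolev 3 p \<Omega> ft \<and> sobolev_field 3 p \<Omega> Ft \<and>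
       C0_closure \<Omega> (\<lambda>z. (f\<^sub>0 z - ft z) / \<sigma> z)
       \<longrightarrow> (let G = weak_gradient \<Omega> (\<lambda>z. (f\<^sub>0 z - ft z) / \<sigma> z); F = (\<lambda>z. Ft z + G z) in
            has_weak_gradient \<Omega> (\<lambda>z. (f\<^sub>0 z - ft z) / \<sigma> z) G \<and>
            sobolev_field 0 p \<Omega> F \<and>
            has_boundary_data \<Omega> a k p f\<^sub>0 F (boundary_data \<Omega> a k p f\<^sub>0 F) \<and>
            has_boundary_data \<Omega> a k p ft Ft (boundary_data \<Omega> a k p ft Ft) \<and>
            same_data \<Omega> (boundary_data \<Omega> a k p f\<^sub>0 F) (boundary_data \<Omega> a k p ft Ft)))
     \<and>
     (\<forall>(M :: nat) (a :: real ^ 2 \<Rightarrow> real) (k :: real ^ 2 \<Rightarrow> real \<Rightarrow> real)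
        (\<kappa> :: nat \<Rightarrow> real ^ 2 \<Rightarrow> real) (\<sigma> :: real ^ 2 \<Rightarrow> real) (p :: real)
        (f\<^sub>0 :: real ^ 2 \<Rightarrow> real) (F :: real ^ 2 \<Rightarrow> real ^ 2)
        (ft :: real ^ 2 \<Rightarrow> real) (Ft :: real ^ 2 \<Rightarrow> real ^ 2).
       M \<ge> 1 \<and>
       (\<forall>z\<in>closure \<Omega>. \<forall>t. k z (cos t) = \<kappa> 0 z + 2 * (\<Sum>n=1..M. \<kappa> n z * cos (real n * t))) \<and>
       Ck_closure 3 \<Omega> a \<and> (\<forall>n\<le>M. Ck_closure 3 \<Omega> (\<kappa> n)) \<and> well_posed \<Omega> a k \<and>
       \<sigma> = (\<lambda>z. a z - \<kappa> 0 z) \<and> (\<forall>z\<in>closure \<Omega>. \<sigma> z > 0) \<and>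
       p > 4 \<and> sobolev 3 p \<Omega> f\<^sub>0 \<and> sobolev_field 3 p \<Omega> F \<and>
       sobolev 3 p \<Omega> ft \<and> sobolev_field 3 p \<Omega> Ft \<and>
       same_data \<Omega> (boundary_data \<Omega> a k p f\<^sub>0 F) (boundary_data \<Omega> a k p ft Ft)
       \<longrightarrow> (let G = weak_gradient \<Omega> (\<lambda>z. (f\<^sub>0 z - ft z) / \<sigma> z) in
            has_weak_gradient \<Omega> (\<lambda>z. (f\<^sub>0 z - ft z) / \<sigma> z) G \<and>
            (AE z in restrict_space lborel \<Omega>. F z = Ft z + G z)))"
  unfolding Let_def
  by (rule conjI; intro allI impI; elim conjE; (rule part_one[OF assms] | rule part_two[OF assms]); (assumption | rule refl))

end
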